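(* Let $\xi=(\xi_t)_{t\ge 0}$ be a subordinator in the class $(\mathcal L)$, with Lévy density $g$ and constant $g_0$, and let $(\mathcal F_t)_{t\ge0}$ be its filtration (see context). Let $k:\mathbb R_+\times\mathbb R_+\to\mathbb R_+$ be a measurable function such that, for some finite constants $\kappa\ge1$ and $\alpha\in\,]0,1[$, $$|k(s,x)-k(s,y)|\le\kappa|x-y|^\alpha,\qquad\forall\,s,x,y\in\mathbb R_+,$$ $$0<\kappa^{-1}\le k(s,x)\le\kappa<\infty,\qquad\forall\,s,x\in\mathbb R_+,$$ and set $K(s,x)=\int_0^xk(s,y)\,dy$ for $s,x\ge0$. Then the process $$N_t^K:=\exp\left(g_0\int_0^t\log k(s,0)\,ds\right)\prod_{s\le t}\left[k(s,\Delta\xi_s)\cdot\frac{g(K(s,\Delta\xi_s))}{g(\Delta\xi_s)}\right],\qquad t\ge0,$$ where the factor in square brackets is by convention $1$ whenever $\Delta\xi_s=0$, is a non-negative $(\mathcal F_t)$-martingale with $\mathbb E(N^K_t)=1$ and a.s. $N^K_t>0$. Then we can define a probability measure $\mathbb P^K$ such that $\mathbb P^K_{|\mathcal F_t}=N^K_t\cdot\mathbb P_{|\mathcal F_t}$ for all $t\ge0$. Under $\mathbb P^K$, the process $$\xi^K_t=\sum_{s\le t}K(s,\Delta\xi_s),\qquad t\ge0,$$ is distributed as $\xi$ under $\mathbb P$.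
   Context: $\mathbb R_+=[0,\infty)$; $\mathbb P$ is the underlying probability and $\mathbb E$ its expectation. A subordinator is an increasing (i.e. non-decreasing) Lévy process $\xi$ with $\xi_0=0$. It is in the class $(\mathcal L)$ if it has zero drift and Lévy measure $\nu(dx)=g(x)\,dx$, $x>0$, where $g:\,]0,\infty[\,\to\mathbb R_+$ is measurable, $g>0$, $\int_1^\infty g(x)\,dx<\infty$, and there exist $g_0\ge 0$ and a measurable $\zeta:[0,1]\to\mathbb R$ with $\int_0^1|\zeta(x)|\,dx<\infty$ such that $g(x)=\frac{g_0}{x}+\zeta(x)$ for all $x\in\,]0,1]$. The filtration of $\xi$ is $\mathcal F_t=\sigma(\xi_s:s\le t)$, $t\ge0$, and $\Delta\xi_s=\xi_s-\xi_{s-}$. Sums and products over $s\le t$ effectively run over the countable set of jump times of $\xi$ in $[0,t]$.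
   Formalization: Existence of P^K is claimed only when every increasing càdlàg path from 0 occurs as a path of ξ (as on canonical path space), since on an arbitrary probability space the measures N_t^K·P on F_t need not extend; all other claims hold on any space. *)

theory Defs
  imports "HOL-Probability.Probability"
begin

section \<open>Levy processes and subordinators\<close>

text \<open>Processes indexed by \<open>[0,\<infinity>)\<close> are functions \<open>real \<Rightarrow> 'a \<Rightarrow> real\<close> of which only the values at
  times \<open>t \<ge> 0\<close> are ever used.\<close>

definition cadlag :: "(real \<Rightarrow> real) \<Rightarrow> bool" where
  "cadlag w \<longleftrightarrow>
     (\<forall>t\<ge>0. continuous (at_right t) w) \<and> (\<forall>t>0. \<exists>l. (w \<longlongrightarrow> l) (at_left t))"

text \<open>The convention \<open>w(0-) = w(0)\<close> is used: there is no jump at time 0.\<close>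

definition jump :: "(real \<Rightarrow> real) \<Rightarrow> real \<Rightarrow> real" where
  "jump w s = (if s \<le> 0 then 0 else w s - Lim (at_left s) w)"

text \<open>The regularity of the paths and \<open>\<xi>\<^sub>0 = 0\<close> are required for every \<open>\<omega>\<close>, not just almost surely.
  This is what makes functionals of the jumps up to time \<open>t\<close> measurable for the uncompleted
  natural filtration.\<close>

locale levy_process = prob_space M for M :: "'a measure" +
  fixes \<xi> :: "real \<Rightarrow> 'a \<Rightarrow> real"
  assumes random_variable: "t \<ge> 0 \<Longrightarrow> \<xi> t \<in> borel_measurable M"
    and start: "\<omega> \<in> space M \<Longrightarrow> \<xi> 0 \<omega> = 0"
    and cadlag_paths: "\<omega> \<in> space M \<Longrightarrow> cadlag (\<lambda>t. \<xi> t \<omega>)"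
    and independent_increments:
      "\<And>(\<tau> :: nat \<Rightarrow> real) n. 0 \<le> \<tau> 0 \<Longrightarrow> mono \<tau> \<Longrightarrow>
         indep_vars (\<lambda>_. borel) (\<lambda>i \<omega>. \<xi> (\<tau> (Suc i)) \<omega> - \<xi> (\<tau> i) \<omega>) {..<n}"
    and stationary_increments:
      "0 \<le> s \<Longrightarrow> 0 \<le> h \<Longrightarrow>
         distr M borel (\<lambda>\<omega>. \<xi> (s + h) \<omega> - \<xi> s \<omega>) = distr M borel (\<xi> h)"

locale subordinator = levy_process +
  assumes increasing: "\<omega> \<in> space M \<Longrightarrow> mono_on {0..} (\<lambda>t. \<xi> t \<omega>)"

text \<open>Drift \<open>d\<close> and Levy measure \<open>\<nu>\<close> of a subordinator are the coefficients in its Levy-Khintchine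
  representation, written without truncation, which is possible since \<open>\<integral> min 1 x \<nu>(dx) < \<infinity>\<close>.\<close>

definition has_drift_levy_measure ::
    "'a measure \<Rightarrow> (real \<Rightarrow> 'a \<Rightarrow> real) \<Rightarrow> real \<Rightarrow> real measure \<Rightarrow> bool" where
  "has_drift_levy_measure M \<xi> d \<nu> \<longleftrightarrow>
     d \<ge> 0 \<and> sets \<nu> = sets borel \<and> emeasure \<nu> {..0} = 0 \<and>
     (\<integral>\<^sup>+x. ennreal (min 1 x) \<partial>\<nu>) < \<infinity> \<and>
     (\<forall>t\<ge>0. \<forall>u. char (distr M borel (\<xi> t)) u =
        exp (of_real t * (\<i> * of_real (d * u) + (CLINT x|\<nu>. iexp (u * x) - 1))))"

definition class_L ::
    "'a measure \<Rightarrow> (real \<Rightarrow> 'a \<Rightarrow> real) \<Rightarrow> (real \<Rightarrow> real) \<Rightarrow> real \<Rightarrow> bool" where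
  "class_L M \<xi> g g0 \<longleftrightarrow>
     subordinator M \<xi> \<and>
     g \<in> borel_measurable (restrict_space borel {0<..}) \<and>
     (\<forall>x>0. g x > 0) \<and>
     has_drift_levy_measure M \<xi> 0 (density lborel (\<lambda>x. ennreal (indicator {0<..} x * g x))) \<and>
     set_integrable lborel {1..} g \<and>
     g0 \<ge> 0 \<and>
     (\<exists>\<zeta>. set_integrable lborel {0..1} \<zeta> \<and> (\<forall>x\<in>{0<..1}. g x = g0 / x + \<zeta> x))"

section \<open>Filtrations, martingales and laws of processes\<close>

definition natural_filtration ::
    "'a measure \<Rightarrow> (real \<Rightarrow> 'a \<Rightarrow> real) \<Rightarrow> real \<Rightarrow> 'a measure" where
  "natural_filtration M X t =
     sigma (space M) {X s -` B \<inter> space M |s B. s \<in> {0..t} \<and> B \<in> sets borel}"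

definition terminal_sigma :: "'a measure \<Rightarrow> (real \<Rightarrow> 'a \<Rightarrow> real) \<Rightarrow> 'a measure" where
  "terminal_sigma M X =
     sigma (space M) {X s -` B \<inter> space M |s B. s \<in> {0..} \<and> B \<in> sets borel}"

definition martingale ::
    "'a measure \<Rightarrow> (real \<Rightarrow> 'a measure) \<Rightarrow> (real \<Rightarrow> 'a \<Rightarrow> real) \<Rightarrow> bool" where
  "martingale M F X \<longleftrightarrow>
     filtration (space M) F \<and>
     (\<forall>t\<ge>0. subalgebra M (F t) \<and> X t \<in> borel_measurable (F t) \<and> integrable M (X t)) \<and>
     (\<forall>s\<ge>0. \<forall>t\<ge>s. AE \<omega> in M. real_cond_exp M (F s) (X t) \<omega> = X s \<omega>)"

definition process_law :: "'a measure \<Rightarrow> (real \<Rightarrow> 'a \<Rightarrow> real) \<Rightarrow> (real \<Rightarrow> real) measure" where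
  "process_law M X = distr M (\<Pi>\<^sub>M t\<in>{0..}. borel) (\<lambda>\<omega>. \<lambda>t\<in>{0..}. X t \<omega>)"

text \<open>Every increasing cadlag path started at 0 is realised by some \<open>\<omega>\<close>. This holds on the canonical
  path space. Some such condition is needed to extend a consistent family of laws on the
  \<open>\<F>\<^sub>t\<close> to their join.\<close>

definition realises_all_paths :: "'a measure \<Rightarrow> (real \<Rightarrow> 'a \<Rightarrow> real) \<Rightarrow> bool" where
  "realises_all_paths M \<xi> \<longleftrightarrow>
     (\<forall>w. cadlag w \<and> mono_on {0..} w \<and> w 0 = 0 \<longrightarrow>
        (\<exists>\<omega>\<in>space M. \<forall>t\<ge>0. \<xi> t \<omega> = w t))"

section \<open>The density process and the transformed process\<close>

text \<open>Unordered product, the multiplicative analogue of \<^const>\<open>infsum\<close>; like a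
  \<^const>\<open>prod\<close> over an infinite set, it is 1 if the net of finite products does not converge.\<close>

definition unordered_prod :: "('b \<Rightarrow> real) \<Rightarrow> 'b set \<Rightarrow> real" where
  "unordered_prod f A =
     (if \<exists>l. ((\<lambda>J. prod f J) \<longlongrightarrow> l) (finite_subsets_at_top A)
      then Lim (finite_subsets_at_top A) (\<lambda>J. prod f J) else 1)"

definition primitive :: "(real \<Rightarrow> real \<Rightarrow> real) \<Rightarrow> real \<Rightarrow> real \<Rightarrow> real" where
  "primitive k s x = (LBINT y:{0..x}. k s y)"

definition jump_factor ::
    "(real \<Rightarrow> real) \<Rightarrow> (real \<Rightarrow> real \<Rightarrow> real) \<Rightarrow> real \<Rightarrow> real \<Rightarrow> real" where
  "jump_factor g k s x = (if x = 0 then 1 else k s x * (g (primitive k s x) / g x))"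

definition density_process ::
    "(real \<Rightarrow> real) \<Rightarrow> real \<Rightarrow> (real \<Rightarrow> real \<Rightarrow> real) \<Rightarrow> (real \<Rightarrow> 'a \<Rightarrow> real) \<Rightarrow> real \<Rightarrow> 'a \<Rightarrow> real" where
  "density_process g g0 k \<xi> t \<omega> =
     exp (g0 * (LBINT s:{0..t}. ln (k s 0))) *
     unordered_prod (\<lambda>s. jump_factor g k s (jump (\<lambda>r. \<xi> r \<omega>) s)) {0..t}"

definition transformed_process ::
    "(real \<Rightarrow> real \<Rightarrow> real) \<Rightarrow> (real \<Rightarrow> 'a \<Rightarrow> real) \<Rightarrow> real \<Rightarrow> 'a \<Rightarrow> real" where
  "transformed_process k \<xi> t \<omega> = (\<Sum>\<^sub>\<infinity>s\<in>{0..t}. primitive k s (jump (\<lambda>r. \<xi> r \<omega>) s))"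

definition has_local_density ::
    "'a measure \<Rightarrow> 'a measure \<Rightarrow> (real \<Rightarrow> 'a \<Rightarrow> real) \<Rightarrow> (real \<Rightarrow> 'a \<Rightarrow> real) \<Rightarrow> bool" where
  "has_local_density Q M \<xi> N \<longleftrightarrow>
     prob_space Q \<and> space Q = space M \<and> sets Q = sets (terminal_sigma M \<xi>) \<and>
     (\<forall>t\<ge>0. restr_to_subalg Q (natural_filtration M \<xi> t) =
        density (restr_to_subalg M (natural_filtration M \<xi> t)) (\<lambda>\<omega>. ennreal (N t \<omega>)))"

end

theory Submission
  imports Defs
begin

text \<open>The jumps of a driftless subordinator form a Poisson random measure with intensity
  \<open>ds \<otimes> \<nu>\<close>. It suffices to have this in the form of the exponential formula
  \<open>E \<Prod>\<^sub>s f(s, \<Delta>\<xi>\<^sub>s) = exp (\<integral>\<integral> (f - 1) ds d\<nu>)\<close>, which follows for \<open>f = exp (- F)\<close>, \<open>F \<ge> 0\<close>, by cutting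
  time into a fine grid and using the small-time asymptotics of the increments of \<open>\<xi>\<close>, and extends
  to \<open>f\<close> above \<open>1\<close> because a Laplace transform determines the law. Up to the factor
  \<open>exp (g\<^sub>0 \<integral> log k(s, 0) ds)\<close>, the process \<open>N\<close> is the multiplicative functional of
  \<open>q(s, x) = k(s, x) g(K(s, x)) / g(x)\<close>. Substituting \<open>y = K(s, x)\<close> turns \<open>q(s, x) g(x) dx\<close> into
  \<open>g(y) dy\<close>, and since \<open>g\<close> differs from \<open>g\<^sub>0 / x\<close> near \<open>0\<close> by an integrable function,
  \<open>\<integral> (q(s, x) - 1) g(x) dx = - g\<^sub>0 log k(s, 0)\<close>. Hence \<open>E N\<^sub>t = 1\<close>, and the weight \<open>N\<close> replaces
  \<open>\<nu>\<close> by \<open>q \<cdot> \<nu>\<close> in every Laplace functional; the same substitution shows that the Laplace functionals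
  of \<open>\<xi>\<^sup>K\<close> under the weight \<open>N\<close> are those of \<open>\<xi>\<close>.\<close>

section \<open>Jumps of increasing cadlag functions\<close>

text \<open>The Levy-Khintchine formula is given through characteristic functions, and a single
  character does not isolate jumps away from 0. Gaussians bridge the gap: they are normal mixtures
  of characters, and polynomials in exp(-x^2) approximate the continuous test functions supported
  away from 0. The resulting Laplace functional controls factors at most 1 only, whereas q may
  exceed 1 and its logarithm need not be integrable; only q - 1 is. A bounded factor is therefore
  written as C^n times a factor at most 1, where n counts the jumps in a set of finite intensity.
  Under the remaining weight n is Poisson up to normalisation, so its exponential moments are known,
  and a truncation removes the bound. Independence of increments enters on the grid only: the
  martingale property, the existence of P^K and the law of \<xi>^K all come from comparing Laplace
  transforms of finitely many coordinates. Since the filtration is not completed, pathwise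
  functionals are handled for every \<omega>, and a path with a divergent product carries the value
  that \<open>unordered_prod\<close> assigns to it.\<close>

definition increasing_path :: "(real \<Rightarrow> real) \<Rightarrow> bool" where
  "increasing_path w \<longleftrightarrow> cadlag w \<and> mono_on {0..} w"

definition jump_times :: "(real \<Rightarrow> real) \<Rightarrow> real \<Rightarrow> real set" where
  "jump_times w T = {s\<in>{0<..T}. 0 < jump w s}"

text \<open>One atom at \<open>(s, jump w s)\<close> for each jump: sums over jumps become integrals
  over the plane, so that monotone class arguments can vary the integrand.\<close>

definition jump_measure :: "(real \<Rightarrow> real) \<Rightarrow> real \<Rightarrow> (real \<times> real) measure" where
  "jump_measure w T = distr (count_space (jump_times w T)) borel (\<lambda>s. (s, jump w s))"

lemma increasing_pathD: "increasing_path w \<Longrightarrow> 0 \<le> a \<Longrightarrow> a \<le> b \<Longrightarrow> w a \<le> w b"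
  by (auto simp: increasing_path_def intro: mono_onD)

lemma cadlag_at_left: "cadlag w \<Longrightarrow> 0 < s \<Longrightarrow> (w \<longlongrightarrow> w s - jump w s) (at_left s)"
  unfolding cadlag_def jump_def by (auto simp: tendsto_Lim[OF trivial_limit_at_left_real])

lemma cadlag_at_right: "cadlag w \<Longrightarrow> 0 \<le> s \<Longrightarrow> continuous (at s within {s..}) w"
  by (auto simp: cadlag_def continuous_within at_within_Ici_at_right)

lemma jump_nonneg:
  assumes w: "increasing_path w" shows "0 \<le> jump w s"
proof (cases "s > 0")
  case True
  have "eventually (\<lambda>u. w u \<le> w s) (at_left s)"
    using eventually_at_left_real[OF True] by eventually_elim (auto intro!: increasing_pathD[OF w])
  from tendsto_upperbound[OF cadlag_at_left this] True w show ?thesis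
    by (auto simp: increasing_path_def)
qed (simp add: jump_def)

text \<open>Induction on the largest time m of \<open>F\<close>: up to any u just below m the
  earlier jumps use at most \<open>w u - w a\<close>, and letting u increase to m leaves room for
  the jump at m itself.\<close>

lemma sum_jumps_le:
  assumes w: "increasing_path w" and "finite F" "F \<subseteq> {a<..b}" "0 \<le> a" "a \<le> b"
  shows "(\<Sum>s\<in>F. jump w s) \<le> w b - w a"
  using assms(2-)
proof (induction F arbitrary: b rule: finite_linorder_max_induct)
  case empty
  then show ?case using increasing_pathD[OF w] by auto
next
  case (insert m F)
  define c where "c = Max (insert a F)"
  have c: "a \<le> c" "c < m" "\<And>x. x \<in> F \<Longrightarrow> x \<le> c"
    using insert by (auto simp: c_def)
  have "eventually (\<lambda>u. sum (jump w) F + w a \<le> w u) (at_left m)"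
    using eventually_at_left_real[OF c(2)]
  proof eventually_elim
    case (elim u)
    have "F \<subseteq> {a<..u}" using c elim insert.prems by fastforce
    then show ?case using insert.IH[of u] c elim insert.prems by auto
  qed
  then have "sum (jump w) F + w a \<le> w m - jump w m"
    using w c insert.prems
    by (intro tendsto_lowerbound[OF cadlag_at_left]) (auto simp: increasing_path_def)
  moreover have "w m \<le> w b" using insert.prems c by (intro increasing_pathD[OF w]) auto
  ultimately show ?case using insert.hyps by auto
qed

text \<open>Each such jump takes at least \<open>a\<close> out of the total increment
  \<open>w T - w 0\<close>.\<close>

lemma finite_big_jumps:
  assumes w: "increasing_path w" and "0 < a"
  shows "finite {s\<in>{0<..T}. a \<le> jump w s}"
proof (cases "0 \<le> T")
  case True
  have "card G \<le> nat \<lceil>(w T - w 0) / a\<rceil>" if "G \<subseteq> {s\<in>{0<..T}. a \<le> jump w s}" "finite G" for G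
  proof -
    have "card G * a = (\<Sum>s\<in>G. a)" by simp
    also have "\<dots> \<le> (\<Sum>s\<in>G. jump w s)" using that by (intro sum_mono) auto
    also have "\<dots> \<le> w T - w 0" using that True by (intro sum_jumps_le[OF w]) auto
    finally have "real (card G) \<le> (w T - w 0) / a" using \<open>0 < a\<close> by (simp add: field_simps)
    then show ?thesis by linarith
  qed
  then show ?thesis by (intro finite_if_finite_subsets_card_bdd[THEN conjunct1]) blast
next
  case False
  then have "{0<..T} = {}" by auto
  then show ?thesis by (metis (no_types, lifting) Collect_empty_eq empty_iff finite.emptyI)
qed

lemma sets_jump_measure [simp, measurable_cong]: "sets (jump_measure w T) = sets borel"
  and space_jump_measure [simp]: "space (jump_measure w T) = UNIV"
  by (simp_all add: jump_measure_def)

lemma nn_integral_jump_measure: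
  "F \<in> borel_measurable borel \<Longrightarrow>
    (\<integral>\<^sup>+z. F z \<partial>jump_measure w T) = (\<integral>\<^sup>+s. F (s, jump w s) \<partial>count_space (jump_times w T))"
  unfolding jump_measure_def by (subst nn_integral_distr) auto

text \<open>Increments over a short interval without a jump of size at least \<open>a/2\<close> are below \<open>a\<close>
  (a Lebesgue number argument), so only the finitely many intervals around big jumps contribute.\<close>

lemma small_increments:
  assumes w: "increasing_path w" and "0 < a" "0 \<le> A"
  obtains e where "0 < e"
    "\<And>u v. A \<le> u \<Longrightarrow> u \<le> v \<Longrightarrow> v \<le> B \<Longrightarrow> v - u < e \<Longrightarrow> (\<And>s. s \<in> {u<..v} \<Longrightarrow> jump w s < a / 2)
       \<Longrightarrow> w v - w u < a"
proof -
  have cad: "cadlag w" using w by (simp add: increasing_path_def)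
  \<comment> \<open>Near s the path stays within a/4 of its left limit \<open>w s - jump w s\<close>
    on the left and of \<open>w s\<close> on the right. For s = 0 the left half is vacuous.\<close>
  have "\<exists>e>0. (\<forall>u. s - e < u \<and> u < s \<and> 0 \<le> u \<longrightarrow> w s - jump w s - w u < a/4) \<and>
              (\<forall>u. s \<le> u \<and> u < s + e \<longrightarrow> w u - w s < a/4)" if "s \<ge> 0" for s
  proof -
    have "\<exists>e>0. \<forall>u. s - e < u \<and> u < s \<and> 0 \<le> u \<longrightarrow> w s - jump w s - w u < a/4"
    proof (cases "s > 0")
      case True
      have "eventually (\<lambda>u. w s - jump w s - a/4 < w u) (at_left s)"
        using cadlag_at_left[OF cad True] \<open>0 < a\<close> by (intro order_tendstoD) auto
      then obtain b where "b < s" "\<And>u. b < u \<Longrightarrow> u < s \<Longrightarrow> w s - jump w s - a/4 < w u"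
        unfolding eventually_at_left_field by blast
      then show ?thesis by (intro exI[of _ "s - b"]) (auto simp: field_simps)
    qed (use that in \<open>auto intro: exI[of _ 1]\<close>)
    then obtain e1 where e1: "e1 > 0"
      "\<And>u. s - e1 < u \<Longrightarrow> u < s \<Longrightarrow> 0 \<le> u \<Longrightarrow> w s - jump w s - w u < a/4" by blast
    have "eventually (\<lambda>u. w u < w s + a/4) (at_right s)"
      using cad that \<open>0 < a\<close> unfolding cadlag_def continuous_within
      by (intro order_tendstoD) auto
    then obtain b where b: "b > s" "\<And>u. s < u \<Longrightarrow> u < b \<Longrightarrow> w u < w s + a/4"
      unfolding eventually_at_right_field by blast
    have "w u - w s < a/4" if "s \<le> u" "u < s + (b - s)" for u
      using b that \<open>0 < a\<close> by (cases "u = s") (auto simp: field_simps)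
    with e1 b(1) show ?thesis
      by (intro exI[of _ "min e1 (b - s)"]) auto
  qed
  then obtain e where e: "\<And>s. s \<ge> 0 \<Longrightarrow> e s > 0"
    "\<And>s u. s \<ge> 0 \<Longrightarrow> s - e s < u \<Longrightarrow> u < s \<Longrightarrow> 0 \<le> u \<Longrightarrow> w s - jump w s - w u < a/4"
    "\<And>s u. s \<ge> 0 \<Longrightarrow> s \<le> u \<Longrightarrow> u < s + e s \<Longrightarrow> w u - w s < a/4"
    by metis
  have "{A..B} \<subseteq> \<Union>((\<lambda>s. ball s (e s)) ` {A..B})"
  proof
    fix x assume "x \<in> {A..B}"
    then show "x \<in> \<Union>((\<lambda>s. ball s (e s)) ` {A..B})"
      using e(1)[of x] \<open>0 \<le> A\<close> by (intro UnionI[of "ball x (e x)"]) auto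
  qed
  then obtain d where d: "d > 0" "\<And>x. x \<in> {A..B} \<Longrightarrow> \<exists>s\<in>{A..B}. ball x d \<subseteq> ball s (e s)"
    using Heine_Borel_lemma[of "{A..B}" "(\<lambda>s. ball s (e s)) ` {A..B}"]
    by (metis (no_types, lifting) compact_Icc imageE open_ball)
  show ?thesis
  proof (rule that[OF d(1)])
    fix u v assume uv: "A \<le> u" "u \<le> v" "v \<le> B" "v - u < d" "\<And>s. s \<in> {u<..v} \<Longrightarrow> jump w s < a / 2"
    obtain s where s: "s \<in> {A..B}" "ball u d \<subseteq> ball s (e s)" using d(2)[of u] uv by auto
    have "u \<in> ball s (e s)" "v \<in> ball s (e s)" using s(2) uv d(1) by (auto simp: subset_eq dist_real_def)
    then have *: "s - e s < u" "u < s + e s" "s - e s < v" "v < s + e s" by (auto simp: dist_real_def)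
    have s0: "s \<ge> 0" using s(1) \<open>0 \<le> A\<close> by auto
    have left: "w x \<le> w s - jump w s" if "0 \<le> x" "x < s" for x
      using sum_jumps_le[OF w, of "{s}" x s] that by auto
    \<comment> \<open>Only an interval containing s in its interior or as right end picks up the
      jump at s, and then the increment is below a/4 + a/2 + a/4.\<close>
    consider "v < s" | "s \<le> u" | "u < s" "s \<le> v" by linarith
    then show "w v - w u < a"
    proof cases
      case 1
      have "w s - jump w s - w u < a/4" "w v \<le> w s - jump w s"
        using e(2)[OF s0 *(1)] left[of v] 1 uv(1,2) \<open>0 \<le> A\<close> by auto
      then show ?thesis using \<open>0 < a\<close> by linarith
    next
      case 2
      have "w v - w s < a/4" "w s \<le> w u"
        using e(3)[OF s0 _ *(4)] 2 uv(2) increasing_pathD[OF w s0 2] by auto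
      then show ?thesis using \<open>0 < a\<close> by linarith
    next
      case 3
      have "w s - jump w s - w u < a/4" "w v - w s < a/4" "jump w s < a/2"
        using e(2)[OF s0 *(1) 3(1)] e(3)[OF s0 3(2) *(4)] uv(5)[of s] uv(1) 3 \<open>0 \<le> A\<close> by auto
      then show ?thesis by linarith
    qed
  qed
qed

text \<open>On a fine grid every jump of size at least a/2 sits alone in its cell and the increment
  over that cell tends to the jump; all other increments are below \<open>a\<close>, where
  \<open>c\<close> vanishes.\<close>

lemma tendsto_sum_increments:
  fixes c :: "real \<Rightarrow> 'b::real_normed_vector"
  assumes w: "increasing_path w" and c: "continuous_on UNIV c" and c0: "\<And>x. x < a \<Longrightarrow> c x = 0"
    and "0 < a" "0 \<le> A" "A < B"
  defines "p \<equiv> \<lambda>n i. A + real i * (B - A) / real n"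
  shows "(\<lambda>n. \<Sum>i<n. c (w (p n (Suc i)) - w (p n i)))
    \<longlonglongrightarrow> (\<Sum>s\<in>{s\<in>{A<..B}. a \<le> jump w s}. c (jump w s))"
proof -
  have cad: "cadlag w" using w by (simp add: increasing_path_def)
  \<comment> \<open>The threshold is a/2 because \<open>small_increments\<close> needs cells free of
    jumps of that size. Jumps between a/2 and a drop out at the end, since \<open>c\<close> is 0 at
    their size.\<close>
  define S where "S = {s\<in>{A<..B}. a/2 \<le> jump w s}"
  have finS: "finite S"
    using finite_big_jumps[OF w, of "a/2" B] \<open>0 < a\<close> \<open>0 \<le> A\<close>
    by (rule_tac finite_subset[of S]) (auto simp: S_def intro!: c0)
  \<comment> \<open>Index of the grid cell, open on the left, that contains s.\<close>
  define i where "i n s = nat (\<lceil>(s - A) * real n / (B - A)\<rceil> - 1)" for n s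
  have pi: "i n s < n \<and> p n (i n s) < s \<and> s \<le> p n (Suc (i n s))" if "s \<in> S" "n > 0" for n s
  proof -
    have pos: "(s - A) * real n / (B - A) > 0" using that by (auto simp: S_def intro!: c0)
    have le: "(s - A) * real n / (B - A) \<le> real n"
      using that \<open>A < B\<close> by (auto simp: S_def field_simps)
    have ge: "\<lceil>(s - A) * real n / (B - A)\<rceil> \<ge> 1" using pos by linarith
    have ri: "real (i n s) = real_of_int \<lceil>(s - A) * real n / (B - A)\<rceil> - 1"
      unfolding i_def using ge by simp
    have 1: "real (i n s) < (s - A) * real n / (B - A)" "(s - A) * real n / (B - A) \<le> real (Suc (i n s))"
      using ri by linarith+
    have "\<lceil>(s - A) * real n / (B - A)\<rceil> \<le> int n" using le by linarith
    then have "i n s < n" using ge unfolding i_def by linarith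
    moreover have "p n (i n s) < s" "s \<le> p n (Suc (i n s))"
      using 1 that \<open>A < B\<close> unfolding p_def by (auto simp: field_simps simp del: of_nat_Suc)
    ultimately show ?thesis by simp
  qed
  have pstep: "p n (Suc j) - p n j = (B - A) / n" for n j
    by (simp add: p_def field_simps add_divide_distrib diff_divide_distrib)
  have mesh: "(\<lambda>n. (B - A) / real n) \<longlonglongrightarrow> 0" by (rule lim_const_over_n)
  have plim: "(\<lambda>n. p n (i n s)) \<longlonglongrightarrow> s" "(\<lambda>n. p n (Suc (i n s))) \<longlonglongrightarrow> s" if "s \<in> S" for s
  proof -
    have ev: "eventually (\<lambda>n. s - (B - A) / real n \<le> p n (i n s) \<and> p n (i n s) \<le> s \<and>
             s \<le> p n (Suc (i n s)) \<and> p n (Suc (i n s)) \<le> s + (B - A) / real n) sequentially"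
      using eventually_gt_at_top[of 0]
    proof eventually_elim
      case (elim n)
      then show ?case using pi[OF that elim] pstep[of n "i n s"] by auto
    qed
    have lims: "(\<lambda>n. s - (B - A) / real n) \<longlonglongrightarrow> s" "(\<lambda>n. s + (B - A) / real n) \<longlonglongrightarrow> s"
      using tendsto_diff[OF tendsto_const mesh, of s] tendsto_add[OF tendsto_const mesh, of s] by auto
    show "(\<lambda>n. p n (i n s)) \<longlonglongrightarrow> s"
      by (rule tendsto_sandwich[OF _ _ lims(1) tendsto_const]; use ev in eventually_elim) auto
    show "(\<lambda>n. p n (Suc (i n s))) \<longlonglongrightarrow> s"
      by (rule tendsto_sandwich[OF _ _ tendsto_const lims(2)]; use ev in eventually_elim) auto
  qed
  have wlim: "(\<lambda>n. w (p n (Suc (i n s))) - w (p n (i n s))) \<longlonglongrightarrow> jump w s" if "s \<in> S" for s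
  proof -
    have s: "0 < s" using that \<open>0 \<le> A\<close> by (auto simp: S_def intro!: c0)
    \<comment> \<open>The left end of the cell is strictly below s and its right end is at or above
      s: the former sees the left limit, the latter right continuity.\<close>
    have "filterlim (\<lambda>n. p n (i n s)) (at_left s) sequentially"
      unfolding filterlim_at
    proof
      show "eventually (\<lambda>n. p n (i n s) \<in> {..<s} \<and> p n (i n s) \<noteq> s) sequentially"
        using eventually_gt_at_top[of 0] by eventually_elim (use pi[OF that] in \<open>metis lessThan_iff less_irrefl\<close>)
    qed (rule plim[OF that])
    from filterlim_compose[OF cadlag_at_left[OF cad s] this]
    have 1: "(\<lambda>n. w (p n (i n s))) \<longlonglongrightarrow> w s - jump w s" .
    have 2: "(\<lambda>n. w (p n (Suc (i n s)))) \<longlonglongrightarrow> w s"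
    proof (rule continuous_within_tendsto_compose[OF cadlag_at_right[OF cad] _ plim(2)[OF that]])
      show "eventually (\<lambda>n. p n (Suc (i n s)) \<in> {s..}) sequentially"
        using eventually_gt_at_top[of 0] by eventually_elim (use pi[OF that] in \<open>metis atLeast_iff\<close>)
    qed (use s in auto)
    show ?thesis using tendsto_diff[OF 2 1] by simp
  qed
  obtain e where e: "0 < e"
    "\<And>u v. A \<le> u \<Longrightarrow> u \<le> v \<Longrightarrow> v \<le> B \<Longrightarrow> v - u < e \<Longrightarrow> (\<And>s. s \<in> {u<..v} \<Longrightarrow> jump w s < a / 2)
       \<Longrightarrow> w v - w u < a"
    using small_increments[OF w \<open>0 < a\<close> \<open>0 \<le> A\<close>] by metis
  have ev1: "eventually (\<lambda>n. (B - A) / real n < e) sequentially"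
    using order_tendstoD(2)[OF mesh e(1)] .
  \<comment> \<open>Once the mesh is below the gaps of the finite set \<open>S\<close>, distinct big
    jumps lie in distinct cells, which makes \<open>i n\<close> injective.\<close>
  have ev2: "eventually (\<lambda>n. \<forall>s\<in>S. \<forall>s'\<in>S. s \<noteq> s' \<longrightarrow> (B - A) / real n < \<bar>s - s'\<bar>) sequentially"
    using finS by (intro eventually_ball_finite ballI) (auto intro!: order_tendstoD(2)[OF mesh])
  have ev: "eventually (\<lambda>n. (\<Sum>i<n. c (w (p n (Suc i)) - w (p n i)))
      = (\<Sum>s\<in>S. c (w (p n (Suc (i n s))) - w (p n (i n s))))) sequentially"
    using ev1 ev2 eventually_gt_at_top[of 0]
  proof eventually_elim
    case (elim n)
    have inj: "inj_on (i n) S"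
    proof (rule inj_onI, rule ccontr)
      fix s s' assume H: "s \<in> S" "s' \<in> S" "i n s = i n s'" "s \<noteq> s'"
      then have "(B - A) / real n < \<bar>s - s'\<bar>" using elim by blast
      moreover have "p n (i n s) < s \<and> s \<le> p n (Suc (i n s))"
        "p n (i n s) < s' \<and> s' \<le> p n (Suc (i n s))"
        using pi[OF H(1), of n] pi[OF H(2), of n] H(3) elim by simp_all
      ultimately show False using pstep[of n "i n s"] by linarith
    qed
    have "(\<Sum>i<n. c (w (p n (Suc i)) - w (p n i))) = (\<Sum>i\<in>i n ` S. c (w (p n (Suc i)) - w (p n i)))"
    proof (rule sum.mono_neutral_right)
      show "i n ` S \<subseteq> {..<n}" using pi elim by auto
      show "\<forall>j\<in>{..<n} - i n ` S. c (w (p n (Suc j)) - w (p n j)) = 0"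
      proof safe
        fix j assume j: "j < n" "j \<notin> i n ` S"
        have le: "p n j \<le> p n (Suc j)" "A \<le> p n j"
          using \<open>A < B\<close> elim by (auto simp: p_def divide_right_mono mult_right_mono)
        have "real (Suc j) * (B - A) \<le> real n * (B - A)"
          using \<open>A < B\<close> j by (intro mult_right_mono) auto
        then have leB: "p n (Suc j) \<le> B" using elim by (auto simp: p_def field_simps simp del: of_nat_Suc)
        have "w (p n (Suc j)) - w (p n j) < a"
        proof (rule e(2))
          fix s assume s: "s \<in> {p n j<..p n (Suc j)}"
          show "jump w s < a / 2"
          proof (rule ccontr)
            assume "\<not> jump w s < a / 2"
            then have sS: "s \<in> S" using s le leB by (auto simp: S_def intro!: c0)
            have "i n s = j"
            proof -
              have "p n (i n s) < p n (Suc j)" "p n j < p n (Suc (i n s))"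
                using pi[OF sS, of n] elim s by auto
              then have "real (i n s) * (B - A) < real (Suc j) * (B - A)"
                  "real j * (B - A) < real (Suc (i n s)) * (B - A)"
                using elim by (auto simp: p_def divide_less_cancel simp del: of_nat_Suc)
              then have "i n s < Suc j" "j < Suc (i n s)"
                using \<open>A < B\<close> by (auto simp: mult_less_cancel_right simp del: of_nat_Suc)
              then show ?thesis by simp
            qed
            then show False using j sS by auto
          qed
        qed (use le leB elim pstep in auto)
        then show "c (w (p n (Suc j)) - w (p n j)) = 0" by (rule c0)
      qed
    qed auto
    also have "\<dots> = (\<Sum>s\<in>S. c (w (p n (Suc (i n s))) - w (p n (i n s))))"
      by (subst sum.reindex[OF inj]) simp
    finally show ?case .
  qed
  have "(\<lambda>n. \<Sum>s\<in>S. c (w (p n (Suc (i n s))) - w (p n (i n s)))) \<longlonglongrightarrow> (\<Sum>s\<in>S. c (jump w s))"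
    using wlim c by (intro tendsto_sum continuous_on_tendsto_compose[OF c]) auto
  moreover have "(\<Sum>s\<in>S. c (jump w s)) = (\<Sum>s\<in>{s\<in>{A<..B}. a \<le> jump w s}. c (jump w s))"
    using finS c0 \<open>0 < a\<close> by (intro sum.mono_neutral_right) (auto simp: S_def intro!: c0)
  ultimately show ?thesis using ev by (simp add: tendsto_cong)
qed

section \<open>Small-time behaviour\<close>

text \<open>The left half-plane is convex and the derivative of \<open>exp\<close> has norm at most
  1 there.\<close>

lemma norm_exp_diff_le:
  assumes "Re a \<le> 0" "Re b \<le> 0" shows "norm (exp a - exp b) \<le> norm (a - b)"
proof -
  have "norm (exp a - exp b) \<le> 1 * norm (a - b)"
  proof (rule field_differentiable_bound[of "{z. Re z \<le> 0}" exp exp])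
    show "convex {z. Re z \<le> 0}" by (rule convex_halfspace_Re_le)
  qed (use assms in \<open>auto intro!: derivative_eq_intros\<close>)
  then show ?thesis by simp
qed

lemma norm_iexp_diff_1_le: "norm (iexp y - 1) \<le> \<bar>y\<bar>" "norm (iexp y - 1) \<le> 2"
proof -
  show "norm (iexp y - 1) \<le> \<bar>y\<bar>" using iexp_approx1[of y 0] by simp
  have "norm (iexp y - 1) \<le> norm (iexp y) + norm (1::complex)" by (rule norm_triangle_ineq4)
  then show "norm (iexp y - 1) \<le> 2" by simp
qed

text \<open>A Gaussian is the normal mixture of the characters iexp(\<sigma> z x). This turns
  information on characteristic functions into information on real test functions.\<close>

lemma exp_minus_square_eq_integral_iexp:
  "complex_of_real (exp (- (\<sigma> * x)\<^sup>2 / 2)) = (CLINT z|std_normal_distribution. iexp (\<sigma> * z * x))"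
proof -
  have "complex_of_real (exp (- (\<sigma> * x)\<^sup>2 / 2)) = char std_normal_distribution (\<sigma> * x)"
    by (simp add: char_std_normal_distribution)
  also have "\<dots> = (CLINT z|std_normal_distribution. iexp (\<sigma> * z * x))"
    unfolding char_def by (intro Bochner_Integration.integral_cong) (auto simp: mult_ac)
  finally show ?thesis .
qed

section \<open>The Levy measure, the characteristic exponent and small-time limits\<close>

locale driftless_subordinator = subordinator M \<xi> for M :: "'a measure" and \<xi> +
  fixes \<nu> :: "real measure"
  assumes levy_measure: "has_drift_levy_measure M \<xi> 0 \<nu>"
begin

lemma sets_nu [simp, measurable_cong]: "sets \<nu> = sets borel"
  using levy_measure by (simp add: has_drift_levy_measure_def)

lemma space_nu [simp]: "space \<nu> = UNIV"
  using sets_eq_imp_space_eq[OF sets_nu] by simp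

lemma AE_nu_pos: "AE x in \<nu>. 0 < x"
proof -
  have "{..0} \<in> null_sets \<nu>" using levy_measure by (auto simp: has_drift_levy_measure_def null_sets_def)
  then show ?thesis by (rule AE_I') auto
qed

lemma integrable_min: "integrable \<nu> (min 1)"
proof (rule integrableI_bounded)
  have "(\<integral>\<^sup>+ x. ennreal (norm (min 1 x)) \<partial>\<nu>) = (\<integral>\<^sup>+ x. ennreal (min 1 x) \<partial>\<nu>)"
    using AE_nu_pos by (intro nn_integral_cong_AE) (auto elim!: eventually_mono)
  then show "(\<integral>\<^sup>+ x. ennreal (norm (min 1 x)) \<partial>\<nu>) < \<infinity>"
    using levy_measure by (simp add: has_drift_levy_measure_def)
qed simp

lemma emeasure_nu_ge_finite:
  assumes "0 < a" shows "emeasure \<nu> {a..} < \<infinity>"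
proof -
  have "ennreal (min 1 a) * emeasure \<nu> {a..} = (\<integral>\<^sup>+x. ennreal (min 1 a) * indicator {a..} x \<partial>\<nu>)"
    by (simp add: nn_integral_cmult_indicator)
  also have "\<dots> \<le> (\<integral>\<^sup>+x. ennreal (min 1 x) \<partial>\<nu>)"
    by (intro nn_integral_mono) (auto simp: indicator_def intro!: ennreal_leI)
  also have "\<dots> < \<infinity>" using levy_measure by (simp add: has_drift_levy_measure_def)
  finally show ?thesis using assms by (auto simp: ennreal_mult_less_top)
qed

sublocale nu: sigma_finite_measure \<nu>
proof
  let ?A = "insert {..0} (range (\<lambda>n. {1 / real (Suc n)..}))"
  have "\<Union>?A = UNIV"
  proof -
    have "x \<in> \<Union>?A" for x :: real
    proof (cases "x \<le> 0")
      case False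
      then obtain n where "1 / real (Suc n) < x" using nat_approx_posE[of x] by auto
      then have "x \<in> {1 / real (Suc n)..}" by simp
      then show ?thesis by blast
    qed auto
    then show ?thesis by blast
  qed
  moreover have "emeasure \<nu> {..0} = 0" using levy_measure by (simp add: has_drift_levy_measure_def)
  moreover have "emeasure \<nu> {1 / real (Suc n)..} \<noteq> \<infinity>" for n
    using emeasure_nu_ge_finite[of "1 / real (Suc n)"] by (simp del: of_nat_Suc)
  ultimately show "\<exists>A. countable A \<and> A \<subseteq> sets \<nu> \<and> \<Union>A = space \<nu> \<and> (\<forall>a\<in>A. emeasure \<nu> a \<noteq> \<infinity>)"
    by (intro exI[of _ ?A]) auto
qed

lemma increasing_paths: "\<omega> \<in> space M \<Longrightarrow> increasing_path (\<lambda>t. \<xi> t \<omega>)"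
  using cadlag_paths increasing by (simp add: increasing_path_def)

lemma nonneg: "\<omega> \<in> space M \<Longrightarrow> 0 \<le> t \<Longrightarrow> 0 \<le> \<xi> t \<omega>"
  using increasing_pathD[OF increasing_paths, of \<omega> 0 t] start by simp

text \<open>The exponent of the Levy-Khintchine formula without drift: \<xi> at time t has
  characteristic function exp(t \<Psi>(u)).\<close>

definition \<Psi> :: "real \<Rightarrow> complex" where
  "\<Psi> u = (CLINT x|\<nu>. iexp (u * x) - 1)"

text \<open>The bound grows only linearly in u, so it remains integrable when u is a multiple of a
  normal variable.\<close>

lemma iexp_diff_1_bound: "0 < x \<Longrightarrow> norm (iexp (u * x) - 1) \<le> (2 + \<bar>u\<bar>) * min 1 x"
proof -
  assume "0 < x"
  show ?thesis
  proof (cases "x \<le> 1")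
    case True
    have "norm (iexp (u * x) - 1) \<le> \<bar>u\<bar> * x"
      using norm_iexp_diff_1_le(1)[of "u * x"] \<open>0 < x\<close> by (simp add: abs_mult)
    also have "\<dots> \<le> (2 + \<bar>u\<bar>) * x" using \<open>0 < x\<close> by (intro mult_right_mono) auto
    finally show ?thesis using True by simp
  qed (use norm_iexp_diff_1_le(2)[of "u * x"] in simp)
qed

lemma integrable_iexp_diff_1: "integrable \<nu> (\<lambda>x. iexp (u * x) - 1)"
proof (rule Bochner_Integration.integrable_bound)
  show "integrable \<nu> (\<lambda>x. (2 + \<bar>u\<bar>) * min 1 x)" using integrable_min by simp
  show "AE x in \<nu>. norm (iexp (u * x) - 1) \<le> norm ((2 + \<bar>u\<bar>) * min 1 x)"
    using AE_nu_pos by eventually_elim (use iexp_diff_1_bound in \<open>auto simp: abs_mult\<close>)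
qed simp

lemma norm_Psi_le: "norm (\<Psi> u) \<le> (2 + \<bar>u\<bar>) * (\<integral>x. min 1 x \<partial>\<nu>)"
proof -
  have "norm (\<Psi> u) \<le> (\<integral>x. norm (iexp (u * x) - 1) \<partial>\<nu>)"
    unfolding \<Psi>_def by (rule integral_norm_bound)
  also have "\<dots> \<le> (\<integral>x. (2 + \<bar>u\<bar>) * min 1 x \<partial>\<nu>)"
    using integrable_iexp_diff_1 integrable_min AE_nu_pos iexp_diff_1_bound
    by (intro integral_mono_AE) (auto elim!: eventually_mono)
  finally show ?thesis by simp
qed

lemma measurable_Psi [measurable]: "\<Psi> \<in> borel_measurable borel"
  unfolding \<Psi>_def by measurable

lemma expectation_iexp:
  assumes "0 \<le> t" shows "(CLINT \<omega>|M. iexp (u * \<xi> t \<omega>)) = exp (t * \<Psi> u)"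
proof -
  note [measurable] = random_variable[OF assms]
  have "(CLINT \<omega>|M. iexp (u * \<xi> t \<omega>)) = char (distr M borel (\<xi> t)) u"
    unfolding char_def by (subst integral_distr) auto
  then show ?thesis using levy_measure assms by (simp add: has_drift_levy_measure_def \<Psi>_def)
qed

lemma norm_exp_Psi_le: "0 \<le> t \<Longrightarrow> norm (exp (of_real t * \<Psi> u)) \<le> 1"
proof -
  assume t: "0 \<le> t"
  interpret D: real_distribution "distr M borel (\<xi> t)"
    using random_variable[OF t] by (rule real_distribution_distr)
  show ?thesis using levy_measure t D.cmod_char_le_1[of u]
    by (simp add: has_drift_levy_measure_def \<Psi>_def)
qed

text \<open>A characteristic function has modulus at most 1, and the modulus of exp(\<Psi>(u)) is
  exp of the real part.\<close>

lemma Re_Psi_le: "Re (\<Psi> u) \<le> 0"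
  using norm_exp_Psi_le[of 1 u] by simp

lemma expectation_gauss:
  assumes "0 \<le> t"
  shows "complex_of_real (\<integral>\<omega>. exp (- (\<sigma> * \<xi> t \<omega>)\<^sup>2 / 2) \<partial>M) =
    (CLINT z|std_normal_distribution. exp (t * \<Psi> (\<sigma> * z)))"
proof -
  note [measurable] = random_variable[OF assms]
  interpret N: prob_space std_normal_distribution by (simp add: prob_space_normal_density)
  interpret P: pair_prob_space M std_normal_distribution ..
  have "complex_of_real (\<integral>\<omega>. exp (- (\<sigma> * \<xi> t \<omega>)\<^sup>2 / 2) \<partial>M)
      = (CLINT \<omega>|M. CLINT z|std_normal_distribution. iexp (\<sigma> * z * \<xi> t \<omega>))"
    by (subst integral_complex_of_real[symmetric]) (simp only: exp_minus_square_eq_integral_iexp)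
  also have "\<dots> = (CLINT z|std_normal_distribution. CLINT \<omega>|M. iexp (\<sigma> * z * \<xi> t \<omega>))"
    by (rule P.Fubini_integral[symmetric]) (auto intro!: P.P.integrable_const_bound[where B=1])
  finally show ?thesis by (simp only: expectation_iexp[OF assms])
qed

text \<open>Fubini as in \<open>expectation_gauss\<close>. Since \<nu> may have infinite mass, joint
  integrability of iexp - 1 has to come from \<open>iexp_diff_1_bound\<close> and the first absolute
  moment of the normal law.\<close>

lemma integral_gauss_diff_1:
  "complex_of_real (\<integral>x. exp (- (\<sigma> * x)\<^sup>2 / 2) - 1 \<partial>\<nu>) =
    (CLINT z|std_normal_distribution. \<Psi> (\<sigma> * z))"
proof -
  interpret N: prob_space std_normal_distribution by (simp add: prob_space_normal_density)
  interpret P: pair_sigma_finite std_normal_distribution \<nu> ..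
  have iN: "integrable std_normal_distribution (\<lambda>z. c * (2 + \<bar>\<sigma> * z\<bar>))" for c
    using integrable_std_normal_distribution_moment[of 1] by (simp add: abs_mult)
  have int: "integrable (std_normal_distribution \<Otimes>\<^sub>M \<nu>) (\<lambda>(z, x). iexp (\<sigma> * z * x) - 1)"
  proof (rule P.Fubini_integrable)
    show "integrable std_normal_distribution (\<lambda>z. \<integral>x. norm (case (z, x) of (z, x) \<Rightarrow> iexp (\<sigma> * z * x) - 1) \<partial>\<nu>)"
    proof (rule Bochner_Integration.integrable_bound[OF iN[of "\<integral>x. min 1 x \<partial>\<nu>"]])
      show "AE z in std_normal_distribution. norm (\<integral>x. norm (case (z, x) of (z, x) \<Rightarrow> iexp (\<sigma> * z * x) - 1) \<partial>\<nu>)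
        \<le> norm ((\<integral>x. min 1 x \<partial>\<nu>) * (2 + \<bar>\<sigma> * z\<bar>))"
      proof (rule AE_I2)
        fix z
        have "(\<integral>x. norm (iexp (\<sigma> * z * x) - 1) \<partial>\<nu>) \<le> (\<integral>x. (2 + \<bar>\<sigma> * z\<bar>) * min 1 x \<partial>\<nu>)"
          using integrable_norm[OF integrable_iexp_diff_1[of "\<sigma> * z"]] integrable_min AE_nu_pos
            iexp_diff_1_bound[of _ "\<sigma> * z"]
          by (intro integral_mono_AE) (auto elim!: eventually_mono)
        then show "norm (\<integral>x. norm (case (z, x) of (z, x) \<Rightarrow> iexp (\<sigma> * z * x) - 1) \<partial>\<nu>)
          \<le> norm ((\<integral>x. min 1 x \<partial>\<nu>) * (2 + \<bar>\<sigma> * z\<bar>))"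
          by (simp add: mult.commute)
      qed
    qed simp
    show "AE z in std_normal_distribution. integrable \<nu> (\<lambda>x. case (z, x) of (z, x) \<Rightarrow> iexp (\<sigma> * z * x) - 1)"
      using integrable_iexp_diff_1[of "\<sigma> * z" for z] by simp
  qed simp
  have "complex_of_real (\<integral>x. exp (- (\<sigma> * x)\<^sup>2 / 2) - 1 \<partial>\<nu>)
      = (CLINT x|\<nu>. CLINT z|std_normal_distribution. iexp (\<sigma> * z * x) - 1)"
  proof (subst integral_complex_of_real[symmetric], rule Bochner_Integration.integral_cong)
    fix x
    have "integrable std_normal_distribution (\<lambda>z. iexp (\<sigma> * z * x))"
      by (rule N.integrable_const_bound[where B=1]) auto
    then have "(CLINT z|std_normal_distribution. iexp (\<sigma> * z * x) - 1)
        = (CLINT z|std_normal_distribution. iexp (\<sigma> * z * x)) - 1"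
      using N.prob_space by (subst Bochner_Integration.integral_diff) auto
    then show "complex_of_real (exp (- (\<sigma> * x)\<^sup>2 / 2) - 1)
        = (CLINT z|std_normal_distribution. iexp (\<sigma> * z * x) - 1)"
      by (simp only: exp_minus_square_eq_integral_iexp[symmetric]) simp
  qed simp
  also have "\<dots> = (CLINT z|std_normal_distribution. CLINT x|\<nu>. iexp (\<sigma> * z * x) - 1)"
    using P.Fubini_integral[OF int] .
  finally show ?thesis by (simp only: \<Psi>_def)
qed

lemma integrable_gauss:
  "0 \<le> t \<Longrightarrow> integrable M (\<lambda>\<omega>. exp (- (\<sigma> * \<xi> t \<omega>)\<^sup>2 / 2))"
  using random_variable[of t] by (intro integrable_const_bound[where B=1]) auto

text \<open>After mixing over z, the claim is the derivative of t |-> exp(t \<Psi>(\<sigma> z)) at 0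
  taken under the integral. The difference quotients are dominated by |\<Psi>(\<sigma> z)|, because
  \<open>exp\<close> is 1-Lipschitz where the real part is at most 0.\<close>

lemma small_time_gauss:
  fixes h :: "nat \<Rightarrow> real"
  assumes h: "\<And>n. 0 < h n" "h \<longlonglongrightarrow> 0"
  shows "(\<lambda>n. (\<integral>\<omega>. exp (- (\<sigma> * \<xi> (h n) \<omega>)\<^sup>2 / 2) - 1 \<partial>M) / h n)
    \<longlonglongrightarrow> (\<integral>x. exp (- (\<sigma> * x)\<^sup>2 / 2) - 1 \<partial>\<nu>)"
proof -
  interpret N: prob_space std_normal_distribution by (simp add: prob_space_normal_density)
  let ?f = "\<lambda>n z. (exp (h n * \<Psi> (\<sigma> * z)) - 1) / h n"
  have "(\<lambda>n. CLINT z|std_normal_distribution. ?f n z) \<longlonglongrightarrow> (CLINT z|std_normal_distribution. \<Psi> (\<sigma> * z))"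
  proof (rule integral_dominated_convergence)
    show "integrable std_normal_distribution (\<lambda>z. (2 + \<bar>\<sigma> * z\<bar>) * (\<integral>x. min 1 x \<partial>\<nu>))"
      using integrable_std_normal_distribution_moment[of 1] by (simp add: abs_mult)
    show "AE z in std_normal_distribution. (\<lambda>n. ?f n z) \<longlonglongrightarrow> \<Psi> (\<sigma> * z)"
    proof (rule AE_I2)
      fix z
      have "((\<lambda>t. exp (t * \<Psi> (\<sigma> * z))) has_field_derivative \<Psi> (\<sigma> * z)) (at 0)"
        by (auto intro!: derivative_eq_intros)
      then have "((\<lambda>t. (exp (t * \<Psi> (\<sigma> * z)) - 1) / t) \<longlongrightarrow> \<Psi> (\<sigma> * z)) (at 0)"
        by (simp add: DERIV_def)
      moreover have "filterlim (\<lambda>n. complex_of_real (h n)) (at 0) sequentially"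
        unfolding filterlim_at using h tendsto_of_real[OF h(2), where 'a=complex]
        by (auto simp: less_imp_neq[symmetric] intro!: always_eventually)
      ultimately show "(\<lambda>n. ?f n z) \<longlonglongrightarrow> \<Psi> (\<sigma> * z)"
        by (rule filterlim_compose)
    qed
    fix n
    show "AE z in std_normal_distribution. norm (?f n z) \<le> (2 + \<bar>\<sigma> * z\<bar>) * (\<integral>x. min 1 x \<partial>\<nu>)"
    proof (rule AE_I2)
      fix z
      have "norm (exp (h n * \<Psi> (\<sigma> * z)) - exp 0) \<le> norm (h n * \<Psi> (\<sigma> * z) - 0)"
        using h(1)[of n] Re_Psi_le by (intro norm_exp_diff_le) (auto simp: mult_le_0_iff)
      then have "norm (?f n z) \<le> norm (\<Psi> (\<sigma> * z))"
        using h(1)[of n] by (simp add: norm_divide norm_mult field_simps)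
      then show "norm (?f n z) \<le> (2 + \<bar>\<sigma> * z\<bar>) * (\<integral>x. min 1 x \<partial>\<nu>)"
        using norm_Psi_le[of "\<sigma> * z"] by linarith
    qed
  qed simp_all
  moreover have "(CLINT z|std_normal_distribution. ?f n z) =
      complex_of_real ((\<integral>\<omega>. exp (- (\<sigma> * \<xi> (h n) \<omega>)\<^sup>2 / 2) - 1 \<partial>M) / h n)" for n
  proof -
    have h0: "0 \<le> h n" using h(1)[of n] by simp
    have "integrable std_normal_distribution (\<lambda>z. exp (h n * \<Psi> (\<sigma> * z)))"
      using norm_exp_Psi_le[OF h0] by (intro N.integrable_const_bound[where B=1]) auto
    then have "(CLINT z|std_normal_distribution. ?f n z)
        = ((CLINT z|std_normal_distribution. exp (h n * \<Psi> (\<sigma> * z))) - 1) / h n"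
      using N.prob_space by simp
    then show ?thesis using integrable_gauss[OF h0]
      by (simp add: expectation_gauss[OF h0, symmetric] prob_space)
  qed
  ultimately have "(\<lambda>n. complex_of_real ((\<integral>\<omega>. exp (- (\<sigma> * \<xi> (h n) \<omega>)\<^sup>2 / 2) - 1 \<partial>M) / h n))
    \<longlonglongrightarrow> complex_of_real (\<integral>x. exp (- (\<sigma> * x)\<^sup>2 / 2) - 1 \<partial>\<nu>)"
    by (simp only: integral_gauss_diff_1)
  then show ?thesis by (rule tendsto_of_real_iff[THEN iffD1])
qed

lemma integrable_one_minus_gauss: "0 \<le> \<sigma> \<Longrightarrow> integrable \<nu> (\<lambda>x. exp (- (\<sigma> * x)\<^sup>2 / 2) - 1)"
proof (rule Bochner_Integration.integrable_bound)
  assume "0 \<le> \<sigma>"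
  show "integrable \<nu> (\<lambda>x. (1 + \<sigma>\<^sup>2) * min 1 x)" using integrable_min by simp
  show "AE x in \<nu>. norm (exp (- (\<sigma> * x)\<^sup>2 / 2) - 1) \<le> norm ((1 + \<sigma>\<^sup>2) * min 1 x)"
    using AE_nu_pos
  proof eventually_elim
    case (elim x)
    have 1: "1 - exp (- (\<sigma> * x)\<^sup>2 / 2) \<le> (\<sigma> * x)\<^sup>2 / 2" using exp_ge_add_one_self[of "- (\<sigma> * x)\<^sup>2 / 2"] by simp
    have 2: "norm (exp (- (\<sigma> * x)\<^sup>2 / 2) - 1) = 1 - exp (- (\<sigma> * x)\<^sup>2 / 2)" by simp
    show ?case
    proof (cases "x \<le> 1")
      case True
      have "x\<^sup>2 \<le> x" using True elim by (simp add: power2_eq_square mult_left_le)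
      then have "\<sigma>\<^sup>2 * x\<^sup>2 \<le> \<sigma>\<^sup>2 * x" by (rule mult_left_mono) simp
      moreover have "0 \<le> \<sigma>\<^sup>2 * x" using elim by simp
      ultimately have "\<sigma>\<^sup>2 * x\<^sup>2 / 2 \<le> \<sigma>\<^sup>2 * x" by linarith
      then have "(\<sigma> * x)\<^sup>2 / 2 \<le> (1 + \<sigma>\<^sup>2) * x" using elim by (simp add: power_mult_distrib algebra_simps)
      then show ?thesis using 1 2 True elim by (simp add: abs_mult)
    next
      case False
      have "1 - exp (- (\<sigma> * x)\<^sup>2 / 2) \<le> 1 + \<sigma>\<^sup>2" using exp_ge_zero[of "- (\<sigma> * x)\<^sup>2 / 2"] zero_le_power2[of \<sigma>] by linarith
      then show ?thesis using 2 False by (simp add: abs_mult)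
    qed
  qed
qed simp

text \<open>Powers of y = exp(-x^2) are again Gaussians, with \<sigma> = sqrt(2 i), so polynomials
  in y come within reach of the Gaussian case.\<close>

lemma integrable_poly_gauss:
  "integrable \<nu> (\<lambda>x. exp (- x\<^sup>2) ^ i - 1)"
  "0 \<le> t \<Longrightarrow> integrable M (\<lambda>\<omega>. exp (- (\<xi> t \<omega>)\<^sup>2) ^ i)"
proof -
  have *: "exp (- x\<^sup>2) ^ i = exp (- (sqrt (2 * real i) * x)\<^sup>2 / 2)" for x :: real
    by (simp add: power_mult_distrib exp_of_nat_mult[symmetric])
  show "integrable \<nu> (\<lambda>x. exp (- x\<^sup>2) ^ i - 1)"
    unfolding * by (rule integrable_one_minus_gauss) simp
  show "integrable M (\<lambda>\<omega>. exp (- (\<xi> t \<omega>)\<^sup>2) ^ i)" if "0 \<le> t"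
    unfolding * by (rule integrable_gauss[OF that])
qed

lemma small_time_power:
  fixes h :: "nat \<Rightarrow> real"
  assumes h: "\<And>n. 0 < h n" "h \<longlonglongrightarrow> 0"
  shows "(\<lambda>n. (\<integral>\<omega>. exp (- (\<xi> (h n) \<omega>)\<^sup>2) ^ i - 1 \<partial>M) / h n) \<longlonglongrightarrow> (\<integral>x. exp (- x\<^sup>2) ^ i - 1 \<partial>\<nu>)"
proof -
  have *: "exp (- x\<^sup>2) ^ i = exp (- (sqrt (2 * real i) * x)\<^sup>2 / 2)" for x :: real
    by (simp add: power_mult_distrib exp_of_nat_mult[symmetric])
  show ?thesis unfolding * by (rule small_time_gauss[OF h])
qed

text \<open>The factor 1 - y, with y = exp(-x^2), vanishes at x = 0 and compensates the possibly
  infinite mass of \<nu> near 0.\<close>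

lemma small_time_poly:
  fixes h :: "nat \<Rightarrow> real"
  assumes h: "\<And>n. 0 < h n" "h \<longlonglongrightarrow> 0" and p: "real_polynomial_function p"
  shows "(\<lambda>n. (\<integral>\<omega>. (1 - exp (- (\<xi> (h n) \<omega>)\<^sup>2)) * p (exp (- (\<xi> (h n) \<omega>)\<^sup>2)) \<partial>M) / h n)
      \<longlonglongrightarrow> (\<integral>x. (1 - exp (- x\<^sup>2)) * p (exp (- x\<^sup>2)) \<partial>\<nu>)"
    and "integrable \<nu> (\<lambda>x. (1 - exp (- x\<^sup>2)) * p (exp (- x\<^sup>2)))"
proof -
  obtain a m where p: "p = (\<lambda>x. \<Sum>i\<le>m. a i * x ^ i)"
    using p unfolding real_polynomial_function_iff_sum by blast
  \<comment> \<open>Each monomial times 1 - y is y^i - y^(i+1), written as a difference of two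
    functions y^j - 1, which are \<nu>-integrable where y^j alone need not be.\<close>
  have eq: "(1 - y) * p y = (\<Sum>i\<le>m. a i * ((y ^ i - 1) - (y ^ Suc i - 1)))" for y
    by (simp add: p sum_distrib_left algebra_simps)
  have I: "(\<integral>\<omega>. (\<Sum>i\<le>m. a i * ((exp (- (\<xi> t \<omega>)\<^sup>2) ^ i - 1) - (exp (- (\<xi> t \<omega>)\<^sup>2) ^ Suc i - 1))) \<partial>M) =
     (\<Sum>i\<le>m. a i * ((\<integral>\<omega>. exp (- (\<xi> t \<omega>)\<^sup>2) ^ i - 1 \<partial>M) - (\<integral>\<omega>. exp (- (\<xi> t \<omega>)\<^sup>2) ^ Suc i - 1 \<partial>M)))"
    if "0 \<le> t" for t
    by (subst Bochner_Integration.integral_sum,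
        intro integrable_mult_right Bochner_Integration.integrable_diff integrable_poly_gauss(2)[OF that] integrable_const,
        intro sum.cong refl, subst integral_mult_right_zero, subst Bochner_Integration.integral_diff)
      (auto simp del: power_Suc intro!: Bochner_Integration.integrable_diff integrable_poly_gauss(2)[OF that])
  have N: "(\<integral>x. (\<Sum>i\<le>m. a i * ((exp (- x\<^sup>2) ^ i - 1) - (exp (- x\<^sup>2) ^ Suc i - 1))) \<partial>\<nu>) =
     (\<Sum>i\<le>m. a i * ((\<integral>x. exp (- x\<^sup>2) ^ i - 1 \<partial>\<nu>) - (\<integral>x. exp (- x\<^sup>2) ^ Suc i - 1 \<partial>\<nu>)))"
    by (subst Bochner_Integration.integral_sum,
        intro integrable_mult_right Bochner_Integration.integrable_diff integrable_poly_gauss(1),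
        intro sum.cong refl, subst integral_mult_right_zero, subst Bochner_Integration.integral_diff)
      (auto simp del: power_Suc intro!: integrable_poly_gauss(1))
  show "(\<lambda>n. (\<integral>\<omega>. (1 - exp (- (\<xi> (h n) \<omega>)\<^sup>2)) * p (exp (- (\<xi> (h n) \<omega>)\<^sup>2)) \<partial>M) / h n)
      \<longlonglongrightarrow> (\<integral>x. (1 - exp (- x\<^sup>2)) * p (exp (- x\<^sup>2)) \<partial>\<nu>)"
    unfolding eq N I[OF less_imp_le[OF h(1)]] sum_divide_distrib
    using tendsto_mult[OF tendsto_const tendsto_diff[OF small_time_power[OF h] small_time_power[OF h]]]
    by (intro tendsto_sum) (simp add: diff_divide_distrib[symmetric] del: power_Suc)
  show "integrable \<nu> (\<lambda>x. (1 - exp (- x\<^sup>2)) * p (exp (- x\<^sup>2)))"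
    unfolding eq
    by (intro Bochner_Integration.integrable_sum integrable_mult_right
        Bochner_Integration.integrable_diff integrable_poly_gauss(1))
qed

text \<open>Weierstrass approximation of q on [0,1]. A uniform error e costs at most e (1 - y), and
  the quantities belonging to 1 - y stay bounded by the polynomial case with p = 1.\<close>

lemma small_time_continuous_exp:
  fixes h :: "nat \<Rightarrow> real"
  assumes h: "\<And>n. 0 < h n" "h \<longlonglongrightarrow> 0" and q: "continuous_on {0..1} q"
    and [measurable]: "q \<in> borel_measurable borel"
  shows "(\<lambda>n. (\<integral>\<omega>. (1 - exp (- (\<xi> (h n) \<omega>)\<^sup>2)) * q (exp (- (\<xi> (h n) \<omega>)\<^sup>2)) \<partial>M) / h n)
      \<longlonglongrightarrow> (\<integral>x. (1 - exp (- x\<^sup>2)) * q (exp (- x\<^sup>2)) \<partial>\<nu>)" (is "?L q \<longlonglongrightarrow> ?I q")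
proof (rule LIMSEQ_I)
  fix r :: real assume "0 < r"
  have pf1: "real_polynomial_function (\<lambda>x::real. 1)" by (rule real_polynomial_function.intros(2))
  let ?D = "?I (\<lambda>x. 1)"
  have i1: "integrable \<nu> (\<lambda>x. 1 - exp (- x\<^sup>2))"
    using small_time_poly(2)[OF h pf1] by simp
  have D0: "0 \<le> ?D" by (intro Bochner_Integration.integral_nonneg) auto
  \<comment> \<open>The three errors are e (D + 1) before the limit, e for the polynomial, and e D
    in the limit; they add up to e (2 D + 2) = r.\<close>
  define e where "e = r / (2 * ?D + 2)"
  have D2: "0 < 2 * ?D + 2" using D0 by linarith
  have e: "0 < e" unfolding e_def by (rule divide_pos_pos[OF \<open>0 < r\<close> D2])
  have e2: "e * (2 * ?D + 2) = r" using D2 unfolding e_def by (metis less_irrefl nonzero_eq_divide_eq)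
  obtain p where p: "real_polynomial_function p" "\<And>x. x \<in> {0..1} \<Longrightarrow> \<bar>q x - p x\<bar> < e"
    using Stone_Weierstrass_real_polynomial_function[OF compact_Icc q e] by blast
  have y01: "exp (- x\<^sup>2) \<in> {0..1}" for x :: real by simp
  have pm [measurable]: "p \<in> borel_measurable borel"
    using p(1) by (intro borel_measurable_continuous_onI) (simp add: continuous_on_polymonial_function real_polynomial_function_eq)
  have bd: "\<bar>(1 - exp (- x\<^sup>2)) * q (exp (- x\<^sup>2)) - (1 - exp (- x\<^sup>2)) * p (exp (- x\<^sup>2))\<bar> \<le> e * (1 - exp (- x\<^sup>2))" for x :: real
  proof -
    have "\<bar>(1 - exp (- x\<^sup>2)) * (q (exp (- x\<^sup>2)) - p (exp (- x\<^sup>2)))\<bar> \<le> (1 - exp (- x\<^sup>2)) * e"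
      unfolding abs_mult using p(2)[OF y01[of x]] by (intro mult_mono) auto
    then show ?thesis by (simp add: algebra_simps)
  qed
  have iq: "integrable \<nu> (\<lambda>x. (1 - exp (- x\<^sup>2)) * q (exp (- x\<^sup>2)))"
  proof (rule Bochner_Integration.integrable_bound)
    show "integrable \<nu> (\<lambda>x. \<bar>(1 - exp (- x\<^sup>2)) * p (exp (- x\<^sup>2))\<bar> + e * (1 - exp (- x\<^sup>2)))"
      using small_time_poly(2)[OF h p(1)] i1 by auto
    show "AE x in \<nu>. norm ((1 - exp (- x\<^sup>2)) * q (exp (- x\<^sup>2)))
        \<le> norm (\<bar>(1 - exp (- x\<^sup>2)) * p (exp (- x\<^sup>2))\<bar> + e * (1 - exp (- x\<^sup>2)))"
    proof (rule AE_I2)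
      fix x
      show "norm ((1 - exp (- x\<^sup>2)) * q (exp (- x\<^sup>2)))
        \<le> norm (\<bar>(1 - exp (- x\<^sup>2)) * p (exp (- x\<^sup>2))\<bar> + e * (1 - exp (- x\<^sup>2)))"
        using bd[of x] unfolding real_norm_def by linarith
    qed
  qed simp
  have Ibd: "\<bar>?I q - ?I p\<bar> \<le> e * ?D"
  proof -
    have eq: "?I q - ?I p = (\<integral>x. (1 - exp (- x\<^sup>2)) * q (exp (- x\<^sup>2)) - (1 - exp (- x\<^sup>2)) * p (exp (- x\<^sup>2)) \<partial>\<nu>)"
      using iq small_time_poly(2)[OF h p(1)] by simp
    have "\<bar>?I q - ?I p\<bar> \<le> (\<integral>x. \<bar>(1 - exp (- x\<^sup>2)) * q (exp (- x\<^sup>2)) - (1 - exp (- x\<^sup>2)) * p (exp (- x\<^sup>2))\<bar> \<partial>\<nu>)"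
      unfolding eq by (rule integral_abs_bound)
    also have "\<dots> \<le> (\<integral>x. e * (1 - exp (- x\<^sup>2)) \<partial>\<nu>)"
      by (intro integral_mono integrable_abs Bochner_Integration.integrable_diff
          integrable_mult_right bd iq i1 small_time_poly(2)[OF h p(1)])
    finally show ?thesis by (simp only: integral_mult_right_zero mult_1_right)
  qed
  have Lbd: "\<bar>?L q n - ?L p n\<bar> \<le> e * ?L (\<lambda>x. 1) n" for n
  proof -
    have h0: "0 \<le> h n" using h(1)[of n] by simp
    note [measurable] = random_variable[OF h0]
    let ?y = "\<lambda>\<omega>. exp (- (\<xi> (h n) \<omega>)\<^sup>2)"
    obtain C where C: "\<And>y. y \<in> {0..1} \<Longrightarrow> \<bar>q y\<bar> \<le> C"
      using compact_imp_bounded[OF compact_continuous_image[OF q compact_Icc]]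
      by (force simp: bounded_iff)
    have bnd: "integrable M (\<lambda>\<omega>. (1 - ?y \<omega>) * f (?y \<omega>))"
      if [measurable]: "f \<in> borel_measurable borel" and f: "\<And>y. y \<in> {0..1} \<Longrightarrow> \<bar>f y\<bar> \<le> C'" for f C'
    proof (rule integrable_const_bound[where B=C'])
      show "AE \<omega> in M. norm ((1 - ?y \<omega>) * f (?y \<omega>)) \<le> C'"
        using f[OF y01] by (intro AE_I2) (auto simp: abs_mult intro!: mult_left_le_one_le[THEN order_trans])
    qed simp
    have iq: "integrable M (\<lambda>\<omega>. (1 - ?y \<omega>) * q (?y \<omega>))"
      and ip: "integrable M (\<lambda>\<omega>. (1 - ?y \<omega>) * p (?y \<omega>))"
      and i1: "integrable M (\<lambda>\<omega>. 1 - ?y \<omega>)"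
      using bnd[of q C] bnd[of p "C + e"] bnd[of "\<lambda>_. 1" 1] C p(2) by (auto) (smt (verit) atLeastAtMost_iff)
    have eq: "?L q n - ?L p n = (\<integral>\<omega>. (1 - ?y \<omega>) * q (?y \<omega>) - (1 - ?y \<omega>) * p (?y \<omega>) \<partial>M) / h n"
      using iq ip by (simp add: diff_divide_distrib)
    have "\<bar>?L q n - ?L p n\<bar> \<le> (\<integral>\<omega>. \<bar>(1 - ?y \<omega>) * q (?y \<omega>) - (1 - ?y \<omega>) * p (?y \<omega>)\<bar> \<partial>M) / h n"
      using h0 unfolding eq abs_divide by (simp add: divide_right_mono integral_abs_bound)
    also have "\<dots> \<le> (\<integral>\<omega>. e * (1 - ?y \<omega>) \<partial>M) / h n"
      by (intro divide_right_mono integral_mono integrable_abs Bochner_Integration.integrable_diff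
          integrable_mult_right bd iq ip i1 h0)
    finally show ?thesis by (simp only: integral_mult_right_zero mult_1_right times_divide_eq_right)
  qed
  have "eventually (\<lambda>n. ?L (\<lambda>x. 1) n < ?D + 1) sequentially"
    using small_time_poly(1)[OF h pf1] by (rule order_tendstoD) simp
  moreover have "eventually (\<lambda>n. dist (?L p n) (?I p) < e) sequentially"
    using small_time_poly(1)[OF h p(1)] e by (rule tendstoD)
  ultimately have "eventually (\<lambda>n. norm (?L q n - ?I q) < r) sequentially"
  proof eventually_elim
    case (elim n)
    have "e * ?L (\<lambda>x. 1) n \<le> e * (?D + 1)" using elim e by (intro mult_left_mono) auto
    moreover have "e * (2 * ?D + 2) = e * (?D + 1) + e * ?D + e" by (simp add: algebra_simps)
    ultimately show ?case using Lbd[of n] Ibd elim(2) e2 unfolding dist_real_def real_norm_def by linarith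
  qed
  then show "\<exists>N. \<forall>n\<ge>N. norm (?L q n - ?I q) < r" by (simp add: eventually_sequentially)
qed

text \<open>The substitution y = exp(-x^2) writes \<phi>(x) as (1 - y) q(y) with q continuous on
  [0,1]. It is injective only for x \<ge> 0, which suffices since \<xi> is non-negative and \<nu>
  lives on positive sizes.\<close>

lemma small_time_real:
  fixes h :: "nat \<Rightarrow> real" and \<phi> :: "real \<Rightarrow> real"
  assumes h: "\<And>n. 0 < h n" "h \<longlonglongrightarrow> 0" and cont: "continuous_on UNIV \<phi>"
    and a: "0 < a" "a \<le> b" and supp: "\<And>x. x \<notin> {a..b} \<Longrightarrow> \<phi> x = 0"
  shows "(\<lambda>n. (\<integral>\<omega>. \<phi> (\<xi> (h n) \<omega>) \<partial>M) / h n) \<longlonglongrightarrow> (\<integral>x. \<phi> x \<partial>\<nu>)"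
proof -
  \<comment> \<open>The images of x = b + 1 and x = a/2. The margins around [a,b] make q vanish at l
    and u, so that it can be continued by 0; and u < 1 keeps the denominator 1 - y away from
    0.\<close>
  define l where "l = exp (- (b + 1)\<^sup>2)"
  define u where "u = exp (- (a / 2)\<^sup>2)"
  have "(a / 2)\<^sup>2 < (b + 1)\<^sup>2" using a by (intro power_strict_mono) auto
  then have lu: "0 < l" "l < u" "u < 1" using a by (auto simp: l_def u_def)
  define q where "q y = (if y \<in> {l..u} then \<phi> (sqrt (- ln y)) / (1 - y) else 0)" for y
  have ql: "q l = 0" and qu: "q u = 0"
    using a supp[of "b + 1"] supp[of "a / 2"] by (auto simp: q_def l_def u_def)
  have qc: "continuous_on ({l..u} \<union> ({..l} \<union> {u..})) q"
  proof (intro continuous_on_closed_Un)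
    have "continuous_on {l..u} (\<lambda>y. \<phi> (sqrt (- ln y)) / (1 - y))"
      using lu by (intro continuous_intros continuous_on_compose2[OF cont]) auto
    then show "continuous_on {l..u} q" by (rule continuous_on_eq) (simp add: q_def)
    have "q y = 0" if "y \<in> {..l}" for y using that ql by (cases "y = l") (auto simp: q_def)
    then show "continuous_on {..l} q" by (metis (no_types, lifting) continuous_on_cong continuous_on_const)
    have "q y = 0" if "y \<in> {u..}" for y using that qu by (cases "y = u") (auto simp: q_def)
    then show "continuous_on {u..} q" by (metis (no_types, lifting) continuous_on_cong continuous_on_const)
  qed (auto intro: closed_Un)
  moreover have "{l..u} \<union> ({..l} \<union> {u..}) = UNIV" by auto
  ultimately have qc: "continuous_on UNIV q" by simp
  have eq: "(1 - exp (- x\<^sup>2)) * q (exp (- x\<^sup>2)) = \<phi> x" if "0 \<le> x" for x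
  proof (cases "exp (- x\<^sup>2) \<in> {l..u}")
    case True
    then have "x\<^sup>2 \<noteq> 0" using lu by auto
    then show ?thesis using True that by (simp add: q_def)
  next
    case False
    have "x \<notin> {a..b}"
    proof
      assume "x \<in> {a..b}"
      then have "(a/2)\<^sup>2 \<le> x\<^sup>2" "x\<^sup>2 \<le> (b+1)\<^sup>2" using a by (auto intro!: power_mono)
      then show False using False by (auto simp: l_def u_def)
    qed
    moreover have "q (exp (- x\<^sup>2)) = 0" using False unfolding q_def by (rule if_not_P)
    ultimately show ?thesis using supp by simp
  qed
  have "(\<lambda>n. (\<integral>\<omega>. (1 - exp (- (\<xi> (h n) \<omega>)\<^sup>2)) * q (exp (- (\<xi> (h n) \<omega>)\<^sup>2)) \<partial>M) / h n)
      \<longlonglongrightarrow> (\<integral>x. (1 - exp (- x\<^sup>2)) * q (exp (- x\<^sup>2)) \<partial>\<nu>)"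
    using qc by (intro small_time_continuous_exp h)
      (auto intro: continuous_on_subset borel_measurable_continuous_onI)
  moreover have "(\<integral>\<omega>. (1 - exp (- (\<xi> (h n) \<omega>)\<^sup>2)) * q (exp (- (\<xi> (h n) \<omega>)\<^sup>2)) \<partial>M) = (\<integral>\<omega>. \<phi> (\<xi> (h n) \<omega>) \<partial>M)" for n
    using nonneg h(1)[of n] by (intro Bochner_Integration.integral_cong refl eq) auto
  moreover have "(\<integral>x. (1 - exp (- x\<^sup>2)) * q (exp (- x\<^sup>2)) \<partial>\<nu>) = (\<integral>x. \<phi> x \<partial>\<nu>)"
    using AE_nu_pos borel_measurable_continuous_onI[OF cont] borel_measurable_continuous_onI[OF qc]
    by (intro integral_cong_AE) (auto elim!: eventually_mono simp: eq)
  ultimately show ?thesis by simp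
qed

lemma integrable_nu_continuous:
  fixes \<phi> :: "real \<Rightarrow> 'b::{banach, second_countable_topology}"
  assumes cont: "continuous_on UNIV \<phi>" and "0 < a" and supp: "\<And>x. x \<notin> {a..b} \<Longrightarrow> \<phi> x = 0"
  shows "integrable \<nu> \<phi>"
proof -
  obtain C where C: "\<And>y. y \<in> {a..b} \<Longrightarrow> norm (\<phi> y) \<le> C"
    using compact_imp_bounded[OF compact_continuous_image[OF continuous_on_subset[OF cont] compact_Icc, of a b]]
    by (force simp: bounded_iff)
  show ?thesis
  proof (rule Bochner_Integration.integrable_bound)
    show "integrable \<nu> (\<lambda>x. C * indicator {a..} x)"
      using emeasure_nu_ge_finite[OF \<open>0 < a\<close>] by (intro integrable_mult_right integrable_real_indicator) auto
    show "AE x in \<nu>. norm (\<phi> x) \<le> norm (C * indicator {a..} x :: real)"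
    proof (rule AE_I2)
      fix x show "norm (\<phi> x) \<le> norm (C * indicator {a..} x :: real)"
        using C[of x] supp[of x] by (cases "x \<in> {a..b}") auto
    qed
    show "\<phi> \<in> borel_measurable \<nu>" using borel_measurable_continuous_onI[OF cont] by simp
  qed
qed

lemma small_time:
  fixes h :: "nat \<Rightarrow> real" and \<phi> :: "real \<Rightarrow> complex"
  assumes h: "\<And>n. 0 < h n" "h \<longlonglongrightarrow> 0" and cont: "continuous_on UNIV \<phi>"
    and a: "0 < a" "a \<le> b" and supp: "\<And>x. x \<notin> {a..b} \<Longrightarrow> \<phi> x = 0"
  shows "(\<lambda>n. (\<integral>\<omega>. \<phi> (\<xi> (h n) \<omega>) \<partial>M) / h n) \<longlonglongrightarrow> (\<integral>x. \<phi> x \<partial>\<nu>)"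
proof -
  have i\<nu>: "integrable \<nu> \<phi>" using cont a(1) supp by (rule integrable_nu_continuous)
  obtain C where C: "\<And>y. y \<in> {a..b} \<Longrightarrow> norm (\<phi> y) \<le> C"
    using compact_imp_bounded[OF compact_continuous_image[OF continuous_on_subset[OF cont] compact_Icc, of a b]]
    by (force simp: bounded_iff)
  have bd: "norm (\<phi> y) \<le> max C 0" for y
    using C[of y] supp[of y] by (cases "y \<in> {a..b}") auto
  have iM: "integrable M (\<lambda>\<omega>. \<phi> (\<xi> (h n) \<omega>))" for n
    using bd random_variable[of "h n"] h(1)[of n] borel_measurable_continuous_onI[OF cont]
    by (intro integrable_const_bound[where B="max C 0"]) auto
  show ?thesis
    unfolding tendsto_complex_iff Re_divide_of_real Im_divide_of_real
      integral_Re[OF iM, symmetric] integral_Im[OF iM, symmetric]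
      integral_Re[OF i\<nu>, symmetric] integral_Im[OF i\<nu>, symmetric]
    by (intro conjI small_time_real[OF h _ a] continuous_intros cont) (use supp in auto)
qed

end

section \<open>The exponential formula for jumps\<close>

text \<open>The complex form of (1 + z/n)^n -> exp z without logarithms: in the unit disc |a^n -
  b^n| \<le> n |a - b|, applied to u n and exp(z/n). The index \<open>Suc n\<close> avoids division
  by 0.\<close>

lemma tendsto_power_exp:
  fixes u :: "nat \<Rightarrow> complex"
  assumes u: "\<And>n. norm (u n) \<le> 1" and lim: "(\<lambda>n. of_nat (Suc n) * (u n - 1)) \<longlonglongrightarrow> z"
  shows "(\<lambda>n. u n ^ Suc n) \<longlonglongrightarrow> exp z"
proof -
  have "Re (of_nat (Suc n) * (u n - 1)) \<le> 0" for n
  proof -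
    have "Re (u n) - 1 \<le> 0" using complex_Re_le_cmod[of "u n"] u[of n] by linarith
    then show ?thesis by (simp add: mult_nonneg_nonpos del: of_nat_Suc)
  qed
  \<comment> \<open>This places exp(z / (n + 1)) in the unit disc, as the power estimate
    requires.\<close>
  then have "Re z \<le> 0"
    using LIMSEQ_le_const2[OF tendsto_Re[OF lim]] by auto
  have lim2: "(\<lambda>n. of_nat (Suc n) * (exp (z / of_nat (Suc n)) - 1)) \<longlonglongrightarrow> z"
  proof -
    have "((\<lambda>t. exp (t * z)) has_field_derivative z) (at 0)"
      by (auto intro!: derivative_eq_intros)
    then have "((\<lambda>t. (exp (t * z) - 1) / t) \<longlongrightarrow> z) (at 0)" by (simp add: DERIV_def)
    moreover have "filterlim (\<lambda>n. 1 / complex_of_nat (Suc n)) (at 0) sequentially"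
      unfolding filterlim_at using LIMSEQ_Suc[OF lim_1_over_n[where 'a=complex]]
      by (auto simp del: of_nat_Suc)
    ultimately have "(\<lambda>n. (exp (1 / complex_of_nat (Suc n) * z) - 1) / (1 / complex_of_nat (Suc n))) \<longlonglongrightarrow> z"
      by (rule filterlim_compose)
    then show ?thesis by (simp add: mult.commute del: of_nat_Suc)
  qed
  have "norm (u n ^ Suc n - exp z) \<le> norm (of_nat (Suc n) * (u n - 1) - of_nat (Suc n) * (exp (z / of_nat (Suc n)) - 1))" for n
  proof -
    have "exp z = exp (z / of_nat (Suc n)) ^ Suc n"
      by (simp add: exp_of_nat_mult[symmetric] del: of_nat_Suc power_Suc)
    then have "norm (u n ^ Suc n - exp z) = norm (u n ^ Suc n - exp (z / of_nat (Suc n)) ^ Suc n)" by simp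
    also have "\<dots> \<le> Suc n * norm (u n - exp (z / of_nat (Suc n)))"
      using u \<open>Re z \<le> 0\<close> by (intro norm_power_diff) (auto simp: divide_le_0_iff simp del: of_nat_Suc)
    also have "\<dots> = norm (of_nat (Suc n) * (u n - exp (z / of_nat (Suc n))))"
      by (simp only: norm_mult norm_of_nat)
    finally show ?thesis by (simp add: algebra_simps del: of_nat_Suc)
  qed
  moreover have "(\<lambda>n. norm (of_nat (Suc n) * (u n - 1) - of_nat (Suc n) * (exp (z / of_nat (Suc n)) - 1))) \<longlonglongrightarrow> 0"
    using tendsto_norm_zero[OF tendsto_diff[OF lim lim2, unfolded diff_self]] .
  ultimately have "(\<lambda>n. u n ^ Suc n - exp z) \<longlonglongrightarrow> 0"
    by (rule Lim_null_comparison[OF always_eventually[OF allI]])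
  then show ?thesis by (rule LIM_zero_cancel)
qed

text \<open>Time 0 is left out because no jump is counted there; for T \<le> 0 this is the null
  measure.\<close>

definition time_measure :: "real \<Rightarrow> real measure" where
  "time_measure T = density lborel (indicator {0<..T})"

lemma sets_time_measure [simp, measurable_cong]: "sets (time_measure T) = sets borel"
  and space_time_measure [simp]: "space (time_measure T) = UNIV"
  by (simp_all add: time_measure_def)

lemma emeasure_time_measure:
  "A \<in> sets borel \<Longrightarrow> emeasure (time_measure T) A = emeasure lborel ({0<..T} \<inter> A)"
  by (simp add: time_measure_def emeasure_density indicator_inter_arith[symmetric])

lemma AE_time_measure: "AE s in time_measure T. s \<in> {0<..T}"
  unfolding time_measure_def
  by (subst AE_density) (auto intro!: AE_I2 simp: indicator_def split: if_splits)

lemma finite_time_measure: "finite_measure (time_measure T)"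
  by (rule finite_measureI) (cases "0 \<le> T"; simp add: emeasure_time_measure)

text \<open>Index of the cell of the uniform grid \<open>j T / m\<close> containing \<open>s\<close>; cells are open on the left.\<close>

definition cell :: "real \<Rightarrow> nat \<Rightarrow> real \<Rightarrow> nat" where
  "cell T m s = nat (\<lceil>s * m / T\<rceil> - 1)"

lemma cell_iff:
  fixes T s :: real
  assumes "0 < T" "0 < m" "s \<in> {0<..T}"
  shows "cell T m s = j \<longleftrightarrow> s \<in> {j * T / m<..Suc j * T / m}" and "cell T m s < m"
proof -
  have pos: "0 < s * m / T" using assms by simp
  then have c1: "\<lceil>s * m / T\<rceil> \<ge> 1" by linarith
  have "cell T m s = j \<longleftrightarrow> \<lceil>s * m / T\<rceil> = int j + 1" using c1 unfolding cell_def by linarith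
  also have "\<dots> \<longleftrightarrow> real j < s * m / T \<and> s * m / T \<le> real j + 1" by (simp add: ceiling_eq_iff)
  also have "\<dots> \<longleftrightarrow> s \<in> {j * T / m<..Suc j * T / m}" using assms by (auto simp: field_simps)
  finally show "cell T m s = j \<longleftrightarrow> s \<in> {j * T / m<..Suc j * T / m}" .
  have "s * m / T \<le> m" using assms by (simp add: field_simps)
  then have "\<lceil>s * m / T\<rceil> \<le> int m" by linarith
  then show "cell T m s < m" using c1 unfolding cell_def by linarith
qed

lemma measurable_cell [measurable]: "cell T m \<in> measurable borel (count_space UNIV)"
  unfolding cell_def by measurable

lemma integral_time_measure_cell:
  fixes T :: real and h :: "nat \<Rightarrow> 'b::{banach, second_countable_topology}"
  assumes "0 < T" "0 < m"
  shows "(\<integral>s. h (cell T m s) \<partial>time_measure T) = (\<Sum>j<m. (T / m) *\<^sub>R h j)"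
proof -
  let ?I = "\<lambda>j. {j * T / m<..Suc j * T / m}"
  have sub: "?I j \<subseteq> {0<..T}" if "j < m" for j
  proof
    fix s assume s: "s \<in> ?I j"
    have "real (Suc j) * T \<le> real m * T" using that assms by (intro mult_right_mono) auto
    then have "real (Suc j) * T / m \<le> T" using assms by (simp add: field_simps del: of_nat_Suc)
    moreover have "0 \<le> real j * T / m" using assms by simp
    ultimately show "s \<in> {0<..T}" using s unfolding greaterThanAtMost_iff by linarith
  qed
  have eq: "indicator {0<..T} s *\<^sub>R h (cell T m s) = (\<Sum>j<m. indicator (?I j) s *\<^sub>R h j)" for s
  proof (cases "s \<in> {0<..T}")
    case True
    have "(\<Sum>j<m. indicator (?I j) s *\<^sub>R h j) = (\<Sum>j<m. if cell T m s = j then h j else 0)"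
      using cell_iff(1)[OF assms True] by (intro sum.cong) (auto simp: indicator_def simp del: of_nat_Suc)
    then show ?thesis using True cell_iff(2)[OF assms True] by simp
  next
    case False
    then have "s \<notin> ?I j" if "j < m" for j using sub[OF that] by blast
    then have "(\<Sum>j<m. indicator (?I j) s *\<^sub>R h j) = 0"
      by (intro sum.neutral) (simp add: indicator_def del: of_nat_Suc)
    then show ?thesis using False by simp
  qed
  have len: "measure lborel (?I j) = T / m" for j
    using assms by (simp add: measure_lborel_Ioc divide_right_mono field_simps)
  have fin: "integrable lborel (indicator (?I j) :: real \<Rightarrow> real)" for j
    using assms by (intro integrable_real_indicator) (auto simp: divide_right_mono mult_right_mono)
  have "(\<integral>s. h (cell T m s) \<partial>time_measure T) = (\<integral>s. indicator {0<..T} s *\<^sub>R h (cell T m s) \<partial>lborel)"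
  proof -
    have "time_measure T = density lborel (\<lambda>s. ennreal (indicator {0<..T} s))"
      by (simp add: time_measure_def ennreal_indicator)
    then show ?thesis by (simp only:) (subst integral_density; simp)
  qed
  also have "\<dots> = (\<Sum>j<m. \<integral>s. indicator (?I j) s *\<^sub>R h j \<partial>lborel)"
    unfolding eq using fin by (intro Bochner_Integration.integral_sum integrable_scaleR_left) auto
  also have "\<dots> = (\<Sum>j<m. (T / m) *\<^sub>R h j)"
    by (intro sum.cong refl) (subst integral_scaleR_left, use fin len in \<open>auto simp del: of_nat_Suc\<close>)
  finally show ?thesis .
qed

lemma sum_cells:
  fixes T :: real and f :: "nat \<Rightarrow> real \<Rightarrow> 'b::comm_monoid_add"
  assumes "0 < T" "0 < m" and S: "finite S" "S \<subseteq> {0<..T}"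
  shows "(\<Sum>j<m. \<Sum>s\<in>{s\<in>S. s \<in> {j * T / m<..Suc j * T / m}}. f j s) = (\<Sum>s\<in>S. f (cell T m s) s)"
proof -
  have "(\<Sum>s\<in>S. f (cell T m s) s) = (\<Sum>j<m. \<Sum>s\<in>{s\<in>S. cell T m s = j}. f (cell T m s) s)"
    using S cell_iff(2)[OF assms(1,2)] by (intro sum.group[symmetric]) auto
  also have "\<dots> = (\<Sum>j<m. \<Sum>s\<in>{s\<in>S. s \<in> {j * T / m<..Suc j * T / m}}. f j s)"
  proof (intro sum.cong refl)
    fix j
    show "{s\<in>S. cell T m s = j} = {s\<in>S. s \<in> {j * T / m<..Suc j * T / m}}"
      using cell_iff(1)[OF assms(1,2)] S(2) by blast
    fix s assume "s \<in> {s\<in>S. s \<in> {j * T / m<..Suc j * T / m}}"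
    then have "cell T m s = j" using cell_iff(1)[OF assms(1,2)] S(2) by blast
    then show "f (cell T m s) s = f j s" by simp
  qed
  finally show ?thesis by simp
qed

text \<open>Each of m coarse cells is cut into n fine ones, numbered consecutively as j n + i;
  \<open>l div n\<close> recovers the coarse cell.\<close>

lemma prod_grid:
  fixes f :: "nat \<Rightarrow> nat \<Rightarrow> 'b::comm_monoid_mult"
  assumes "0 < n"
  shows "(\<Prod>j<m. \<Prod>i<n. f j (j * n + i)) = (\<Prod>l<m * n. f (l div n) l)"
proof -
  have "prod (\<lambda>l. f (l div n) l) {j * n..<j * n + n} = (\<Prod>i<n. f j (j * n + i))" for j
  proof -
    have "prod (\<lambda>l. f (l div n) l) {j * n..<j * n + n} = (\<Prod>i<n. f ((j * n + i) div n) (j * n + i))"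
      by (rule prod.reindex_bij_witness[of _ "\<lambda>i. j * n + i" "\<lambda>l. l - j * n"]) auto
    then show ?thesis using assms by simp
  qed
  moreover have "(\<Prod>j<m. prod (\<lambda>l. f (l div n) l) {j * n..<j * n + n}) = (\<Prod>l<m * n. f (l div n) l)"
    by (rule prod.nat_group)
  ultimately show ?thesis by simp
qed

section \<open>Jump functionals that are constant in time on grid cells\<close>

context driftless_subordinator
begin

definition path :: "'a \<Rightarrow> real \<Rightarrow> real" where "path \<omega> t = \<xi> t \<omega>"

lemma increasing_path: "\<omega> \<in> space M \<Longrightarrow> increasing_path (path \<omega>)"
  using increasing_paths unfolding path_def .

lemma space_natural_filtration [simp]: "space (natural_filtration M \<xi> t) = space M"
  by (auto simp: natural_filtration_def space_measure_of_conv)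

lemma sets_natural_filtration:
  "sets (natural_filtration M \<xi> t) = sigma_sets (space M) {\<xi> s -` B \<inter> space M |s B. s \<in> {0..t} \<and> B \<in> sets borel}"
  unfolding natural_filtration_def by (subst sets_measure_of) auto

lemma measurable_natural_filtration:
  "0 \<le> s \<Longrightarrow> s \<le> t \<Longrightarrow> \<xi> s \<in> borel_measurable (natural_filtration M \<xi> t)"
  by (rule measurableI) (auto simp: sets_natural_filtration)

lemma subalgebra_natural_filtration: "subalgebra M (natural_filtration M \<xi> t)"
  unfolding subalgebra_def sets_natural_filtration
  by (auto intro!: sets.sigma_sets_subset measurable_sets[OF random_variable])

lemma expectation_stationary:
  fixes f :: "real \<Rightarrow> complex"
  assumes [measurable]: "f \<in> borel_measurable borel" and "0 \<le> s" "0 \<le> h"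
  shows "(\<integral>\<omega>. f (\<xi> (s + h) \<omega> - \<xi> s \<omega>) \<partial>M) = (\<integral>\<omega>. f (\<xi> h \<omega>) \<partial>M)"
proof -
  note [measurable] = random_variable[OF \<open>0 \<le> s\<close>] random_variable[OF \<open>0 \<le> h\<close>]
    random_variable[of "s + h"]
  have [measurable]: "\<xi> (s + h) \<in> borel_measurable M" using assms random_variable by simp
  have "(\<integral>\<omega>. f (\<xi> (s + h) \<omega> - \<xi> s \<omega>) \<partial>M) = (\<integral>x. f x \<partial>distr M borel (\<lambda>\<omega>. \<xi> (s + h) \<omega> - \<xi> s \<omega>))"
    by (subst integral_distr) auto
  also have "\<dots> = (\<integral>\<omega>. f (\<xi> h \<omega>) \<partial>M)"
    unfolding stationary_increments[OF assms(2,3)] by (subst integral_distr) auto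
  finally show ?thesis .
qed

lemma expectation_prod_increments:
  fixes d :: real and f :: "nat \<Rightarrow> real \<Rightarrow> complex"
  assumes f [measurable]: "\<And>l. f l \<in> borel_measurable borel" and bd: "\<And>l x. norm (f l x) \<le> 1" and "0 \<le> d"
  shows "(\<integral>\<omega>. (\<Prod>l<n. f l (\<xi> (Suc l * d) \<omega> - \<xi> (l * d) \<omega>)) \<partial>M) = (\<Prod>l<n. \<integral>\<omega>. f l (\<xi> d \<omega>) \<partial>M)"
proof -
  have [measurable]: "\<xi> (real l * d) \<in> borel_measurable M" for l
    using \<open>0 \<le> d\<close> by (intro random_variable) simp
  have "indep_vars (\<lambda>_. borel) (\<lambda>i \<omega>. \<xi> (real (Suc i) * d) \<omega> - \<xi> (real i * d) \<omega>) {..<n}"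
    using \<open>0 \<le> d\<close> by (intro independent_increments[of "\<lambda>i. real i * d"]) (auto simp: mono_def mult_right_mono)
  from indep_vars_compose2[OF this, of f "\<lambda>_. borel"]
  have "indep_vars (\<lambda>_. borel) (\<lambda>l \<omega>. f l (\<xi> (real (Suc l) * d) \<omega> - \<xi> (real l * d) \<omega>)) {..<n}" by simp
  then have "(\<integral>\<omega>. (\<Prod>l<n. f l (\<xi> (Suc l * d) \<omega> - \<xi> (l * d) \<omega>)) \<partial>M)
      = (\<Prod>l<n. \<integral>\<omega>. f l (\<xi> (Suc l * d) \<omega> - \<xi> (l * d) \<omega>) \<partial>M)"
    using bd by (intro indep_vars_lebesgue_integral)
        (auto intro!: integrable_const_bound[where B=1] simp del: of_nat_Suc)
  also have "\<dots> = (\<Prod>l<n. \<integral>\<omega>. f l (\<xi> d \<omega>) \<partial>M)"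
    using expectation_stationary[OF f, of "real l * d" d for l] \<open>0 \<le> d\<close>
    by (intro prod.cong) (auto simp: algebra_simps)
  finally show ?thesis .
qed

text \<open>exp(c) - 1 vanishes off [a,b], hence is a test function for \<open>small_time\<close>
  with step t / (n + 1). Re c \<le> 0 keeps the expectations in the unit disc for
  \<open>tendsto_power_exp\<close>.\<close>

lemma expectation_power_lim:
  fixes c :: "real \<Rightarrow> complex"
  assumes "0 < t" and cont: "continuous_on UNIV c" and a: "0 < a" "a \<le> b"
    and supp: "\<And>x. x \<notin> {a..b} \<Longrightarrow> c x = 0" and Re: "\<And>x. Re (c x) \<le> 0"
  shows "(\<lambda>n. (\<integral>\<omega>. exp (c (\<xi> (t / Suc n) \<omega>)) \<partial>M) ^ Suc n) \<longlonglongrightarrow> exp (t * (\<integral>x. exp (c x) - 1 \<partial>\<nu>))"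
proof (rule tendsto_power_exp)
  let ?h = "\<lambda>n. t / real (Suc n)"
  have h: "\<And>n. 0 < ?h n" "?h \<longlonglongrightarrow> 0"
    using \<open>0 < t\<close> LIMSEQ_Suc[OF lim_const_over_n[of t]] by auto
  have [measurable]: "c \<in> borel_measurable borel" by (rule borel_measurable_continuous_onI[OF cont])
  have [measurable]: "\<xi> (?h n) \<in> borel_measurable M" for n
    using h(1)[of n] by (intro random_variable) simp
  have le1: "norm (exp (c x)) \<le> 1" for x using Re by simp
  have int: "integrable M (\<lambda>\<omega>. exp (c (\<xi> (?h n) \<omega>)))" for n
    using le1 by (intro integrable_const_bound[where B=1] AE_I2) (auto simp del: of_nat_Suc norm_exp_eq_Re)
  show "norm (\<integral>\<omega>. exp (c (\<xi> (?h n) \<omega>)) \<partial>M) \<le> 1" for n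
  proof -
    have "norm (\<integral>\<omega>. exp (c (\<xi> (?h n) \<omega>)) \<partial>M) \<le> (\<integral>\<omega>. norm (exp (c (\<xi> (?h n) \<omega>))) \<partial>M)"
      by (rule integral_norm_bound)
    also have "\<dots> \<le> (\<integral>\<omega>. 1 \<partial>M)"
      using le1 int by (intro integral_mono integrable_norm) auto
    finally show ?thesis by (simp add: prob_space)
  qed
  have "(\<lambda>n. t * ((\<integral>\<omega>. exp (c (\<xi> (?h n) \<omega>)) - 1 \<partial>M) / ?h n)) \<longlonglongrightarrow> t * (\<integral>x. exp (c x) - 1 \<partial>\<nu>)"
    using supp by (intro tendsto_mult tendsto_const small_time[OF h _ a] continuous_intros cont) auto
  moreover have "t * ((\<integral>\<omega>. exp (c (\<xi> (?h n) \<omega>)) - 1 \<partial>M) / ?h n)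
      = of_nat (Suc n) * ((\<integral>\<omega>. exp (c (\<xi> (?h n) \<omega>)) \<partial>M) - 1)" for n
  proof -
    have eq: "(\<integral>\<omega>. exp (c (\<xi> (?h n) \<omega>)) - 1 \<partial>M) = (\<integral>\<omega>. exp (c (\<xi> (?h n) \<omega>)) \<partial>M) - 1"
      using int[of n] prob_space by simp
    show ?thesis unfolding eq using \<open>0 < t\<close> by (simp add: field_simps del: of_nat_Suc)
  qed
  ultimately show "(\<lambda>n. of_nat (Suc n) * ((\<integral>\<omega>. exp (c (\<xi> (?h n) \<omega>)) \<partial>M) - 1)) \<longlonglongrightarrow> t * (\<integral>x. exp (c x) - 1 \<partial>\<nu>)"
    by simp
qed

text \<open>The product of exp(c(increment)) over a refined grid converges for every \<omega> to the
  exponential of the sum over jumps of size at least \<open>a\<close>, while its expectation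
  factorises by independence. Complex \<open>c\<close> is allowed because the formula serves both
  for Laplace functionals and for the characteristic function of the sum of jumps.\<close>

lemma expectation_exp_jumps_grid:
  fixes c :: "nat \<Rightarrow> real \<Rightarrow> complex"
  assumes T: "0 < T" and m: "0 < m" and cont: "\<And>j. continuous_on UNIV (c j)" and a: "0 < a" "a \<le> b"
    and supp: "\<And>j x. x \<notin> {a..b} \<Longrightarrow> c j x = 0" and Re: "\<And>j x. Re (c j x) \<le> 0"
  shows "(\<integral>\<omega>. exp (\<Sum>s\<in>{s\<in>{0<..T}. a \<le> jump (path \<omega>) s}. c (cell T m s) (jump (path \<omega>) s)) \<partial>M) =
    exp (\<integral>s. (\<integral>x. exp (c (cell T m s) x) - 1 \<partial>\<nu>) \<partial>time_measure T)" (is "?E = ?R")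
    and "(\<lambda>\<omega>. exp (\<Sum>s\<in>{s\<in>{0<..T}. a \<le> jump (path \<omega>) s}. c (cell T m s) (jump (path \<omega>) s)))
      \<in> borel_measurable (natural_filtration M \<xi> T)"
proof -
  let ?t = "T / m"
  let ?d = "\<lambda>n. ?t / real (Suc n)"
  have cm [measurable]: "c j \<in> borel_measurable borel" for j by (rule borel_measurable_continuous_onI[OF cont])
  have [measurable]: "\<xi> (real l * ?d n) \<in> borel_measurable M" for l n
    using T by (intro random_variable) simp
  let ?F = "\<lambda>n \<omega>. \<Prod>l<m * Suc n. exp (c (l div Suc n) (\<xi> (real (Suc l) * ?d n) \<omega> - \<xi> (real l * ?d n) \<omega>))"
  let ?S = "\<lambda>\<omega>. {s\<in>{0<..T}. a \<le> jump (path \<omega>) s}"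
  let ?L = "\<lambda>\<omega>. exp (\<Sum>s\<in>?S \<omega>. c (cell T m s) (jump (path \<omega>) s))"
  have le1: "norm (exp (c j x)) \<le> 1" for j x using Re by simp
  have F_lim: "(\<lambda>n. ?F n \<omega>) \<longlonglongrightarrow> ?L \<omega>" if \<omega>: "\<omega> \<in> space M" for \<omega>
  proof -
    let ?A = "\<lambda>j. real j * T / m"
    have len: "?A (Suc j) - ?A j = ?t" for j
      by (simp add: diff_divide_distrib[symmetric] algebra_simps)
    have lim: "(\<lambda>n. \<Sum>i<Suc n. c j (path \<omega> (?A j + real (Suc i) * (?A (Suc j) - ?A j) / real (Suc n))
                   - path \<omega> (?A j + real i * (?A (Suc j) - ?A j) / real (Suc n))))
        \<longlonglongrightarrow> (\<Sum>s\<in>{s\<in>{?A j<..?A (Suc j)}. a \<le> jump (path \<omega>) s}. c j (jump (path \<omega>) s))" for j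
      using T m supp a
      by (intro LIMSEQ_Suc tendsto_sum_increments[OF increasing_path[OF \<omega>] cont])
        (auto simp: divide_strict_right_mono mult_strict_right_mono)
    \<comment> \<open>Point i of the subdivision of coarse cell j is point j (n + 1) + i of the fine
      grid.\<close>
    have pt: "?A j + real i * ?t / real (Suc n) = real (j * Suc n + i) * ?d n" for i j n
      using T m by (simp add: field_simps del: of_nat_Suc) (simp add: algebra_simps)
    have "?F n \<omega> = (\<Prod>j<m. \<Prod>i<Suc n. exp (c j (path \<omega> (real (Suc (j * Suc n + i)) * ?d n) - path \<omega> (real (j * Suc n + i) * ?d n))))" for n
      unfolding path_def by (rule prod_grid[symmetric]) simp
    also have "\<dots> n = exp (\<Sum>j<m. \<Sum>i<Suc n. c j (path \<omega> (?A j + real (Suc i) * (?A (Suc j) - ?A j) / real (Suc n))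
                   - path \<omega> (?A j + real i * (?A (Suc j) - ?A j) / real (Suc n))))" for n
      unfolding len pt by (simp only: exp_sum finite_lessThan add_Suc_right)
    finally have F: "?F n \<omega> = exp (\<Sum>j<m. \<Sum>i<Suc n. c j (path \<omega> (?A j + real (Suc i) * (?A (Suc j) - ?A j) / real (Suc n))
                   - path \<omega> (?A j + real i * (?A (Suc j) - ?A j) / real (Suc n))))" for n .
    have "(\<Sum>j<m. \<Sum>s\<in>{s\<in>{?A j<..?A (Suc j)}. a \<le> jump (path \<omega>) s}. c j (jump (path \<omega>) s))
      = (\<Sum>j<m. \<Sum>s\<in>{s\<in>?S \<omega>. s \<in> {?A j<..?A (Suc j)}}. c j (jump (path \<omega>) s))"
    proof (intro sum.cong refl)
      fix j assume "j \<in> {..<m}"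
      then have "real (Suc j) * T \<le> real m * T" using T by (intro mult_right_mono) auto
      then have "?A (Suc j) \<le> T" "0 \<le> ?A j" using m T by (simp_all add: field_simps del: of_nat_Suc)
      then show "{s\<in>{?A j<..?A (Suc j)}. a \<le> jump (path \<omega>) s} = {s\<in>?S \<omega>. s \<in> {?A j<..?A (Suc j)}}"
        by (auto simp del: of_nat_Suc)
    qed
    also have "\<dots> = (\<Sum>s\<in>?S \<omega>. c (cell T m s) (jump (path \<omega>) s))"
      using finite_big_jumps[OF increasing_path[OF \<omega>] a(1)] by (intro sum_cells T m) auto
    finally show ?thesis
      unfolding F by (subst (asm) eq_commute) (simp only:, intro tendsto_exp tendsto_sum lim)
  qed
  \<comment> \<open>The approximating products only involve \<xi> at grid points up to T, and they
    converge at every \<omega>, so no null sets are needed.\<close>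
  show meas: "?L \<in> borel_measurable (natural_filtration M \<xi> T)"
  proof (rule borel_measurable_LIMSEQ_metric)
    fix n
    have [measurable]: "\<xi> (real l * ?d n) \<in> borel_measurable (natural_filtration M \<xi> T)" if "l \<le> m * Suc n" for l
    proof (rule measurable_natural_filtration)
      have "real l * T \<le> real (m * Suc n) * T" using that T by (intro mult_right_mono) (auto simp del: of_nat_Suc of_nat_mult mult_Suc_right)
      moreover have "0 < real (m * Suc n)" using m by (simp only: of_nat_0_less_iff) simp
      ultimately have "real l * T / real (m * Suc n) \<le> T"
        by (simp only: pos_divide_le_eq mult.commute[of T])
      then show "real l * ?d n \<le> T" by (simp add: distrib_left)
    qed (use T in simp)
    show "?F n \<in> borel_measurable (natural_filtration M \<xi> T)"
      by (intro borel_measurable_prod) (measurable; auto simp del: of_nat_Suc mult_Suc_right)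
  qed (use F_lim in auto)
  have [measurable]: "?L \<in> borel_measurable M"
    using measurable_from_subalg[OF subalgebra_natural_filtration meas] .
  have "(\<lambda>n. \<integral>\<omega>. ?F n \<omega> \<partial>M) \<longlonglongrightarrow> ?E"
  proof (rule integral_dominated_convergence[where w="\<lambda>_. 1"])
    show "AE \<omega> in M. norm (?F n \<omega>) \<le> 1" for n
      using le1 by (intro AE_I2) (auto simp: prod_norm[symmetric] intro!: prod_le_1)
    show "?L \<in> borel_measurable M" by fact
    show "?F n \<in> borel_measurable M" for n by measurable
    show "AE \<omega> in M. (\<lambda>n. ?F n \<omega>) \<longlonglongrightarrow> ?L \<omega>" by (intro AE_I2 F_lim)
  qed simp
  moreover have "(\<integral>\<omega>. ?F n \<omega> \<partial>M) = (\<Prod>j<m. (\<integral>\<omega>. exp (c j (\<xi> (?d n) \<omega>)) \<partial>M) ^ Suc n)" for n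
  proof -
    have "(\<integral>\<omega>. ?F n \<omega> \<partial>M) = (\<Prod>l<m * Suc n. \<integral>\<omega>. exp (c (l div Suc n) (\<xi> (?d n) \<omega>)) \<partial>M)"
      using T le1 by (intro expectation_prod_increments) auto
    also have "\<dots> = (\<Prod>j<m. \<Prod>i<Suc n. \<integral>\<omega>. exp (c j (\<xi> (?d n) \<omega>)) \<partial>M)"
      by (rule prod_grid[symmetric, of "Suc n" "\<lambda>j l. \<integral>\<omega>. exp (c j (\<xi> (?d n) \<omega>)) \<partial>M"]) simp
    finally show ?thesis by simp
  qed
  moreover have "(\<lambda>n. \<Prod>j<m. (\<integral>\<omega>. exp (c j (\<xi> (?d n) \<omega>)) \<partial>M) ^ Suc n)
      \<longlonglongrightarrow> (\<Prod>j<m. exp (?t * (\<integral>x. exp (c j x) - 1 \<partial>\<nu>)))"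
    using T m by (intro tendsto_prod expectation_power_lim[OF _ cont a supp Re]) auto
  ultimately have "?E = (\<Prod>j<m. exp (?t * (\<integral>x. exp (c j x) - 1 \<partial>\<nu>)))"
    by (simp add: LIMSEQ_unique)
  also have "\<dots> = ?R"
    unfolding integral_time_measure_cell[OF T m, of "\<lambda>j. \<integral>x. exp (c j x) - 1 \<partial>\<nu>"]
    by (simp add: exp_sum scaleR_conv_of_real)
  finally show "?E = ?R" .
qed

end

text \<open>exp(-x) on [0,\<infinity>] with value 0 at \<infinity>, so that Laplace functionals make
  sense without any finiteness of the sum over jumps.\<close>

definition nexp :: "ennreal \<Rightarrow> real" where
  "nexp x = (if x = \<infinity> then 0 else exp (- enn2real x))"

lemma nexp_ennreal [simp]: "0 \<le> r \<Longrightarrow> nexp (ennreal r) = exp (- r)"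
  and nexp_top [simp]: "nexp \<top> = 0"
  and nexp_zero [simp]: "nexp 0 = 1"
  by (simp_all add: nexp_def)

lemma nexp_nonneg [simp]: "0 \<le> nexp x" and nexp_le_1 [simp]: "nexp x \<le> 1"
  by (simp_all add: nexp_def)

lemma measurable_nexp [measurable]: "nexp \<in> borel_measurable borel"
  unfolding nexp_def by measurable

lemma nexp_add: "nexp (x + y) = nexp x * nexp y"
  by (cases x; cases y) (auto simp: nexp_def ennreal_plus[symmetric] exp_add[symmetric] simp del: ennreal_plus)

lemma nexp_mono: "x \<le> y \<Longrightarrow> nexp y \<le> nexp x"
  by (cases x; cases y) (auto simp: nexp_def top_unique)

lemma tendsto_nexp:
  assumes "(f \<longlonglongrightarrow> l)" shows "(\<lambda>n. nexp (f n)) \<longlonglongrightarrow> nexp l"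
proof (cases l)
  case (real r)
  have "eventually (\<lambda>n. f n < \<top>) sequentially"
    using order_tendstoD(2)[OF assms, of \<top>] real by simp
  moreover have "(\<lambda>n. exp (- enn2real (f n))) \<longlonglongrightarrow> exp (- enn2real l)"
    using assms real by (auto intro!: tendsto_intros tendsto_enn2real)
  ultimately show ?thesis
    using real by (auto simp: nexp_def elim!: Lim_transform_eventually eventually_mono)
next
  case top
  show ?thesis
  proof (rule LIMSEQ_I)
    fix e :: real assume "0 < e"
    define r where "r = max 0 (1 - ln e)"
    have "exp (- r) < e"
    proof -
      have "- r < ln e" by (simp add: r_def)
      then show ?thesis using \<open>0 < e\<close> by (metis exp_less_mono exp_ln)
    qed
    have "eventually (\<lambda>n. ennreal r < f n) sequentially"
      using order_tendstoD(1)[OF assms, of "ennreal r"] top by simp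
    moreover have "nexp (ennreal r) = exp (- r)" by (rule nexp_ennreal) (simp add: r_def)
    ultimately have "eventually (\<lambda>n. nexp (f n) \<le> exp (- r)) sequentially"
      by (auto elim!: eventually_mono dest!: less_imp_le nexp_mono)
    then have "eventually (\<lambda>n. norm (nexp (f n) - nexp l) < e) sequentially"
      by eventually_elim (use top \<open>exp (- r) < e\<close> in auto)
    then show "\<exists>N. \<forall>n\<ge>N. norm (nexp (f n) - nexp l) < e" by (simp add: eventually_sequentially)
  qed
qed

lemma nn_integral_jump_measure_eq_sum:
  assumes w: "increasing_path w" and "0 < a" and v [measurable]: "v \<in> borel_measurable borel"
    and supp: "\<And>s x. x < a \<Longrightarrow> v (s, x) = 0" and v0: "\<And>z. 0 \<le> v z"
  shows "(\<integral>\<^sup>+z. ennreal (v z) \<partial>jump_measure w T) = ennreal (\<Sum>s\<in>{s\<in>{0<..T}. a \<le> jump w s}. v (s, jump w s))"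
proof -
  let ?S = "{s\<in>{0<..T}. a \<le> jump w s}"
  have "(\<integral>\<^sup>+z. ennreal (v z) \<partial>jump_measure w T) = (\<integral>\<^sup>+s. ennreal (v (s, jump w s)) \<partial>count_space (jump_times w T))"
    by (rule nn_integral_jump_measure) simp
  also have "\<dots> = (\<Sum>s\<in>?S. ennreal (v (s, jump w s)))"
    using finite_big_jumps[OF w \<open>0 < a\<close>] \<open>0 < a\<close> supp
    by (intro nn_integral_count_space') (auto simp: jump_times_def not_le[symmetric])
  finally show ?thesis using v0 by simp
qed

section \<open>The intensity measure and time-dependent continuous test functions\<close>

context driftless_subordinator
begin

definition intensity :: "real \<Rightarrow> (real \<times> real) measure" where
  "intensity T = time_measure T \<Otimes>\<^sub>M \<nu>"

lemma sets_intensity [simp, measurable_cong]: "sets (intensity T) = sets borel"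
  unfolding intensity_def by (subst borel_prod[symmetric]) (rule sets_pair_measure_cong; simp)

lemma space_intensity [simp]: "space (intensity T) = UNIV"
  using sets_eq_imp_space_eq[OF sets_intensity] by simp

lemma pair_sigma_finite_intensity: "pair_sigma_finite (time_measure T) \<nu>"
  using finite_time_measure[of T] nu.sigma_finite_measure_axioms
  by (simp add: pair_sigma_finite_def finite_measure.axioms(1))

lemma emeasure_intensity_strip_finite:
  assumes "0 < a" shows "emeasure (intensity T) (UNIV \<times> {a..}) < \<infinity>"
proof -
  have "emeasure (intensity T) (UNIV \<times> {a..}) = emeasure (time_measure T) UNIV * emeasure \<nu> {a..}"
    unfolding intensity_def by (intro nu.emeasure_pair_measure_Times) auto
  then show ?thesis
    using emeasure_nu_ge_finite[OF assms] finite_measure.emeasure_finite[OF finite_time_measure[of T], of UNIV]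
    by (simp add: ennreal_mult_less_top less_top)
qed

lemma integrable_intensity_strip:
  fixes f :: "real \<times> real \<Rightarrow> real"
  assumes f [measurable]: "f \<in> borel_measurable borel" and "0 < a"
    and supp: "\<And>s x. x < a \<Longrightarrow> f (s, x) = 0" and bd: "\<And>z. norm (f z) \<le> C"
  shows "integrable (intensity T) f"
proof (rule Bochner_Integration.integrable_bound)
  show "integrable (intensity T) (\<lambda>z. C * indicator (UNIV \<times> {a..}) z)"
    using emeasure_intensity_strip_finite[OF \<open>0 < a\<close>]
    by (intro integrable_mult_right integrable_real_indicator) (auto simp: borel_prod[symmetric] intro!: pair_measureI)
  have "0 \<le> C" using order_trans[OF norm_ge_zero bd] by blast
  then show "AE z in intensity T. norm (f z) \<le> norm (C * indicator (UNIV \<times> {a..}) z :: real)"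
  proof (intro AE_I2)
    fix z assume "0 \<le> C"
    then show "norm (f z) \<le> norm (C * indicator (UNIV \<times> {a..}) z :: real)"
      using bd[of z] supp[of "snd z" "fst z"] by (cases "a \<le> snd z") (auto simp: indicator_def mem_Times_iff)
  qed
qed simp

text \<open>Freezing the time argument on the cells of a grid reduces to the previous formula.
  Continuity of \<open>v\<close> gives convergence as the grid is refined, and the inner integrals
  are dominated by the finite \<nu>-mass of [a,\<infinity>).\<close>

lemma laplace_continuous_sum:
  fixes v :: "real \<times> real \<Rightarrow> real"
  assumes T: "0 < T" and cont: "continuous_on UNIV v" and a: "0 < a" "a \<le> b"
    and supp: "\<And>s x. x \<notin> {a..b} \<Longrightarrow> v (s, x) = 0" and v0: "\<And>z. 0 \<le> v z"
  shows "(\<integral>\<omega>. exp (- (\<Sum>s\<in>{s\<in>{0<..T}. a \<le> jump (path \<omega>) s}. v (s, jump (path \<omega>) s))) \<partial>M) =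
      exp (\<integral>s. (\<integral>x. exp (- v (s, x)) - 1 \<partial>\<nu>) \<partial>time_measure T)"
    and "(\<lambda>\<omega>. \<Sum>s\<in>{s\<in>{0<..T}. a \<le> jump (path \<omega>) s}. v (s, jump (path \<omega>) s))
      \<in> borel_measurable (natural_filtration M \<xi> T)"
proof -
  interpret TM: finite_measure "time_measure T" by (rule finite_time_measure)
  have [measurable]: "v \<in> borel_measurable borel" by (rule borel_measurable_continuous_onI[OF cont])
  have contx: "continuous_on UNIV (\<lambda>x. v (s, x))" for s
    by (intro continuous_on_compose2[OF cont] continuous_intros) auto
  let ?S = "\<lambda>\<omega>. {s\<in>{0<..T}. a \<le> jump (path \<omega>) s}"
  \<comment> \<open>Right end of the grid cell of s, at distance at most T / (n + 1).\<close>
  define r where "r n s = real (Suc (cell T (Suc n) s)) * T / real (Suc n)" for n s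
  have [measurable]: "r n \<in> borel_measurable borel" for n unfolding r_def by measurable
  have r_lim: "(\<lambda>n. r n s) \<longlonglongrightarrow> s" if s: "s \<in> {0<..T}" for s
  proof (rule tendsto_sandwich[of "\<lambda>n. s" _ _ "\<lambda>n. s + T / real (Suc n)"])
    have *: "s \<le> r n s \<and> r n s \<le> s + T / real (Suc n)" for n
    proof -
      have "s \<in> {real (cell T (Suc n) s) * T / real (Suc n)<..r n s}"
        using cell_iff(1)[OF T _ s, of "Suc n" "cell T (Suc n) s"] by (simp add: r_def)
      moreover have "r n s - real (cell T (Suc n) s) * T / real (Suc n) = T / real (Suc n)"
        unfolding r_def by (simp add: diff_divide_distrib[symmetric] algebra_simps)
      ultimately show ?thesis by auto
    qed
    show "eventually (\<lambda>n. s \<le> r n s) sequentially" "eventually (\<lambda>n. r n s \<le> s + T / real (Suc n)) sequentially"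
      using * by (auto intro!: always_eventually)
    show "(\<lambda>n. s + T / real (Suc n)) \<longlonglongrightarrow> s"
      using tendsto_add[OF tendsto_const LIMSEQ_Suc[OF lim_const_over_n[of T]], of s] by simp
  qed simp
  let ?X = "\<lambda>n \<omega>. \<Sum>s\<in>?S \<omega>. v (r n s, jump (path \<omega>) s)"
  let ?Y = "\<lambda>\<omega>. \<Sum>s\<in>?S \<omega>. v (s, jump (path \<omega>) s)"
  have XY: "(\<lambda>n. ?X n \<omega>) \<longlonglongrightarrow> ?Y \<omega>" for \<omega>
    by (intro tendsto_sum continuous_on_tendsto_compose[OF cont] tendsto_Pair r_lim tendsto_const) auto
  have X0: "0 \<le> ?X n \<omega>" for n \<omega> using v0 by (intro sum_nonneg) auto
  have "(\<integral>\<omega>. exp (- ?X n \<omega>) \<partial>M) = exp (\<integral>s. (\<integral>x. exp (- v (r n s, x)) - 1 \<partial>\<nu>) \<partial>time_measure T)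
    \<and> (\<lambda>\<omega>. exp (- ?X n \<omega>)) \<in> borel_measurable (natural_filtration M \<xi> T)" for n
  proof -
    let ?c = "\<lambda>j x. complex_of_real (- v (real (Suc j) * T / real (Suc n), x))"
    have c: "continuous_on UNIV (?c j)" "\<And>x. x \<notin> {a..b} \<Longrightarrow> ?c j x = 0" "\<And>x. Re (?c j x) \<le> 0" for j
      using supp v0 by (auto intro!: continuous_intros contx)
    have L: "(\<Sum>s\<in>?S \<omega>. ?c (cell T (Suc n) s) (jump (path \<omega>) s)) = complex_of_real (- ?X n \<omega>)" for \<omega>
      by (simp add: r_def sum_negf del: of_nat_Suc)
    have R: "(\<integral>x. exp (?c (cell T (Suc n) s) x) - 1 \<partial>\<nu>) = complex_of_real (\<integral>x. exp (- v (r n s, x)) - 1 \<partial>\<nu>)" for s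
      unfolding integral_complex_of_real[symmetric] r_def
      by (intro Bochner_Integration.integral_cong) (auto simp: exp_of_real[symmetric])
    note E0 = expectation_exp_jumps_grid[OF T, of "Suc n" ?c, OF _ c(1) a c(2,3), unfolded L R]
    note E = E0[unfolded exp_of_real integral_complex_of_real]
    have "complex_of_real (\<integral>\<omega>. exp (- ?X n \<omega>) \<partial>M) = complex_of_real (exp (\<integral>s. (\<integral>x. exp (- v (r n s, x)) - 1 \<partial>\<nu>) \<partial>time_measure T))"
      using E(1) by simp
    moreover have "(\<lambda>\<omega>. exp (- ?X n \<omega>)) \<in> borel_measurable (natural_filtration M \<xi> T)"
      using measurable_compose[OF E(2), of Re] by simp
    ultimately show ?thesis by simp
  qed
  then have E: "(\<integral>\<omega>. exp (- ?X n \<omega>) \<partial>M) = exp (\<integral>s. (\<integral>x. exp (- v (r n s, x)) - 1 \<partial>\<nu>) \<partial>time_measure T)"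
    and meas: "(\<lambda>\<omega>. exp (- ?X n \<omega>)) \<in> borel_measurable (natural_filtration M \<xi> T)" for n by auto
  have measY: "(\<lambda>\<omega>. exp (- ?Y \<omega>)) \<in> borel_measurable (natural_filtration M \<xi> T)"
    using XY by (intro borel_measurable_LIMSEQ_real[OF _ meas]) (intro tendsto_exp tendsto_minus)
  \<comment> \<open>The grid formula yields measurability of exponentials only; the logarithm
    recovers the sum itself.\<close>
  then have "(\<lambda>\<omega>. - ln (exp (- ?Y \<omega>))) \<in> borel_measurable (natural_filtration M \<xi> T)"
    by measurable
  then show "?Y \<in> borel_measurable (natural_filtration M \<xi> T)" by simp
  have mXY: "(\<lambda>\<omega>. exp (- ?X n \<omega>)) \<in> borel_measurable M" "(\<lambda>\<omega>. exp (- ?Y \<omega>)) \<in> borel_measurable M" for n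
    using measurable_from_subalg[OF subalgebra_natural_filtration meas]
      measurable_from_subalg[OF subalgebra_natural_filtration measY] by auto
  have 1: "(\<lambda>n. \<integral>\<omega>. exp (- ?X n \<omega>) \<partial>M) \<longlonglongrightarrow> (\<integral>\<omega>. exp (- ?Y \<omega>) \<partial>M)"
  proof (rule integral_dominated_convergence[where w="\<lambda>_. 1"])
    show "AE \<omega> in M. (\<lambda>n. exp (- ?X n \<omega>)) \<longlonglongrightarrow> exp (- ?Y \<omega>)"
      using XY by (intro AE_I2 tendsto_exp tendsto_minus)
  qed (use X0 mXY in auto)
  have bd: "norm (exp (- v (t, x)) - 1) \<le> indicator {a..} x" for t x
    using v0[of "(t, x)"] supp[of x t] by (auto simp: indicator_def)
  have ind: "integrable \<nu> (indicator {a..} :: real \<Rightarrow> real)"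
    using emeasure_nu_ge_finite[OF a(1)] by (intro integrable_real_indicator) auto
  have int: "integrable \<nu> (\<lambda>x. exp (- v (t, x)) - 1)" for t
    using bd by (intro Bochner_Integration.integrable_bound[OF ind] AE_I2) auto
  have 2: "(\<lambda>n. \<integral>s. (\<integral>x. exp (- v (r n s, x)) - 1 \<partial>\<nu>) \<partial>time_measure T)
      \<longlonglongrightarrow> (\<integral>s. (\<integral>x. exp (- v (s, x)) - 1 \<partial>\<nu>) \<partial>time_measure T)"
  proof (rule integral_dominated_convergence[where w="\<lambda>_. \<integral>x. indicator {a..} x \<partial>\<nu>"])
    show "AE s in time_measure T. (\<lambda>n. \<integral>x. exp (- v (r n s, x)) - 1 \<partial>\<nu>) \<longlonglongrightarrow> (\<integral>x. exp (- v (s, x)) - 1 \<partial>\<nu>)"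
      using AE_time_measure[of T]
    proof eventually_elim
      case (elim s)
      show ?case
        by (rule integral_dominated_convergence[OF _ _ ind])
          (use bd in \<open>auto intro!: AE_I2 tendsto_intros continuous_on_tendsto_compose[OF cont] tendsto_Pair r_lim[OF elim]\<close>)
    qed
    show "AE s in time_measure T. norm (\<integral>x. exp (- v (r n s, x)) - 1 \<partial>\<nu>) \<le> (\<integral>x. indicator {a..} x \<partial>\<nu>)" for n
    proof (rule AE_I2)
      fix s
      have "norm (\<integral>x. exp (- v (r n s, x)) - 1 \<partial>\<nu>) \<le> (\<integral>x. norm (exp (- v (r n s, x)) - 1) \<partial>\<nu>)"
        by (rule integral_norm_bound)
      also have "\<dots> \<le> (\<integral>x. indicator {a..} x \<partial>\<nu>)"
        by (intro integral_mono integrable_norm int ind bd)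
      finally show "norm (\<integral>x. exp (- v (r n s, x)) - 1 \<partial>\<nu>) \<le> (\<integral>x. indicator {a..} x \<partial>\<nu>)" .
    qed
  qed auto
  show "(\<integral>\<omega>. exp (- ?Y \<omega>) \<partial>M) = exp (\<integral>s. (\<integral>x. exp (- v (s, x)) - 1 \<partial>\<nu>) \<partial>time_measure T)"
    using LIMSEQ_unique[OF 1] tendsto_exp[OF 2] unfolding E by blast
qed

end

section \<open>Lipschitz estimates and continuous approximation in L1\<close>

lemma one_minus_exp_bounds:
  fixes a :: real
  shows "a * exp (- a) \<le> 1 - exp (- a)" "1 - exp (- a) \<le> a"
proof -
  have "(1 + a) * exp (- a) \<le> exp a * exp (- a)"
    by (intro mult_right_mono exp_ge_add_one_self) simp
  then show "a * exp (- a) \<le> 1 - exp (- a)" by (simp add: exp_minus algebra_simps)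
  show "1 - exp (- a) \<le> a" using exp_ge_add_one_self[of "- a"] by simp
qed

lemma abs_exp_minus_diff_le:
  fixes a b :: real
  assumes "0 \<le> a" "0 \<le> b" shows "\<bar>exp (- a) - exp (- b)\<bar> \<le> \<bar>a - b\<bar>"
  using norm_exp_diff_le[of "complex_of_real (- a)" "complex_of_real (- b)"] assms
  unfolding exp_of_real of_real_diff[symmetric] norm_of_real by simp

lemma nn_integral_le_add_diff:
  assumes [measurable]: "f \<in> borel_measurable m" "g \<in> borel_measurable m" and "\<And>z. 0 \<le> (g z :: real)"
  shows "(\<integral>\<^sup>+z. ennreal (f z) \<partial>m) \<le> (\<integral>\<^sup>+z. ennreal (g z) \<partial>m) + (\<integral>\<^sup>+z. ennreal \<bar>f z - g z\<bar> \<partial>m)"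
  unfolding nn_integral_add[symmetric, OF measurable_compose[OF assms(2) measurable_ennreal]
      measurable_compose[OF borel_measurable_abs[OF borel_measurable_diff[OF assms(1,2)]] measurable_ennreal]]
  using assms(3) by (intro nn_integral_mono) (auto simp flip: ennreal_plus intro!: ennreal_leI)

text \<open>exp(-x) is 1-Lipschitz on [0,\<infinity>). If the L1-distance is finite, the two
  integrals are finite or infinite together, and in the infinite case both sides of the difference
  are 0.\<close>

lemma nexp_nn_integral_diff_le:
  assumes [measurable]: "f \<in> borel_measurable m" "g \<in> borel_measurable m"
    and fg: "\<And>z. 0 \<le> (f z :: real)" "\<And>z. 0 \<le> (g z :: real)"
  shows "ennreal \<bar>nexp (\<integral>\<^sup>+z. f z \<partial>m) - nexp (\<integral>\<^sup>+z. g z \<partial>m)\<bar> \<le> (\<integral>\<^sup>+z. ennreal \<bar>f z - g z\<bar> \<partial>m)"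
proof -
  let ?F = "\<integral>\<^sup>+z. ennreal (f z) \<partial>m" and ?G = "\<integral>\<^sup>+z. ennreal (g z) \<partial>m"
  let ?D = "\<integral>\<^sup>+z. ennreal \<bar>f z - g z\<bar> \<partial>m"
  have 1: "?F \<le> ?G + ?D" using fg by (intro nn_integral_le_add_diff) auto
  have 2: "?G \<le> ?F + ?D"
    using nn_integral_le_add_diff[of g m f] fg by (simp add: abs_minus_commute)
  show ?thesis
  proof (cases "?D = \<infinity>")
    case False
    then obtain d where d: "?D = ennreal d" "0 \<le> d" by (cases "?D") auto
    show ?thesis
    proof (cases "?F = \<infinity>")
      case True
      then have "?G = \<infinity>" using 1 d by (cases "?G") (auto simp: top_unique simp flip: ennreal_plus)
      then show ?thesis using True by simp
    next
      case False
      then obtain a where a: "?F = ennreal a" "0 \<le> a" by (cases "?F") auto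
      then obtain b where b: "?G = ennreal b" "0 \<le> b" using 2 d
        by (cases "?G") (auto simp: top_unique simp flip: ennreal_plus)
      have "a \<le> b + d" "b \<le> a + d" using 1 2 a b d by (auto simp flip: ennreal_plus)
      then have "\<bar>exp (- a) - exp (- b)\<bar> \<le> d" using abs_exp_minus_diff_le[of a b] a b by linarith
      then show ?thesis using a b d by (auto intro!: ennreal_leI)
    qed
  qed simp
qed

text \<open>For an indicator, a Urysohn function between a compact set inside and an open set
  outside; linear combinations and limits follow by the induction for integrable functions. The
  approximant has to vanish off \<open>U\<close>, since only test functions supported away from jump
  size 0 are available later.\<close>

lemma continuous_approx_L1:
  fixes f :: "'b::euclidean_space \<Rightarrow> real"
  assumes m: "finite_measure m" and sets_m [measurable_cong]: "sets m = sets borel" and U: "open U"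
    and f: "integrable m f" and "0 < e"
  shows "\<exists>v. continuous_on UNIV v \<and> (\<forall>z. z \<notin> U \<longrightarrow> v z = 0) \<and>
    (\<integral>\<^sup>+z. ennreal \<bar>indicator U z * f z - v z\<bar> \<partial>m) < ennreal e"
  using f \<open>0 < e\<close>
proof (induction f arbitrary: e rule: integrable_induct)
  case (base A c)
  interpret m: finite_measure m by fact
  have A [measurable]: "A \<in> sets borel" using base sets_m by simp
  have [measurable]: "U \<in> sets borel" using U by auto
  \<comment> \<open>The error set W - K gets measure below 2 d, and |c| 2 d < e; the summand 1
    covers c = 0.\<close>
  define d where "d = e / (2 * (\<bar>c\<bar> + 1))"
  have d: "0 < d" using base by (simp add: d_def)
  let ?B = "A \<inter> U"
  have fin: "emeasure m X \<noteq> \<infinity>" for X by simp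
  have "\<exists>K. K \<subseteq> ?B \<and> compact K \<and> emeasure m ?B < emeasure m K + ennreal d"
  proof (cases "emeasure m ?B = 0")
    case True
    then show ?thesis using d by (intro exI[of _ "{}"]) simp
  next
    case False
    have "emeasure m ?B - ennreal d < emeasure m ?B"
      using d False by (intro ennreal_between) (auto simp: zero_less_iff_neq_zero less_top[symmetric])
    also have "emeasure m ?B = (SUP K \<in> {K. K \<subseteq> ?B \<and> compact K}. emeasure m K)"
      using sets_m fin by (intro inner_regular) auto
    finally obtain K where "K \<subseteq> ?B" "compact K" "emeasure m ?B - ennreal d < emeasure m K"
      unfolding less_SUP_iff by auto
    moreover from this(3) have "measure m ?B < measure m K + d"
      using ennreal_leI[of "measure m K" "measure m ?B - d"] d
      by (fastforce simp: m.emeasure_eq_measure ennreal_minus not_less[symmetric])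
    ultimately show ?thesis using d
      by (intro exI[of _ K]) (auto simp: m.emeasure_eq_measure ennreal_less_iff simp flip: ennreal_plus)
  qed
  then obtain K where K: "K \<subseteq> ?B" "compact K" "emeasure m ?B < emeasure m K + ennreal d" by blast
  have "(INF W \<in> {W. ?B \<subseteq> W \<and> open W}. emeasure m W) < emeasure m ?B + ennreal d"
    using sets_m fin d by (subst outer_regular[symmetric]) (auto simp: m.emeasure_eq_measure ennreal_less_iff simp flip: ennreal_plus)
  then obtain W where W: "?B \<subseteq> W" "open W" "emeasure m W < emeasure m ?B + ennreal d"
    unfolding INF_less_iff by auto
  have [measurable]: "K \<in> sets borel" "W \<in> sets borel" using K W by (auto intro: borel_compact)
  \<comment> \<open>Separating K from the complement of W \<inter> U, not just of W, forces the
    approximant to vanish off U.\<close>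
  have "closed K" "closed (- (W \<inter> U))" "K \<inter> - (W \<inter> U) = {}"
    using K W U by (auto intro!: compact_imp_closed open_Int simp: closed_def simp del: Compl_Int)
  then obtain u :: "'b \<Rightarrow> real" where u: "continuous_on UNIV u" "\<And>x. u x \<in> closed_segment 1 0"
    "\<And>x. x \<in> K \<Longrightarrow> u x = 1" "\<And>x. x \<in> - (W \<inter> U) \<Longrightarrow> u x = 0"
    by (rule Urysohn[where a="1::real" and b=0]) blast
  have u01: "0 \<le> u x" "u x \<le> 1" for x using u(2)[of x] by (auto simp: closed_segment_eq_real_ivl)
  have [measurable]: "u \<in> borel_measurable borel" by (rule borel_measurable_continuous_onI[OF u(1)])
  have WK: "measure m (W - K) < 2 * d"
  proof -
    have "measure m (W - K) = measure m W - measure m K"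
      using K W by (intro m.finite_measure_Diff) (auto simp: sets_m)
    then show ?thesis using K(3) W(3) d
      by (auto simp: m.emeasure_eq_measure ennreal_less_iff simp flip: ennreal_plus)
  qed
  have "(\<integral>\<^sup>+z. ennreal \<bar>indicator U z * (indicator A z *\<^sub>R c) - u z * c\<bar> \<partial>m)
      \<le> (\<integral>\<^sup>+z. ennreal \<bar>c\<bar> * indicator (W - K) z \<partial>m)"
  proof (intro nn_integral_mono)
    fix z
    have "\<bar>indicator U z * (indicator A z *\<^sub>R c) - u z * c\<bar> \<le> \<bar>c\<bar> * indicator (W - K) z"
    proof (cases "z \<in> W - K")
      case True
      have "\<bar>indicator U z * indicator A z - u z\<bar> \<le> 1" using u01[of z] by (auto simp: indicator_def)
      then have "\<bar>(indicator U z * indicator A z - u z) * c\<bar> \<le> 1 * \<bar>c\<bar>"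
        unfolding abs_mult by (intro mult_right_mono) auto
      then show ?thesis using True by (simp add: algebra_simps)
    next
      case False
      then show ?thesis using K W u(3)[of z] u(4)[of z] by (cases "z \<in> K") (auto simp: indicator_def)
    qed
    then show "ennreal \<bar>indicator U z * (indicator A z *\<^sub>R c) - u z * c\<bar> \<le> ennreal \<bar>c\<bar> * indicator (W - K) z"
      by (auto simp: indicator_def ennreal_leI split: if_splits)
  qed
  also have "\<dots> = ennreal (\<bar>c\<bar> * measure m (W - K))"
    by (subst nn_integral_cmult_indicator) (auto simp: sets_m m.emeasure_eq_measure ennreal_mult)
  also have "\<dots> < ennreal e"
  proof (rule ennreal_lessI[OF base(3)])
    have "\<bar>c\<bar> * measure m (W - K) \<le> \<bar>c\<bar> * (2 * d)" using WK by (intro mult_left_mono) auto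
    also have "\<dots> < (\<bar>c\<bar> + 1) * (2 * d)" using d by simp
    also have "\<dots> = e" unfolding d_def by (simp add: field_simps add_pos_nonneg)
    finally show "\<bar>c\<bar> * measure m (W - K) < e" .
  qed
  finally show ?case
    using u(1,4) by (intro exI[of _ "\<lambda>z. u z * c"]) (auto intro!: continuous_intros)
next
  case (add f g)
  have [measurable]: "f \<in> borel_measurable m" "g \<in> borel_measurable m" using add by auto
  have [measurable]: "U \<in> sets borel" using U by auto
  obtain v where v: "continuous_on UNIV v" "\<And>z. z \<notin> U \<Longrightarrow> v z = 0"
    "(\<integral>\<^sup>+z. ennreal \<bar>indicator U z * f z - v z\<bar> \<partial>m) < ennreal (e / 2)"
    using add.IH(1)[of "e/2"] add.prems by auto
  obtain v' where v': "continuous_on UNIV v'" "\<And>z. z \<notin> U \<Longrightarrow> v' z = 0"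
    "(\<integral>\<^sup>+z. ennreal \<bar>indicator U z * g z - v' z\<bar> \<partial>m) < ennreal (e / 2)"
    using add.IH(2)[of "e/2"] add.prems by auto
  have [measurable]: "v \<in> borel_measurable borel" "v' \<in> borel_measurable borel"
    using v v' by (auto intro: borel_measurable_continuous_onI)
  have "(\<integral>\<^sup>+z. ennreal \<bar>indicator U z * (f z + g z) - (v z + v' z)\<bar> \<partial>m)
    \<le> (\<integral>\<^sup>+z. ennreal \<bar>indicator U z * f z - v z\<bar> + ennreal \<bar>indicator U z * g z - v' z\<bar> \<partial>m)"
    by (intro nn_integral_mono) (auto simp flip: ennreal_plus intro!: ennreal_leI simp: algebra_simps)
  also have "\<dots> = (\<integral>\<^sup>+z. ennreal \<bar>indicator U z * f z - v z\<bar> \<partial>m) + (\<integral>\<^sup>+z. ennreal \<bar>indicator U z * g z - v' z\<bar> \<partial>m)"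
    by (rule nn_integral_add) measurable
  also have "\<dots> < ennreal (e / 2) + ennreal (e / 2)"
    by (rule add_strict_mono[OF v(3) v'(3)])
  also have "\<dots> = ennreal e" using add.prems by (simp flip: ennreal_plus)
  finally show ?case
    using v v' by (intro exI[of _ "\<lambda>z. v z + v' z"]) (auto intro!: continuous_intros)
next
  case (lim f s)
  have [measurable]: "f \<in> borel_measurable m" "\<And>i. s i \<in> borel_measurable m" using lim by auto
  have [measurable]: "U \<in> sets borel" using U by auto
  have "(\<lambda>i. \<integral>z. \<bar>f z - s i z\<bar> \<partial>m) \<longlonglongrightarrow> (\<integral>z. 0 \<partial>m)"
  proof (rule integral_dominated_convergence[where w="\<lambda>z. 3 * \<bar>f z\<bar>"])
    show "AE z in m. (\<lambda>i. \<bar>f z - s i z\<bar>) \<longlonglongrightarrow> 0"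
      using lim.hyps(2) by (intro AE_I2 tendsto_rabs_zero) (auto intro!: tendsto_eq_intros)
    show "AE z in m. norm \<bar>f z - s i z\<bar> \<le> 3 * \<bar>f z\<bar>" for i
      using lim.hyps(3)[of _ i] by (intro AE_I2) fastforce
  qed (use lim in auto)
  then have "eventually (\<lambda>i. (\<integral>z. \<bar>f z - s i z\<bar> \<partial>m) < e / 2) sequentially"
    using lim.prems by (intro order_tendstoD) auto
  then obtain i where i: "(\<integral>z. \<bar>f z - s i z\<bar> \<partial>m) < e / 2" by (auto simp: eventually_sequentially)
  obtain v where v: "continuous_on UNIV v" "\<And>z. z \<notin> U \<Longrightarrow> v z = 0"
    "(\<integral>\<^sup>+z. ennreal \<bar>indicator U z * s i z - v z\<bar> \<partial>m) < ennreal (e / 2)"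
    using lim.IH[of "e/2" i] lim.prems by auto
  have [measurable]: "v \<in> borel_measurable borel" using v by (auto intro: borel_measurable_continuous_onI)
  have "(\<integral>\<^sup>+z. ennreal \<bar>indicator U z * f z - v z\<bar> \<partial>m)
    \<le> (\<integral>\<^sup>+z. ennreal \<bar>f z - s i z\<bar> + ennreal \<bar>indicator U z * s i z - v z\<bar> \<partial>m)"
    by (intro nn_integral_mono) (auto simp flip: ennreal_plus intro!: ennreal_leI simp: indicator_def)
  also have "\<dots> = (\<integral>\<^sup>+z. ennreal \<bar>f z - s i z\<bar> \<partial>m) + (\<integral>\<^sup>+z. ennreal \<bar>indicator U z * s i z - v z\<bar> \<partial>m)"
    by (rule nn_integral_add) measurable
  also have "\<dots> < ennreal (e / 2) + ennreal (e / 2)"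
  proof (rule add_strict_mono[OF _ v(3)])
    have "(\<integral>\<^sup>+z. ennreal \<bar>f z - s i z\<bar> \<partial>m) = ennreal (\<integral>z. \<bar>f z - s i z\<bar> \<partial>m)"
      using lim by (intro nn_integral_eq_integral) auto
    also have "\<dots> < ennreal (e / 2)" using i lim.prems by (intro ennreal_lessI) auto
    finally show "(\<integral>\<^sup>+z. ennreal \<bar>f z - s i z\<bar> \<partial>m) < ennreal (e / 2)" .
  qed
  also have "\<dots> = ennreal e" using lim.prems by (simp flip: ennreal_plus)
  finally show ?case using v by blast
qed

section \<open>From continuous to Borel functionals: mean and Laplace formula\<close>

context driftless_subordinator
begin

lemma laplace_continuous:
  fixes v :: "real \<times> real \<Rightarrow> real"
  assumes T: "0 < T" and cont: "continuous_on UNIV v" and a: "0 < a" "a \<le> b"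
    and supp: "\<And>s x. x \<notin> {a..b} \<Longrightarrow> v (s, x) = 0" and v0: "\<And>z. 0 \<le> v z"
  shows "(\<integral>\<omega>. exp (- (\<Sum>s\<in>{s\<in>{0<..T}. a \<le> jump (path \<omega>) s}. v (s, jump (path \<omega>) s))) \<partial>M) =
      exp (- (\<integral>z. 1 - exp (- v z) \<partial>intensity T))"
    and "integrable (intensity T) (\<lambda>z. 1 - exp (- v z))"
proof -
  interpret P: pair_sigma_finite "time_measure T" \<nu> by (rule pair_sigma_finite_intensity)
  have [measurable]: "v \<in> borel_measurable borel" by (rule borel_measurable_continuous_onI[OF cont])
  show int: "integrable (intensity T) (\<lambda>z. 1 - exp (- v z))"
    by (rule integrable_intensity_strip[OF _ a(1), where C=1]) (use supp v0 in auto)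
  have "(\<integral>s. (\<integral>x. exp (- v (s, x)) - 1 \<partial>\<nu>) \<partial>time_measure T) = (\<integral>s. - (\<integral>x. 1 - exp (- v (s, x)) \<partial>\<nu>) \<partial>time_measure T)"
    unfolding Bochner_Integration.integral_minus[symmetric] by simp
  also have "\<dots> = - (\<integral>s. (\<integral>x. 1 - exp (- v (s, x)) \<partial>\<nu>) \<partial>time_measure T)" by simp
  also have "(\<integral>s. (\<integral>x. 1 - exp (- v (s, x)) \<partial>\<nu>) \<partial>time_measure T) = (\<integral>z. 1 - exp (- v z) \<partial>intensity T)"
    using P.integral_fst'[OF int[unfolded intensity_def]] by (simp add: intensity_def)
  finally show "(\<integral>\<omega>. exp (- (\<Sum>s\<in>{s\<in>{0<..T}. a \<le> jump (path \<omega>) s}. v (s, jump (path \<omega>) s))) \<partial>M) =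
      exp (- (\<integral>z. 1 - exp (- v z) \<partial>intensity T))"
    using laplace_continuous_sum(1)[OF T cont a supp v0] by simp
qed

text \<open>Differentiation of the Laplace transform at 0 in a monotone form: 2^k (1 - exp(-X /
  2^k)) increases to X, and its expectation is 2^k (1 - exp(-A k)), where A k tends to 0 and 2^k A k
  to the integral of v.\<close>

lemma mean_continuous:
  fixes v :: "real \<times> real \<Rightarrow> real"
  assumes T: "0 < T" and cont: "continuous_on UNIV v" and a: "0 < a" "a \<le> b"
    and supp: "\<And>s x. x \<notin> {a..b} \<Longrightarrow> v (s, x) = 0" and v0: "\<And>z. 0 \<le> v z" and vC: "\<And>z. v z \<le> C"
  shows "(\<lambda>\<omega>. \<integral>\<^sup>+z. v z \<partial>jump_measure (path \<omega>) T) \<in> borel_measurable (natural_filtration M \<xi> T)"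
    and "(\<integral>\<^sup>+\<omega>. (\<integral>\<^sup>+z. v z \<partial>jump_measure (path \<omega>) T) \<partial>M) = (\<integral>\<^sup>+z. v z \<partial>intensity T)"
proof -
  have [measurable]: "v \<in> borel_measurable borel" by (rule borel_measurable_continuous_onI[OF cont])
  define X where "X \<omega> = (\<Sum>s\<in>{s\<in>{0<..T}. a \<le> jump (path \<omega>) s}. v (s, jump (path \<omega>) s))" for \<omega>
  have X0: "0 \<le> X \<omega>" for \<omega> using v0 unfolding X_def by (intro sum_nonneg) auto
  have XF [measurable]: "X \<in> borel_measurable (natural_filtration M \<xi> T)"
    using laplace_continuous_sum(2)[OF T cont a supp v0] unfolding X_def .
  have XM [measurable]: "X \<in> borel_measurable M"
    by (rule measurable_from_subalg[OF subalgebra_natural_filtration XF])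
  have J: "(\<integral>\<^sup>+z. v z \<partial>jump_measure (path \<omega>) T) = ennreal (X \<omega>)" if "\<omega> \<in> space M" for \<omega>
    unfolding X_def using supp a
    by (intro nn_integral_jump_measure_eq_sum[OF increasing_path[OF that] a(1)] v0) auto
  show "(\<lambda>\<omega>. \<integral>\<^sup>+z. v z \<partial>jump_measure (path \<omega>) T) \<in> borel_measurable (natural_filtration M \<xi> T)"
    by (subst measurable_cong[OF J]) (auto intro: measurable_compose[OF XF])
  define L where "L k \<omega> = 2 ^ k * (1 - exp (- (X \<omega> / 2 ^ k)))" for k :: nat and \<omega>
  have L0: "0 \<le> L k \<omega>" for k \<omega> using X0 by (simp add: L_def)
  have [measurable]: "L k \<in> borel_measurable M" for k unfolding L_def by measurable
  have Linc: "L k \<omega> \<le> L (Suc k) \<omega>" for k \<omega>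
  proof -
    \<comment> \<open>Along powers of 2 monotonicity is just 1 - y^2 \<le> 2 (1 - y).\<close>
    define y where "y = exp (- (X \<omega> / 2 ^ Suc k))"
    have "exp (- (X \<omega> / 2 ^ k)) = y * y" unfolding y_def exp_add[symmetric] by (simp add: field_simps)
    moreover have "0 \<le> (1 - y)\<^sup>2" by simp
    then have "1 - y * y \<le> 2 * (1 - y)" by (simp add: power2_eq_square algebra_simps)
    ultimately show ?thesis unfolding L_def y_def[symmetric] by simp
  qed
  have Llim: "(\<lambda>k. L k \<omega>) \<longlonglongrightarrow> X \<omega>" for \<omega>
  proof (rule tendsto_sandwich[of "\<lambda>k. X \<omega> * exp (- (X \<omega> / 2 ^ k))" _ _ "\<lambda>_. X \<omega>"])
    have "X \<omega> * exp (- (X \<omega> / 2 ^ k)) \<le> L k \<omega> \<and> L k \<omega> \<le> X \<omega>" for k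
      using one_minus_exp_bounds[of "X \<omega> / 2 ^ k"] by (simp add: L_def field_simps)
    then show "eventually (\<lambda>k. X \<omega> * exp (- (X \<omega> / 2 ^ k)) \<le> L k \<omega>) sequentially"
      "eventually (\<lambda>k. L k \<omega> \<le> X \<omega>) sequentially" by auto
    have "(\<lambda>k. X \<omega> / 2 ^ k) \<longlonglongrightarrow> 0"
      using tendsto_mult[OF tendsto_const[of "X \<omega>"] LIMSEQ_realpow_zero[of "1/2"]] by (simp add: power_one_over)
    from tendsto_mult[OF tendsto_const[of "X \<omega>"] tendsto_exp[OF tendsto_minus[OF this]]]
    show "(\<lambda>k. X \<omega> * exp (- (X \<omega> / 2 ^ k))) \<longlonglongrightarrow> X \<omega>" by simp
  qed simp
  have ivk: "integrable (intensity T) (\<lambda>z. 1 - exp (- (v z / 2 ^ k)))"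
    and EX: "(\<integral>\<omega>. exp (- (X \<omega> / 2 ^ k)) \<partial>M) = exp (- (\<integral>z. 1 - exp (- (v z / 2 ^ k)) \<partial>intensity T))" for k :: nat
  proof -
    have "continuous_on UNIV (\<lambda>z. v z / 2 ^ k)" by (intro continuous_intros cont) auto
    note l = laplace_continuous[OF T this a]
    show "integrable (intensity T) (\<lambda>z. 1 - exp (- (v z / 2 ^ k)))"
      using supp v0 by (intro l(2)) auto
    show "(\<integral>\<omega>. exp (- (X \<omega> / 2 ^ k)) \<partial>M) = exp (- (\<integral>z. 1 - exp (- (v z / 2 ^ k)) \<partial>intensity T))"
      unfolding X_def sum_divide_distrib using supp v0 by (intro l(1)) auto
  qed
  define A where "A k = (\<integral>z. 1 - exp (- (v z / 2 ^ k)) \<partial>intensity T)" for k :: nat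
  have iv: "integrable (intensity T) v"
  proof (rule integrable_intensity_strip[OF _ a(1), where C=C])
    show "norm (v z) \<le> C" for z using v0[of z] vC[of z] by simp
  qed (use supp in auto)
  have B: "(\<lambda>k. 2 ^ k * A k) \<longlonglongrightarrow> (\<integral>z. v z \<partial>intensity T)"
  proof -
    have "(\<lambda>k. \<integral>z. 2 ^ k * (1 - exp (- (v z / 2 ^ k))) \<partial>intensity T) \<longlonglongrightarrow> (\<integral>z. v z \<partial>intensity T)"
    proof (rule integral_dominated_convergence[OF _ _ iv])
      show "AE z in intensity T. (\<lambda>k. 2 ^ k * (1 - exp (- (v z / 2 ^ k)))) \<longlonglongrightarrow> v z"
      proof (rule AE_I2)
        fix z
        show "(\<lambda>k. 2 ^ k * (1 - exp (- (v z / 2 ^ k)))) \<longlonglongrightarrow> v z"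
        proof (rule tendsto_sandwich[of "\<lambda>k. v z * exp (- (v z / 2 ^ k))" _ _ "\<lambda>_. v z"])
          have "v z * exp (- (v z / 2 ^ k)) \<le> 2 ^ k * (1 - exp (- (v z / 2 ^ k))) \<and> 2 ^ k * (1 - exp (- (v z / 2 ^ k))) \<le> v z" for k
            using one_minus_exp_bounds[of "v z / 2 ^ k"] by (simp add: field_simps)
          then show "eventually (\<lambda>k. v z * exp (- (v z / 2 ^ k)) \<le> 2 ^ k * (1 - exp (- (v z / 2 ^ k)))) sequentially"
            "eventually (\<lambda>k. 2 ^ k * (1 - exp (- (v z / 2 ^ k))) \<le> v z) sequentially" by auto
          have "(\<lambda>k. v z / 2 ^ k) \<longlonglongrightarrow> 0"
            using tendsto_mult[OF tendsto_const[of "v z"] LIMSEQ_realpow_zero[of "1/2"]] by (simp add: power_one_over)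
          from tendsto_mult[OF tendsto_const[of "v z"] tendsto_exp[OF tendsto_minus[OF this]]]
          show "(\<lambda>k. v z * exp (- (v z / 2 ^ k))) \<longlonglongrightarrow> v z" by simp
        qed simp
      qed
      show "AE z in intensity T. norm (2 ^ k * (1 - exp (- (v z / 2 ^ k)))) \<le> v z" for k
        using one_minus_exp_bounds(2)[of "v z / 2 ^ k" for z] v0 by (intro AE_I2) (auto simp: field_simps abs_mult)
    qed auto
    then show ?thesis by (simp add: A_def)
  qed
  \<comment> \<open>A k is 2^k A k, which converges, times 2^(-k).\<close>
  have A0: "A \<longlonglongrightarrow> 0"
    using tendsto_mult[OF B LIMSEQ_realpow_zero[of "1/2"]] by (simp add: power_one_over)
  have lim: "(\<lambda>k. 2 ^ k * (1 - exp (- A k))) \<longlonglongrightarrow> (\<integral>z. v z \<partial>intensity T)"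
  proof (rule tendsto_sandwich[of "\<lambda>k. 2 ^ k * A k * exp (- A k)" _ _ "\<lambda>k. 2 ^ k * A k"])
    show "(\<lambda>k. 2 ^ k * A k * exp (- A k)) \<longlonglongrightarrow> (\<integral>z. v z \<partial>intensity T)"
      using tendsto_mult[OF B tendsto_exp[OF tendsto_minus[OF A0]]] by simp
    show "eventually (\<lambda>k. 2 ^ k * A k * exp (- A k) \<le> 2 ^ k * (1 - exp (- A k))) sequentially"
      using one_minus_exp_bounds(1)[of "A k" for k] by (auto simp: mult.assoc)
    show "eventually (\<lambda>k. 2 ^ k * (1 - exp (- A k)) \<le> 2 ^ k * A k) sequentially"
      using one_minus_exp_bounds(2)[of "A k" for k] by auto
  qed (rule B)
  have "(\<lambda>k. \<integral>\<^sup>+\<omega>. ennreal (L k \<omega>) \<partial>M) \<longlonglongrightarrow> (\<integral>\<^sup>+\<omega>. ennreal (X \<omega>) \<partial>M)"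
    using Linc Llim by (intro nn_integral_LIMSEQ) (auto intro!: incseq_SucI le_funI ennreal_leI tendsto_ennrealI)
  moreover have "(\<integral>\<^sup>+\<omega>. ennreal (L k \<omega>) \<partial>M) = ennreal (2 ^ k * (1 - exp (- A k)))" for k
  proof -
    have i: "integrable M (\<lambda>\<omega>. exp (- (X \<omega> / 2 ^ k)))"
      using X0 by (intro integrable_const_bound[where B=1]) auto
    then have "integrable M (L k)" unfolding L_def by auto
    moreover have "(\<integral>\<omega>. L k \<omega> \<partial>M) = 2 ^ k * (1 - exp (- A k))"
      unfolding L_def A_def EX[symmetric] using i prob_space by simp
    ultimately show ?thesis using L0 by (subst nn_integral_eq_integral) auto
  qed
  ultimately have "(\<integral>\<^sup>+\<omega>. ennreal (X \<omega>) \<partial>M) = ennreal (\<integral>z. v z \<partial>intensity T)"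
    using LIMSEQ_unique tendsto_ennrealI[OF lim] by fastforce
  also have "\<dots> = (\<integral>\<^sup>+z. v z \<partial>intensity T)"
    using iv v0 by (intro nn_integral_eq_integral[symmetric]) auto
  finally show "(\<integral>\<^sup>+\<omega>. (\<integral>\<^sup>+z. v z \<partial>jump_measure (path \<omega>) T) \<partial>M) = (\<integral>\<^sup>+z. v z \<partial>intensity T)"
    using J by (simp cong: nn_integral_cong)
qed

lemma sets_quadrant: "{z. 0 < snd z \<and> fst z \<in> {0<..T}} \<in> sets (borel :: (real \<times> real) measure)"
proof -
  have "{z. 0 < snd z \<and> fst z \<in> {0<..T}} = {0<..T} \<times> {0 :: real<..}" by auto
  moreover have "{0<..T} \<times> {0 :: real<..} \<in> sets (borel \<Otimes>\<^sub>M borel)" by (intro pair_measureI) auto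
  ultimately show ?thesis by (simp only: borel_prod)
qed

lemma AE_jump_measure_pos: "AE z in jump_measure w T. 0 < snd z \<and> fst z \<in> {0<..T}"
  unfolding jump_measure_def
  by (subst AE_distr_iff) (use sets_quadrant[of T] in \<open>auto simp: AE_count_space jump_times_def\<close>)

lemma AE_intensity_pos: "AE z in intensity T. 0 < snd z \<and> fst z \<in> {0<..T}"
proof -
  interpret P: pair_sigma_finite "time_measure T" \<nu> by (rule pair_sigma_finite_intensity)
  have "AE s in time_measure T. AE x in \<nu>. 0 < snd (s, x) \<and> fst (s, x) \<in> {0<..T}"
    using AE_time_measure[of T] by eventually_elim (use AE_nu_pos in auto)
  then show ?thesis
    unfolding intensity_def
  proof (rule P.AE_pair_measure[rotated])
    have "sets (time_measure T \<Otimes>\<^sub>M \<nu>) = sets borel" using sets_intensity[of T] unfolding intensity_def .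
    then show "{z \<in> space (time_measure T \<Otimes>\<^sub>M \<nu>). 0 < snd z \<and> fst z \<in> {0<..T}} \<in> sets (time_measure T \<Otimes>\<^sub>M \<nu>)"
      using sets_quadrant[of T] by (simp add: space_pair_measure)
  qed
qed

text \<open>Sets exhausting the positive jump sizes on which the intensity and every jump measure
  are finite. They are open, so that continuous functions supported in them approximate their
  indicators.\<close>

definition strip :: "nat \<Rightarrow> (real \<times> real) set" where
  "strip p = UNIV \<times> {1 / real (Suc p)<..<real (Suc p)}"

lemma open_strip: "open (strip p)"
  unfolding strip_def by (intro open_Times open_UNIV open_greaterThanLessThan)

lemma sets_strip [measurable]: "strip p \<in> sets borel"
  using open_strip by auto

lemma strip_mono: "p \<le> q \<Longrightarrow> strip p \<subseteq> strip q"
proof -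
  assume "p \<le> q"
  then have "1 / real (Suc q) \<le> 1 / real (Suc p)" "real (Suc p) \<le> real (Suc q)" by (auto intro: frac_le)
  then show ?thesis unfolding strip_def by (intro Sigma_mono subset_refl) (auto simp del: of_nat_Suc)
qed

lemma mem_strip: assumes "0 < snd z" shows "\<exists>p. z \<in> strip p"
proof -
  obtain m where "1 / real (Suc m) < snd z" using nat_approx_posE[OF assms] by auto
  moreover obtain n where "snd z < real n" using reals_Archimedean2 by blast
  moreover have "1 / real (Suc (max m n)) \<le> 1 / real (Suc m)" "real n \<le> real (Suc (max m n))"
    by (auto intro!: frac_le)
  ultimately have "z \<in> strip (max m n)"
    by (auto simp: strip_def mem_Times_iff simp del: of_nat_Suc)
  then show ?thesis by blast
qed

lemma indicator_strip_lim:
  "0 < snd z \<Longrightarrow> eventually (\<lambda>p. z \<in> strip p) sequentially"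
  using mem_strip[of z] strip_mono unfolding eventually_sequentially by blast

lemma strip_snd: "z \<in> strip p \<Longrightarrow> 1 / real (Suc p) < snd z"
  by (auto simp: strip_def mem_Times_iff)

lemma strip_iff: "(s, x) \<in> strip p \<Longrightarrow> x \<in> {1 / real (Suc p)..real (Suc p)}"
  by (auto simp: strip_def)

lemma emeasure_intensity_strip: "emeasure (intensity T) (strip p) < \<infinity>"
proof -
  have "emeasure (intensity T) (strip p) \<le> emeasure (intensity T) (UNIV \<times> {1 / real (Suc p)..})"
    unfolding strip_def by (intro emeasure_mono) (auto simp: borel_prod[symmetric] intro!: pair_measureI)
  also have "\<dots> < \<infinity>" by (rule emeasure_intensity_strip_finite) simp
  finally show ?thesis .
qed

lemma emeasure_jump_measure_strip:
  assumes w: "increasing_path w" shows "emeasure (jump_measure w T) (strip p) < \<infinity>"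
proof -
  have "emeasure (jump_measure w T) (strip p)
      = emeasure (count_space (jump_times w T)) ((\<lambda>s. (s, jump w s)) -` strip p \<inter> jump_times w T)"
    unfolding jump_measure_def by (subst emeasure_distr) auto
  moreover have "finite ((\<lambda>s. (s, jump w s)) -` strip p \<inter> jump_times w T)"
    by (rule finite_subset[OF _ finite_big_jumps[OF w, of "1 / real (Suc p)" T]])
      (auto simp: strip_def jump_times_def simp del: of_nat_Suc)
  ultimately show ?thesis by (simp add: emeasure_count_space ennreal_of_nat_eq_real_of_nat)
qed

text \<open>The functions min(1, n dist(z, complement)) are continuous, bounded, supported in the
  strip and increase to the indicator of the open set.\<close>

lemma jump_mean_open:
  assumes T: "0 < T" and A: "open A"
  shows "(\<lambda>\<omega>. emeasure (jump_measure (path \<omega>) T) (A \<inter> strip p)) \<in> borel_measurable (natural_filtration M \<xi> T)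
    \<and> (\<integral>\<^sup>+\<omega>. emeasure (jump_measure (path \<omega>) T) (A \<inter> strip p) \<partial>M) = emeasure (intensity T) (A \<inter> strip p)"
proof -
  let ?U = "A \<inter> strip p" and ?a = "1 / real (Suc p)" and ?b = "real (Suc p)"
  have oU: "open ?U" using A open_strip by auto
  then have [measurable]: "?U \<in> sets borel" by auto
  have ne: "- ?U \<noteq> {}" using strip_snd[of "(0, 0)" p] by auto
  have ab: "0 < ?a" "?a \<le> ?b" by (auto simp: field_simps)
  define v where "v n z = min 1 (real n * infdist z (- ?U))" for n and z :: "real \<times> real"
  have cont: "continuous_on UNIV (v n)" for n
    unfolding v_def by (intro continuous_intros)
  have v0: "0 \<le> v n z" "v n z \<le> 1" for n z by (auto simp: v_def infdist_nonneg)
  have supp: "v n (s, x) = 0" if "x \<notin> {?a..?b}" for n s x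
  proof -
    have "(s, x) \<in> - ?U" using strip_iff[of s x p] that by blast
    then show ?thesis by (simp add: v_def infdist_zero)
  qed
  have [measurable]: "v n \<in> borel_measurable borel" for n by (rule borel_measurable_continuous_onI[OF cont])
  have inc: "incseq (\<lambda>n z. ennreal (v n z))"
    unfolding v_def by (intro incseq_SucI le_funI ennreal_leI min.mono mult_right_mono) (auto simp: infdist_nonneg)
  have lim: "(\<lambda>n. ennreal (v n z)) \<longlonglongrightarrow> indicator ?U z" for z
  proof (cases "z \<in> ?U")
    case True
    have pos: "0 < infdist z (- ?U)"
      using in_closed_iff_infdist_zero[of "- ?U" z] ne oU True infdist_nonneg[of z "- ?U"]
      by (auto simp: closed_def less_le simp del: Compl_Int)
    obtain N where N: "1 / infdist z (- ?U) < real N" using reals_Archimedean2 by blast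
    have "v n z = 1" if "n \<ge> N" for n
    proof -
      have "1 < real N * infdist z (- ?U)" using N pos by (simp add: field_simps)
      also have "\<dots> \<le> real n * infdist z (- ?U)" using that pos by (intro mult_right_mono) auto
      finally show ?thesis by (simp add: v_def)
    qed
    then have "eventually (\<lambda>n. ennreal (v n z) = 1) sequentially"
      unfolding eventually_sequentially by (intro exI[of _ N]) auto
    then show ?thesis using True by (simp add: tendsto_eventually)
  next
    case False
    then have "v n z = 0" for n by (simp add: v_def infdist_zero)
    then show ?thesis using False by simp
  qed
  note mc = mean_continuous[OF T cont ab supp v0]
  have L: "(\<lambda>n. \<integral>\<^sup>+z. v n z \<partial>m) \<longlonglongrightarrow> emeasure m ?U" if [measurable_cong]: "sets m = sets borel" for m :: "(real \<times> real) measure"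
    using nn_integral_LIMSEQ[OF inc _ lim, of m] that by simp
  have Li: "incseq (\<lambda>n. \<integral>\<^sup>+z. v n z \<partial>m)" for m :: "(real \<times> real) measure"
    using inc by (rule incseq_nn_integral)
  have meas: "(\<lambda>\<omega>. emeasure (jump_measure (path \<omega>) T) ?U) \<in> borel_measurable (natural_filtration M \<xi> T)"
    by (rule borel_measurable_LIMSEQ_order[OF L[OF sets_jump_measure] mc(1)])
  have measM: "(\<lambda>\<omega>. \<integral>\<^sup>+z. v n z \<partial>jump_measure (path \<omega>) T) \<in> borel_measurable M" for n
    by (rule measurable_from_subalg[OF subalgebra_natural_filtration mc(1)])
  have "(\<lambda>n. \<integral>\<^sup>+\<omega>. (\<integral>\<^sup>+z. v n z \<partial>jump_measure (path \<omega>) T) \<partial>M) \<longlonglongrightarrow> (\<integral>\<^sup>+\<omega>. emeasure (jump_measure (path \<omega>) T) ?U \<partial>M)"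
    using Li L[OF sets_jump_measure] measM
    by (intro nn_integral_LIMSEQ) (auto simp: incseq_def le_fun_def)
  moreover have "(\<integral>\<^sup>+\<omega>. (\<integral>\<^sup>+z. v n z \<partial>jump_measure (path \<omega>) T) \<partial>M) = (\<integral>\<^sup>+z. v n z \<partial>intensity T)" for n
    by (rule mc(2))
  ultimately have "(\<integral>\<^sup>+\<omega>. emeasure (jump_measure (path \<omega>) T) ?U \<partial>M) = emeasure (intensity T) ?U"
    using L[OF sets_intensity[of T]] by (auto intro: LIMSEQ_unique)
  then show ?thesis using meas by blast
qed

text \<open>Dynkin's argument from open sets. Intersecting with a strip makes all masses finite,
  which the subtraction for complements requires.\<close>

lemma jump_mean_strip:
  assumes T: "0 < T" and A: "A \<in> sets borel"
  shows "(\<lambda>\<omega>. emeasure (jump_measure (path \<omega>) T) (A \<inter> strip p)) \<in> borel_measurable (natural_filtration M \<xi> T)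
    \<and> (\<integral>\<^sup>+\<omega>. emeasure (jump_measure (path \<omega>) T) (A \<inter> strip p) \<partial>M) = emeasure (intensity T) (A \<inter> strip p)"
proof -
  let ?P = "\<lambda>A. (\<lambda>\<omega>. emeasure (jump_measure (path \<omega>) T) (A \<inter> strip p)) \<in> borel_measurable (natural_filtration M \<xi> T)
    \<and> (\<integral>\<^sup>+\<omega>. emeasure (jump_measure (path \<omega>) T) (A \<inter> strip p) \<partial>M) = emeasure (intensity T) (A \<inter> strip p)"
  have sb: "sigma_sets UNIV {S. open S} = sets (borel :: (real \<times> real) measure)"
    by (simp add: borel_def)
  note M_of_F = measurable_from_subalg[OF subalgebra_natural_filtration[of T]]
  have A: "A \<in> sigma_sets UNIV {S. open S}" using A by (simp only: sb)
  have "Int_stable {S :: (real \<times> real) set. open S}" "{S :: (real \<times> real) set. open S} \<subseteq> Pow UNIV"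
    by (auto simp: Int_stable_def)
  from this A show ?thesis
  proof (induction rule: sigma_sets_induct_disjoint)
    case (basic A)
    then show ?case using jump_mean_open[OF T] by blast
  next
    case empty
    then show ?case by simp
  next
    case (compl A)
    then have A [measurable]: "A \<in> sets borel" by (simp only: sb)
    have eq: "(UNIV - A) \<inter> strip p = UNIV \<inter> strip p - A \<inter> strip p" by auto
    have U: "?P UNIV" by (rule jump_mean_open[OF T open_UNIV])
    have fin: "emeasure (jump_measure (path \<omega>) T) (A \<inter> strip p) \<noteq> \<infinity>" if "\<omega> \<in> space M" for \<omega>
    proof -
      have "emeasure (jump_measure (path \<omega>) T) (A \<inter> strip p) \<le> emeasure (jump_measure (path \<omega>) T) (strip p)"
        by (intro emeasure_mono) auto
      then show ?thesis
        using emeasure_jump_measure_strip[OF increasing_path[OF that], of T p] by (auto simp: top_unique)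
    qed
    have finI: "emeasure (intensity T) (A \<inter> strip p) \<noteq> \<infinity>"
    proof -
      have "emeasure (intensity T) (A \<inter> strip p) \<le> emeasure (intensity T) (strip p)"
        by (intro emeasure_mono) auto
      then show ?thesis using emeasure_intensity_strip[of T p] by (auto simp: top_unique)
    qed
    have D: "emeasure (jump_measure (path \<omega>) T) ((UNIV - A) \<inter> strip p)
      = emeasure (jump_measure (path \<omega>) T) (UNIV \<inter> strip p) - emeasure (jump_measure (path \<omega>) T) (A \<inter> strip p)"
      if "\<omega> \<in> space M" for \<omega>
      unfolding eq using fin[OF that] by (intro emeasure_Diff) auto
    have "(\<lambda>\<omega>. emeasure (jump_measure (path \<omega>) T) ((UNIV - A) \<inter> strip p)) \<in> borel_measurable (natural_filtration M \<xi> T)"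
      by (subst measurable_cong[OF D])
        (simp, intro borel_measurable_minus_ennreal conjunct1[OF U] conjunct1[OF compl(2)])
    moreover have "(\<integral>\<^sup>+\<omega>. emeasure (jump_measure (path \<omega>) T) ((UNIV - A) \<inter> strip p) \<partial>M)
        = (\<integral>\<^sup>+\<omega>. emeasure (jump_measure (path \<omega>) T) (UNIV \<inter> strip p) - emeasure (jump_measure (path \<omega>) T) (A \<inter> strip p) \<partial>M)"
      using D by (intro nn_integral_cong) simp
    moreover have "\<dots> = (\<integral>\<^sup>+\<omega>. emeasure (jump_measure (path \<omega>) T) (UNIV \<inter> strip p) \<partial>M)
        - (\<integral>\<^sup>+\<omega>. emeasure (jump_measure (path \<omega>) T) (A \<inter> strip p) \<partial>M)"
    proof (intro nn_integral_diff M_of_F conjunct1[OF U] conjunct1[OF compl(2)])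
      show "(\<integral>\<^sup>+\<omega>. emeasure (jump_measure (path \<omega>) T) (A \<inter> strip p) \<partial>M) \<noteq> \<infinity>"
        using finI conjunct2[OF compl(2)] by simp
      show "AE \<omega> in M. emeasure (jump_measure (path \<omega>) T) (A \<inter> strip p)
          \<le> emeasure (jump_measure (path \<omega>) T) (UNIV \<inter> strip p)"
        by (intro AE_I2 emeasure_mono) auto
    qed
    moreover have "\<dots> = emeasure (intensity T) ((UNIV - A) \<inter> strip p)"
    proof -
      have "emeasure (intensity T) (UNIV \<inter> strip p - A \<inter> strip p)
        = emeasure (intensity T) (UNIV \<inter> strip p) - emeasure (intensity T) (A \<inter> strip p)"
        using finI by (intro emeasure_Diff) auto
      then show ?thesis unfolding eq conjunct2[OF U] conjunct2[OF compl(2)] by (rule sym)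
    qed
    ultimately show ?case by simp
  next
    case (union A)
    then have A: "A i \<in> sets borel" for i using sb by blast
    have S: "emeasure m ((\<Union>i. A i) \<inter> strip p) = (\<Sum>i. emeasure m (A i \<inter> strip p))"
      if "sets m = sets borel" for m :: "(real \<times> real) measure"
    proof -
      have "(\<Union>i. A i) \<inter> strip p = (\<Union>i. A i \<inter> strip p)" by auto
      moreover have "disjoint_family (\<lambda>i. A i \<inter> strip p)"
        using union(1) by (auto simp: disjoint_family_on_def)
      ultimately show ?thesis using A that by (subst suminf_emeasure) auto
    qed
    have "(\<lambda>\<omega>. emeasure (jump_measure (path \<omega>) T) ((\<Union>i. A i) \<inter> strip p)) \<in> borel_measurable (natural_filtration M \<xi> T)"
      unfolding S[OF sets_jump_measure] using union by (intro borel_measurable_suminf_order) auto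
    moreover have "(\<integral>\<^sup>+\<omega>. emeasure (jump_measure (path \<omega>) T) ((\<Union>i. A i) \<inter> strip p) \<partial>M)
        = (\<Sum>i. \<integral>\<^sup>+\<omega>. emeasure (jump_measure (path \<omega>) T) (A i \<inter> strip p) \<partial>M)"
      unfolding S[OF sets_jump_measure] using union M_of_F by (intro nn_integral_suminf) auto
    ultimately show ?case using union S[OF sets_intensity] by simp
  qed
qed

lemma emeasure_strip_lim:
  assumes [measurable_cong]: "sets m = sets borel" and m: "AE z in m. 0 < snd z" and [measurable]: "A \<in> sets borel"
  shows "(\<lambda>p. emeasure m (A \<inter> strip p)) \<longlonglongrightarrow> emeasure m A"
proof -
  have "(\<lambda>p. emeasure m (A \<inter> strip p)) \<longlonglongrightarrow> emeasure m (\<Union>p. A \<inter> strip p)"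
    using strip_mono by (intro Lim_emeasure_incseq) (auto simp: incseq_def assms(1))
  also have "emeasure m (\<Union>p. A \<inter> strip p) = emeasure m A"
    using m by (intro emeasure_eq_AE) (auto elim!: eventually_mono dest: mem_strip simp: assms(1))
  finally show ?thesis .
qed

text \<open>Campbell's formula. Measurability is proved along with it because every stage of the
  induction needs it, and it holds for the uncompleted filtration, since all limits are taken at
  every \<omega>.\<close>

theorem jump_mean_pos:
  assumes T: "0 < T" and F: "F \<in> borel_measurable borel"
  shows "(\<lambda>\<omega>. \<integral>\<^sup>+z. F z \<partial>jump_measure (path \<omega>) T) \<in> borel_measurable (natural_filtration M \<xi> T)
    \<and> (\<integral>\<^sup>+\<omega>. (\<integral>\<^sup>+z. F z \<partial>jump_measure (path \<omega>) T) \<partial>M) = (\<integral>\<^sup>+z. F z \<partial>intensity T)"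
  using F
proof (induction rule: borel_measurable_induct)
  case (cong f g)
  then have "f = g" by auto
  then show ?case using cong by simp
next
  case (set A)
  have 1: "AE z in jump_measure w T. 0 < snd z" "AE z in intensity T. 0 < snd z" for w
    using AE_jump_measure_pos[where w=w and T=T] AE_intensity_pos[of T] by auto
  note mc = jump_mean_strip[OF T set]
  note L = emeasure_strip_lim[OF sets_jump_measure 1(1) set]
  have meas: "(\<lambda>\<omega>. emeasure (jump_measure (path \<omega>) T) A) \<in> borel_measurable (natural_filtration M \<xi> T)"
    by (rule borel_measurable_LIMSEQ_order[OF L]) (use mc in blast)
  have "(\<lambda>p. \<integral>\<^sup>+\<omega>. emeasure (jump_measure (path \<omega>) T) (A \<inter> strip p) \<partial>M) \<longlonglongrightarrow> (\<integral>\<^sup>+\<omega>. emeasure (jump_measure (path \<omega>) T) A \<partial>M)"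
    using L mc strip_mono[THEN subsetD] set
    by (intro nn_integral_LIMSEQ measurable_from_subalg[OF subalgebra_natural_filtration[of T]])
      (auto simp: incseq_def le_fun_def intro!: emeasure_mono)
  then have "(\<integral>\<^sup>+\<omega>. emeasure (jump_measure (path \<omega>) T) A \<partial>M) = emeasure (intensity T) A"
    using emeasure_strip_lim[OF sets_intensity 1(2) set] mc by (auto dest: LIMSEQ_unique)
  then show ?case using meas set by simp
next
  case (mult u c)
  then show ?case
    by (auto simp: nn_integral_cmult measurable_from_subalg[OF subalgebra_natural_filtration[of T]])
next
  case (add u v)
  then show ?case
    by (auto simp: nn_integral_add measurable_from_subalg[OF subalgebra_natural_filtration[of T]])
next
  case (seq U)
  have [measurable]: "U i \<in> borel_measurable borel" for i using seq by auto
  have e: "(\<integral>\<^sup>+z. (SUP i. U i) z \<partial>m) = (SUP i. \<integral>\<^sup>+z. U i z \<partial>m)"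
    if [measurable_cong]: "sets m = sets borel" for m :: "(real \<times> real) measure"
    unfolding SUP_apply using seq by (intro nn_integral_monotone_convergence_SUP) auto
  have "(\<integral>\<^sup>+\<omega>. (SUP i. \<integral>\<^sup>+z. U i z \<partial>jump_measure (path \<omega>) T) \<partial>M)
    = (SUP i. \<integral>\<^sup>+\<omega>. (\<integral>\<^sup>+z. U i z \<partial>jump_measure (path \<omega>) T) \<partial>M)"
    using seq by (intro nn_integral_monotone_convergence_SUP measurable_from_subalg[OF subalgebra_natural_filtration[of T]])
      (auto simp: incseq_def le_fun_def intro!: nn_integral_mono)
  moreover have "(\<lambda>\<omega>. SUP i. \<integral>\<^sup>+z. U i z \<partial>jump_measure (path \<omega>) T) \<in> borel_measurable (natural_filtration M \<xi> T)"
    using seq by (intro borel_measurable_SUP) auto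
  ultimately show ?case using seq unfolding e[OF sets_jump_measure] e[OF sets_intensity] by auto
qed

lemma jump_measure_nonpos: "T \<le> 0 \<Longrightarrow> jump_measure w T = null_measure borel"
proof (rule measure_eqI)
  assume T: "T \<le> 0"
  fix A assume "A \<in> sets (jump_measure w T)"
  moreover have "jump_times w T = {}" using T by (auto simp: jump_times_def)
  ultimately show "emeasure (jump_measure w T) A = emeasure (null_measure borel) A"
    unfolding jump_measure_def by (subst emeasure_distr) auto
qed simp

lemma intensity_nonpos: "T \<le> 0 \<Longrightarrow> intensity T = null_measure borel"
proof (rule measure_eqI)
  assume T: "T \<le> 0"
  fix A assume A: "A \<in> sets (intensity T)"
  have "AE z in intensity T. False" using AE_intensity_pos[of T] T by (auto elim!: eventually_mono)
  then have "emeasure (intensity T) A = emeasure (intensity T) {}"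
    using A by (intro emeasure_eq_AE) (auto elim!: eventually_mono)
  then show "emeasure (intensity T) A = emeasure (null_measure borel) A" by simp
qed simp

theorem measurable_jump_functional:
  assumes "F \<in> borel_measurable borel"
  shows "(\<lambda>\<omega>. \<integral>\<^sup>+z. F z \<partial>jump_measure (path \<omega>) T) \<in> borel_measurable (natural_filtration M \<xi> T)"
  using jump_mean_pos[of T F] assms by (cases "0 < T") (auto simp: jump_measure_nonpos)

theorem jump_mean:
  assumes "F \<in> borel_measurable borel"
  shows "(\<integral>\<^sup>+\<omega>. (\<integral>\<^sup>+z. F z \<partial>jump_measure (path \<omega>) T) \<partial>M) = (\<integral>\<^sup>+z. F z \<partial>intensity T)"
  using jump_mean_pos[of T F] assms by (cases "0 < T") (auto simp: jump_measure_nonpos intensity_nonpos)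

lemmas measurable_jump_functional_M [measurable (raw)] =
  measurable_from_subalg[OF subalgebra_natural_filtration measurable_jump_functional]

text \<open>Both sides are Lipschitz in \<open>F\<close> for the L1-norm of the intensity, the left
  side thanks to the mean formula. Continuous functions supported in the strip are dense for this
  norm.\<close>

lemma laplace_strip:
  fixes F :: "real \<times> real \<Rightarrow> real"
  assumes T: "0 < T" and F [measurable]: "F \<in> borel_measurable borel" and F0: "\<And>z. 0 \<le> F z" and FC: "\<And>z. F z \<le> C"
    and supp: "\<And>z. z \<notin> strip p \<Longrightarrow> F z = 0"
  shows "(\<integral>\<omega>. nexp (\<integral>\<^sup>+z. F z \<partial>jump_measure (path \<omega>) T) \<partial>M) = nexp (\<integral>\<^sup>+z. ennreal (1 - exp (- F z)) \<partial>intensity T)"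
    (is "?L F = ?R F")
proof -
  have "\<bar>?L F - ?R F\<bar> \<le> e" if e: "0 < e" for e
  proof -
    \<comment> \<open>The intensity restricted to the strip is a finite measure, as
      \<open>continuous_approx_L1\<close> demands.\<close>
    define m where "m = density (intensity T) (indicator (strip p))"
    have sm [measurable_cong]: "sets m = sets borel" by (simp add: m_def)
    have "emeasure m (space m) < \<infinity>"
      using emeasure_intensity_strip[of T p] by (simp add: m_def emeasure_density)
    then have fm: "finite_measure m" by (intro finite_measureI) auto
    then interpret m: finite_measure m .
    have "integrable m F"
      using F0 FC by (intro m.integrable_const_bound[where B=C]) (auto intro!: AE_I2)
    from continuous_approx_L1[OF fm sm open_strip this, of "e/2" p] e
    obtain v where v: "continuous_on UNIV v" "\<And>z. z \<notin> strip p \<Longrightarrow> v z = 0"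
      "(\<integral>\<^sup>+z. ennreal \<bar>indicator (strip p) z * F z - v z\<bar> \<partial>m) < ennreal (e/2)" by auto
    \<comment> \<open>As F is non-negative, cutting v off at 0 cannot increase the distance to
      F.\<close>
    define u where "u z = max 0 (v z)" for z
    have uc: "continuous_on UNIV u" unfolding u_def by (intro continuous_intros v)
    have u0: "0 \<le> u z" for z by (simp add: u_def)
    have us: "u z = 0" if "z \<notin> strip p" for z using v(2)[OF that] by (simp add: u_def)
    have [measurable]: "u \<in> borel_measurable borel" by (rule borel_measurable_continuous_onI[OF uc])
    have [measurable]: "v \<in> borel_measurable borel" by (rule borel_measurable_continuous_onI[OF v(1)])
    have D: "(\<integral>\<^sup>+z. ennreal \<bar>F z - u z\<bar> \<partial>intensity T) < ennreal (e/2)"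
    proof -
      have "(\<integral>\<^sup>+z. ennreal \<bar>F z - u z\<bar> \<partial>intensity T) = (\<integral>\<^sup>+z. ennreal \<bar>F z - u z\<bar> * indicator (strip p) z \<partial>intensity T)"
        using supp us by (intro nn_integral_cong) (auto simp: indicator_def)
      also have "\<dots> \<le> (\<integral>\<^sup>+z. indicator (strip p) z * ennreal \<bar>indicator (strip p) z * F z - v z\<bar> \<partial>intensity T)"
        using F0 by (intro nn_integral_mono) (auto simp: indicator_def u_def intro!: ennreal_leI split: split_max)
      also have "\<dots> = (\<integral>\<^sup>+z. ennreal \<bar>indicator (strip p) z * F z - v z\<bar> \<partial>m)"
        unfolding m_def by (subst nn_integral_density) auto
      finally show ?thesis using v(3) by simp
    qed
    let ?a = "1 / real (Suc p)" and ?b = "real (Suc p)"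
    have ab: "0 < ?a" "?a \<le> ?b" by (auto simp: field_simps)
    have supp': "u (s, x) = 0" if "x \<notin> {?a..?b}" for s x using us[of "(s, x)"] strip_iff[of s x p] that by blast
    note lc = laplace_continuous[OF T uc ab supp' u0]
    have "?L u = (\<integral>\<omega>. exp (- (\<Sum>s\<in>{s\<in>{0<..T}. ?a \<le> jump (path \<omega>) s}. u (s, jump (path \<omega>) s))) \<partial>M)"
    proof (intro Bochner_Integration.integral_cong refl)
      fix \<omega> assume "\<omega> \<in> space M"
      have "(\<integral>\<^sup>+z. u z \<partial>jump_measure (path \<omega>) T) = ennreal (\<Sum>s\<in>{s\<in>{0<..T}. ?a \<le> jump (path \<omega>) s}. u (s, jump (path \<omega>) s))"
        using supp' by (intro nn_integral_jump_measure_eq_sum increasing_path \<open>\<omega> \<in> space M\<close> ab u0) auto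
      then show "nexp (\<integral>\<^sup>+z. u z \<partial>jump_measure (path \<omega>) T) = exp (- (\<Sum>s\<in>{s\<in>{0<..T}. ?a \<le> jump (path \<omega>) s}. u (s, jump (path \<omega>) s)))"
        using u0 by (simp add: sum_nonneg)
    qed
    also have "\<dots> = ?R u"
    proof -
      have "(\<integral>\<^sup>+z. ennreal (1 - exp (- u z)) \<partial>intensity T) = ennreal (\<integral>z. 1 - exp (- u z) \<partial>intensity T)"
        using lc(2) u0 by (intro nn_integral_eq_integral) auto
      moreover have "0 \<le> (\<integral>z. 1 - exp (- u z) \<partial>intensity T)"
        using u0 by (intro Bochner_Integration.integral_nonneg) auto
      ultimately show ?thesis using lc(1) by simp
    qed
    finally have eq: "?L u = ?R u" .
    have iM: "integrable M (\<lambda>\<omega>. nexp (\<integral>\<^sup>+z. f z \<partial>jump_measure (path \<omega>) T))"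
      if [measurable]: "f \<in> borel_measurable borel" for f :: "real \<times> real \<Rightarrow> ennreal"
      by (rule integrable_const_bound[where B=1]) auto
    \<comment> \<open>Pathwise, the two values of \<open>nexp\<close> differ by at most the sum of
      |F - u| over the jumps, whose expectation is its integral for the intensity.\<close>
    have "ennreal \<bar>?L F - ?L u\<bar> \<le> ennreal (e/2)"
    proof -
      have "\<bar>?L F - ?L u\<bar> = \<bar>\<integral>\<omega>. nexp (\<integral>\<^sup>+z. F z \<partial>jump_measure (path \<omega>) T) - nexp (\<integral>\<^sup>+z. u z \<partial>jump_measure (path \<omega>) T) \<partial>M\<bar>"
        using iM[of "\<lambda>z. ennreal (F z)"] iM[of "\<lambda>z. ennreal (u z)"] by simp
      also have "\<dots> \<le> (\<integral>\<omega>. \<bar>nexp (\<integral>\<^sup>+z. F z \<partial>jump_measure (path \<omega>) T) - nexp (\<integral>\<^sup>+z. u z \<partial>jump_measure (path \<omega>) T)\<bar> \<partial>M)"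
        by (rule integral_abs_bound)
      finally have "ennreal \<bar>?L F - ?L u\<bar> \<le> ennreal \<dots>" by (rule ennreal_leI)
      also have "\<dots> = (\<integral>\<^sup>+\<omega>. ennreal \<bar>nexp (\<integral>\<^sup>+z. F z \<partial>jump_measure (path \<omega>) T) - nexp (\<integral>\<^sup>+z. u z \<partial>jump_measure (path \<omega>) T)\<bar> \<partial>M)"
        using iM[of "\<lambda>z. ennreal (F z)"] iM[of "\<lambda>z. ennreal (u z)"] by (intro nn_integral_eq_integral[symmetric]) auto
      also have "\<dots> \<le> (\<integral>\<^sup>+\<omega>. (\<integral>\<^sup>+z. ennreal \<bar>F z - u z\<bar> \<partial>jump_measure (path \<omega>) T) \<partial>M)"
        using F0 u0 by (intro nn_integral_mono nexp_nn_integral_diff_le) auto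
      also have "\<dots> = (\<integral>\<^sup>+z. ennreal \<bar>F z - u z\<bar> \<partial>intensity T)" by (rule jump_mean) measurable
      finally show ?thesis using D by simp
    qed
    moreover have "ennreal \<bar>?R F - ?R u\<bar> \<le> ennreal (e/2)"
    proof -
      have "ennreal \<bar>?R F - ?R u\<bar> \<le> (\<integral>\<^sup>+z. ennreal \<bar>(1 - exp (- F z)) - (1 - exp (- u z))\<bar> \<partial>intensity T)"
        using F0 u0 by (intro nexp_nn_integral_diff_le) auto
      also have "\<dots> \<le> (\<integral>\<^sup>+z. ennreal \<bar>F z - u z\<bar> \<partial>intensity T)"
      proof (intro nn_integral_mono ennreal_leI)
        fix z
        show "\<bar>(1 - exp (- F z)) - (1 - exp (- u z))\<bar> \<le> \<bar>F z - u z\<bar>"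
          using abs_exp_minus_diff_le[OF F0[of z] u0[of z]] by linarith
      qed
      finally show ?thesis using D by simp
    qed
    ultimately have "\<bar>?L F - ?L u\<bar> \<le> e/2" "\<bar>?R F - ?R u\<bar> \<le> e/2"
      using e by (auto simp: ennreal_le_iff)
    then show ?thesis using eq by linarith
  qed
  then have "\<bar>?L F - ?R F\<bar> \<le> 0" by (rule field_le_epsilon) simp
  then show ?thesis by simp
qed

text \<open>Truncating F in height and to a strip gives a sequence that increases to F on positive
  jump sizes, where both measures live. Both exponents converge by monotone convergence, possibly to
  \<infinity>, where \<open>nexp\<close> is still continuous.\<close>

theorem laplace:
  fixes F :: "real \<times> real \<Rightarrow> real"
  assumes F [measurable]: "F \<in> borel_measurable borel" and F0: "\<And>z. 0 \<le> F z"
  shows "(\<integral>\<omega>. nexp (\<integral>\<^sup>+z. F z \<partial>jump_measure (path \<omega>) T) \<partial>M) = nexp (\<integral>\<^sup>+z. ennreal (1 - exp (- F z)) \<partial>intensity T)"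
proof (cases "0 < T")
  case True
  define f where "f p z = indicator (strip p) z * min (F z) (real p)" for p z
  have fm [measurable]: "f p \<in> borel_measurable borel" for p unfolding f_def by measurable
  have f0: "0 \<le> f p z" "f p z \<le> real p" for p z using F0[of z] by (auto simp: f_def indicator_def)
  have eq: "(\<integral>\<omega>. nexp (\<integral>\<^sup>+z. f p z \<partial>jump_measure (path \<omega>) T) \<partial>M)
      = nexp (\<integral>\<^sup>+z. ennreal (1 - exp (- f p z)) \<partial>intensity T)" for p
    by (rule laplace_strip[OF True fm f0, of p]) (simp add: f_def)
  have finc: "f p z \<le> f q z" if "p \<le> q" for p q z
    using strip_mono[OF that] that F0[of z] by (auto simp: f_def indicator_def)
  have flim: "eventually (\<lambda>p. f p z = F z) sequentially" if "0 < snd z" for z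
  proof -
    obtain n where n: "F z < real n" using reals_Archimedean2 by blast
    show ?thesis
      using indicator_strip_lim[OF that] eventually_ge_at_top[of n]
      by eventually_elim (use n in \<open>auto simp: f_def\<close>)
  qed
  have lim: "(\<lambda>p. \<integral>\<^sup>+z. ennreal (h (f p z)) \<partial>m) \<longlonglongrightarrow> (\<integral>\<^sup>+z. ennreal (h (F z)) \<partial>m)"
    if [measurable_cong]: "sets m = sets borel" and pos: "AE z in m. 0 < snd z"
      and [measurable]: "h \<in> borel_measurable borel" and "mono h" for m :: "(real \<times> real) measure" and h :: "real \<Rightarrow> real"
  proof -
    let ?u = "\<lambda>z. SUP p. ennreal (h (f p z))"
    have inc: "incseq (\<lambda>p z. ennreal (h (f p z)))"
      using finc \<open>mono h\<close> by (auto simp: incseq_def le_fun_def mono_def intro!: ennreal_leI)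
    then have incz: "incseq (\<lambda>p. ennreal (h (f p z)))" for z unfolding incseq_def le_fun_def by blast
    have "(\<lambda>p. \<integral>\<^sup>+z. ennreal (h (f p z)) \<partial>m) \<longlonglongrightarrow> (\<integral>\<^sup>+z. ?u z \<partial>m)"
      by (rule nn_integral_LIMSEQ[OF inc _ LIMSEQ_SUP[OF incz]]) measurable
    also have "(\<integral>\<^sup>+z. ?u z \<partial>m) = (\<integral>\<^sup>+z. ennreal (h (F z)) \<partial>m)"
    proof (rule nn_integral_cong_AE)
      show "AE z in m. ?u z = ennreal (h (F z))"
        using pos
      proof eventually_elim
        case (elim z)
        have "(\<lambda>p. ennreal (h (f p z))) \<longlonglongrightarrow> ?u z"
          by (rule LIMSEQ_SUP[OF incz])
        moreover have "(\<lambda>p. ennreal (h (f p z))) \<longlonglongrightarrow> ennreal (h (F z))"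
          using flim[OF elim] by (intro tendsto_eventually) (auto elim: eventually_mono)
        ultimately show ?case by (rule LIMSEQ_unique)
      qed
    qed
    finally show ?thesis .
  qed
  have 1: "(\<lambda>p. \<integral>\<omega>. nexp (\<integral>\<^sup>+z. f p z \<partial>jump_measure (path \<omega>) T) \<partial>M)
      \<longlonglongrightarrow> (\<integral>\<omega>. nexp (\<integral>\<^sup>+z. F z \<partial>jump_measure (path \<omega>) T) \<partial>M)"
  proof (rule integral_dominated_convergence[where w="\<lambda>_. 1"])
    have pos: "AE z in jump_measure w T. 0 < snd z" for w using AE_jump_measure_pos[where w=w and T=T] by auto
    show "AE \<omega> in M. (\<lambda>p. nexp (\<integral>\<^sup>+z. f p z \<partial>jump_measure (path \<omega>) T)) \<longlonglongrightarrow> nexp (\<integral>\<^sup>+z. F z \<partial>jump_measure (path \<omega>) T)"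
      by (rule AE_I2, rule tendsto_nexp, rule lim[of _ "\<lambda>x. x", OF sets_jump_measure pos])
        (auto simp: mono_def)
  qed auto
  have "AE z in intensity T. 0 < snd z" using AE_intensity_pos[of T] by auto
  then have 2: "(\<lambda>p. nexp (\<integral>\<^sup>+z. ennreal (1 - exp (- f p z)) \<partial>intensity T))
      \<longlonglongrightarrow> nexp (\<integral>\<^sup>+z. ennreal (1 - exp (- F z)) \<partial>intensity T)"
    by (intro tendsto_nexp lim[of _ "\<lambda>x. 1 - exp (- x)"]) (auto simp: mono_def)
  show ?thesis using LIMSEQ_unique[OF 1[unfolded eq] 2] .
next
  case False
  then show ?thesis by (simp add: jump_measure_nonpos intensity_nonpos prob_space)
qed

end

section \<open>Uniqueness of Laplace transforms\<close>

text \<open>The transform at the integers gives the integrals of all powers of y = exp(-x), hence of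
  polynomials, hence by Weierstrass of continuous functions on [0,1]. The case n = 0 makes the total
  masses agree, so one error bound serves both measures.\<close>

lemma integral_poly_exp_eq:
  fixes m1 m2 :: "real measure" and q :: "real \<Rightarrow> real"
  assumes fin: "finite_measure m1" "finite_measure m2"
    and sm [measurable_cong]: "sets m1 = sets borel" "sets m2 = sets borel"
    and pos: "AE x in m1. 0 \<le> x" "AE x in m2. 0 \<le> x"
    and eq: "\<And>n::nat. (\<integral>\<^sup>+x. ennreal (exp (- (real n * x))) \<partial>m1) = (\<integral>\<^sup>+x. ennreal (exp (- (real n * x))) \<partial>m2)"
    and q: "continuous_on {0..1} q" and [measurable]: "q \<in> borel_measurable borel"
  shows "(\<integral>x. q (exp (- x)) \<partial>m1) = (\<integral>x. q (exp (- x)) \<partial>m2)"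
proof -
  interpret m1: finite_measure m1 by fact
  interpret m2: finite_measure m2 by fact
  have int: "integrable m (\<lambda>x. f (exp (- x)))"
    if "finite_measure m" and [measurable_cong]: "sets m = sets borel" and pm: "AE x in m. 0 \<le> x"
      and c: "continuous_on {0..1} f" and [measurable]: "f \<in> borel_measurable borel"
    for m :: "real measure" and f :: "real \<Rightarrow> real"
  proof -
    interpret finite_measure m by fact
    obtain C where "\<And>y. y \<in> {0..1} \<Longrightarrow> \<bar>f y\<bar> \<le> C"
      using compact_imp_bounded[OF compact_continuous_image[OF c compact_Icc]] by (force simp: bounded_iff)
    then show ?thesis using pm
      by (intro integrable_const_bound[where B=C]) (auto elim!: eventually_mono)
  qed
  have pw: "integrable m (\<lambda>x. exp (- x) ^ n)"
    if "finite_measure m" "sets m = sets borel" "AE x in m. 0 \<le> x" for m :: "real measure" and n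
    by (rule int[OF that, of "\<lambda>y. y ^ n"]) (auto intro!: continuous_intros)
  have pow: "(\<integral>x. exp (- x) ^ n \<partial>m1) = (\<integral>x. exp (- x) ^ n \<partial>m2)" for n :: nat
  proof -
    have "ennreal (\<integral>x. exp (- x) ^ n \<partial>m1) = ennreal (\<integral>x. exp (- x) ^ n \<partial>m2)"
      using eq[of n] nn_integral_eq_integral[OF pw[OF fin(1) sm(1) pos(1)], of n]
        nn_integral_eq_integral[OF pw[OF fin(2) sm(2) pos(2)], of n]
      by (simp add: exp_of_nat_mult[symmetric])
    then show ?thesis by simp
  qed
  have poly: "(\<integral>x. p (exp (- x)) \<partial>m1) = (\<integral>x. p (exp (- x)) \<partial>m2)" if pp: "real_polynomial_function p" for p
  proof -
    obtain a k where p: "p = (\<lambda>x. \<Sum>i\<le>k. a i * x ^ i)"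
      using pp unfolding real_polynomial_function_iff_sum by blast
    show ?thesis unfolding p
      by (simp add: pow pw[OF fin(1) sm(1) pos(1)] pw[OF fin(2) sm(2) pos(2)])
  qed
  have mass: "measure m1 (space m1) = measure m2 (space m2)" using pow[of 0] by simp
  have "\<bar>(\<integral>x. q (exp (- x)) \<partial>m1) - (\<integral>x. q (exp (- x)) \<partial>m2)\<bar> \<le> e" if "0 < e" for e
  proof -
    let ?C = "measure m1 (space m1)"
    define d where "d = e / (2 * (?C + 1))"
    have d: "0 < d" "2 * (d * ?C) \<le> e"
    proof -
      have C0: "0 < 2 * (?C + 1)" by (intro mult_pos_pos add_nonneg_pos measure_nonneg) simp_all
      show "0 < d" unfolding d_def by (rule divide_pos_pos[OF that C0])
      then have "2 * (d * ?C) \<le> d * (2 * (?C + 1))" by (simp add: algebra_simps)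
      also have "\<dots> = e" using C0 unfolding d_def by (metis less_irrefl nonzero_eq_divide_eq)
      finally show "2 * (d * ?C) \<le> e" .
    qed
    obtain p where p: "real_polynomial_function p" "\<And>x. x \<in> {0..1} \<Longrightarrow> \<bar>q x - p x\<bar> < d"
      using Stone_Weierstrass_real_polynomial_function[OF compact_Icc q d(1)] by blast
    have pc: "continuous_on A p" for A
      using p(1) by (simp add: continuous_on_polymonial_function real_polynomial_function_eq)
    then have [measurable]: "p \<in> borel_measurable borel" by (rule borel_measurable_continuous_onI)
    have bd: "\<bar>(\<integral>x. q (exp (- x)) \<partial>m) - (\<integral>x. p (exp (- x)) \<partial>m)\<bar> \<le> d * measure m (space m)"
      if "finite_measure m" and [measurable_cong]: "sets m = sets borel" and pm: "AE x in m. 0 \<le> x" for m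
    proof -
      interpret finite_measure m by fact
      note i = int[OF that q] int[OF that pc]
      have diff: "(\<integral>x. q (exp (- x)) \<partial>m) - (\<integral>x. p (exp (- x)) \<partial>m) = (\<integral>x. q (exp (- x)) - p (exp (- x)) \<partial>m)"
        using i by simp
      have "(\<integral>x. \<bar>q (exp (- x)) - p (exp (- x))\<bar> \<partial>m) \<le> (\<integral>x. d \<partial>m)"
        using i pm p(2) by (intro integral_mono_AE) (auto elim!: eventually_mono intro: less_imp_le)
      from order_trans[OF integral_abs_bound this] show ?thesis
        unfolding diff by (simp add: mult.commute)
    qed
    show ?thesis
      using bd[OF fin(1) sm(1) pos(1)] bd[OF fin(2) sm(2) pos(2)] poly[OF p(1)] d(2) mass by simp
  qed
  then have "\<bar>(\<integral>x. q (exp (- x)) \<partial>m1) - (\<integral>x. q (exp (- x)) \<partial>m2)\<bar> \<le> 0"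
    by (rule field_le_epsilon) simp
  then show ?thesis by simp
qed

text \<open>A measure on [0,\<infinity>) is determined by its values on half-lines, and their
  indicators are limits of continuous functions of exp(-x).\<close>

lemma laplace_unique_real:
  fixes m1 m2 :: "real measure"
  assumes fin: "finite_measure m1" "finite_measure m2"
    and sm [measurable_cong]: "sets m1 = sets borel" "sets m2 = sets borel"
    and pos: "AE x in m1. 0 \<le> x" "AE x in m2. 0 \<le> x"
    and eq: "\<And>n::nat. (\<integral>\<^sup>+x. ennreal (exp (- (real n * x))) \<partial>m1) = (\<integral>\<^sup>+x. ennreal (exp (- (real n * x))) \<partial>m2)"
  shows "m1 = m2"
proof (rule measure_eqI_lessThan)
  fix a :: real
  show "emeasure m1 {a<..} < \<infinity>" using finite_measure.emeasure_finite[OF fin(1)] by (simp add: less_top)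
  \<comment> \<open>Ramps of slope n that increase to the indicator of y < exp(-a), that is of x > a
    for y = exp(-x).\<close>
  define q where "q n y = min 1 (real n * max 0 (exp (- a) - y))" for n and y :: real
  have qc: "continuous_on A (q n)" for A n unfolding q_def by (intro continuous_intros)
  have qm [measurable]: "q n \<in> borel_measurable borel" for n unfolding q_def by measurable
  have lim: "(\<lambda>n. \<integral>x. q n (exp (- x)) \<partial>m) \<longlonglongrightarrow> measure m {a<..}"
    if "finite_measure m" and sm [measurable_cong]: "sets m = sets borel" for m
  proof -
    interpret finite_measure m by fact
    have "(\<lambda>n. \<integral>x. q n (exp (- x)) \<partial>m) \<longlonglongrightarrow> (\<integral>x. indicator {a<..} x \<partial>m)"
    proof (rule integral_dominated_convergence[where w="\<lambda>_. 1"])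
      show "AE x in m. (\<lambda>n. q n (exp (- x))) \<longlonglongrightarrow> indicator {a<..} x"
      proof (rule AE_I2)
        fix x
        show "(\<lambda>n. q n (exp (- x))) \<longlonglongrightarrow> indicator {a<..} x"
        proof (cases "a < x")
          case True
          then have c: "0 < exp (- a) - exp (- x)" by simp
          obtain N where N: "1 / (exp (- a) - exp (- x)) < real N" using reals_Archimedean2 by blast
          have "q n (exp (- x)) = 1" if "N \<le> n" for n
          proof -
            have "1 < real N * (exp (- a) - exp (- x))" using N c by (simp add: field_simps)
            also have "\<dots> \<le> real n * (exp (- a) - exp (- x))" using that c by (intro mult_right_mono) auto
            finally show ?thesis using c by (simp add: q_def)
          qed
          then have "eventually (\<lambda>n. q n (exp (- x)) = 1) sequentially"
            unfolding eventually_sequentially by blast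
          then show ?thesis using True by (simp add: tendsto_eventually)
        qed (simp add: q_def)
      qed
      show "AE x in m. norm (q n (exp (- x))) \<le> 1" for n by (simp add: q_def)
    qed (auto simp: sm)
    also have "(\<integral>x. indicator {a<..} x \<partial>m) = measure m {a<..}"
      using sets_eq_imp_space_eq[OF sm] by simp
    finally show ?thesis .
  qed
  have "(\<integral>x. q n (exp (- x)) \<partial>m1) = (\<integral>x. q n (exp (- x)) \<partial>m2)" for n
    by (rule integral_poly_exp_eq[OF fin sm pos eq qc qm])
  then have "measure m1 {a<..} = measure m2 {a<..}"
    using lim[OF fin(1) sm(1)] lim[OF fin(2) sm(2)] by (auto intro: LIMSEQ_unique)
  then show "emeasure m1 {a<..} = emeasure m2 {a<..}"
    using fin by (simp add: finite_measure.emeasure_eq_measure)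
qed (rule sm)+

text \<open>The one-dimensional result is applied to one coordinate at a time: the exponential weight of a
  coordinate is exchanged for the indicator of a Borel set.\<close>

lemma laplace_unique_indicators:
  fixes X1 :: "'i \<Rightarrow> 'a \<Rightarrow> real" and X2 :: "'i \<Rightarrow> 'b \<Rightarrow> real"
  assumes fin: "finite_measure M1" "finite_measure M2"
    and X [measurable]: "\<And>i. i \<in> I \<Longrightarrow> X1 i \<in> borel_measurable M1" "\<And>i. i \<in> I \<Longrightarrow> X2 i \<in> borel_measurable M2"
    and pos: "\<And>i. i \<in> I \<Longrightarrow> AE \<omega> in M1. 0 \<le> X1 i \<omega>" "\<And>i. i \<in> I \<Longrightarrow> AE \<omega> in M2. 0 \<le> X2 i \<omega>"
    and eq: "\<And>J (u :: 'i \<Rightarrow> nat). finite J \<Longrightarrow> J \<subseteq> I \<Longrightarrow>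
      (\<integral>\<^sup>+\<omega>. ennreal (exp (- (\<Sum>j\<in>J. real (u j) * X1 j \<omega>))) \<partial>M1) = (\<integral>\<^sup>+\<omega>. ennreal (exp (- (\<Sum>j\<in>J. real (u j) * X2 j \<omega>))) \<partial>M2)"
    and K: "finite K" "K \<subseteq> I" and A: "\<And>k. k \<in> K \<Longrightarrow> A k \<in> sets borel" and J: "finite J" "J \<subseteq> I"
  shows "(\<integral>\<^sup>+\<omega>. (\<Prod>k\<in>K. indicator (A k) (X1 k \<omega>)) * ennreal (exp (- (\<Sum>j\<in>J. real (u j) * X1 j \<omega>))) \<partial>M1)
    = (\<integral>\<^sup>+\<omega>. (\<Prod>k\<in>K. indicator (A k) (X2 k \<omega>)) * ennreal (exp (- (\<Sum>j\<in>J. real (u j) * X2 j \<omega>))) \<partial>M2)"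
  using K A J
proof (induction K arbitrary: J u rule: finite_induct)
  case empty
  then show ?case using eq by simp
next
  case (insert k K)
  have k: "k \<in> I" and KI: "K \<subseteq> I" and Ak [measurable]: "A k \<in> sets borel" using insert.prems by auto
  let ?W1 = "\<lambda>\<omega>. (\<Prod>k\<in>K. indicator (A k) (X1 k \<omega>)) * ennreal (exp (- (\<Sum>j\<in>J. real (u j) * X1 j \<omega>)))"
  let ?W2 = "\<lambda>\<omega>. (\<Prod>k\<in>K. indicator (A k) (X2 k \<omega>)) * ennreal (exp (- (\<Sum>j\<in>J. real (u j) * X2 j \<omega>)))"
  have W: "(\<lambda>\<omega>. (\<Prod>k\<in>K. indicator (A k) (X k \<omega>)) * ennreal (exp (- (\<Sum>j\<in>J. real (u j) * X j \<omega>)))) \<in> borel_measurable m"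
    if X: "\<And>i. i \<in> I \<Longrightarrow> X i \<in> borel_measurable m" for m :: "'c measure" and X :: "'i \<Rightarrow> 'c \<Rightarrow> real"
  proof (intro borel_measurable_times_ennreal borel_measurable_prod_ennreal)
    fix k assume "k \<in> K"
    then have [measurable]: "X k \<in> borel_measurable m" "A k \<in> sets borel" using X KI insert.prems by auto
    show "(\<lambda>\<omega>. indicator (A k) (X k \<omega>) :: ennreal) \<in> borel_measurable m" by measurable
  next
    have "(\<lambda>\<omega>. \<Sum>j\<in>J. real (u j) * X j \<omega>) \<in> borel_measurable m"
      using insert.prems X by (intro borel_measurable_sum borel_measurable_times) auto
    then show "(\<lambda>\<omega>. ennreal (exp (- (\<Sum>j\<in>J. real (u j) * X j \<omega>)))) \<in> borel_measurable m" by measurable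
  qed
  have [measurable]: "?W1 \<in> borel_measurable M1" "?W2 \<in> borel_measurable M2"
    by (rule W[OF X(1)], assumption) (rule W[OF X(2)], assumption)
  note [measurable] = X(1)[OF k] X(2)[OF k]
  let ?m1 = "distr (density M1 ?W1) borel (X1 k)" and ?m2 = "distr (density M2 ?W2) borel (X2 k)"
  \<comment> \<open>Multiplication by exp(-n x k) keeps the form of the weight: k joins the
    exponent, or n is added to its coefficient if k is already in J.\<close>
  have step: "(\<Prod>k\<in>K. indicator (A k) (x k)) * ennreal (exp (- (\<Sum>j\<in>J. real (u j) * x j))) * ennreal (exp (- (real n * x k)))
      = (\<Prod>k\<in>K. indicator (A k) (x k)) * ennreal (exp (- (\<Sum>j\<in>insert k J. real ((if j \<in> J then u j else 0) + (if j = k then n else 0)) * x j)))"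
    for x :: "'i \<Rightarrow> real" and n
  proof -
    have "(\<Sum>j\<in>insert k J. real ((if j \<in> J then u j else 0) + (if j = k then n else 0)) * x j)
      = (\<Sum>j\<in>insert k J. (if j \<in> J then real (u j) * x j else 0)) + (\<Sum>j\<in>insert k J. (if j = k then real n * x k else 0))"
      unfolding sum.distrib[symmetric] by (intro sum.cong) (auto simp: distrib_right)
    also have "(\<Sum>j\<in>insert k J. (if j \<in> J then real (u j) * x j else 0)) = (\<Sum>j\<in>J. real (u j) * x j)"
      using insert.prems by (intro sum.mono_neutral_cong_right) auto
    also have "(\<Sum>j\<in>insert k J. (if j = k then real n * x k else 0)) = real n * x k"
      using insert.prems by simp
    finally show ?thesis
      by (simp add: exp_add exp_diff exp_minus ennreal_mult'[symmetric] mult.assoc field_simps flip: exp_add)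
  qed
  have L1: "(\<integral>\<^sup>+x. ennreal (exp (- (real n * x))) \<partial>?m1) = (\<integral>\<^sup>+\<omega>. ?W1 \<omega> * ennreal (exp (- (real n * X1 k \<omega>))) \<partial>M1)" for n
    by (simp add: nn_integral_distr nn_integral_density)
  have L2: "(\<integral>\<^sup>+x. ennreal (exp (- (real n * x))) \<partial>?m2) = (\<integral>\<^sup>+\<omega>. ?W2 \<omega> * ennreal (exp (- (real n * X2 k \<omega>))) \<partial>M2)" for n
    by (simp add: nn_integral_distr nn_integral_density)
  have eqm: "(\<integral>\<^sup>+x. ennreal (exp (- (real n * x))) \<partial>?m1) = (\<integral>\<^sup>+x. ennreal (exp (- (real n * x))) \<partial>?m2)" for n
    unfolding L1 L2 step[of "\<lambda>j. X1 j \<omega>" for \<omega>] step[of "\<lambda>j. X2 j \<omega>" for \<omega>]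
    using insert.prems KI by (intro insert.IH) auto
  have ind_le: "(\<Prod>k\<in>K. indicator (A k) (f k)) \<le> (1::ennreal)" for f
    by (intro prod_le_1) (auto simp: indicator_def)
  have fin1: "finite_measure ?m1"
  proof
    have "emeasure ?m1 (space ?m1) = (\<integral>\<^sup>+\<omega>. ?W1 \<omega> \<partial>M1)"
      by (simp add: emeasure_distr emeasure_density cong: nn_integral_cong)
    also have "\<dots> \<le> (\<integral>\<^sup>+\<omega>. ennreal (exp (- (\<Sum>j\<in>J. real (u j) * X1 j \<omega>))) \<partial>M1)"
      using mult_right_mono[OF ind_le] by (intro nn_integral_mono) fastforce
    also have "\<dots> \<le> (\<integral>\<^sup>+\<omega>. 1 \<partial>M1)"
    proof (rule nn_integral_mono_AE)
      have "AE \<omega> in M1. \<forall>j\<in>J. 0 \<le> X1 j \<omega>"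
        using insert.prems pos(1) by (auto simp: AE_finite_all)
      then show "AE \<omega> in M1. ennreal (exp (- (\<Sum>j\<in>J. real (u j) * X1 j \<omega>))) \<le> 1"
        by eventually_elim (auto intro!: sum_nonneg simp: ennreal_le_1)
    qed
    also have "\<dots> < \<infinity>" using finite_measure.emeasure_finite[OF fin(1)] by (simp add: less_top)
    finally show "emeasure ?m1 (space ?m1) \<noteq> \<infinity>" by simp
  qed
  \<comment> \<open>The total mass is the transform at n = 0, so finiteness carries over from
    \<open>?m1\<close>.\<close>
  have fin2: "finite_measure ?m2"
  proof
    have "emeasure ?m2 (space ?m2) = emeasure ?m1 (space ?m1)" using eqm[of 0] by simp
    then show "emeasure ?m2 (space ?m2) \<noteq> \<infinity>" using finite_measure.emeasure_finite[OF fin1, of "space ?m1"] by simp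
  qed
  have p1: "AE x in ?m1. 0 \<le> x" using pos(1)[OF k]
    by (subst AE_distr_iff) (auto simp: AE_density elim!: eventually_mono)
  have p2: "AE x in ?m2. 0 \<le> x" using pos(2)[OF k]
    by (subst AE_distr_iff) (auto simp: AE_density elim!: eventually_mono)
  have "?m1 = ?m2"
    by (rule laplace_unique_real[OF fin1 fin2 _ _ p1 p2 eqm]) auto
  then have "emeasure ?m1 (A k) = emeasure ?m2 (A k)" by simp
  moreover have "emeasure ?m1 (A k) = (\<integral>\<^sup>+\<omega>. ?W1 \<omega> * indicator (A k) (X1 k \<omega>) \<partial>M1)"
    by (subst emeasure_distr; (simp add: emeasure_density)?) (auto simp: indicator_def intro!: nn_integral_cong)
  moreover have "emeasure ?m2 (A k) = (\<integral>\<^sup>+\<omega>. ?W2 \<omega> * indicator (A k) (X2 k \<omega>) \<partial>M2)"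
    by (subst emeasure_distr; (simp add: emeasure_density)?) (auto simp: indicator_def intro!: nn_integral_cong)
  ultimately show ?case using insert.hyps by (simp add: ac_simps)
qed

text \<open>Cylinder sets over finitely many coordinates determine a finite measure on the product.
  On these the claim is \<open>laplace_unique_indicators\<close> with every exponential weight
  already exchanged.\<close>

theorem laplace_unique:
  fixes X1 :: "'i \<Rightarrow> 'a \<Rightarrow> real" and X2 :: "'i \<Rightarrow> 'b \<Rightarrow> real"
  assumes fin: "finite_measure M1" "finite_measure M2"
    and X [measurable]: "\<And>i. i \<in> I \<Longrightarrow> X1 i \<in> borel_measurable M1" "\<And>i. i \<in> I \<Longrightarrow> X2 i \<in> borel_measurable M2"
    and pos: "\<And>i. i \<in> I \<Longrightarrow> AE \<omega> in M1. 0 \<le> X1 i \<omega>" "\<And>i. i \<in> I \<Longrightarrow> AE \<omega> in M2. 0 \<le> X2 i \<omega>"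
    and eq: "\<And>J (u :: 'i \<Rightarrow> nat). finite J \<Longrightarrow> J \<subseteq> I \<Longrightarrow>
      (\<integral>\<^sup>+\<omega>. ennreal (exp (- (\<Sum>j\<in>J. real (u j) * X1 j \<omega>))) \<partial>M1) = (\<integral>\<^sup>+\<omega>. ennreal (exp (- (\<Sum>j\<in>J. real (u j) * X2 j \<omega>))) \<partial>M2)"
  shows "distr M1 (\<Pi>\<^sub>M i\<in>I. borel) (\<lambda>\<omega>. \<lambda>i\<in>I. X1 i \<omega>) = distr M2 (\<Pi>\<^sub>M i\<in>I. borel) (\<lambda>\<omega>. \<lambda>i\<in>I. X2 i \<omega>)"
proof (rule measure_eqI_PiM_infinite)
  have m1 [measurable]: "(\<lambda>\<omega>. \<lambda>i\<in>I. X1 i \<omega>) \<in> measurable M1 (\<Pi>\<^sub>M i\<in>I. borel)" by (rule measurable_restrict) (rule X)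
  have m2 [measurable]: "(\<lambda>\<omega>. \<lambda>i\<in>I. X2 i \<omega>) \<in> measurable M2 (\<Pi>\<^sub>M i\<in>I. borel)" by (rule measurable_restrict) (rule X)
  show "finite_measure (distr M1 (\<Pi>\<^sub>M i\<in>I. borel) (\<lambda>\<omega>. \<lambda>i\<in>I. X1 i \<omega>))"
    by (rule finite_measure.finite_measure_distr[OF fin(1) m1])
  fix A :: "'i \<Rightarrow> real set" and J assume J: "finite J" "J \<subseteq> I" "\<And>i. i \<in> J \<Longrightarrow> A i \<in> sets borel"
  have *: "emeasure (distr m (\<Pi>\<^sub>M i\<in>I. borel) (\<lambda>\<omega>. \<lambda>i\<in>I. X i \<omega>)) (prod_emb I (\<lambda>_. borel) J (Pi\<^sub>E J A))
      = (\<integral>\<^sup>+\<omega>. (\<Prod>k\<in>J. indicator (A k) (X k \<omega>)) \<partial>m)"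
    if [measurable]: "(\<lambda>\<omega>. \<lambda>i\<in>I. X i \<omega>) \<in> measurable m (\<Pi>\<^sub>M i\<in>I. borel)" for m :: "'c measure" and X
  proof -
    have S: "prod_emb I (\<lambda>_. borel) J (Pi\<^sub>E J A) \<in> sets (\<Pi>\<^sub>M i\<in>I. borel :: real measure)"
      using J by (intro sets_PiM_I) auto
    have "emeasure (distr m (\<Pi>\<^sub>M i\<in>I. borel) (\<lambda>\<omega>. \<lambda>i\<in>I. X i \<omega>)) (prod_emb I (\<lambda>_. borel) J (Pi\<^sub>E J A))
      = (\<integral>\<^sup>+\<omega>. indicator (prod_emb I (\<lambda>_. borel) J (Pi\<^sub>E J A)) (\<lambda>i\<in>I. X i \<omega>) \<partial>m)"
      by (subst nn_integral_indicator[symmetric], use S in simp, subst nn_integral_distr) (use S in auto)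
    also have "\<dots> = (\<integral>\<^sup>+\<omega>. (\<Prod>k\<in>J. indicator (A k) (X k \<omega>)) \<partial>m)"
    proof (intro nn_integral_cong)
      fix \<omega>
      have "(\<lambda>i\<in>I. X i \<omega>) \<in> prod_emb I (\<lambda>_. borel) J (Pi\<^sub>E J A) \<longleftrightarrow> (\<forall>k\<in>J. X k \<omega> \<in> A k)"
        using J(2) by (auto simp: prod_emb_def PiE_iff restrict_def extensional_def)
      moreover have "(\<Prod>k\<in>J. indicator (A k) (X k \<omega>)) = (if \<forall>k\<in>J. X k \<omega> \<in> A k then 1 else 0 :: ennreal)"
        using J(1) by (auto simp: indicator_def prod_zero_iff)
      ultimately show "indicator (prod_emb I (\<lambda>_. borel) J (Pi\<^sub>E J A)) (\<lambda>i\<in>I. X i \<omega>) = (\<Prod>k\<in>J. indicator (A k) (X k \<omega>) :: ennreal)"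
        by (simp add: indicator_def)
    qed
    finally show ?thesis .
  qed
  show "emeasure (distr M1 (\<Pi>\<^sub>M i\<in>I. borel) (\<lambda>\<omega>. \<lambda>i\<in>I. X1 i \<omega>)) (prod_emb I (\<lambda>_. borel) J (Pi\<^sub>E J A))
    = emeasure (distr M2 (\<Pi>\<^sub>M i\<in>I. borel) (\<lambda>\<omega>. \<lambda>i\<in>I. X2 i \<omega>)) (prod_emb I (\<lambda>_. borel) J (Pi\<^sub>E J A))"
    unfolding *[OF m1] *[OF m2]
    using laplace_unique_indicators[OF fin X pos eq J, where J="{}"] by simp
qed simp_all

section \<open>Exponential moments of multiplicative jump functionals\<close>

text \<open>The generating function of the Poisson weights a^k / k!, up to the constant c.\<close>

lemma nn_integral_exp_series:
  assumes "0 \<le> a" and "0 \<le> z" "0 \<le> c"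
  shows "(\<integral>\<^sup>+k. ennreal (c * (a ^ k / fact k)) * ennreal (z ^ k) \<partial>count_space UNIV) = ennreal (c * exp (a * z))"
proof -
  have s: "(\<lambda>k. c * ((a * z) ^ k / fact k)) sums (c * exp (a * z))"
    using exp_converges[of "a * z"] by (intro sums_mult) (simp add: scaleR_conv_of_real divide_inverse mult.commute)
  have "(\<integral>\<^sup>+k. ennreal (c * (a ^ k / fact k)) * ennreal (z ^ k) \<partial>count_space UNIV) = (\<Sum>k. ennreal (c * ((a * z) ^ k / fact k)))"
    unfolding nn_integral_count_space_nat using assms
    by (intro suminf_cong) (simp add: ennreal_mult[symmetric] power_mult_distrib)
  also have "\<dots> = ennreal (\<Sum>k. c * ((a * z) ^ k / fact k))"
    using assms s by (intro suminf_ennreal2) (auto simp: sums_iff)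
  finally show ?thesis using s by (simp add: sums_iff)
qed

context driftless_subordinator
begin

text \<open>The hypothesis is the Laplace transform of a Poisson law under the weight \<open>W\<close>; uniqueness
  identifies the law of \<open>N\<close> under \<open>W\<close>, and hence also gives its exponential moments.\<close>

lemma exponential_moment_extend:
  fixes N :: "'a \<Rightarrow> ennreal" and W :: "'a \<Rightarrow> real"
  assumes [measurable]: "N \<in> borel_measurable M" "W \<in> borel_measurable M"
    and W: "\<And>\<omega>. 0 \<le> W \<omega>" "\<And>\<omega>. W \<omega> \<le> 1" and a: "0 \<le> a"
    and eq: "\<And>n::nat. (\<integral>\<omega>. exp (- (real n * enn2real (N \<omega>))) * W \<omega> \<partial>M) = exp (exp (- real n) * a - b)"
  shows "(\<integral>\<^sup>+\<omega>. ennreal (exp (l * enn2real (N \<omega>)) * W \<omega>) \<partial>M) = ennreal (exp (exp l * a - b))"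
proof -
  let ?m1 = "distr (density M (\<lambda>\<omega>. ennreal (W \<omega>))) borel (\<lambda>\<omega>. enn2real (N \<omega>))"
  \<comment> \<open>The Poisson law with parameter a, rescaled to total mass exp(a - b). Its
    exponential moments are explicit for every real exponent.\<close>
  let ?m2 = "distr (density (count_space UNIV) (\<lambda>k. ennreal (exp (- b) * (a ^ k / fact k)))) borel real"
  have L1: "(\<integral>\<^sup>+x. ennreal (exp (c * x)) \<partial>?m1) = (\<integral>\<^sup>+\<omega>. ennreal (exp (c * enn2real (N \<omega>)) * W \<omega>) \<partial>M)" for c
    using W by (simp add: nn_integral_distr nn_integral_density ennreal_mult mult.commute)
  have L2: "(\<integral>\<^sup>+x. ennreal (exp (c * x)) \<partial>?m2) = ennreal (exp (exp c * a - b))" for c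
  proof -
    have "(\<integral>\<^sup>+x. ennreal (exp (c * x)) \<partial>?m2)
      = (\<integral>\<^sup>+k. ennreal (exp (- b) * (a ^ k / fact k)) * ennreal (exp c ^ k) \<partial>count_space UNIV)"
      by (simp add: nn_integral_distr nn_integral_density exp_of_nat_mult[symmetric] mult.commute)
    also have "\<dots> = ennreal (exp (- b) * exp (a * exp c))"
      using a by (intro nn_integral_exp_series) auto
    finally show ?thesis by (simp add: exp_add[symmetric] mult.commute exp_diff exp_minus divide_inverse)
  qed
  have eqn: "(\<integral>\<^sup>+x. ennreal (exp (- (real n * x))) \<partial>?m1) = (\<integral>\<^sup>+x. ennreal (exp (- (real n * x))) \<partial>?m2)" for n :: nat
  proof -
    have "integrable M (\<lambda>\<omega>. exp (- (real n * enn2real (N \<omega>))) * W \<omega>)"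
      using W by (intro integrable_const_bound[where B=1]) (auto simp: abs_mult intro!: mult_le_one)
    then have "(\<integral>\<^sup>+\<omega>. ennreal (exp (- real n * enn2real (N \<omega>)) * W \<omega>) \<partial>M) = ennreal (exp (exp (- real n) * a - b))"
      using W eq[of n] by (subst nn_integral_eq_integral) auto
    then show ?thesis using L1[of "- real n"] L2[of "- real n"] by simp
  qed
  have fin2: "finite_measure ?m2"
  proof
    have "emeasure ?m2 (space ?m2) = (\<integral>\<^sup>+x. ennreal (exp (0 * x)) \<partial>?m2)" by simp
    then show "emeasure ?m2 (space ?m2) \<noteq> \<infinity>" unfolding L2 by simp
  qed
  have fin1: "finite_measure ?m1"
  proof
    have "emeasure ?m1 (space ?m1) = (\<integral>\<^sup>+x. ennreal (exp (- (real 0 * x))) \<partial>?m1)" by simp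
    also have "\<dots> = (\<integral>\<^sup>+x. ennreal (exp (0 * x)) \<partial>?m2)" unfolding eqn by simp
    finally show "emeasure ?m1 (space ?m1) \<noteq> \<infinity>" unfolding L2 by simp
  qed
  have "?m1 = ?m2"
    by (rule laplace_unique_real[OF fin1 fin2 _ _ _ _ eqn])
      (auto simp: AE_distr_iff AE_density)
  then show ?thesis using L1[of l] L2[of l] by simp
qed

text \<open>The two parts of the logarithm are kept apart, because the sum of the logarithms over
  all jumps may take the form \<infinity> - \<infinity>.\<close>

definition log_plus :: "(real \<times> real \<Rightarrow> real) \<Rightarrow> real \<times> real \<Rightarrow> real" where
  "log_plus f z = max 0 (ln (f z))"

definition log_minus :: "(real \<times> real \<Rightarrow> real) \<Rightarrow> real \<times> real \<Rightarrow> real" where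
  "log_minus f z = max 0 (- ln (f z))"

lemma measurable_log_plus [measurable (raw)]:
  assumes [measurable]: "f \<in> borel_measurable borel" shows "log_plus f \<in> borel_measurable borel"
  unfolding log_plus_def[abs_def] by measurable

lemma measurable_log_minus [measurable (raw)]:
  assumes [measurable]: "f \<in> borel_measurable borel" shows "log_minus f \<in> borel_measurable borel"
  unfolding log_minus_def[abs_def] by measurable

lemma log_nonneg [simp]: "0 \<le> log_plus f z" "0 \<le> log_minus f z"
  by (simp_all add: log_plus_def log_minus_def)

definition J :: "real \<Rightarrow> (real \<times> real \<Rightarrow> real) \<Rightarrow> 'a \<Rightarrow> ennreal" where
  "J T f \<omega> = (\<integral>\<^sup>+z. ennreal (f z) \<partial>jump_measure (path \<omega>) T)"

lemma measurable_J:
  assumes [measurable]: "f \<in> borel_measurable borel"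
  shows "J T f \<in> borel_measurable (natural_filtration M \<xi> T)"
  unfolding J_def by (rule measurable_jump_functional) measurable

lemma measurable_J_M [measurable (raw)]:
  "f \<in> borel_measurable borel \<Longrightarrow> J T f \<in> borel_measurable M"
  by (rule measurable_from_subalg[OF subalgebra_natural_filtration measurable_J])

lemma AE_J_finite:
  assumes [measurable]: "f \<in> borel_measurable borel" and "(\<integral>\<^sup>+z. ennreal (f z) \<partial>intensity T) < \<infinity>"
  shows "AE \<omega> in M. J T f \<omega> < \<infinity>"
proof -
  have "(\<integral>\<^sup>+\<omega>. J T f \<omega> \<partial>M) = (\<integral>\<^sup>+z. ennreal (f z) \<partial>intensity T)"
    unfolding J_def by (rule jump_mean) measurable
  then have "AE \<omega> in M. J T f \<omega> \<noteq> \<infinity>"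
    using assms(2) by (intro nn_integral_PInf_AE) auto
  then show ?thesis by (auto elim!: eventually_mono simp: less_top)
qed

lemma J_mono: "(\<And>z. f z \<le> g z) \<Longrightarrow> J T f \<omega> \<le> J T g \<omega>"
  unfolding J_def by (intro nn_integral_mono ennreal_leI)

lemma J_add:
  assumes [measurable]: "f \<in> borel_measurable borel" "g \<in> borel_measurable borel" and "\<And>z. 0 \<le> f z" "\<And>z. 0 \<le> g z"
  shows "J T (\<lambda>z. f z + g z) \<omega> = J T f \<omega> + J T g \<omega>"
  unfolding J_def using assms(3,4) by (simp add: nn_integral_add)

lemma J_cmult:
  assumes [measurable]: "f \<in> borel_measurable borel" and "\<And>z. 0 \<le> f z" "0 \<le> c"
  shows "J T (\<lambda>z. c * f z) \<omega> = ennreal c * J T f \<omega>"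
  unfolding J_def using assms(2,3) by (simp add: nn_integral_cmult ennreal_mult)

text \<open>ln^+ f is at most |f - 1|, and ln^- f at most 2 |f - 1| where f \<ge> 1/2. The jumps
  with f < 1/2 each contribute at least 1/2 to a finite sum, so they are finite in number. This is a
  pathwise argument: ln^- f need not be integrable for the intensity.\<close>

lemma J_log_finite:
  assumes f [measurable]: "f \<in> borel_measurable borel" and fpos: "\<And>z. 0 < f z"
    and fin: "J T (\<lambda>z. \<bar>f z - 1\<bar>) \<omega> < \<infinity>"
  shows "J T (log_plus f) \<omega> < \<infinity>" "J T (log_minus f) \<omega> < \<infinity>"
proof -
  have "log_plus f z \<le> \<bar>f z - 1\<bar>" for z
    using ln_le_minus_one[OF fpos[of z]] by (auto simp: log_plus_def)
  then have "J T (log_plus f) \<omega> \<le> J T (\<lambda>z. \<bar>f z - 1\<bar>) \<omega>" by (rule J_mono)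
  then show "J T (log_plus f) \<omega> < \<infinity>" using fin by (rule le_less_trans)
  \<comment> \<open>The part of ln^- f that |f - 1| does not control; it is summed over finitely
    many jumps only.\<close>
  define g where "g z = (if f z < 1/2 then log_minus f z else 0)" for z
  have gm [measurable]: "g \<in> borel_measurable borel" unfolding g_def by measurable
  have le: "log_minus f z \<le> 2 * \<bar>f z - 1\<bar> + g z" for z
  proof (cases "f z < 1/2")
    case False
    have "- ln (f z) = ln (1 / f z)" using fpos[of z] by (simp add: ln_div)
    also have "\<dots> \<le> 1 / f z - 1" using fpos[of z] by (intro ln_le_minus_one) auto
    also have "\<dots> = (1 - f z) / f z" using fpos[of z] by (simp add: field_simps)
    also have "\<dots> \<le> 2 * \<bar>f z - 1\<bar>"
    proof -
      have "1 - f z \<le> \<bar>f z - 1\<bar> * (2 * f z)"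
        using False mult_left_mono[of 1 "2 * f z" "\<bar>f z - 1\<bar>"] by auto
      then show ?thesis using fpos[of z] by (simp add: field_simps)
    qed
    finally show ?thesis by (auto simp: log_minus_def g_def)
  qed (auto simp: g_def)
  let ?w = "path \<omega>"
  let ?B = "{s\<in>jump_times ?w T. f (s, jump ?w s) < 1/2}"
  have finB: "finite ?B"
  proof -
    have "ennreal (1/2) * emeasure (count_space (jump_times ?w T)) ?B
      = (\<integral>\<^sup>+s. ennreal (1/2) * indicator ?B s \<partial>count_space (jump_times ?w T))"
      by (rule nn_integral_cmult_indicator[symmetric]) auto
    also have "\<dots> \<le> (\<integral>\<^sup>+s. ennreal \<bar>f (s, jump ?w s) - 1\<bar> \<partial>count_space (jump_times ?w T))"
    proof (intro nn_integral_mono)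
      fix s
      show "ennreal (1/2) * indicator ?B s \<le> ennreal \<bar>f (s, jump ?w s) - 1\<bar>"
      proof (cases "s \<in> ?B")
        case True
        then have "1/2 \<le> \<bar>f (s, jump ?w s) - 1\<bar>" by auto
        from ennreal_leI[OF this] True show ?thesis by (simp only: indicator_simps mult_1_right)
      qed simp
    qed
    also have "\<dots> = J T (\<lambda>z. \<bar>f z - 1\<bar>) \<omega>"
      unfolding J_def by (rule nn_integral_jump_measure[symmetric]) measurable
    finally have "ennreal (1/2) * emeasure (count_space (jump_times ?w T)) ?B < \<infinity>"
      using fin by (rule le_less_trans)
    then have "emeasure (count_space (jump_times ?w T)) ?B < \<infinity>"
      by (auto simp: ennreal_mult_less_top)
    then show ?thesis by (auto simp: emeasure_count_space split: if_splits)
  qed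
  have "J T g \<omega> = (\<integral>\<^sup>+s. ennreal (g (s, jump ?w s)) \<partial>count_space (jump_times ?w T))"
    unfolding J_def by (rule nn_integral_jump_measure) measurable
  also have "\<dots> = (\<Sum>s\<in>?B. ennreal (g (s, jump ?w s)))"
    using finB by (intro nn_integral_count_space') (auto simp: g_def)
  also have "\<dots> < \<infinity>" by (subst sum_ennreal) (auto simp: g_def)
  finally have "J T g \<omega> < \<infinity>" .
  moreover have "J T (log_minus f) \<omega> \<le> ennreal 2 * J T (\<lambda>z. \<bar>f z - 1\<bar>) \<omega> + J T g \<omega>"
  proof -
    have "J T (log_minus f) \<omega> \<le> J T (\<lambda>z. 2 * \<bar>f z - 1\<bar> + g z) \<omega>" using le by (rule J_mono)
    also have "\<dots> = J T (\<lambda>z. 2 * \<bar>f z - 1\<bar>) \<omega> + J T g \<omega>" by (rule J_add) (auto simp: g_def)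
    also have "J T (\<lambda>z. 2 * \<bar>f z - 1\<bar>) \<omega> = ennreal 2 * J T (\<lambda>z. \<bar>f z - 1\<bar>) \<omega>" by (rule J_cmult) auto
    finally show ?thesis .
  qed
  ultimately show "J T (log_minus f) \<omega> < \<infinity>"
    using fin by (auto simp: ennreal_mult_less_top less_top[symmetric] top_unique ennreal_mult_eq_top_iff)
qed

text \<open>The product of f over the jumps, with value 0 if only the negative part of the logarithm
  diverges. If the positive part diverges, \<open>enn2real\<close> replaces it by 0; that happens on
  a null set when f - 1 is integrable.\<close>

definition jump_prod :: "real \<Rightarrow> (real \<times> real \<Rightarrow> real) \<Rightarrow> 'a \<Rightarrow> real" where
  "jump_prod T f \<omega> = exp (enn2real (J T (log_plus f) \<omega>)) * nexp (J T (log_minus f) \<omega>)"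

lemma measurable_jump_prod:
  assumes [measurable]: "f \<in> borel_measurable borel"
  shows "jump_prod T f \<in> borel_measurable (natural_filtration M \<xi> T)"
  unfolding jump_prod_def
  by (intro borel_measurable_times borel_measurable_exp measurable_compose[OF measurable_J] borel_measurable_enn2real measurable_nexp) measurable

lemma measurable_jump_prod_M [measurable (raw)]:
  "f \<in> borel_measurable borel \<Longrightarrow> jump_prod T f \<in> borel_measurable M"
  by (rule measurable_from_subalg[OF subalgebra_natural_filtration measurable_jump_prod])

lemma jump_prod_nonneg: "0 \<le> jump_prod T f \<omega>"
  by (simp add: jump_prod_def)

text \<open>With ln f = ln C on A minus a non-negative h, the product is C^N W, where N counts the
  jumps in A and W = exp(- sum of h) is at most 1. The Laplace formula gives the expectation of
  exp(-n N) W in the form exp(exp(-n) a - b), and \<open>exponential_moment_extend\<close> replaces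
  -n by ln C.\<close>

lemma expectation_jump_prod_bounded:
  assumes f [measurable]: "f \<in> borel_measurable borel" and fpos: "\<And>z. 0 < f z"
    and int: "integrable (intensity T) (\<lambda>z. f z - 1)"
    and A [measurable]: "A \<in> sets borel" and finA: "emeasure (intensity T) A < \<infinity>"
    and C: "1 \<le> C" "\<And>z. f z \<le> C" and le1: "\<And>z. z \<notin> A \<Longrightarrow> f z \<le> 1"
  shows "(\<integral>\<^sup>+\<omega>. ennreal (jump_prod T f \<omega>) \<partial>M) = ennreal (exp (\<integral>z. f z - 1 \<partial>intensity T))"
proof -
  \<comment> \<open>Non-negative because f \<le> C on A and f \<le> 1 off A.\<close>
  define h where "h z = indicator A z * ln C - ln (f z)" for z
  have [measurable]: "h \<in> borel_measurable borel" unfolding h_def by measurable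
  have h0: "0 \<le> h z" for z
    using C le1[of z] fpos[of z] by (cases "z \<in> A") (auto simp: h_def)
  define N where "N = J T (indicator A)"
  define W where "W \<omega> = nexp (J T h \<omega>)" for \<omega>
  have [measurable]: "N \<in> borel_measurable M" "W \<in> borel_measurable M" unfolding N_def W_def by measurable
  have iA: "integrable (intensity T) (indicator A :: _ \<Rightarrow> real)" using finA by (intro integrable_real_indicator) auto
  have NF: "AE \<omega> in M. N \<omega> < \<infinity>"
    unfolding N_def using finA by (intro AE_J_finite) (auto simp: ennreal_indicator)
  have if1: "integrable (intensity T) (\<lambda>z. indicator A z * f z)"
  proof -
    have "integrable (intensity T) (\<lambda>z. (f z - 1) * indicator A z + indicator A z)"
      by (intro Bochner_Integration.integrable_add integrable_real_mult_indicator int iA) simp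
    then show ?thesis by (simp add: algebra_simps)
  qed
  define a where "a = (\<integral>z. indicator A z * (f z / C) \<partial>intensity T)"
  have a0: "0 \<le> a" using fpos C unfolding a_def by (intro Bochner_Integration.integral_nonneg) (auto simp: less_imp_le)
  \<comment> \<open>Fixed so that the exponent exp(l) a - b becomes the integral of f - 1 at l = ln
    C.\<close>
  define b where "b = C * a - (\<integral>z. f z - 1 \<partial>intensity T)"
  have Ca: "C * a = (\<integral>z. indicator A z * f z \<partial>intensity T)"
    using C if1 by (simp add: a_def mult.assoc[symmetric] flip: integral_mult_right_zero) (simp add: field_simps)
  have key: "(\<integral>\<omega>. exp (- (real n * enn2real (N \<omega>))) * W \<omega> \<partial>M) = exp (exp (- real n) * a - b)" for n :: nat
  proof -
    \<comment> \<open>exp(-F) equals exp(-n) f / C on A and f off A, so 1 - exp(-F) is a combination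
      of the integrable functions 1 - f and f on A.\<close>
    let ?F = "\<lambda>z. real n * indicator A z + h z"
    have "(\<integral>\<omega>. exp (- (real n * enn2real (N \<omega>))) * W \<omega> \<partial>M) = (\<integral>\<omega>. nexp (J T ?F \<omega>) \<partial>M)"
    proof (rule integral_cong_AE)
      show "AE \<omega> in M. exp (- (real n * enn2real (N \<omega>))) * W \<omega> = nexp (J T ?F \<omega>)"
        using NF
      proof eventually_elim
        case (elim \<omega>)
        have "J T ?F \<omega> = ennreal (real n) * N \<omega> + J T h \<omega>"
          unfolding N_def using h0 by (subst J_add) (auto simp: J_cmult)
        moreover have "nexp (ennreal (real n) * N \<omega>) = exp (- (real n * enn2real (N \<omega>)))"
          using elim by (cases "N \<omega>") (auto simp: ennreal_mult[symmetric])
        ultimately show ?case by (simp add: nexp_add W_def)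
      qed
    qed measurable
    also have "\<dots> = nexp (\<integral>\<^sup>+z. ennreal (1 - exp (- ?F z)) \<partial>intensity T)"
      unfolding J_def using h0 by (intro laplace) auto
    also have "(\<integral>\<^sup>+z. ennreal (1 - exp (- ?F z)) \<partial>intensity T)
        = (\<integral>\<^sup>+z. ennreal ((1 - f z) + indicator A z * f z - exp (- real n) * (indicator A z * (f z / C))) \<partial>intensity T)"
    proof (intro nn_integral_cong arg_cong[where f=ennreal])
      fix z
      have "exp (- ?F z) = (if z \<in> A then exp (- real n) * (f z / C) else f z)"
        using fpos[of z] C by (auto simp: h_def exp_diff exp_minus field_simps exp_add)
      then show "1 - exp (- ?F z) = (1 - f z) + indicator A z * f z - exp (- real n) * (indicator A z * (f z / C))"
        by auto
    qed
    also have "\<dots> = ennreal (\<integral>z. (1 - f z) + indicator A z * f z - exp (- real n) * (indicator A z * (f z / C)) \<partial>intensity T)"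
    proof (rule nn_integral_eq_integral)
      have "integrable (intensity T) (\<lambda>z. 1 - f z)" using integrable_minus[OF int] by simp
      moreover have "integrable (intensity T) (\<lambda>z. indicator A z * (f z / C))"
        using integrable_divide[OF if1, of C] by simp
      ultimately show "integrable (intensity T) (\<lambda>z. (1 - f z) + indicator A z * f z - exp (- real n) * (indicator A z * (f z / C)))"
        using if1 by simp
      show "AE z in intensity T. 0 \<le> (1 - f z) + indicator A z * f z - exp (- real n) * (indicator A z * (f z / C))"
      proof (rule AE_I2)
        fix z
        show "0 \<le> (1 - f z) + indicator A z * f z - exp (- real n) * (indicator A z * (f z / C))"
        proof (cases "z \<in> A")
          case True
          have "exp (- real n) * (f z / C) \<le> 1 * 1"
            using C fpos[of z] by (intro mult_mono) (auto simp: divide_le_eq_1 less_imp_le)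
          then show ?thesis using True by simp
        qed (use le1 in auto)
      qed
    qed
    also have "(\<integral>z. (1 - f z) + indicator A z * f z - exp (- real n) * (indicator A z * (f z / C)) \<partial>intensity T)
       = b - exp (- real n) * a"
    proof -
      have "integrable (intensity T) (\<lambda>z. 1 - f z)" using integrable_minus[OF int] by simp
      moreover have "integrable (intensity T) (\<lambda>z. indicator A z * (f z / C))"
        using integrable_divide[OF if1, of C] by simp
      moreover have "(\<integral>z. 1 - f z \<partial>intensity T) = - (\<integral>z. f z - 1 \<partial>intensity T)"
        by (subst Bochner_Integration.integral_minus[symmetric]) simp
      ultimately show ?thesis using if1 C(1) by (auto simp: b_def Ca a_def)
    qed
    finally have *: "(\<integral>\<omega>. exp (- (real n * enn2real (N \<omega>))) * W \<omega> \<partial>M) = nexp (ennreal (b - exp (- real n) * a))" .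
    have "0 \<le> b - exp (- real n) * a"
    proof -
      have "0 \<le> (\<integral>z. (1 - f z) + indicator A z * f z - exp (- real n) * (indicator A z * (f z / C)) \<partial>intensity T)"
      proof (rule Bochner_Integration.integral_nonneg)
        fix z
        show "0 \<le> (1 - f z) + indicator A z * f z - exp (- real n) * (indicator A z * (f z / C))"
        proof (cases "z \<in> A")
          case True
          have "exp (- real n) * (f z / C) \<le> 1 * 1"
            using C fpos[of z] by (intro mult_mono) (auto simp: divide_le_eq_1 less_imp_le)
          then show ?thesis using True by simp
        qed (use le1 in auto)
      qed
      moreover have "integrable (intensity T) (\<lambda>z. 1 - f z)" using integrable_minus[OF int] by simp
      moreover have "integrable (intensity T) (\<lambda>z. indicator A z * (f z / C))"
        using integrable_divide[OF if1, of C] by simp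
      moreover have "(\<integral>z. 1 - f z \<partial>intensity T) = - (\<integral>z. f z - 1 \<partial>intensity T)"
        by (subst Bochner_Integration.integral_minus[symmetric]) simp
      ultimately show ?thesis using if1 C(1) by (auto simp: b_def Ca a_def)
    qed
    then show ?thesis unfolding * by simp
  qed
  have "(\<integral>\<^sup>+\<omega>. ennreal (jump_prod T f \<omega>) \<partial>M) = (\<integral>\<^sup>+\<omega>. ennreal (exp (ln C * enn2real (N \<omega>)) * W \<omega>) \<partial>M)"
  proof (rule nn_integral_cong_AE)
    have "(\<integral>\<^sup>+z. ennreal \<bar>f z - 1\<bar> \<partial>intensity T) < \<infinity>"
      using int by (auto simp: integrable_iff_bounded)
    then have "AE \<omega> in M. J T (\<lambda>z. \<bar>f z - 1\<bar>) \<omega> < \<infinity>" by (intro AE_J_finite) auto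
    with NF show "AE \<omega> in M. ennreal (jump_prod T f \<omega>) = ennreal (exp (ln C * enn2real (N \<omega>)) * W \<omega>)"
    proof eventually_elim
      case (elim \<omega>)
      note fin = J_log_finite[OF f fpos elim(2)]
      \<comment> \<open>The identity ln f = ln C - h on A and ln f = - h off A is rearranged into an
        equality of sums of non-negative functions, on which \<open>J\<close> is additive.\<close>
      have "J T (log_plus f) \<omega> + J T h \<omega> = J T (\<lambda>z. log_plus f z + h z) \<omega>"
        using h0 by (intro J_add[symmetric]) auto
      also have "(\<lambda>z. log_plus f z + h z) = (\<lambda>z. ln C * indicator A z + log_minus f z)"
        by (auto simp: log_plus_def log_minus_def h_def fun_eq_iff)
      also have "J T (\<lambda>z. ln C * indicator A z + log_minus f z) \<omega> = ennreal (ln C) * N \<omega> + J T (log_minus f) \<omega>"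
        unfolding N_def using C by (subst J_add) (auto simp: J_cmult)
      finally have e: "J T (log_plus f) \<omega> + J T h \<omega> = ennreal (ln C) * N \<omega> + J T (log_minus f) \<omega>" .
      obtain p where p: "J T (log_plus f) \<omega> = ennreal p" "0 \<le> p" using fin by (cases "J T (log_plus f) \<omega>") auto
      obtain q where q: "J T (log_minus f) \<omega> = ennreal q" "0 \<le> q" using fin by (cases "J T (log_minus f) \<omega>") auto
      obtain k where k: "N \<omega> = ennreal k" "0 \<le> k" using elim by (cases "N \<omega>") auto
      have lnC: "0 \<le> ln C" using C by simp
      have e2: "ennreal p + J T h \<omega> = ennreal (ln C * k + q)"
        using e p q k lnC by (simp add: ennreal_mult)
      then have "J T h \<omega> \<noteq> \<top>" by auto
      then obtain y where y: "J T h \<omega> = ennreal y" "0 \<le> y" by (cases "J T h \<omega>") auto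
      have "p + y = ln C * k + q" using e2 p q k y lnC by (simp flip: ennreal_plus)
      then have "p - q = ln C * k - y" by simp
      then have "exp p * exp (- q) = exp (ln C * k) * exp (- y)" by (simp add: exp_add[symmetric])
      then show ?case using p q k y by (simp add: jump_prod_def W_def)
    qed
  qed
  also have "\<dots> = ennreal (exp (exp (ln C) * a - b))"
    by (rule exponential_moment_extend[OF _ _ _ _ a0 key]) (auto simp: W_def)
  also have "exp (ln C) * a - b = (\<integral>z. f z - 1 \<partial>intensity T)" using C by (simp add: b_def)
  finally show ?thesis .
qed

text \<open>Truncation of f from above only: the products then increase, so monotone convergence
  needs no integrable majorant.\<close>

theorem expectation_jump_prod:
  assumes f [measurable]: "f \<in> borel_measurable borel" and fpos: "\<And>z. 0 < f z"
    and int: "integrable (intensity T) (\<lambda>z. f z - 1)"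
  shows "AE \<omega> in M. J T (log_plus f) \<omega> < \<infinity> \<and> J T (log_minus f) \<omega> < \<infinity>"
    and "(\<integral>\<^sup>+\<omega>. ennreal (jump_prod T f \<omega>) \<partial>M) = ennreal (exp (\<integral>z. f z - 1 \<partial>intensity T))"
proof -
  have intb: "(\<integral>\<^sup>+z. ennreal \<bar>f z - 1\<bar> \<partial>intensity T) < \<infinity>"
    using int by (auto simp: integrable_iff_bounded)
  then have "AE \<omega> in M. J T (\<lambda>z. \<bar>f z - 1\<bar>) \<omega> < \<infinity>" by (intro AE_J_finite) auto
  then show fin: "AE \<omega> in M. J T (log_plus f) \<omega> < \<infinity> \<and> J T (log_minus f) \<omega> < \<infinity>"
    by eventually_elim (use J_log_finite[OF f fpos] in auto)
  define e where "e m = 1 / real (Suc m)" for m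
  have e0: "0 < e m" for m by (simp add: e_def)
  have emono: "e (Suc m) \<le> e m" for m by (simp add: e_def frac_le)
  define A where "A m = {z. 1 + e m < f z}" for m
  have [measurable]: "A m \<in> sets borel" for m unfolding A_def by measurable
  \<comment> \<open>Capped at m + 2 where f > 1 + e m, a set of finite intensity by Markov's
    inequality for |f - 1|, and at 1 elsewhere. Each F m therefore meets the conditions of the
    bounded case.\<close>
  define F where "F m z = (if z \<in> A m then min (f z) (real m + 2) else min (f z) 1)" for m z
  have Fm [measurable]: "F m \<in> borel_measurable borel" for m unfolding F_def by measurable
  have Fpos: "0 < F m z" for m z using fpos[of z] by (auto simp: F_def)
  have FA: "1 < f z" if "z \<in> A m" for m z using that e0[of m] by (auto simp: A_def)
  have Fmono: "F m z \<le> F (Suc m) z" for m z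
  proof (cases "z \<in> A m")
    case True
    then have "z \<in> A (Suc m)" using emono[of m] by (auto simp: A_def)
    then show ?thesis using True by (auto simp: F_def)
  next
    case False
    then show ?thesis using FA[of z "Suc m"] by (auto simp: F_def)
  qed
  have Fbd: "\<bar>F m z - 1\<bar> \<le> \<bar>f z - 1\<bar>" for m z
    using FA[of z m] by (auto simp: F_def)
  have Flim: "(\<lambda>m. F m z) \<longlonglongrightarrow> f z" for z
  proof (cases "1 < f z")
    case True
    then obtain n where n: "1 / real (Suc n) < f z - 1" using nat_approx_posE[of "f z - 1"] by auto
    obtain k where k: "f z < real k" using reals_Archimedean2 by blast
    have "F m z = f z" if "max n k \<le> m" for m
    proof -
      have "e m \<le> 1 / real (Suc n)" using that by (auto simp: e_def intro!: frac_le)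
      then have "z \<in> A m" using n by (auto simp: A_def)
      then show ?thesis using k that by (auto simp: F_def)
    qed
    then have "eventually (\<lambda>m. F m z = f z) sequentially" unfolding eventually_sequentially by blast
    then show ?thesis by (rule tendsto_eventually)
  next
    case False
    then have "F m z = f z" for m using FA[of z m] by (auto simp: F_def)
    then show ?thesis by simp
  qed
  have Fint: "integrable (intensity T) (\<lambda>z. F m z - 1)" for m
    by (rule Bochner_Integration.integrable_bound[OF int]) (use Fbd in auto)
  have EF: "(\<integral>\<^sup>+\<omega>. ennreal (jump_prod T (F m) \<omega>) \<partial>M) = ennreal (exp (\<integral>z. F m z - 1 \<partial>intensity T))" for m
  proof (rule expectation_jump_prod_bounded[OF Fm Fpos Fint, where A="A m" and C="real m + 2"])
    have "ennreal (e m) * emeasure (intensity T) (A m) = (\<integral>\<^sup>+z. ennreal (e m) * indicator (A m) z \<partial>intensity T)"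
      by (simp add: nn_integral_cmult_indicator)
    also have "\<dots> \<le> (\<integral>\<^sup>+z. ennreal \<bar>f z - 1\<bar> \<partial>intensity T)"
      by (intro nn_integral_mono) (auto simp: indicator_def A_def intro!: ennreal_leI)
    also have "\<dots> < \<infinity>" by (rule intb)
    finally show "emeasure (intensity T) (A m) < \<infinity>" using e0[of m] by (auto simp: ennreal_mult_less_top)
  qed (auto simp: F_def)
  have R: "(\<lambda>m. ennreal (exp (\<integral>z. F m z - 1 \<partial>intensity T))) \<longlonglongrightarrow> ennreal (exp (\<integral>z. f z - 1 \<partial>intensity T))"
  proof (intro tendsto_ennrealI tendsto_exp integral_dominated_convergence[where w="\<lambda>z. \<bar>f z - 1\<bar>"])
    show "AE z in intensity T. (\<lambda>m. F m z - 1) \<longlonglongrightarrow> f z - 1"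
      using Flim by (intro AE_I2 tendsto_diff tendsto_const)
  qed (use int Fbd in auto)
  \<comment> \<open>Values of f up to 1 are left alone and larger ones stay at least 1, so only the
    positive part of the logarithm varies with m.\<close>
  have lm: "log_minus (F m) = log_minus f" for m
  proof
    fix z show "log_minus (F m) z = log_minus f z"
      using FA[of z m] fpos[of z] by (cases "f z \<le> 1") (auto simp: log_minus_def F_def min_def ln_ge_zero)
  qed
  have lpmono: "log_plus (F m) z \<le> log_plus (F (Suc m)) z" for m z
    using Fmono[of m z] Fpos[of m z] Fpos[of "Suc m" z] unfolding log_plus_def by (intro max.mono) auto
  have lple: "log_plus (F m) z \<le> log_plus f z" for m z
    using Fpos[of m z] fpos[of z] FA[of z m] unfolding log_plus_def by (intro max.mono) (auto simp: F_def)
  have lplim: "(\<lambda>m. log_plus (F m) z) \<longlonglongrightarrow> log_plus f z" for z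
    unfolding log_plus_def using Flim[of z] fpos[of z] by (intro tendsto_max tendsto_const tendsto_ln) auto
  have Jlim: "(\<lambda>m. J T (log_plus (F m)) \<omega>) \<longlonglongrightarrow> J T (log_plus f) \<omega>" for \<omega>
    unfolding J_def using lpmono lplim
    by (intro nn_integral_LIMSEQ) (auto simp: le_fun_def intro!: incseq_SucI ennreal_leI tendsto_ennrealI)
  have Zmono: "AE \<omega> in M. ennreal (jump_prod T (F m) \<omega>) \<le> ennreal (jump_prod T (F (Suc m)) \<omega>)" for m
    using fin
  proof eventually_elim
    case (elim \<omega>)
    have "J T (log_plus (F m)) \<omega> \<le> J T (log_plus (F (Suc m))) \<omega>" using lpmono by (rule J_mono)
    moreover have "J T (log_plus (F (Suc m))) \<omega> < \<infinity>" 
      using le_less_trans[OF J_mono[of "log_plus (F (Suc m))" "log_plus f" T \<omega>, OF lple]] elim by blast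
    ultimately have "enn2real (J T (log_plus (F m)) \<omega>) \<le> enn2real (J T (log_plus (F (Suc m))) \<omega>)"
      by (intro enn2real_mono) auto
    then show ?case unfolding jump_prod_def lm by (intro ennreal_leI mult_right_mono) auto
  qed
  have "(\<integral>\<^sup>+\<omega>. (SUP m. ennreal (jump_prod T (F m) \<omega>)) \<partial>M) = (SUP m. \<integral>\<^sup>+\<omega>. ennreal (jump_prod T (F m) \<omega>) \<partial>M)"
    using Zmono by (intro nn_integral_monotone_convergence_SUP_AE) auto
  also have "\<dots> = ennreal (exp (\<integral>z. f z - 1 \<partial>intensity T))"
  proof (rule LIMSEQ_unique[OF _ R])
    have "incseq (\<lambda>m. \<integral>\<^sup>+\<omega>. ennreal (jump_prod T (F m) \<omega>) \<partial>M)"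
      using Zmono by (intro incseq_SucI nn_integral_mono_AE)
    then show "(\<lambda>m. ennreal (exp (\<integral>z. F m z - 1 \<partial>intensity T))) \<longlonglongrightarrow> (SUP m. \<integral>\<^sup>+\<omega>. ennreal (jump_prod T (F m) \<omega>) \<partial>M)"
      unfolding EF by (rule LIMSEQ_SUP)
  qed
  also have "(\<integral>\<^sup>+\<omega>. (SUP m. ennreal (jump_prod T (F m) \<omega>)) \<partial>M) = (\<integral>\<^sup>+\<omega>. ennreal (jump_prod T f \<omega>) \<partial>M)"
  proof (rule nn_integral_cong_AE)
    have "AE \<omega> in M. \<forall>m. ennreal (jump_prod T (F m) \<omega>) \<le> ennreal (jump_prod T (F (Suc m)) \<omega>)"
      using Zmono by (simp add: AE_all_countable)
    with fin show "AE \<omega> in M. (SUP m. ennreal (jump_prod T (F m) \<omega>)) = ennreal (jump_prod T f \<omega>)"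
    proof eventually_elim
      case (elim \<omega>)
      have "(\<lambda>m. enn2real (J T (log_plus (F m)) \<omega>)) \<longlonglongrightarrow> enn2real (J T (log_plus f) \<omega>)"
        using Jlim[of \<omega>] elim(1) by (intro tendsto_enn2real) (auto simp: less_top)
      then have "(\<lambda>m. ennreal (jump_prod T (F m) \<omega>)) \<longlonglongrightarrow> ennreal (jump_prod T f \<omega>)"
        unfolding jump_prod_def lm by (intro tendsto_ennrealI tendsto_mult tendsto_exp tendsto_const)
      moreover have "(\<lambda>m. ennreal (jump_prod T (F m) \<omega>)) \<longlonglongrightarrow> (SUP m. ennreal (jump_prod T (F m) \<omega>))"
        using elim(2) by (intro LIMSEQ_SUP incseq_SucI) auto
      ultimately show ?case by (rule LIMSEQ_unique[symmetric])
    qed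
  qed
  finally show "(\<integral>\<^sup>+\<omega>. ennreal (jump_prod T f \<omega>) \<partial>M) = ennreal (exp (\<integral>z. f z - 1 \<partial>intensity T))" .
qed

end

section \<open>The process is the sum of its jumps\<close>

lemma borel_measurable_fst_snd [measurable]:
  "fst \<in> borel_measurable (borel :: (real \<times> real) measure)"
  "snd \<in> borel_measurable (borel :: (real \<times> real) measure)"
  by (intro borel_measurable_continuous_onI continuous_intros)+

lemma nn_integral_jumps_le:
  assumes w: "increasing_path w" and ab: "0 \<le> a" "a \<le> b"
  shows "(\<integral>\<^sup>+s. ennreal (jump w s) * indicator {a<..b} s \<partial>count_space (jump_times w T)) \<le> ennreal (w b - w a)"
proof -
  define A where "A n = {s\<in>jump_times w T. s \<in> {a<..b} \<and> 1 / real (Suc n) \<le> jump w s}" for n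
  have finA: "finite (A n)" for n
    by (rule finite_subset[OF _ finite_big_jumps[OF w, of "1 / real (Suc n)" T]]) (auto simp: A_def jump_times_def)
  have Asub: "A n \<subseteq> A (Suc n)" for n
  proof -
    have "1 / real (Suc (Suc n)) \<le> 1 / real (Suc n)" by (intro frac_le) auto
    then show ?thesis unfolding A_def by (auto simp del: of_nat_Suc)
  qed
  have "(\<lambda>n. \<integral>\<^sup>+s. ennreal (jump w s) * indicator (A n) s \<partial>count_space (jump_times w T))
    \<longlonglongrightarrow> (\<integral>\<^sup>+s. ennreal (jump w s) * indicator ({a<..b} \<inter> jump_times w T) s \<partial>count_space (jump_times w T))"
  proof (rule nn_integral_LIMSEQ)
    show "incseq (\<lambda>n s. ennreal (jump w s) * indicator (A n) s)"
      using Asub by (intro incseq_SucI le_funI mult_left_mono) (auto simp: indicator_def)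
    fix s
    show "(\<lambda>n. ennreal (jump w s) * indicator (A n) s) \<longlonglongrightarrow> ennreal (jump w s) * indicator ({a<..b} \<inter> jump_times w T) s"
    proof (cases "s \<in> {a<..b} \<inter> jump_times w T")
      case True
      then obtain N where N: "1 / real (Suc N) < jump w s" using nat_approx_posE[of "jump w s"] by (auto simp: jump_times_def)
      have "s \<in> A n" if "N \<le> n" for n
      proof -
        have "1 / real (Suc n) \<le> 1 / real (Suc N)" using that by (intro frac_le) auto
        then show ?thesis using N True by (auto simp: A_def simp del: of_nat_Suc)
      qed
      then have "eventually (\<lambda>n. ennreal (jump w s) * indicator (A n) s = ennreal (jump w s)) sequentially"
        unfolding eventually_sequentially by (intro exI[of _ N]) auto
      then show ?thesis using True by (simp add: tendsto_eventually)
    next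
      case False
      then have "s \<notin> A n" for n by (auto simp: A_def)
      then show ?thesis using False by simp
    qed
  qed simp
  moreover have "(\<integral>\<^sup>+s. ennreal (jump w s) * indicator (A n) s \<partial>count_space (jump_times w T)) \<le> ennreal (w b - w a)" for n
  proof -
    have "(\<integral>\<^sup>+s. ennreal (jump w s) * indicator (A n) s \<partial>count_space (jump_times w T)) = (\<Sum>s\<in>A n. ennreal (jump w s) * indicator (A n) s)"
      using finA by (intro nn_integral_count_space') (auto simp: A_def)
    also have "\<dots> = (\<Sum>s\<in>A n. ennreal (jump w s))" by (intro sum.cong) auto
    also have "\<dots> = ennreal (\<Sum>s\<in>A n. jump w s)" using jump_nonneg[OF w] by (intro sum_ennreal) auto
    also have "\<dots> \<le> ennreal (w b - w a)"
      using finA ab by (intro ennreal_leI sum_jumps_le[OF w]) (auto simp: A_def)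
    finally show ?thesis .
  qed
  ultimately have "(\<integral>\<^sup>+s. ennreal (jump w s) * indicator ({a<..b} \<inter> jump_times w T) s \<partial>count_space (jump_times w T)) \<le> ennreal (w b - w a)"
    by (intro LIMSEQ_le_const2) auto
  also have "(\<integral>\<^sup>+s. ennreal (jump w s) * indicator ({a<..b} \<inter> jump_times w T) s \<partial>count_space (jump_times w T))
    = (\<integral>\<^sup>+s. ennreal (jump w s) * indicator {a<..b} s \<partial>count_space (jump_times w T))"
    by (intro nn_integral_cong) (auto simp: indicator_def)
  finally show ?thesis .
qed

lemma measure_time_measure: "0 \<le> T \<Longrightarrow> measure (time_measure T) UNIV = T"
  by (simp add: measure_def emeasure_time_measure)

context driftless_subordinator
begin

lemma J_snd_le:
  assumes "\<omega> \<in> space M" "0 \<le> T" shows "J T snd \<omega> \<le> ennreal (\<xi> T \<omega>)"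
proof -
  have "J T snd \<omega> = (\<integral>\<^sup>+s. ennreal (jump (path \<omega>) s) * indicator {0<..T} s \<partial>count_space (jump_times (path \<omega>) T))"
    unfolding J_def by (subst nn_integral_jump_measure) (auto intro!: nn_integral_cong simp: jump_times_def)
  also have "\<dots> \<le> ennreal (path \<omega> T - path \<omega> 0)"
    using assms by (intro nn_integral_jumps_le increasing_path) auto
  finally show ?thesis using start[OF assms(1)] by (simp add: path_def)
qed

text \<open>The exponential formula for the jumps with smoothly cut-off sizes, followed by removal
  of the cut-off. In the exponent, the limit is dominated by a multiple of min 1 x uniformly in the
  cut-off.\<close>

lemma expectation_iexp_sum_jumps:
  assumes T: "0 < T"
  shows "(\<integral>\<omega>. iexp (u * enn2real (J T snd \<omega>)) \<partial>M) = exp (of_real T * \<Psi> u)"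
proof -
  \<comment> \<open>A trapezoid: 0 off [1/(n+1), n+1], and 1 on [2/(n+1), n] as soon as this
    interval is non-empty.\<close>
  define cut where "cut n x = max 0 (min 1 (min (real (Suc n) * x - 1) (real (Suc n) - x)))" for n x
  have chi01: "0 \<le> cut n x" "cut n x \<le> 1" for n x by (auto simp: cut_def)
  have supp: "cut n x = 0" if "x \<notin> {1 / real (Suc n)..real (Suc n)}" for n x
  proof (cases "x < 1 / real (Suc n)")
    case True
    then have "real (Suc n) * x - 1 < 0" by (simp add: field_simps del: of_nat_Suc)
    then show ?thesis by (simp add: cut_def del: of_nat_Suc)
  next
    case False
    then have "real (Suc n) - x < 0" using that by auto
    then show ?thesis by (simp add: cut_def del: of_nat_Suc)
  qed
  have chic: "continuous_on UNIV (cut n)" for n unfolding cut_def by (intro continuous_intros)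
  have [measurable]: "cut n \<in> borel_measurable borel" for n by (rule borel_measurable_continuous_onI[OF chic])
  have chilim: "(\<lambda>n. cut n x) \<longlonglongrightarrow> 1" if "0 < x" for x
  proof -
    obtain k where k: "2 / x < real k" using reals_Archimedean2 by blast
    obtain l where l: "x + 1 < real l" using reals_Archimedean2 by blast
    have "cut n x = 1" if "max k l \<le> n" for n
    proof -
      have "2 < real k * x" using k \<open>0 < x\<close> by (simp add: field_simps)
      also have "\<dots> \<le> real (Suc n) * x" using that \<open>0 < x\<close> by (intro mult_right_mono) auto
      finally show ?thesis using l that by (auto simp: cut_def)
    qed
    then have "eventually (\<lambda>n. cut n x = 1) sequentially" unfolding eventually_sequentially by blast
    then show ?thesis by (rule tendsto_eventually)
  qed
  define v where "v n z = snd z * cut n (snd z)" for n and z :: "real \<times> real"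
  have [measurable]: "v n \<in> borel_measurable borel" for n unfolding v_def[abs_def] by measurable
  have pos: "0 < 1 / real (Suc n)" "1 / real (Suc n) \<le> real (Suc n)" for n by (auto simp: field_simps)
  have v0: "0 \<le> v n z" for n z
  proof (cases "0 \<le> snd z")
    case False
    then have "snd z \<notin> {1 / real (Suc n)..real (Suc n)}"
      unfolding atLeastAtMost_iff using pos(1)[of n] by linarith
    then show ?thesis using supp by (simp add: v_def)
  qed (use chi01 in \<open>auto simp: v_def\<close>)
  have vle: "v n z \<le> snd z" if "0 < snd z" for n z using that chi01 by (simp add: v_def mult_left_le)
  let ?S = "\<lambda>n \<omega>. {s\<in>{0<..T}. 1 / real (Suc n) \<le> jump (path \<omega>) s}"
  define X where "X n \<omega> = (\<Sum>s\<in>?S n \<omega>. v n (s, jump (path \<omega>) s))" for n \<omega>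
  have XJ: "J T (v n) \<omega> = ennreal (X n \<omega>)" if "\<omega> \<in> space M" for n \<omega>
    unfolding J_def X_def
    by (rule nn_integral_jump_measure_eq_sum[OF increasing_path[OF that] pos(1) _ _ v0])
      (use supp in \<open>auto simp: v_def simp del: of_nat_Suc\<close>)
  have Xlim: "(\<lambda>n. X n \<omega>) \<longlonglongrightarrow> enn2real (J T snd \<omega>)" if \<omega>: "\<omega> \<in> space M" for \<omega>
  proof -
    have fin: "J T snd \<omega> < \<infinity>" using J_snd_le[OF \<omega>, of T] T by (auto intro: le_less_trans)
    have jpos: "AE z in jump_measure (path \<omega>) T. 0 < snd z" using AE_jump_measure_pos[where w="path \<omega>" and T=T] by auto
    have "(\<lambda>n. J T (v n) \<omega>) \<longlonglongrightarrow> J T snd \<omega>"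
      unfolding J_def
    proof (rule nn_integral_dominated_convergence[where w="\<lambda>z. ennreal (snd z)"])
      show "AE z in jump_measure (path \<omega>) T. ennreal (v n z) \<le> ennreal (snd z)" for n
        using jpos by eventually_elim (auto intro!: ennreal_leI vle)
      show "AE z in jump_measure (path \<omega>) T. (\<lambda>n. ennreal (v n z)) \<longlonglongrightarrow> ennreal (snd z)"
        using jpos
      proof eventually_elim
        case (elim z)
        have "(\<lambda>n. v n z) \<longlonglongrightarrow> snd z * 1" unfolding v_def by (intro tendsto_mult tendsto_const chilim elim)
        then show ?case by (intro tendsto_ennrealI) simp
      qed
      show "(\<integral>\<^sup>+z. ennreal (snd z) \<partial>jump_measure (path \<omega>) T) < \<infinity>" using fin by (simp add: J_def)
    qed auto
    then have "(\<lambda>n. ennreal (X n \<omega>)) \<longlonglongrightarrow> ennreal (enn2real (J T snd \<omega>))"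
      using fin by (simp add: XJ[OF \<omega>] less_top)
    then have "(\<lambda>n. enn2real (ennreal (X n \<omega>))) \<longlonglongrightarrow> enn2real (J T snd \<omega>)"
      by (rule tendsto_enn2real) simp
    moreover have "0 \<le> X n \<omega>" for n using v0 unfolding X_def by (intro sum_nonneg) auto
    ultimately show ?thesis by simp
  qed
  have XM: "X n \<in> borel_measurable M" for n
  proof -
    have "(\<lambda>\<omega>. enn2real (J T (v n) \<omega>)) \<in> borel_measurable M" by measurable
    moreover have "enn2real (J T (v n) \<omega>) = X n \<omega>" if "\<omega> \<in> space M" for \<omega>
      using XJ[OF that] v0 by (simp add: X_def sum_nonneg)
    ultimately show ?thesis by (simp cong: measurable_cong)
  qed
  note [measurable] = XM
  have E: "(\<integral>\<omega>. iexp (u * X n \<omega>) \<partial>M) = exp (of_real T * (\<integral>x. iexp (u * (x * cut n x)) - 1 \<partial>\<nu>))" for n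
  proof -
    \<comment> \<open>The test function does not depend on time, so a grid with a single cell
      suffices.\<close>
    let ?c = "\<lambda>j::nat. \<lambda>x. \<i> * complex_of_real (u * (x * cut n x))"
    have "(\<integral>\<omega>. exp (\<Sum>s\<in>?S n \<omega>. ?c (cell T 1 s) (jump (path \<omega>) s)) \<partial>M)
      = exp (\<integral>s. (\<integral>x. exp (?c (cell T 1 s) x) - 1 \<partial>\<nu>) \<partial>time_measure T)"
      by (rule expectation_exp_jumps_grid(1)[OF T _ _ pos])
        (use supp in \<open>auto intro!: continuous_intros continuous_on_compose2[OF chic]\<close>)
    moreover have "(\<Sum>s\<in>?S n \<omega>. ?c (cell T 1 s) (jump (path \<omega>) s)) = \<i> * complex_of_real (u * X n \<omega>)" for \<omega>
      unfolding X_def v_def by (simp only: of_real_sum sum_distrib_left snd_conv)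
    ultimately show ?thesis
      using T by (simp add: scaleR_conv_of_real measure_time_measure)
  qed
  have 1: "(\<lambda>n. \<integral>\<omega>. iexp (u * X n \<omega>) \<partial>M) \<longlonglongrightarrow> (\<integral>\<omega>. iexp (u * enn2real (J T snd \<omega>)) \<partial>M)"
  proof (rule integral_dominated_convergence[where w="\<lambda>_. 1"])
    show "AE \<omega> in M. (\<lambda>n. iexp (u * X n \<omega>)) \<longlonglongrightarrow> iexp (u * enn2real (J T snd \<omega>))"
      by (intro AE_I2 tendsto_exp tendsto_mult tendsto_const tendsto_of_real Xlim)
  qed auto
  have 2: "(\<lambda>n. \<integral>x. iexp (u * (x * cut n x)) - 1 \<partial>\<nu>) \<longlonglongrightarrow> \<Psi> u"
    unfolding \<Psi>_def
  proof (rule integral_dominated_convergence[where w="\<lambda>x. (2 + \<bar>u\<bar>) * min 1 x"])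
    show "AE x in \<nu>. (\<lambda>n. iexp (u * (x * cut n x)) - 1) \<longlonglongrightarrow> iexp (u * x) - 1"
      using AE_nu_pos
    proof eventually_elim
      case (elim x)
      have lim: "(\<lambda>n. u * (x * cut n x)) \<longlonglongrightarrow> u * x"
        using tendsto_mult[OF tendsto_const tendsto_mult[OF tendsto_const chilim[OF elim]], of u x] by simp
      show ?case by (rule tendsto_diff[OF tendsto_exp[OF tendsto_mult[OF tendsto_const tendsto_of_real[OF lim]]] tendsto_const])
    qed
    show "AE x in \<nu>. norm (iexp (u * (x * cut n x)) - 1) \<le> (2 + \<bar>u\<bar>) * min 1 x" for n
      using AE_nu_pos
    proof eventually_elim
      case (elim x)
      show ?case
      proof (cases "x * cut n x = 0")
        case False
        then have "0 < x * cut n x" "x * cut n x \<le> x" using elim chi01[of n x] by (auto simp: mult_left_le less_le)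
        then have "norm (iexp (u * (x * cut n x)) - 1) \<le> (2 + \<bar>u\<bar>) * min 1 (x * cut n x)"
          by (intro iexp_diff_1_bound)
        also have "\<dots> \<le> (2 + \<bar>u\<bar>) * min 1 x" using \<open>x * cut n x \<le> x\<close> by (intro mult_left_mono) auto
        finally show ?thesis .
      qed (use elim in simp)
    qed
  qed (use integrable_min in auto)
  show ?thesis
    using LIMSEQ_unique[OF 1] tendsto_exp[OF tendsto_mult[OF tendsto_const 2]] unfolding E by blast
qed

text \<open>The analytic absence of drift turned into a pathwise statement: the sum of the jumps is
  at most \<xi> T at every \<omega> and has the same characteristic function, hence the same law, so
  the two agree almost surely.\<close>

theorem sum_jumps_eq:
  assumes T: "0 \<le> T" shows "AE \<omega> in M. J T snd \<omega> = ennreal (\<xi> T \<omega>)"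
proof (cases "T = 0")
  case True
  then show ?thesis using start by (auto simp: J_def jump_measure_nonpos)
next
  case False
  then have T: "0 < T" using T by simp
  define X where "X \<omega> = enn2real (J T snd \<omega>)" for \<omega>
  have Xm [measurable]: "X \<in> borel_measurable M" unfolding X_def by measurable
  have xm [measurable]: "\<xi> T \<in> borel_measurable M" using T by (intro random_variable) simp
  have le: "X \<omega> \<le> \<xi> T \<omega>" and JX: "J T snd \<omega> = ennreal (X \<omega>)" if "\<omega> \<in> space M" for \<omega>
  proof -
    have JT: "J T snd \<omega> \<le> ennreal (\<xi> T \<omega>)" using J_snd_le[OF that] T by simp
    show "X \<omega> \<le> \<xi> T \<omega>" unfolding X_def
      using nonneg[OF that, of T] T JT by (intro enn2real_leI) auto
    have "J T snd \<omega> < \<top>" using JT by (rule le_less_trans) simp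
    then show "J T snd \<omega> = ennreal (X \<omega>)" by (simp add: X_def)
  qed
  have "distr M borel X = distr M borel (\<xi> T)"
  proof (rule Levy_uniqueness)
    show "char (distr M borel X) = char (distr M borel (\<xi> T))"
    proof
      fix u
      have "char (distr M borel X) u = (\<integral>\<omega>. iexp (u * X \<omega>) \<partial>M)"
        unfolding char_def by (subst integral_distr) auto
      also have "\<dots> = (\<integral>\<omega>. iexp (u * \<xi> T \<omega>) \<partial>M)"
        unfolding X_def expectation_iexp_sum_jumps[OF T] using T by (subst expectation_iexp) auto
      also have "\<dots> = char (distr M borel (\<xi> T)) u"
        unfolding char_def by (subst integral_distr) auto
      finally show "char (distr M borel X) u = char (distr M borel (\<xi> T)) u" .
    qed
  qed (auto intro!: real_distribution_distr)
  \<comment> \<open>Any bounded function that is strictly monotone on [0,\<infinity>) would do: the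
    variables are ordered, and equal expectations then force equality.\<close>
  then have "(\<integral>x. exp (- \<bar>x\<bar>) \<partial>distr M borel X) = (\<integral>x. exp (- \<bar>x\<bar>) \<partial>distr M borel (\<xi> T))" by simp
  then have E: "(\<integral>\<omega>. exp (- \<bar>X \<omega>\<bar>) \<partial>M) = (\<integral>\<omega>. exp (- \<bar>\<xi> T \<omega>\<bar>) \<partial>M)"
    by (simp add: integral_distr)
  have i: "integrable M (\<lambda>\<omega>. exp (- \<bar>Y \<omega>\<bar>))" if [measurable]: "Y \<in> borel_measurable M" for Y :: "'a \<Rightarrow> real"
    by (intro integrable_const_bound[where B=1]) auto
  have "(\<integral>\<omega>. exp (- \<bar>X \<omega>\<bar>) - exp (- \<bar>\<xi> T \<omega>\<bar>) \<partial>M) = 0"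
    using E i[OF Xm] i[OF xm] by simp
  moreover have "AE \<omega> in M. 0 \<le> exp (- \<bar>X \<omega>\<bar>) - exp (- \<bar>\<xi> T \<omega>\<bar>)"
  proof (rule AE_I2)
    fix \<omega> assume "\<omega> \<in> space M"
    then show "0 \<le> exp (- \<bar>X \<omega>\<bar>) - exp (- \<bar>\<xi> T \<omega>\<bar>)" using le[of \<omega>] by (simp add: X_def)
  qed
  ultimately have "AE \<omega> in M. exp (- \<bar>X \<omega>\<bar>) - exp (- \<bar>\<xi> T \<omega>\<bar>) = 0"
    using i[OF Xm] i[OF xm] by (subst integral_nonneg_eq_0_iff_AE[symmetric]) auto
  with AE_space show ?thesis
  proof eventually_elim
    case (elim \<omega>)
    then have "\<bar>X \<omega>\<bar> = \<bar>\<xi> T \<omega>\<bar>" by simp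
    then have "X \<omega> = \<xi> T \<omega>" using nonneg[OF elim(1), of T] T by (simp add: X_def)
    then show ?case using JX[OF elim(1)] by simp
  qed
qed

end

section \<open>Unordered products\<close>

lemma nn_integral_count_space_summable:
  fixes f :: "'b \<Rightarrow> real"
  assumes "\<And>x. 0 \<le> f x"
  shows "f summable_on A \<longleftrightarrow> (\<integral>\<^sup>+x. ennreal (f x) \<partial>count_space A) < \<infinity>"
    and "infsum f A = enn2real (\<integral>\<^sup>+x. ennreal (f x) \<partial>count_space A)"
proof -
  have nf: "(\<lambda>x. norm (f x)) = f" using assms by auto
  have "f summable_on A \<longleftrightarrow> Infinite_Sum.abs_summable_on f A" by (simp only: nf)
  also have "\<dots> \<longleftrightarrow> Infinite_Set_Sum.abs_summable_on f A" by (rule abs_summable_equivalent)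
  also have "\<dots> \<longleftrightarrow> (\<integral>\<^sup>+x. ennreal (f x) \<partial>count_space A) < \<infinity>"
    using assms unfolding Infinite_Set_Sum.abs_summable_on_def by (simp add: integrable_iff_bounded)
  finally show *: "f summable_on A \<longleftrightarrow> (\<integral>\<^sup>+x. ennreal (f x) \<partial>count_space A) < \<infinity>" .
  show "infsum f A = enn2real (\<integral>\<^sup>+x. ennreal (f x) \<partial>count_space A)"
  proof (cases "f summable_on A")
    case True
    then have abs: "Infinite_Set_Sum.abs_summable_on f A"
      unfolding abs_summable_equivalent[symmetric] nf .
    have "infsum f A = infsetsum f A" by (rule infsetsum_infsum[OF abs, symmetric])
    also have "\<dots> = enn2real (\<integral>\<^sup>+x. ennreal (f x) \<partial>count_space A)"
      using True assms * by (intro infsetsum_conv_nn_integral) auto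
    finally show ?thesis .
  next
    case False
    then have "(\<integral>\<^sup>+x. ennreal (f x) \<partial>count_space A) = \<top>" using * by (simp add: less_top[symmetric])
    then show ?thesis using False by (simp add: infsum_not_exists)
  qed
qed

lemma not_summable_large_sum:
  fixes f :: "'b \<Rightarrow> real"
  assumes "\<And>x. 0 \<le> f x" "\<not> f summable_on A"
  obtains F where "finite F" "F \<subseteq> A" "B < sum f F"
proof -
  have "\<not> bdd_above (sum f ` {F. F \<subseteq> A \<and> finite F})"
    using nonneg_bdd_above_summable_on[of A f] assms by auto
  then show ?thesis using that unfolding bdd_above_def by (auto simp: not_le)
qed

lemma prod_eq_exp_sum:
  fixes f :: "'b \<Rightarrow> real"
  assumes "finite F" "\<And>x. x \<in> F \<Longrightarrow> 0 < f x"
  shows "prod f F = exp ((\<Sum>x\<in>F. max 0 (ln (f x))) - (\<Sum>x\<in>F. max 0 (- ln (f x))))"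
proof -
  have "(\<Sum>x\<in>F. max 0 (ln (f x))) - (\<Sum>x\<in>F. max 0 (- ln (f x))) = (\<Sum>x\<in>F. ln (f x))"
    unfolding sum_subtractf[symmetric] by (intro sum.cong) auto
  then show ?thesis using assms by (simp add: exp_sum)
qed

text \<open>If ln^+ f is not summable, no finite stage bounds the later products, whatever ln^- f
  does, so the net has no limit and the default 1 applies. If only ln^- f fails to be summable, the
  products tend to 0.\<close>

lemma unordered_prod_eq:
  fixes f :: "'b \<Rightarrow> real"
  assumes pos: "\<And>x. x \<in> A \<Longrightarrow> 0 < f x"
  defines "p \<equiv> \<lambda>x. max 0 (ln (f x))" and "m \<equiv> \<lambda>x. max 0 (- ln (f x))"
  shows "unordered_prod f A =
    (if \<not> p summable_on A then 1 else if \<not> m summable_on A then 0 else exp (infsum p A - infsum m A))"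
proof -
  let ?F = "finite_subsets_at_top A"
  have p0: "0 \<le> p x" and m0: "0 \<le> m x" for x by (auto simp: p_def m_def)
  have pe: "prod f F = exp (sum p F - sum m F)" if "finite F" "F \<subseteq> A" for F
    unfolding p_def m_def using that pos by (intro prod_eq_exp_sum) auto
  have unique: "unordered_prod f A = l" if "((\<lambda>J. prod f J) \<longlongrightarrow> l) ?F" for l
    using that tendsto_Lim[OF finite_subsets_at_top_neq_bot that] by (auto simp: unordered_prod_def)
  consider "\<not> p summable_on A" | "p summable_on A" "\<not> m summable_on A" | "p summable_on A" "m summable_on A" by blast
  then show ?thesis
  proof cases
    case 1
    have "\<not> ((\<lambda>J. prod f J) \<longlongrightarrow> l) ?F" for l
    proof
      assume "((\<lambda>J. prod f J) \<longlongrightarrow> l) ?F"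
      then have "eventually (\<lambda>J. prod f J < \<bar>l\<bar> + 1) ?F" by (rule order_tendstoD) simp
      then have "\<exists>X. finite X \<and> X \<subseteq> A \<and> (\<forall>Y. finite Y \<and> X \<subseteq> Y \<and> Y \<subseteq> A \<longrightarrow> prod f Y < \<bar>l\<bar> + 1)"
        unfolding eventually_finite_subsets_at_top .
      then obtain X where X: "finite X" "X \<subseteq> A"
        and XY: "\<forall>Y. finite Y \<and> X \<subseteq> Y \<and> Y \<subseteq> A \<longrightarrow> prod f Y < \<bar>l\<bar> + 1" by (elim exE conjE)
      obtain G where G: "finite G" "G \<subseteq> A" "ln (\<bar>l\<bar> + 1) + sum m X < sum p G"
        using not_summable_large_sum[OF p0 1] by blast
      \<comment> \<open>Only factors at least 1 are added to X, so the sum of the negative parts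
        does not grow while that of the positive parts becomes large.\<close>
      define G' where "G' = {x\<in>G - X. 1 \<le> f x}"
      have sub: "finite (X \<union> G')" "X \<union> G' \<subseteq> A" using X G by (auto simp: G'_def)
      have "sum p G \<le> sum p (X \<union> G')"
      proof -
        have pz: "p x = 0" if "x \<in> G - (X \<union> G')" for x
        proof -
          have "0 < f x" "f x \<le> 1" using that G(2) pos[of x] by (auto simp: G'_def)
          then show ?thesis by (simp add: p_def)
        qed
        have "sum p G = sum p (G \<inter> (X \<union> G'))"
          using G pz by (intro sum.mono_neutral_right) auto
        also have "\<dots> \<le> sum p (X \<union> G')" using sub p0 by (intro sum_mono2) auto
        finally show ?thesis .
      qed
      moreover have "sum m (X \<union> G') = sum m X"
      proof (rule sum.mono_neutral_right)
        show "\<forall>x\<in>X \<union> G' - X. m x = 0" by (auto simp: G'_def m_def)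
      qed (use sub in auto)
      ultimately have "ln (\<bar>l\<bar> + 1) < sum p (X \<union> G') - sum m (X \<union> G')" using G(3) by linarith
      then have "\<bar>l\<bar> + 1 < prod f (X \<union> G')"
        
        unfolding pe[OF sub] by (subst exp_ln[symmetric, of "\<bar>l\<bar> + 1"]) (simp, simp only: exp_less_cancel_iff)
      moreover have "prod f (X \<union> G') < \<bar>l\<bar> + 1" using sub by (intro XY[rule_format]) auto
      ultimately show False by simp
    qed
    then show ?thesis using 1 by (simp add: unordered_prod_def)
  next
    case 2
    have "((\<lambda>J. prod f J) \<longlongrightarrow> 0) ?F"
    proof (rule tendstoI)
      fix e :: real assume e: "0 < e"
      obtain X where X: "finite X" "X \<subseteq> A" "infsum p A - ln e < sum m X"
        using not_summable_large_sum[OF m0 2(2)] by blast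
      have "dist (prod f Y) 0 < e" if Y: "finite Y" "X \<subseteq> Y" "Y \<subseteq> A" for Y
      proof -
        have "sum p Y \<le> infsum p A" using 2(1) Y p0 by (intro finite_sum_le_infsum) auto
        moreover have "sum m X \<le> sum m Y" using Y m0 by (intro sum_mono2) auto
        ultimately have "sum p Y - sum m Y < ln e" using X(3) by linarith
        then have "prod f Y < e" unfolding pe[OF Y(1,3)] using e by (metis exp_less_mono exp_ln)
        moreover have "0 < prod f Y" unfolding pe[OF Y(1,3)] by simp
        ultimately show ?thesis by simp
      qed
      then show "eventually (\<lambda>J. dist (prod f J) 0 < e) ?F"
        unfolding eventually_finite_subsets_at_top using X by blast
    qed
    then show ?thesis using 2 unique by simp
  next
    case 3
    have "(sum p \<longlongrightarrow> infsum p A) ?F" "(sum m \<longlongrightarrow> infsum m A) ?F"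
      using 3 has_sum_infsum unfolding has_sum_def by blast+
    then have "((\<lambda>J. exp (sum p J - sum m J)) \<longlongrightarrow> exp (infsum p A - infsum m A)) ?F"
      by (intro tendsto_intros)
    then have "((\<lambda>J. prod f J) \<longlongrightarrow> exp (infsum p A - infsum m A)) ?F"
      by (rule Lim_transform_eventually) (auto intro!: eventually_finite_subsets_at_top_weakI simp: pe)
    then show ?thesis using 3 unique by simp
  qed
qed

section \<open>Jump functionals of the process\<close>

lemma infsum_jumps:
  assumes w: "increasing_path w" and h [measurable]: "h \<in> borel_measurable borel" and h0: "\<And>z. 0 \<le> h z"
    and q: "\<And>s. s \<in> jump_times w T \<Longrightarrow> q s = h (s, jump w s)" "\<And>s. s \<in> {0..T} - jump_times w T \<Longrightarrow> q s = 0"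
  shows "q summable_on {0..T} \<longleftrightarrow> (\<integral>\<^sup>+z. ennreal (h z) \<partial>jump_measure w T) < \<infinity>"
    and "infsum q {0..T} = enn2real (\<integral>\<^sup>+z. ennreal (h z) \<partial>jump_measure w T)"
proof -
  have sub: "jump_times w T \<subseteq> {0..T}" by (auto simp: jump_times_def)
  have e: "(\<integral>\<^sup>+z. ennreal (h z) \<partial>jump_measure w T) = (\<integral>\<^sup>+s. ennreal (h (s, jump w s)) \<partial>count_space (jump_times w T))"
    by (rule nn_integral_jump_measure) measurable
  have "q summable_on {0..T} \<longleftrightarrow> (\<lambda>s. h (s, jump w s)) summable_on jump_times w T"
    using sub q by (intro summable_on_cong_neutral) auto
  then show "q summable_on {0..T} \<longleftrightarrow> (\<integral>\<^sup>+z. ennreal (h z) \<partial>jump_measure w T) < \<infinity>"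
    unfolding e nn_integral_count_space_summable(1)[of "\<lambda>s. h (s, jump w s)", OF h0] .
  have "infsum q {0..T} = infsum (\<lambda>s. h (s, jump w s)) (jump_times w T)"
    using sub q by (intro infsum_cong_neutral) auto
  then show "infsum q {0..T} = enn2real (\<integral>\<^sup>+z. ennreal (h z) \<partial>jump_measure w T)"
    unfolding e nn_integral_count_space_summable(2)[of "\<lambda>s. h (s, jump w s)", OF h0] .
qed

lemma jump_eq_0:
  assumes w: "increasing_path w" and "s \<in> {0..T} - jump_times w T" shows "jump w s = 0"
  using assms jump_nonneg[OF w, of s] by (cases "s = 0") (auto simp: jump_times_def jump_def)

context driftless_subordinator
begin

lemma unordered_prod_jumps:
  assumes \<omega>: "\<omega> \<in> space M" and f [measurable]: "f \<in> borel_measurable borel" and fpos: "\<And>z. 0 < f z"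
    and q: "\<And>s. s \<in> jump_times (path \<omega>) T \<Longrightarrow> q s = f (s, jump (path \<omega>) s)" "\<And>s. s \<in> {0..T} - jump_times (path \<omega>) T \<Longrightarrow> q s = 1"
  shows "unordered_prod q {0..T} =
    (if J T (log_plus f) \<omega> = \<infinity> then 1 else jump_prod T f \<omega>)"
proof -
  note w = increasing_path[OF \<omega>]
  have qpos: "0 < q s" if "s \<in> {0..T}" for s
    using q that fpos by (cases "s \<in> jump_times (path \<omega>) T") auto
  have p: "(\<lambda>x. max 0 (ln (q x))) summable_on {0..T} \<longleftrightarrow> J T (log_plus f) \<omega> < \<infinity>"
      "(\<Sum>\<^sub>\<infinity>x\<in>{0..T}. max 0 (ln (q x))) = enn2real (J T (log_plus f) \<omega>)"
    unfolding J_def by (rule infsum_jumps[OF w]; simp add: q log_plus_def measurable_log_plus)+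
  have m: "(\<lambda>x. max 0 (- ln (q x))) summable_on {0..T} \<longleftrightarrow> J T (log_minus f) \<omega> < \<infinity>"
      "(\<Sum>\<^sub>\<infinity>x\<in>{0..T}. max 0 (- ln (q x))) = enn2real (J T (log_minus f) \<omega>)"
    unfolding J_def by (rule infsum_jumps[OF w]; simp add: q log_minus_def measurable_log_minus)+
  show ?thesis
    by (subst unordered_prod_eq, erule qpos, unfold p m)
      (auto simp: jump_prod_def nexp_def exp_diff exp_minus divide_inverse less_top)
qed

end

section \<open>The deterministic change of variables\<close>

text \<open>The bounds are asked for every real s, which frees the analysis from case distinctions
  on time; a kernel given on the quadrant is extended by a constant to fit.\<close>

locale hoelder_kernel =
  fixes k :: "real \<Rightarrow> real \<Rightarrow> real" and \<kappa> \<alpha> :: real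
  assumes k_measurable [measurable]: "(\<lambda>z. k (fst z) (snd z)) \<in> borel_measurable borel"
    and \<kappa>: "1 \<le> \<kappa>" and \<alpha>: "0 < \<alpha>"
    and hoelder: "\<And>s x y. 0 \<le> x \<Longrightarrow> 0 \<le> y \<Longrightarrow> \<bar>k s x - k s y\<bar> \<le> \<kappa> * \<bar>x - y\<bar> powr \<alpha>"
    and k_bounds: "\<And>s x. 0 \<le> x \<Longrightarrow> inverse \<kappa> \<le> k s x \<and> k s x \<le> \<kappa>"
begin

abbreviation "K \<equiv> primitive k"

lemma k_pos: "0 \<le> x \<Longrightarrow> 0 < k s x"
  using k_bounds[of x s] \<kappa> by (meson inverse_positive_iff_positive less_le_trans zero_less_one)

lemma k_section [measurable]: "k s \<in> borel_measurable borel"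
proof -
  have "(\<lambda>x. (s, x)) \<in> measurable borel (borel :: (real \<times> real) measure)"
    by (intro borel_measurable_continuous_onI continuous_intros)
  from measurable_compose[OF this k_measurable] show ?thesis by simp
qed

lemma k_continuous: "continuous_on {0..} (k s)"
  unfolding continuous_on_iff
proof safe
  fix x e :: real assume "0 \<le> x" "0 < e"
  define d where "d = (e / \<kappa>) powr (1 / \<alpha>)"
  have d: "0 < d" "\<kappa> * d powr \<alpha> = e" using \<open>0 < e\<close> \<kappa> \<alpha> by (auto simp: d_def powr_powr)
  show "\<exists>d>0. \<forall>x'\<in>{0..}. dist x' x < d \<longrightarrow> dist (k s x') (k s x) < e"
  proof (intro exI conjI ballI impI)
    fix x' :: real assume x': "x' \<in> {0..}" "dist x' x < d"
    have "\<bar>k s x' - k s x\<bar> \<le> \<kappa> * \<bar>x' - x\<bar> powr \<alpha>" using hoelder x' \<open>0 \<le> x\<close> by auto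
    also have "\<dots> < \<kappa> * d powr \<alpha>"
      using x' \<kappa> \<alpha> by (intro mult_strict_left_mono powr_less_mono2) (auto simp: dist_real_def)
    finally show "dist (k s x') (k s x) < e" using d by (simp add: dist_real_def)
  qed (rule d)
qed

lemma k_set_integrable: "set_integrable lborel {0..x} (k s)"
  using k_continuous by (intro borel_integrable_atLeastAtMost' continuous_on_subset[OF k_continuous]) auto

lemma K_eq: "K s x = integral {0..x} (k s)"
  unfolding primitive_def by (rule set_borel_integral_eq_integral(2)[OF k_set_integrable])

lemma K_zero [simp]: "x \<le> 0 \<Longrightarrow> K s x = 0"
  by (cases "x = 0") (auto simp: K_eq)

lemma K_deriv_within:
  assumes "0 \<le> x" "x \<le> b" shows "(K s has_real_derivative k s x) (at x within {0..b})"
  unfolding K_eq[abs_def] using assms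
  by (intro integral_has_real_derivative continuous_on_subset[OF k_continuous]) auto

lemma K_deriv:
  assumes "0 < x" shows "(K s has_real_derivative k s x) (at x)"
  using K_deriv_within[of x "x + 1" s] assms by (simp add: at_within_Icc_at)

lemma K_continuous: "continuous_on {0..b} (K s)"
  by (rule DERIV_continuous_on) (use K_deriv_within in auto)

lemma K_mvt:
  assumes "0 < x" shows "\<exists>y. 0 < y \<and> y < x \<and> K s x = x * k s y"
proof -
  have d: "K s differentiable (at z)" if "0 < z" for z
    using K_deriv[OF that] by (auto simp: real_differentiable_def)
  have "\<exists>l z. 0 < z \<and> z < x \<and> DERIV (K s) z :> l \<and> K s x - K s 0 = (x - 0) * l"
    by (intro MVT assms K_continuous d)
  then obtain l z where z: "0 < z" "z < x" "DERIV (K s) z :> l" "K s x = x * l" by auto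
  then have "l = k s z" using K_deriv[of z s] DERIV_unique by blast
  then show ?thesis using z by auto
qed

lemma K_bounds: assumes "0 \<le> x" shows "x / \<kappa> \<le> K s x" "K s x \<le> \<kappa> * x"
proof -
  show "x / \<kappa> \<le> K s x"
  proof (cases "x = 0")
    case False
    then obtain y where y: "0 < y" "y < x" "K s x = x * k s y" using K_mvt[of x s] assms by auto
    have "x * inverse \<kappa> \<le> x * k s y" using k_bounds[of y s] y assms by (intro mult_left_mono) auto
    then show ?thesis using y by (simp add: divide_inverse)
  qed simp
  show "K s x \<le> \<kappa> * x"
  proof (cases "x = 0")
    case False
    then obtain y where y: "0 < y" "y < x" "K s x = x * k s y" using K_mvt[of x s] assms by auto
    have "x * k s y \<le> x * \<kappa>" using k_bounds[of y s] y assms by (intro mult_left_mono) auto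
    then show ?thesis using y by (simp add: mult.commute)
  qed simp
qed

lemma K_pos: assumes "0 < x" shows "0 < K s x"
proof -
  have "0 < x / \<kappa>" using assms \<kappa> by simp
  then show ?thesis using K_bounds(1)[of x s] assms by linarith
qed

lemma K_strict_mono: assumes "0 \<le> x" "x < y" shows "K s x < K s y"
proof (rule DERIV_pos_imp_increasing_open[OF assms(2)])
  show "\<exists>l. DERIV (K s) z :> l \<and> 0 < l" if "x < z" "z < y" for z
    using that assms K_deriv[of z s] k_pos[of z s] by (intro exI[of _ "k s z"]) auto
  show "continuous_on {x..y} (K s)" using assms by (intro continuous_on_subset[OF K_continuous[of y]]) auto
qed

lemma K_le_iff: "0 \<le> x \<Longrightarrow> 0 \<le> y \<Longrightarrow> K s x \<le> K s y \<longleftrightarrow> x \<le> y"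
  using K_strict_mono[of x y s] K_strict_mono[of y x s] by (cases x y rule: linorder_cases) auto

lemma K_measurable [measurable]: "(\<lambda>z. K (fst z) (snd z)) \<in> borel_measurable borel"
proof -
  have [measurable]: "(\<lambda>p. k (fst (fst p)) (snd p)) \<in> borel_measurable ((borel :: (real \<times> real) measure) \<Otimes>\<^sub>M lborel)"
  proof -
    have "(\<lambda>p. (fst (fst p), snd p)) \<in> measurable ((borel :: (real \<times> real) measure) \<Otimes>\<^sub>M lborel) (borel \<Otimes>\<^sub>M (borel :: real measure))"
      by measurable
    then have "(\<lambda>p. (fst (fst p), snd p)) \<in> measurable ((borel :: (real \<times> real) measure) \<Otimes>\<^sub>M lborel) (borel :: (real \<times> real) measure)"
      by (simp add: borel_prod)
    from measurable_compose[OF this k_measurable] show ?thesis by simp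
  qed
  have "(\<lambda>z. \<integral>y. (if 0 \<le> y \<and> y \<le> snd z then k (fst z) y else 0) \<partial>lborel) \<in> borel_measurable (borel :: (real \<times> real) measure)"
    by (rule lborel.borel_measurable_lebesgue_integral) (simp add: case_prod_beta)
  moreover have "K s x = (\<integral>y. (if 0 \<le> y \<and> y \<le> x then k s y else 0) \<partial>lborel)" for s x
    unfolding primitive_def set_lebesgue_integral_def by (intro Bochner_Integration.integral_cong) (auto simp: indicator_def)
  ultimately show ?thesis by simp
qed

lemma K_section [measurable]: "K s \<in> borel_measurable borel"
proof -
  have "(\<lambda>x. (s, x)) \<in> measurable borel (borel :: (real \<times> real) measure)"
    by (intro borel_measurable_continuous_onI continuous_intros)
  from measurable_compose[OF this K_measurable] show ?thesis by simp
qed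

lemma K_surj: assumes "0 \<le> y" shows "\<exists>x\<ge>0. K s x = y"
proof -
  have "y \<le> K s (\<kappa> * y)" using K_bounds(1)[of "\<kappa> * y" s] assms \<kappa> by simp
  then have "\<exists>x\<ge>0. x \<le> \<kappa> * y \<and> K s x = y"
    using assms \<kappa> K_continuous by (intro IVT') auto
  then show ?thesis by blast
qed

definition Kinv :: "real \<Rightarrow> real \<Rightarrow> real" where
  "Kinv s y = (if 0 \<le> y then THE x. 0 \<le> x \<and> K s x = y else 0)"

lemma Kinv: assumes "0 \<le> y" shows "0 \<le> Kinv s y" "K s (Kinv s y) = y"
proof -
  obtain x where x: "0 \<le> x" "K s x = y" using K_surj[OF assms] by blast
  have "0 \<le> Kinv s y \<and> K s (Kinv s y) = y"
    unfolding Kinv_def if_P[OF assms]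
  proof (rule theI)
    show "0 \<le> x \<and> K s x = y" using x by simp
    fix x' assume "0 \<le> x' \<and> K s x' = y"
    then show "x' = x" using K_le_iff[of x x' s] K_le_iff[of x' x s] x by simp
  qed
  then show "0 \<le> Kinv s y" "K s (Kinv s y) = y" by auto
qed

lemma Kinv_K: assumes "0 \<le> x" shows "Kinv s (K s x) = x"
proof -
  have y: "0 \<le> K s x" using K_pos[of x s] assms by (cases "x = 0") auto
  show ?thesis using Kinv[OF y, of s] K_le_iff[of x "Kinv s (K s x)" s] K_le_iff[of "Kinv s (K s x)" x s] assms by simp
qed

lemma Kinv_nonneg: "0 \<le> Kinv s y"
  using Kinv(1)[of y s] by (cases "0 \<le> y") (auto simp: Kinv_def)

lemma Kinv_le: assumes "0 \<le> y" shows "Kinv s y \<le> \<kappa> * y"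
  using K_bounds(1)[OF Kinv(1)[OF assms, of s], of s] Kinv(2)[OF assms, of s] \<kappa> by (simp add: field_simps)

lemma Kinv_pos: assumes "0 < y" shows "0 < Kinv s y"
  using Kinv[of y s] assms by (cases "Kinv s y = 0") auto

text \<open>For c \<ge> 0 the condition \<open>Kinv s y \<le> c\<close> says y \<le> K(s, c), so
  joint measurability follows from that of \<open>K\<close>, without any regularity in s.\<close>

lemma Kinv_measurable [measurable]: "(\<lambda>z. Kinv (fst z) (snd z)) \<in> borel_measurable borel"
proof (rule borel_measurable_iff_le[THEN iffD2], rule allI)
  fix c :: real
  have Kc: "(\<lambda>z. K (fst z) c) \<in> borel_measurable (borel :: (real \<times> real) measure)"
  proof -
    have "(\<lambda>z. (fst z, c)) \<in> measurable (borel :: (real \<times> real) measure) (borel :: (real \<times> real) measure)"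
      by (intro borel_measurable_continuous_onI continuous_intros)
    from measurable_compose[OF this K_measurable] show ?thesis by simp
  qed
  show "{z \<in> space borel. Kinv (fst z) (snd z) \<le> c} \<in> sets borel"
  proof (cases "0 \<le> c")
    case True
    have "{z. Kinv (fst z) (snd z) \<le> c} = {z. snd z \<le> K (fst z) c}"
    proof (intro Collect_cong)
      fix z :: "real \<times> real"
      show "Kinv (fst z) (snd z) \<le> c \<longleftrightarrow> snd z \<le> K (fst z) c"
      proof (cases "0 \<le> snd z")
        case True
        then show ?thesis using K_le_iff[OF Kinv(1)[OF True, of "fst z"] \<open>0 \<le> c\<close>, of "fst z"] Kinv(2)[OF True, of "fst z"] by simp
      next
        case False
        have "0 \<le> K (fst z) c" using K_pos[of c "fst z"] \<open>0 \<le> c\<close> by (cases "c = 0") auto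
        then show ?thesis using False \<open>0 \<le> c\<close> by (simp add: Kinv_def)
      qed
    qed
    also have "\<dots> \<in> sets borel"
      using borel_measurable_le[OF borel_measurable_fst_snd(2) Kc] by simp
    finally show ?thesis by simp
  next
    case False
    then have "{z :: real \<times> real. Kinv (fst z) (snd z) \<le> c} = {}"
      using Kinv_nonneg by (auto simp: not_le intro: less_le_trans)
    then show ?thesis by simp
  qed
qed

text \<open>The substitution rule on compact intervals inside the open half-line, where
  \<open>K s\<close> is differentiable from both sides, followed by monotone exhaustion.\<close>

lemma nn_integral_K:
  assumes F [measurable]: "F \<in> borel_measurable borel"
  shows "(\<integral>\<^sup>+x. F (K s x) * ennreal (k s x) * indicator {0<..} x \<partial>lborel) = (\<integral>\<^sup>+y. F y * indicator {0<..} y \<partial>lborel)"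
proof -
  \<comment> \<open>The double successor guarantees a n < 1 < b n already at n = 0.\<close>
  define a where "a n = 1 / real (Suc (Suc n))" for n
  define b where "b n = real (Suc (Suc n))" for n
  have ab: "0 < a n" "a n < b n" for n
  proof -
    show "0 < a n" by (simp add: a_def)
    have "a n < 1" "1 < b n" by (simp_all add: a_def b_def)
    then show "a n < b n" by linarith
  qed
  have mono: "a (Suc n) \<le> a n" "b n \<le> b (Suc n)" for n by (auto simp: a_def b_def frac_le)
  have ev: "eventually (\<lambda>n. x \<in> {a n..b n}) sequentially" if "0 < x" for x
  proof -
    obtain m where m: "1 / real (Suc m) < x" using nat_approx_posE[OF \<open>0 < x\<close>] by auto
    obtain l where l: "x < real l" using reals_Archimedean2 by blast
    have "x \<in> {a n..b n}" if "max m l \<le> n" for n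
    proof -
      have "a n \<le> 1 / real (Suc m)" using that by (auto simp: a_def intro!: frac_le)
      then show ?thesis using m l that by (auto simp: b_def)
    qed
    then show ?thesis unfolding eventually_sequentially by blast
  qed
  have eq: "(\<integral>\<^sup>+y. F y * indicator {K s (a n)..K s (b n)} y \<partial>lborel)
      = (\<integral>\<^sup>+x. F (K s x) * ennreal (k s x) * indicator {a n..b n} x \<partial>lborel)" for n
  proof (rule nn_integral_substitution_aux[OF F])
    fix x assume "x \<in> {a n..b n}"
    then have "0 < x" using ab(1)[of n] by auto
    then show "(K s has_real_derivative k s x) (at x)" "0 \<le> k s x"
      using K_deriv k_pos[of x s] by auto
  qed (use ab(1)[of n] ab(2)[of n] in \<open>auto intro!: continuous_on_subset[OF k_continuous]\<close>)
  have 1: "(\<lambda>n. \<integral>\<^sup>+x. F (K s x) * ennreal (k s x) * indicator {a n..b n} x \<partial>lborel)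
     \<longlonglongrightarrow> (\<integral>\<^sup>+x. F (K s x) * ennreal (k s x) * indicator {0<..} x \<partial>lborel)"
  proof (rule nn_integral_LIMSEQ)
    show "incseq (\<lambda>n x. F (K s x) * ennreal (k s x) * indicator {a n..b n} x)"
      using mono by (intro incseq_SucI le_funI mult_left_mono) (auto simp: indicator_def intro: order_trans)
    fix x
    show "(\<lambda>n. F (K s x) * ennreal (k s x) * indicator {a n..b n} x) \<longlonglongrightarrow> F (K s x) * ennreal (k s x) * indicator {0<..} x"
    proof (cases "0 < x")
      case True
      then show ?thesis using ev[OF True] by (intro tendsto_eventually) (auto elim!: eventually_mono)
    next
      case False
      then have "x \<notin> {a n..b n}" for n using ab(1)[of n] by auto
      then show ?thesis using False by simp
    qed
  qed measurable
  have 2: "(\<lambda>n. \<integral>\<^sup>+y. F y * indicator {K s (a n)..K s (b n)} y \<partial>lborel) \<longlonglongrightarrow> (\<integral>\<^sup>+y. F y * indicator {0<..} y \<partial>lborel)"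
  proof (rule nn_integral_LIMSEQ)
    have "K s (a (Suc n)) \<le> K s (a n)" "K s (b n) \<le> K s (b (Suc n))" for n
      using mono[of n] ab(1)[of n] ab(1)[of "Suc n"] ab(2)[of n] ab(2)[of "Suc n"] by (auto simp: K_le_iff)
    then show "incseq (\<lambda>n y. F y * indicator {K s (a n)..K s (b n)} y)"
      by (intro incseq_SucI le_funI mult_left_mono) (auto simp: indicator_def intro: order_trans)
    fix y
    show "(\<lambda>n. F y * indicator {K s (a n)..K s (b n)} y) \<longlonglongrightarrow> F y * indicator {0<..} y"
    proof (cases "0 < y")
      case True
      have "eventually (\<lambda>n. y \<in> {K s (a n)..K s (b n)}) sequentially"
        using ev[OF Kinv_pos[OF True, of s]]
      proof eventually_elim
        case (elim n)
        then show ?case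
          using K_le_iff[of "a n" "Kinv s y" s] K_le_iff[of "Kinv s y" "b n" s] Kinv[of y s] True ab(1)[of n] ab(2)[of n] by auto
      qed
      then show ?thesis using True by (intro tendsto_eventually) (auto elim!: eventually_mono)
    next
      case False
      then have "y \<notin> {K s (a n)..K s (b n)}" for n using K_pos[OF ab(1), of s n] by auto
      then show ?thesis using False by simp
    qed
  qed measurable
  show ?thesis using LIMSEQ_unique[OF 1] 2 unfolding eq by blast
qed

text \<open>By the mean value theorem the quotient is k(s, y) for some y between 0 and e n, and the
  Hoelder bound compares this with k(s, 0).\<close>

lemma K_over_lim:
  assumes e: "\<And>n. 0 < e n" "e \<longlonglongrightarrow> 0" shows "(\<lambda>n. K s (e n) / e n) \<longlonglongrightarrow> k s 0"
proof -
  have "\<bar>K s (e n) / e n - k s 0\<bar> \<le> \<kappa> * e n powr \<alpha>" for n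
  proof -
    obtain y where y: "0 < y" "y < e n" "K s (e n) = e n * k s y" using K_mvt[OF e(1)] by blast
    have "\<bar>k s y - k s 0\<bar> \<le> \<kappa> * \<bar>y - 0\<bar> powr \<alpha>" using hoelder[of y 0 s] y by simp
    also have "\<dots> \<le> \<kappa> * e n powr \<alpha>" using y \<kappa> \<alpha> by (intro mult_left_mono powr_mono2) auto
    finally show ?thesis using y by simp
  qed
  moreover have "(\<lambda>n. \<kappa> * e n powr \<alpha>) \<longlonglongrightarrow> \<kappa> * 0"
    using e \<alpha> by (intro tendsto_mult tendsto_const tendsto_zero_powrI[of e _ "\<lambda>_. \<alpha>" \<alpha>]) (auto simp: less_imp_le)
  ultimately have "(\<lambda>n. K s (e n) / e n - k s 0) \<longlonglongrightarrow> 0"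
    by (intro Lim_null_comparison[of "\<lambda>n. K s (e n) / e n - k s 0" "\<lambda>n. \<kappa> * e n powr \<alpha>"]) auto
  then show ?thesis by (rule LIM_zero_cancel)
qed

text \<open>The density 1/x cut off at 1, transported by the substitution \<open>K s\<close>, minus
  itself. It carries the singular part of k(s, x) g(K(s, x)) - g(x).\<close>

definition E :: "real \<Rightarrow> real \<Rightarrow> real" where
  "E s x = (if 0 < x then (if K s x \<le> 1 then k s x / K s x else 0) - (if x \<le> 1 then 1 / x else 0) else 0)"

lemma E_section [measurable]: "E s \<in> borel_measurable borel"
  unfolding E_def[abs_def] by measurable

text \<open>An integrable majorant of \<open>E s\<close> that does not depend on s. The power of x
  comes from the Hoelder condition near 0, the constant from the crude bounds on
  [1/\<kappa>, \<kappa>].\<close>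

definition B :: "real \<Rightarrow> real" where
  "B x = indicator {0..\<kappa>} x * (\<kappa>\<^sup>2 * x powr (\<alpha> - 1) + (\<kappa> ^ 3 + \<kappa>))"

text \<open>For x \<le> 1/\<kappa> both cut-offs are active and the two singular terms cancel up to
  the Hoelder error; between 1/\<kappa> and \<kappa> each term is bounded separately; beyond
  \<kappa> both x and K(s, x) exceed 1 and \<open>E\<close> vanishes.\<close>

lemma E_le_B: "\<bar>E s x\<bar> \<le> B x"
proof (cases "0 < x")
  case x: True
  have \<kappa>0: "0 < \<kappa>" using \<kappa> by simp
  obtain y where y: "0 < y" "y < x" "K s x = x * k s y" using K_mvt[OF x] by blast
  have kx: "0 < k s x" "k s x \<le> \<kappa>" and ky0: "0 < k s y"
    using k_bounds[of y s] k_bounds[of x s] k_pos[of x s] k_pos[of y s] x y by auto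
  have Kx: "0 < K s x" by (rule K_pos[OF x])
  have kK: "k s x / K s x \<le> \<kappa>\<^sup>2 / x"
  proof -
    have "k s x / K s x \<le> \<kappa> / (x / \<kappa>)" using kx K_bounds(1)[of x s] x \<kappa>0 by (intro frac_le) auto
    then show ?thesis by (simp add: power2_eq_square)
  qed
  show ?thesis
  proof (cases "x \<le> 1 / \<kappa>")
    case True
    have "1 / \<kappa> \<le> 1" using \<kappa> by simp
    then have x1: "x \<le> 1" using True by linarith
    have "K s x \<le> 1" using K_bounds(2)[of x s] x True \<kappa>0 by (auto simp: field_simps)
    then have "E s x = k s x / K s x - 1 / x" using x x1 by (simp add: E_def)
    \<comment> \<open>K(s, x) = x k(s, y) turns 1/x into k(s, y) / K(s, x). The Hoelder bound in the
      numerator gains x^\<alpha> over the non-integrable 1/x.\<close>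
    also have "\<dots> = (k s x - k s y) / K s x" using y ky0 x by (simp add: field_simps)
    finally have "\<bar>E s x\<bar> = \<bar>k s x - k s y\<bar> / K s x" using Kx by simp
    also have "\<dots> \<le> (\<kappa> * x powr \<alpha>) / (x / \<kappa>)"
    proof (rule frac_le)
      have "\<bar>k s x - k s y\<bar> \<le> \<kappa> * \<bar>x - y\<bar> powr \<alpha>" using hoelder[of x y s] x y by simp
      also have "\<dots> \<le> \<kappa> * x powr \<alpha>" using y x \<kappa>0 \<alpha> by (intro mult_left_mono powr_mono2) auto
      finally show "\<bar>k s x - k s y\<bar> \<le> \<kappa> * x powr \<alpha>" .
    qed (use x \<kappa>0 K_bounds(1)[of x s] in auto)
    also have "\<dots> = \<kappa>\<^sup>2 * x powr (\<alpha> - 1)"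
      using x by (simp add: powr_diff power2_eq_square)
    finally have "\<bar>E s x\<bar> \<le> \<kappa>\<^sup>2 * x powr (\<alpha> - 1)" .
    moreover have "0 \<le> \<kappa> ^ 3 + \<kappa>" using \<kappa>0 by simp
    moreover have "B x = \<kappa>\<^sup>2 * x powr (\<alpha> - 1) + (\<kappa> ^ 3 + \<kappa>)" using x x1 \<kappa> by (simp add: B_def)
    ultimately show ?thesis by linarith
  next
    case False
    then have ix: "1 / x < \<kappa>" using x \<kappa>0 by (simp add: field_simps)
    have "k s x / K s x \<le> \<kappa> ^ 3"
    proof -
      have "\<kappa>\<^sup>2 * (1 / x) \<le> \<kappa>\<^sup>2 * \<kappa>" using ix by (intro mult_left_mono) auto
      then show ?thesis using kK by (simp add: power3_eq_cube power2_eq_square)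
    qed
    moreover have "0 \<le> k s x / K s x" using kx Kx by simp
    ultimately have p: "0 \<le> (if K s x \<le> 1 then k s x / K s x else 0)" "(if K s x \<le> 1 then k s x / K s x else 0) \<le> \<kappa> ^ 3"
      using \<kappa>0 by simp_all
    have q: "0 \<le> (if x \<le> 1 then 1 / x else 0)" "(if x \<le> 1 then 1 / x else 0) \<le> \<kappa>"
      using ix x \<kappa>0 by simp_all
    have bd: "\<bar>E s x\<bar> \<le> \<kappa> ^ 3 + \<kappa>" unfolding E_def if_P[OF x] using p q by linarith
    show ?thesis
    proof (cases "x \<le> \<kappa>")
      case True
      then have "B x = \<kappa>\<^sup>2 * x powr (\<alpha> - 1) + (\<kappa> ^ 3 + \<kappa>)" using x by (simp add: B_def)
      moreover have "0 \<le> \<kappa>\<^sup>2 * x powr (\<alpha> - 1)" by simp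
      ultimately show ?thesis using bd by linarith
    next
      case False
      then have "1 < x / \<kappa>" using \<kappa>0 by (simp add: field_simps)
      then have "1 < K s x" using K_bounds(1)[of x s] x by linarith
      moreover have "1 < x" using False \<kappa> by linarith
      ultimately have "E s x = 0" by (simp add: E_def)
      then show ?thesis using False by (simp add: B_def)
    qed
  qed
next
  case False
  have "0 \<le> B x" using \<kappa> by (auto simp: B_def)
  then show ?thesis using False by (simp add: E_def)
qed

lemma B_integrable: "integrable lborel B"
proof -
  have p: "integrable lborel (\<lambda>x. indicator {0..\<kappa>} x * x powr (\<alpha> - 1))"
  proof (rule integrableI_nonneg)
    have "((\<lambda>x. x powr (\<alpha> - 1)) has_integral \<kappa> powr (\<alpha> - 1 + 1) / (\<alpha> - 1 + 1)) {0..\<kappa>}"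
      using \<alpha> \<kappa> by (intro has_integral_powr_from_0) auto
    then have "((\<lambda>x. if x \<in> {0..\<kappa>} then x powr (\<alpha> - 1) else 0) has_integral \<kappa> powr (\<alpha> - 1 + 1) / (\<alpha> - 1 + 1)) UNIV"
      by (simp only: has_integral_restrict_UNIV)
    then have "((\<lambda>x. indicator {0..\<kappa>} x * x powr (\<alpha> - 1)) has_integral \<kappa> powr (\<alpha> - 1 + 1) / (\<alpha> - 1 + 1)) UNIV"
      by (rule has_integral_eq[rotated]) (auto simp: indicator_def)
    then have "(\<integral>\<^sup>+x. ennreal (indicator {0..\<kappa>} x * x powr (\<alpha> - 1)) \<partial>lborel) = ennreal (\<kappa> powr (\<alpha> - 1 + 1) / (\<alpha> - 1 + 1))"
      by (intro nn_integral_has_integral_lborel) auto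
    then show "(\<integral>\<^sup>+x. ennreal (indicator {0..\<kappa>} x * x powr (\<alpha> - 1)) \<partial>lborel) < \<infinity>" by simp
  qed auto
  have c: "integrable lborel (\<lambda>x. indicator {0..\<kappa>} x * (\<kappa> ^ 3 + \<kappa>))"
    using \<kappa> by (intro integrable_mult_left integrable_real_indicator) auto
  have "B = (\<lambda>x. \<kappa>\<^sup>2 * (indicator {0..\<kappa>} x * x powr (\<alpha> - 1)) + indicator {0..\<kappa>} x * (\<kappa> ^ 3 + \<kappa>))"
    by (auto simp: B_def fun_eq_iff algebra_simps)
  then show ?thesis using p c by simp
qed

lemma E_integrable: "integrable lborel (E s)"
  by (rule Bochner_Integration.integrable_bound[OF B_integrable]) (auto intro!: AE_I2 order_trans[OF E_le_B abs_ge_self])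

lemma nn_integral_inverse:
  assumes "0 < c" "c \<le> 1"
  shows "(\<integral>\<^sup>+y. ennreal (1 / y) * indicator {c..1} y \<partial>lborel) = ennreal (- ln c)"
proof -
  have "(\<integral>\<^sup>+y. ennreal (1 / y) * indicator {c..1} y \<partial>lborel) = ennreal (ln 1 - ln c)"
    by (rule nn_integral_FTC_Icc) (use assms in \<open>auto intro!: derivative_eq_intros\<close>)
  then show ?thesis by simp
qed

text \<open>Away from 0 the two terms are integrable separately, and both are logarithmic:
  substitution turns the first into the integral of 1/y over [K(s, e), 1], the second is that over
  [e, 1].\<close>

lemma integral_E_tail:
  assumes e: "0 < e" "e \<le> 1 / \<kappa>"
  shows "(\<integral>x. indicator {e..} x * E s x \<partial>lborel) = - ln (K s e / e)"
proof -
  have \<kappa>0: "0 < \<kappa>" using \<kappa> by simp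
  have "1 / \<kappa> \<le> 1" using \<kappa> by simp
  then have e1: "e \<le> 1" using e by linarith
  have Ke: "0 < K s e" "K s e \<le> 1" using K_pos[OF e(1)] K_bounds(2)[of e s] e \<kappa>0 by (auto simp: field_simps)
  let ?u = "\<lambda>x. if e \<le> x \<and> K s x \<le> 1 then k s x / K s x else 0"
  let ?v = "\<lambda>x. if e \<le> x \<and> x \<le> 1 then 1 / x else 0"
  have u0: "0 \<le> ?u x" for x using K_pos[of x s] k_pos[of x s] e(1) by (auto intro!: divide_nonneg_nonneg)
  have v0: "0 \<le> ?v x" for x using e by auto
  have "(\<integral>\<^sup>+x. ennreal (?u x) \<partial>lborel)
    = (\<integral>\<^sup>+x. (ennreal (1 / K s x) * indicator {K s e..1} (K s x)) * ennreal (k s x) * indicator {0<..} x \<partial>lborel)"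
  proof (intro nn_integral_cong)
    fix x
    show "ennreal (?u x) = ennreal (1 / K s x) * indicator {K s e..1} (K s x) * ennreal (k s x) * indicator {0<..} x"
    proof (cases "0 < x")
      case True
      have "ennreal (k s x / K s x) = ennreal (1 / K s x) * ennreal (k s x)"
        using K_pos[OF True, of s] k_pos[of x s] True by (subst ennreal_mult[symmetric]) auto
      then show ?thesis using True K_le_iff[of e x s] e by (auto simp: indicator_def)
    qed (use e in auto)
  qed
  also have "\<dots> = (\<integral>\<^sup>+y. ennreal (1 / y) * indicator {K s e..1} y * indicator {0<..} y \<partial>lborel)"
    by (rule nn_integral_K[of "\<lambda>y. ennreal (1 / y) * indicator {K s e..1} y"]) measurable
  also have "\<dots> = (\<integral>\<^sup>+y. ennreal (1 / y) * indicator {K s e..1} y \<partial>lborel)"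
    using Ke by (intro nn_integral_cong) (auto simp: indicator_def)
  also have "\<dots> = ennreal (- ln (K s e))" by (rule nn_integral_inverse[OF Ke])
  finally have u: "has_bochner_integral lborel ?u (- ln (K s e))"
    using u0 Ke by (intro has_bochner_integral_nn_integral) (auto intro!: ln_le_zero_iff[THEN iffD2])
  have "(\<integral>\<^sup>+x. ennreal (?v x) \<partial>lborel) = (\<integral>\<^sup>+y. ennreal (1 / y) * indicator {e..1} y \<partial>lborel)"
    by (intro nn_integral_cong) (auto simp: indicator_def)
  also have "\<dots> = ennreal (- ln e)" by (rule nn_integral_inverse[OF e(1) e1])
  finally have v: "has_bochner_integral lborel ?v (- ln e)"
    using v0 e e1 by (intro has_bochner_integral_nn_integral) (auto intro!: ln_le_zero_iff[THEN iffD2])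
  have "has_bochner_integral lborel (\<lambda>x. ?u x - ?v x) (- ln (K s e) - - ln e)"
    by (rule has_bochner_integral_diff[OF u v])
  moreover have "?u x - ?v x = indicator {e..} x * E s x" for x
    using e by (auto simp: E_def indicator_def)
  ultimately have "has_bochner_integral lborel (\<lambda>x. indicator {e..} x * E s x) (- ln (K s e) - - ln e)" by simp
  then have "(\<integral>x. indicator {e..} x * E s x \<partial>lborel) = - ln (K s e) - - ln e"
    by (rule has_bochner_integral_integral_eq)
  also have "\<dots> = - ln (K s e / e)" using Ke e by (simp add: ln_div)
  finally show ?thesis .
qed

text \<open>A Frullani-type integral: letting e tend to 0 in the tail formula, only the slope k(s,
  0) of \<open>K s\<close> at 0 survives.\<close>

lemma integral_E: "(\<integral>x. E s x \<partial>lborel) = - ln (k s 0)"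
proof -
  \<comment> \<open>A null sequence that starts at 1/\<kappa>, so that the tail formula applies to
    every term.\<close>
  define e where "e n = 1 / \<kappa> / real (Suc n)" for n
  have \<kappa>0: "0 < \<kappa>" using \<kappa> by simp
  have e: "0 < e n" "e n \<le> 1 / \<kappa>" for n
  proof -
    show "0 < e n" using \<kappa>0 by (simp add: e_def)
    show "e n \<le> 1 / \<kappa>" using \<kappa>0 unfolding e_def by (intro divide_le_eq[THEN iffD2]) (auto simp: field_simps)
  qed
  have e0: "e \<longlonglongrightarrow> 0" unfolding e_def by (rule LIMSEQ_Suc[OF lim_const_over_n])
  have 1: "(\<lambda>n. \<integral>x. indicator {e n..} x * E s x \<partial>lborel) \<longlonglongrightarrow> (\<integral>x. E s x \<partial>lborel)"
  proof (rule integral_dominated_convergence[where w="\<lambda>x. \<bar>E s x\<bar>"])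
    show "AE x in lborel. (\<lambda>n. indicator {e n..} x * E s x) \<longlonglongrightarrow> E s x"
    proof (rule AE_I2)
      fix x
      show "(\<lambda>n. indicator {e n..} x * E s x) \<longlonglongrightarrow> E s x"
      proof (cases "0 < x")
        case True
        from order_tendstoD(2)[OF e0 True]
        have "eventually (\<lambda>n. indicator {e n..} x * E s x = E s x) sequentially"
          by eventually_elim auto
        then show ?thesis by (rule tendsto_eventually)
      qed (simp add: E_def)
    qed
  qed (use E_integrable in \<open>auto simp: indicator_def\<close>)
  have "(\<lambda>n. - ln (K s (e n) / e n)) \<longlonglongrightarrow> - ln (k s 0)"
    using k_pos[of 0 s] by (intro tendsto_minus tendsto_ln K_over_lim e e0) auto
  then show ?thesis using LIMSEQ_unique[OF 1] integral_E_tail[OF e] by simp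
qed

end

section \<open>The density process\<close>

locale class_L_kernel = hoelder_kernel k \<kappa> \<alpha> for k \<kappa> \<alpha> +
  fixes g :: "real \<Rightarrow> real" and g0 :: real and \<zeta> :: "real \<Rightarrow> real"
  assumes g_measurable [measurable]: "(\<lambda>x. indicator {0<..} x * g x) \<in> borel_measurable borel"
    and g_pos: "\<And>x. 0 < x \<Longrightarrow> 0 < g x"
    and g_tail: "set_integrable lborel {1..} g"
    and zeta: "set_integrable lborel {0..1} \<zeta>"
    and g_eq: "\<And>x. x \<in> {0<..1} \<Longrightarrow> g x = g0 / x + \<zeta> x"
begin

text \<open>\<open>g\<close> is arbitrary on non-positive arguments; this version is Borel
  measurable on the whole line.\<close>

definition G :: "real \<Rightarrow> real" where "G x = indicator {0<..} x * g x"

text \<open>The integrable rest of \<open>g\<close> once the term g0/x on ]0,1] is removed.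
  Substitution by \<open>K s\<close> does not change its integral, so the logarithm comes from the
  singular term alone.\<close>

definition rem :: "real \<Rightarrow> real" where
  "rem x = indicator {0<..1} x * \<zeta> x + indicator {1<..} x * g x"

lemma G_measurable [measurable]: "G \<in> borel_measurable borel"
  unfolding G_def[abs_def] by (rule g_measurable)

lemma G_pos: "0 < x \<Longrightarrow> 0 < G x" by (simp add: G_def g_pos)

lemma G_nonneg: "0 \<le> G x" using G_pos[of x] by (cases "0 < x") (auto simp: G_def)

lemma rem_integrable: "integrable lborel rem"
proof -
  have "set_integrable lborel {0<..1} \<zeta>" using zeta by (rule set_integrable_subset) auto
  moreover have "set_integrable lborel {1<..} g" using g_tail by (rule set_integrable_subset) auto
  ultimately show ?thesis unfolding rem_def[abs_def] set_integrable_def by simp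
qed

lemma g_decomp: "0 < x \<Longrightarrow> g x = g0 * (if x \<le> 1 then 1 / x else 0) + rem x"
  using g_eq[of x] by (auto simp: rem_def)

lemma has_integral_K_nonneg:
  assumes F: "integrable lborel F" and F0: "\<And>x. 0 \<le> F x" and Fz: "\<And>x. x \<le> 0 \<Longrightarrow> F x = (0::real)"
  shows "has_bochner_integral lborel (\<lambda>x. indicator {0<..} x * (k s x * F (K s x))) (\<integral>x. F x \<partial>lborel)"
proof (rule has_bochner_integral_nn_integral)
  have [measurable]: "F \<in> borel_measurable borel" using borel_measurable_integrable[OF F] by simp
  show "(\<lambda>x. indicator {0<..} x * (k s x * F (K s x))) \<in> borel_measurable lborel" by measurable
  show "AE x in lborel. 0 \<le> indicator {0<..} x * (k s x * F (K s x))"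
    using F0 k_pos[of _ s] by (intro AE_I2) (auto simp: indicator_def less_imp_le)
  show "0 \<le> (\<integral>x. F x \<partial>lborel)" using F0 by simp
  have "(\<integral>\<^sup>+x. ennreal (indicator {0<..} x * (k s x * F (K s x))) \<partial>lborel)
      = (\<integral>\<^sup>+x. ennreal (F (K s x)) * ennreal (k s x) * indicator {0<..} x \<partial>lborel)"
    using F0 k_pos[of _ s]
    by (intro nn_integral_cong) (auto simp: indicator_def ennreal_mult'[symmetric] mult.commute less_imp_le)
  also have "\<dots> = (\<integral>\<^sup>+x. ennreal (F x) * indicator {0<..} x \<partial>lborel)" by (rule nn_integral_K) measurable
  also have "\<dots> = (\<integral>\<^sup>+x. ennreal (F x) \<partial>lborel)" using Fz by (intro nn_integral_cong) (auto simp: indicator_def)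
  also have "\<dots> = ennreal (\<integral>x. F x \<partial>lborel)" using F F0 by (intro nn_integral_eq_integral) auto
  finally show "(\<integral>\<^sup>+x. ennreal (indicator {0<..} x * (k s x * F (K s x))) \<partial>lborel) = ennreal (\<integral>x. F x \<partial>lborel)" .
qed

text \<open>\<open>rem\<close> may change sign, since \<zeta> may, so its positive and negative
  parts are substituted separately.\<close>

lemma has_integral_K_rem:
  "has_bochner_integral lborel (\<lambda>x. indicator {0<..} x * (k s x * rem (K s x))) (\<integral>x. rem x \<partial>lborel)"
proof -
  have z: "x \<le> 0 \<Longrightarrow> rem x = 0" for x by (auto simp: rem_def)
  have i: "integrable lborel (\<lambda>x. max 0 (rem x))" "integrable lborel (\<lambda>x. max 0 (- rem x))"
    using rem_integrable by auto
  have d: "max 0 (y::real) - max 0 (- y) = y" for y by auto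
  have "has_bochner_integral lborel
    (\<lambda>x. indicator {0<..} x * (k s x * max 0 (rem (K s x))) - indicator {0<..} x * (k s x * max 0 (- rem (K s x))))
    ((\<integral>x. max 0 (rem x) \<partial>lborel) - (\<integral>x. max 0 (- rem x) \<partial>lborel))"
    using z by (intro has_bochner_integral_diff has_integral_K_nonneg i) auto
  moreover have "(\<integral>x. max 0 (rem x) \<partial>lborel) - (\<integral>x. max 0 (- rem x) \<partial>lborel) = (\<integral>x. rem x \<partial>lborel)"
    using i by (simp add: Bochner_Integration.integral_diff[symmetric] d del: Bochner_Integration.integral_diff)
  ultimately show ?thesis
    by (simp add: right_diff_distrib[symmetric] d)
qed

definition D :: "real \<Rightarrow> real \<Rightarrow> real" where
  "D s x = indicator {0<..} x * (k s x * g (K s x) - g x)"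

text \<open>Decomposing \<open>g\<close> at both x and K(s, x) separates the singular difference
  from two integrable terms whose integrals cancel.\<close>

lemma D_eq: "D s x = g0 * E s x + (indicator {0<..} x * (k s x * rem (K s x)) - rem x)"
proof (cases "0 < x")
  case True
  have "g (K s x) = g0 * (if K s x \<le> 1 then 1 / K s x else 0) + rem (K s x)"
    by (rule g_decomp[OF K_pos[OF True]])
  moreover have "g x = g0 * (if x \<le> 1 then 1 / x else 0) + rem x" by (rule g_decomp[OF True])
  ultimately show ?thesis using True by (simp add: D_def E_def algebra_simps)
next
  case False
  then show ?thesis by (auto simp: D_def E_def rem_def)
qed

lemma D_integral: "has_bochner_integral lborel (D s) (- g0 * ln (k s 0))"
proof -
  have "has_bochner_integral lborel (\<lambda>x. g0 * E s x + (indicator {0<..} x * (k s x * rem (K s x)) - rem x))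
    (g0 * (\<integral>x. E s x \<partial>lborel) + ((\<integral>x. rem x \<partial>lborel) - (\<integral>x. rem x \<partial>lborel)))"
    using E_integrable rem_integrable
    by (intro has_bochner_integral_add has_bochner_integral_diff has_bochner_integral_mult_right
        has_bochner_integral_integrable has_integral_K_rem) auto
  then show ?thesis unfolding D_eq[symmetric] integral_E by simp
qed

text \<open>The right side is free of s, which makes the function integrable jointly in time and
  jump size.\<close>

lemma D_bound: "(\<integral>x. \<bar>D s x\<bar> \<partial>lborel) \<le> \<bar>g0\<bar> * (\<integral>x. B x \<partial>lborel) + 2 * (\<integral>x. \<bar>rem x\<bar> \<partial>lborel)"
proof -
  have z: "x \<le> 0 \<Longrightarrow> \<bar>rem x\<bar> = 0" for x by (auto simp: rem_def)
  have a: "has_bochner_integral lborel (\<lambda>x. indicator {0<..} x * (k s x * \<bar>rem (K s x)\<bar>)) (\<integral>x. \<bar>rem x\<bar> \<partial>lborel)"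
    using z rem_integrable by (intro has_integral_K_nonneg) auto
  have "(\<integral>x. \<bar>D s x\<bar> \<partial>lborel) \<le> (\<integral>x. \<bar>g0\<bar> * B x + (indicator {0<..} x * (k s x * \<bar>rem (K s x)\<bar>) + \<bar>rem x\<bar>) \<partial>lborel)"
  proof (rule integral_mono)
    fix x
    have "\<bar>g0 * E s x\<bar> \<le> \<bar>g0\<bar> * B x" unfolding abs_mult using E_le_B by (intro mult_left_mono) auto
    moreover have "\<bar>indicator {0<..} x * (k s x * rem (K s x))\<bar> = indicator {0<..} x * (k s x * \<bar>rem (K s x)\<bar>)"
      using k_pos[of x s] by (auto simp: indicator_def abs_mult)
    ultimately show "\<bar>D s x\<bar> \<le> \<bar>g0\<bar> * B x + (indicator {0<..} x * (k s x * \<bar>rem (K s x)\<bar>) + \<bar>rem x\<bar>)"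
      unfolding D_eq by linarith
  qed (use D_integral[of s] a B_integrable rem_integrable in \<open>auto simp: has_bochner_integral_iff\<close>)
  also have "\<dots> = \<bar>g0\<bar> * (\<integral>x. B x \<partial>lborel) + ((\<integral>x. \<bar>rem x\<bar> \<partial>lborel) + (\<integral>x. \<bar>rem x\<bar> \<partial>lborel))"
    using a B_integrable rem_integrable by (simp add: has_bochner_integral_iff)
  finally show ?thesis by simp
qed

text \<open>The factor q of the product, set to 1 at non-positive sizes so that it is positive
  everywhere and its logarithm is harmless there.\<close>

definition ratio :: "real \<times> real \<Rightarrow> real" where
  "ratio z = (if 0 < snd z then k (fst z) (snd z) * (G (K (fst z) (snd z)) / G (snd z)) else 1)"

lemma ratio_measurable [measurable]: "ratio \<in> borel_measurable borel"
proof -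
  have [measurable]: "(\<lambda>z. G (K (fst z) (snd z))) \<in> borel_measurable borel"
    by (rule measurable_compose[OF K_measurable G_measurable])
  show ?thesis unfolding ratio_def[abs_def] by measurable
qed

lemma ratio_pos: "0 < ratio z"
  using k_pos[of "snd z" "fst z"] G_pos[of "snd z"] G_pos[OF K_pos, of "snd z" "fst z"] by (auto simp: ratio_def)

abbreviation "levy \<equiv> density lborel (\<lambda>x. ennreal (indicator {0<..} x * g x))"

lemma levy_eq: "levy = density lborel (\<lambda>x. ennreal (G x))"
  by (simp add: G_def)

lemma G_ratio: "0 < x \<Longrightarrow> G x * ratio (s, x) = k s x * G (K s x)"
  using G_pos[of x] by (simp add: ratio_def)

text \<open>\<open>K s\<close> maps the measure with density \<open>ratio\<close> with respect to
  the Levy measure back to the Levy measure, because G(x) ratio(s, x) = k(s, x) G(K(s, x)). This is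
  the source of the invariance in law.\<close>

lemma nn_integral_levy_ratio:
  assumes F [measurable]: "F \<in> borel_measurable borel"
  shows "(\<integral>\<^sup>+x. F (K s x) * ennreal (ratio (s, x)) \<partial>levy) = (\<integral>\<^sup>+y. F y \<partial>levy)"
proof -
  have "(\<integral>\<^sup>+x. F (K s x) * ennreal (ratio (s, x)) \<partial>levy) = (\<integral>\<^sup>+x. ennreal (G x) * (F (K s x) * ennreal (ratio (s, x))) \<partial>lborel)"
    unfolding levy_eq by (rule nn_integral_density) measurable
  also have "\<dots> = (\<integral>\<^sup>+x. F (K s x) * ennreal (G (K s x)) * ennreal (k s x) * indicator {0<..} x \<partial>lborel)"
  proof (intro nn_integral_cong)
    fix x
    show "ennreal (G x) * (F (K s x) * ennreal (ratio (s, x))) = F (K s x) * ennreal (G (K s x)) * ennreal (k s x) * indicator {0<..} x"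
    proof (cases "0 < x")
      case True
      have "ennreal (G x) * ennreal (ratio (s, x)) = ennreal (G (K s x)) * ennreal (k s x)"
        using G_ratio[OF True, of s] G_nonneg ratio_pos[of "(s, x)"] k_pos[of x s] True
        by (simp add: ennreal_mult[symmetric] less_imp_le mult.commute)
      then show ?thesis using True by (simp add: mult_ac) (metis mult.assoc mult.commute)
    qed (simp add: G_def)
  qed
  also have "\<dots> = (\<integral>\<^sup>+y. F y * ennreal (G y) * indicator {0<..} y \<partial>lborel)"
    by (rule nn_integral_K[of "\<lambda>y. F y * ennreal (G y)"]) measurable
  also have "\<dots> = (\<integral>\<^sup>+y. ennreal (G y) * F y \<partial>lborel)"
    by (intro nn_integral_cong) (auto simp: G_def indicator_def mult.commute)
  also have "\<dots> = (\<integral>\<^sup>+y. F y \<partial>levy)"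
    unfolding levy_eq by (rule nn_integral_density[symmetric]) measurable
  finally show ?thesis .
qed

lemma G_ratio_diff: "G x * (ratio (s, x) - 1) = D s x"
proof (cases "0 < x")
  case True
  have "G x * (ratio (s, x) - 1) = k s x * G (K s x) - G x" using G_ratio[OF True, of s] by (simp add: algebra_simps)
  then show ?thesis using True K_pos[OF True, of s] by (simp add: D_def G_def)
qed (simp add: D_def G_def)

lemma ratio_levy:
  shows "integrable levy (\<lambda>x. ratio (s, x) - 1)"
    and "(\<integral>x. ratio (s, x) - 1 \<partial>levy) = - g0 * ln (k s 0)"
    and "(\<integral>x. \<bar>ratio (s, x) - 1\<bar> \<partial>levy) \<le> \<bar>g0\<bar> * (\<integral>x. B x \<partial>lborel) + 2 * (\<integral>x. \<bar>rem x\<bar> \<partial>lborel)"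
proof -
  have D: "integrable lborel (D s)" "(\<integral>x. D s x \<partial>lborel) = - g0 * ln (k s 0)"
    using D_integral[of s] by (auto simp: has_bochner_integral_iff)
  show "integrable levy (\<lambda>x. ratio (s, x) - 1)"
    unfolding levy_eq using D(1) G_nonneg by (subst integrable_density) (auto simp: G_ratio_diff)
  show "(\<integral>x. ratio (s, x) - 1 \<partial>levy) = - g0 * ln (k s 0)"
    unfolding levy_eq using D(2) G_nonneg by (subst integral_density) (auto simp: G_ratio_diff)
  have "(\<integral>x. \<bar>ratio (s, x) - 1\<bar> \<partial>levy) = (\<integral>x. \<bar>D s x\<bar> \<partial>lborel)"
    unfolding levy_eq using G_nonneg
    by (subst integral_density) (auto simp: G_ratio_diff[symmetric] abs_mult)
  then show "(\<integral>x. \<bar>ratio (s, x) - 1\<bar> \<partial>levy) \<le> \<bar>g0\<bar> * (\<integral>x. B x \<partial>lborel) + 2 * (\<integral>x. \<bar>rem x\<bar> \<partial>lborel)"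
    using D_bound[of s] by simp
qed

end

lemma integral_time_measure:
  fixes h :: "real \<Rightarrow> real"
  assumes [measurable]: "h \<in> borel_measurable borel"
  shows "(\<integral>s. h s \<partial>time_measure T) = (LBINT s:{0..T}. h s)"
proof -
  have "time_measure T = density lborel (\<lambda>s. ennreal (indicator {0<..T} s))"
    by (simp add: time_measure_def ennreal_indicator)
  then have "(\<integral>s. h s \<partial>time_measure T) = (\<integral>s. indicator {0<..T} s *\<^sub>R h s \<partial>lborel)"
    by (simp only:) (subst integral_density; simp)
  also have "\<dots> = (\<integral>s. indicator {0..T} s *\<^sub>R h s \<partial>lborel)"
    using AE_lborel_singleton[of 0] by (intro integral_cong_AE) (auto simp: indicator_def elim!: eventually_mono)
  finally show ?thesis by (simp add: set_lebesgue_integral_def)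
qed

section \<open>The multiplicative weight and its Laplace functional\<close>

locale class_L_transform = class_L_kernel k \<kappa> \<alpha> g g0 \<zeta> +
  driftless_subordinator M \<xi> "density lborel (\<lambda>x. ennreal (indicator {0<..} x * g x))"
  for k \<kappa> \<alpha> g g0 \<zeta> and M :: "'a measure" and \<xi>
begin

text \<open>Fubini, justified by the bound uniform in s. The value is minus the exponent in the
  prefactor of the density process, which is what normalises it.\<close>

lemma ratio_intensity:
  shows "integrable (intensity T) (\<lambda>z. ratio z - 1)"
    and "(\<integral>z. ratio z - 1 \<partial>intensity T) = - g0 * (LBINT s:{0..T}. ln (k s 0))"
proof -
  interpret P: pair_sigma_finite "time_measure T" levy by (rule pair_sigma_finite_intensity)
  interpret TM: finite_measure "time_measure T" by (rule finite_time_measure)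
  have meas: "(\<lambda>z. ratio z - 1) \<in> borel_measurable (time_measure T \<Otimes>\<^sub>M levy)"
    using sets_intensity[of T] unfolding intensity_def by (subst measurable_cong_sets[OF _ refl]) auto
  have int: "integrable (time_measure T \<Otimes>\<^sub>M levy) (\<lambda>z. ratio z - 1)"
  proof (rule P.Fubini_integrable[OF meas])
    show "AE s in time_measure T. integrable levy (\<lambda>x. ratio (s, x) - 1)"
      using ratio_levy(1) by simp
    show "integrable (time_measure T) (\<lambda>s. \<integral>x. norm (ratio (s, x) - 1) \<partial>levy)"
    proof (rule TM.integrable_const_bound)
      show "AE s in time_measure T. norm (\<integral>x. norm (ratio (s, x) - 1) \<partial>levy)
        \<le> \<bar>g0\<bar> * (\<integral>x. B x \<partial>lborel) + 2 * (\<integral>x. \<bar>rem x\<bar> \<partial>lborel)"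
        using ratio_levy(3) by simp
      have "(\<lambda>z. norm (ratio z - 1)) \<in> borel_measurable (time_measure T \<Otimes>\<^sub>M levy)"
        using meas by measurable
      then show "(\<lambda>s. \<integral>x. norm (ratio (s, x) - 1) \<partial>levy) \<in> borel_measurable (time_measure T)"
        by (intro nu.borel_measurable_lebesgue_integral) (simp add: case_prod_beta)
    qed
  qed
  then show "integrable (intensity T) (\<lambda>z. ratio z - 1)" by (simp add: intensity_def)
  have km: "(\<lambda>s. k s 0) \<in> borel_measurable borel"
  proof -
    have "(\<lambda>s. (s, 0)) \<in> measurable borel (borel :: (real \<times> real) measure)"
      by (intro borel_measurable_continuous_onI continuous_intros)
    from measurable_compose[OF this k_measurable] show ?thesis by simp
  qed
  have "(\<integral>z. ratio z - 1 \<partial>intensity T) = (\<integral>s. (\<integral>x. ratio (s, x) - 1 \<partial>levy) \<partial>time_measure T)"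
    unfolding intensity_def by (rule P.integral_fst'[OF int, symmetric])
  also have "\<dots> = - g0 * (\<integral>s. ln (k s 0) \<partial>time_measure T)"
    unfolding ratio_levy(2) by simp
  also have "(\<integral>s. ln (k s 0) \<partial>time_measure T) = (LBINT s:{0..T}. ln (k s 0))"
    using km by (intro integral_time_measure) measurable
  finally show "(\<integral>z. ratio z - 1 \<partial>intensity T) = - g0 * (LBINT s:{0..T}. ln (k s 0))" .
qed

lemma nn_integral_intensity_ratio:
  assumes F [measurable]: "F \<in> borel_measurable borel"
  shows "(\<integral>\<^sup>+z. F (fst z, K (fst z) (snd z)) * ennreal (ratio z) \<partial>intensity T) = (\<integral>\<^sup>+z. F z \<partial>intensity T)"
proof -
  interpret P: pair_sigma_finite "time_measure T" levy by (rule pair_sigma_finite_intensity)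
  have Fs [measurable]: "(\<lambda>x. F (s, x)) \<in> borel_measurable borel" for s
  proof -
    have "(\<lambda>x. (s, x)) \<in> measurable borel (borel :: (real \<times> real) measure)"
      by (intro borel_measurable_continuous_onI continuous_intros)
    from measurable_compose[OF this F] show ?thesis .
  qed
  have [measurable]: "(\<lambda>z. F (fst z, K (fst z) (snd z))) \<in> borel_measurable borel"
  proof -
    have "(\<lambda>z. (fst z, K (fst z) (snd z))) \<in> measurable borel (borel \<Otimes>\<^sub>M borel)" by measurable
    then have "(\<lambda>z. (fst z, K (fst z) (snd z))) \<in> measurable borel (borel :: (real \<times> real) measure)"
      by (simp add: borel_prod)
    from measurable_compose[OF this F] show ?thesis .
  qed
  have meas: "h \<in> borel_measurable (time_measure T \<Otimes>\<^sub>M levy)" if "h \<in> borel_measurable borel" for h :: "real \<times> real \<Rightarrow> ennreal"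
    using that sets_intensity[of T] unfolding intensity_def by (subst measurable_cong_sets[OF _ refl]) auto
  have "(\<integral>\<^sup>+z. F (fst z, K (fst z) (snd z)) * ennreal (ratio z) \<partial>intensity T)
      = (\<integral>\<^sup>+s. (\<integral>\<^sup>+x. F (s, K s x) * ennreal (ratio (s, x)) \<partial>levy) \<partial>time_measure T)"
    unfolding intensity_def by (subst nu.nn_integral_fst[symmetric]) (auto intro!: meas)
  also have "\<dots> = (\<integral>\<^sup>+s. (\<integral>\<^sup>+x. F (s, x) \<partial>levy) \<partial>time_measure T)"
    using nn_integral_levy_ratio[OF Fs] by simp
  also have "\<dots> = (\<integral>\<^sup>+z. F z \<partial>intensity T)"
    unfolding intensity_def by (rule nu.nn_integral_fst) (rule meas[OF F])
  finally show ?thesis .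
qed

text \<open>Measurable form of the density process. The case distinction reproduces the default
  value of \<open>unordered_prod\<close> on paths with divergent positive logarithms, so that the
  two agree at every \<omega> and not just almost surely.\<close>

definition N :: "real \<Rightarrow> 'a \<Rightarrow> real" where
  "N T \<omega> = exp (g0 * (LBINT s:{0..T}. ln (k s 0))) *
     (if J T (log_plus ratio) \<omega> = \<infinity> then 1 else jump_prod T ratio \<omega>)"

lemma N_nonneg: "0 \<le> N T \<omega>" by (simp add: N_def jump_prod_nonneg)

lemma N_measurable: "N T \<in> borel_measurable (natural_filtration M \<xi> T)"
proof -
  have [measurable]: "J T (log_plus ratio) \<in> borel_measurable (natural_filtration M \<xi> T)"
      "jump_prod T ratio \<in> borel_measurable (natural_filtration M \<xi> T)"
    by (intro measurable_J measurable_jump_prod measurable_log_plus ratio_measurable)+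
  show ?thesis unfolding N_def[abs_def] by measurable
qed

lemma N_measurable_M [measurable]: "N T \<in> borel_measurable M"
  by (rule measurable_from_subalg[OF subalgebra_natural_filtration N_measurable])

lemma AE_N: "AE \<omega> in M. N T \<omega> = exp (g0 * (LBINT s:{0..T}. ln (k s 0))) * jump_prod T ratio \<omega> \<and> 0 < N T \<omega>"
  using expectation_jump_prod(1)[OF ratio_measurable ratio_pos ratio_intensity(1), of T]
  by eventually_elim (auto simp: N_def jump_prod_def nexp_def)

lemma J_finite:
  assumes "\<omega> \<in> space M" "0 \<le> T" and F [measurable]: "F \<in> borel_measurable borel" and "0 \<le> C"
    and FC: "\<And>s x. 0 < x \<Longrightarrow> F (s, x) \<le> C * x"
  shows "J T F \<omega> < \<infinity>"
proof -
  have "J T F \<omega> \<le> (\<integral>\<^sup>+z. ennreal C * ennreal (snd z) \<partial>jump_measure (path \<omega>) T)"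
    unfolding J_def
  proof (rule nn_integral_mono_AE)
    show "AE z in jump_measure (path \<omega>) T. ennreal (F z) \<le> ennreal C * ennreal (snd z)"
      using AE_jump_measure_pos[where w="path \<omega>" and T=T]
    proof eventually_elim
      case (elim z)
      then show ?case using FC[of "snd z" "fst z"] \<open>0 \<le> C\<close>
        by (auto simp: ennreal_mult[symmetric] intro!: ennreal_leI)
    qed
  qed
  also have "\<dots> = ennreal C * J T snd \<omega>" unfolding J_def by (rule nn_integral_cmult) measurable
  also have "\<dots> < \<infinity>"
    using le_less_trans[OF J_snd_le[OF assms(1,2)], of \<top>] by (simp add: ennreal_mult_less_top)
  finally show ?thesis .
qed

text \<open>The weight times exp(- sum of F) is again a multiplicative functional, with factor f =
  ratio exp(-F). The integral of f - 1 is that of ratio - 1, which cancels the prefactor, minus that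
  of (1 - exp(-F)) ratio. Linear growth of F makes its sum over jumps finite and 1 - exp(-F)
  integrable.\<close>

theorem weighted_laplace:
  assumes T: "0 \<le> T" and F [measurable]: "F \<in> borel_measurable borel" and F0: "\<And>z. 0 \<le> F z" and C: "0 \<le> C"
    and FC: "\<And>s x. 0 < x \<Longrightarrow> F (s, x) \<le> C * x"
  shows "(\<integral>\<^sup>+\<omega>. ennreal (N T \<omega> * nexp (J T F \<omega>)) \<partial>M)
    = ennreal (nexp (\<integral>\<^sup>+z. ennreal (1 - exp (- F z)) * ennreal (ratio z) \<partial>intensity T))"
proof -
  interpret P: pair_sigma_finite "time_measure T" levy by (rule pair_sigma_finite_intensity)
  interpret TM: finite_measure "time_measure T" by (rule finite_time_measure)
  let ?c = "exp (g0 * (LBINT s:{0..T}. ln (k s 0)))"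
  define f where "f z = ratio z * exp (- F z)" for z
  have fm [measurable]: "f \<in> borel_measurable borel" unfolding f_def[abs_def] by measurable
  have fpos: "0 < f z" for z using ratio_pos[of z] by (simp add: f_def)
  have i1: "integrable (intensity T) (\<lambda>z. 1 - exp (- F z))"
  proof -
    have "integrable (intensity T) (\<lambda>z. (1 + C) * min 1 (snd z))"
    proof -
      have "integrable (time_measure T \<Otimes>\<^sub>M levy) (\<lambda>z. min 1 (snd z))"
      proof (rule P.Fubini_integrable)
        show "(\<lambda>z. min 1 (snd z)) \<in> borel_measurable (time_measure T \<Otimes>\<^sub>M levy)" by measurable
      qed (use integrable_min in auto)
      then show ?thesis by (simp add: intensity_def)
    qed
    then show ?thesis
    proof (rule Bochner_Integration.integrable_bound)
      show "AE z in intensity T. norm (1 - exp (- F z)) \<le> norm ((1 + C) * min 1 (snd z))"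
        using AE_intensity_pos[of T]
      proof eventually_elim
        case (elim z)
        have "1 - exp (- F z) \<le> 1" "1 - exp (- F z) \<le> F z" using one_minus_exp_bounds(2)[of "F z"] by auto
        moreover have "F z \<le> C * snd z" using FC[of "snd z" "fst z"] elim by simp
        moreover have "0 \<le> C * snd z" "0 \<le> C" using elim C by auto
        ultimately have "1 - exp (- F z) \<le> (1 + C) * min 1 (snd z)"
          using elim unfolding min_def by (auto simp: algebra_simps)
        then show ?case using F0[of z] elim C by (simp add: abs_mult)
      qed
    qed simp
  qed
  have if1: "integrable (intensity T) (\<lambda>z. f z - 1)"
  proof (rule Bochner_Integration.integrable_bound)
    show "integrable (intensity T) (\<lambda>z. \<bar>ratio z - 1\<bar> + (1 - exp (- F z)))"
      using ratio_intensity(1)[of T] i1 by simp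
    show "AE z in intensity T. norm (f z - 1) \<le> norm (\<bar>ratio z - 1\<bar> + (1 - exp (- F z)))"
    proof (rule AE_I2)
      fix z
      have "f z - 1 = (ratio z - 1) * exp (- F z) - (1 - exp (- F z))" by (simp add: f_def algebra_simps)
      moreover have "\<bar>(ratio z - 1) * exp (- F z)\<bar> \<le> \<bar>ratio z - 1\<bar>"
        using F0[of z] by (simp add: abs_mult mult_left_le)
      moreover have "0 \<le> 1 - exp (- F z)" using F0[of z] by simp
      ultimately show "norm (f z - 1) \<le> norm (\<bar>ratio z - 1\<bar> + (1 - exp (- F z)))"
        unfolding real_norm_def by linarith
    qed
  qed simp
  have "(\<integral>\<^sup>+\<omega>. ennreal (N T \<omega> * nexp (J T F \<omega>)) \<partial>M) = (\<integral>\<^sup>+\<omega>. ennreal ?c * ennreal (jump_prod T f \<omega>) \<partial>M)"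
  proof (rule nn_integral_cong_AE)
    show "AE \<omega> in M. ennreal (N T \<omega> * nexp (J T F \<omega>)) = ennreal ?c * ennreal (jump_prod T f \<omega>)"
      using AE_N[of T] AE_space expectation_jump_prod(1)[OF ratio_measurable ratio_pos ratio_intensity(1), of T]
        expectation_jump_prod(1)[OF fm fpos if1]
    proof eventually_elim
      case (elim \<omega>)
      have JF: "J T F \<omega> < \<infinity>" by (rule J_finite[OF elim(2) T F C FC])
      \<comment> \<open>ln f = ln ratio - F, arranged so that only sums of non-negative functions
        occur; differences are taken after finiteness is known.\<close>
      have "J T (log_plus f) \<omega> + (J T (log_minus ratio) \<omega> + J T F \<omega>) = J T (\<lambda>z. log_plus f z + (log_minus ratio z + F z)) \<omega>"
        using F0 by (simp add: J_add)
      also have "(\<lambda>z. log_plus f z + (log_minus ratio z + F z)) = (\<lambda>z. log_plus ratio z + log_minus f z)"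
      proof
        fix z
        have "ln (f z) = ln (ratio z) - F z" using ratio_pos[of z] by (simp add: f_def ln_mult)
        then show "log_plus f z + (log_minus ratio z + F z) = log_plus ratio z + log_minus f z"
          by (auto simp: log_plus_def log_minus_def)
      qed
      also have "J T (\<lambda>z. log_plus ratio z + log_minus f z) \<omega> = J T (log_plus ratio) \<omega> + J T (log_minus f) \<omega>"
        by (simp add: J_add)
      finally have e: "J T (log_plus f) \<omega> + (J T (log_minus ratio) \<omega> + J T F \<omega>) = J T (log_plus ratio) \<omega> + J T (log_minus f) \<omega>" .
      obtain a where a: "J T (log_plus f) \<omega> = ennreal a" "0 \<le> a" using elim by (cases "J T (log_plus f) \<omega>") auto
      obtain b where b: "J T (log_minus ratio) \<omega> = ennreal b" "0 \<le> b" using elim by (cases "J T (log_minus ratio) \<omega>") auto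
      obtain c where c: "J T (log_plus ratio) \<omega> = ennreal c" "0 \<le> c" using elim by (cases "J T (log_plus ratio) \<omega>") auto
      obtain d where d: "J T (log_minus f) \<omega> = ennreal d" "0 \<le> d" using elim by (cases "J T (log_minus f) \<omega>") auto
      obtain y where y: "J T F \<omega> = ennreal y" "0 \<le> y" using JF by (cases "J T F \<omega>") auto
      note v = a b c d y
      have "a + (b + y) = c + d" using e v by (simp flip: ennreal_plus)
      then have "exp c * exp (- b) * exp (- y) = exp a * exp (- d)" unfolding exp_add[symmetric] by simp
      then show ?case using elim v by (simp add: jump_prod_def ennreal_mult[symmetric] mult.assoc)
    qed
  qed
  also have "\<dots> = ennreal ?c * (\<integral>\<^sup>+\<omega>. ennreal (jump_prod T f \<omega>) \<partial>M)" by (rule nn_integral_cmult) measurable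
  also have "\<dots> = ennreal (?c * exp (\<integral>z. f z - 1 \<partial>intensity T))"
    by (simp add: expectation_jump_prod(2)[OF fm fpos if1] ennreal_mult)
  also have "?c * exp (\<integral>z. f z - 1 \<partial>intensity T) = exp (- (\<integral>z. (1 - exp (- F z)) * ratio z \<partial>intensity T))"
  proof -
    have "(\<integral>z. (1 - exp (- F z)) * ratio z \<partial>intensity T) = (\<integral>z. (ratio z - 1) - (f z - 1) \<partial>intensity T)"
      by (intro Bochner_Integration.integral_cong) (auto simp: f_def algebra_simps)
    also have "\<dots> = (\<integral>z. ratio z - 1 \<partial>intensity T) - (\<integral>z. f z - 1 \<partial>intensity T)"
      by (rule Bochner_Integration.integral_diff[OF ratio_intensity(1) if1])
    finally have *: "(\<integral>z. (1 - exp (- F z)) * ratio z \<partial>intensity T) = (\<integral>z. ratio z - 1 \<partial>intensity T) - (\<integral>z. f z - 1 \<partial>intensity T)" .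
    show ?thesis unfolding * ratio_intensity(2) exp_add[symmetric] by simp
  qed
  also have "\<dots> = nexp (\<integral>\<^sup>+z. ennreal (1 - exp (- F z)) * ennreal (ratio z) \<partial>intensity T)"
  proof -
    have nn: "0 \<le> (1 - exp (- F z)) * ratio z" for z using F0[of z] ratio_pos[of z] by simp
    have "integrable (intensity T) (\<lambda>z. (ratio z - 1) - (f z - 1))"
      by (rule Bochner_Integration.integrable_diff[OF ratio_intensity(1) if1])
    then have i: "integrable (intensity T) (\<lambda>z. (1 - exp (- F z)) * ratio z)"
      by (rule Bochner_Integration.integrable_cong[THEN iffD1, rotated -1]) (auto simp: f_def algebra_simps)
    have "(\<integral>\<^sup>+z. ennreal (1 - exp (- F z)) * ennreal (ratio z) \<partial>intensity T) = (\<integral>\<^sup>+z. ennreal ((1 - exp (- F z)) * ratio z) \<partial>intensity T)"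
      using F0 ratio_pos by (intro nn_integral_cong) (simp add: ennreal_mult less_imp_le)
    also have "\<dots> = ennreal (\<integral>z. (1 - exp (- F z)) * ratio z \<partial>intensity T)"
      using i nn by (intro nn_integral_eq_integral) auto
    finally show ?thesis using nn by (simp add: Bochner_Integration.integral_nonneg)
  qed
  finally show ?thesis .
qed

end

text \<open>Events of the filtration are preimages under the path restricted to [0,T], so statements
  about measures on them reduce to laws of restricted paths.\<close>

lemma natural_filtration_vimage:
  assumes "A \<in> sets (natural_filtration M X T)"
  obtains S where "S \<in> sets (\<Pi>\<^sub>M i\<in>{0..T}. borel)" "A = (\<lambda>\<omega>. \<lambda>i\<in>{0..T}. X i \<omega>) -` S \<inter> space M"
proof -
  let ?f = "\<lambda>\<omega>. \<lambda>i\<in>{0..T}. X i \<omega>" and ?P = "\<Pi>\<^sub>M i\<in>{0..T}. (borel :: real measure)"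
  have f: "?f \<in> space M \<rightarrow> space ?P" by (auto simp: space_PiM)
  have "{X s -` B \<inter> space M |s B. s \<in> {0..T} \<and> B \<in> sets borel} \<subseteq> sets (vimage_algebra (space M) ?f ?P)"
  proof clarify
    fix s B assume s: "s \<in> {0..T}" and B: "B \<in> sets (borel :: real measure)"
    have "(\<lambda>w. w s) -` B \<inter> space ?P \<in> sets ?P"
      using s B by (intro measurable_sets[OF measurable_component_singleton]) auto
    from in_vimage_algebra[OF this, of ?f "space M"]
    have "?f -` ((\<lambda>w. w s) -` B \<inter> space ?P) \<inter> space M \<in> sets (vimage_algebra (space M) ?f ?P)" .
    moreover have "X s -` B \<inter> space M = ?f -` ((\<lambda>w. w s) -` B \<inter> space ?P) \<inter> space M"
      using f s by auto
    ultimately show "X s -` B \<inter> space M \<in> sets (vimage_algebra (space M) ?f ?P)"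
      by (simp only:)
  qed
  then have "sigma_sets (space M) {X s -` B \<inter> space M |s B. s \<in> {0..T} \<and> B \<in> sets borel} \<subseteq> sets (vimage_algebra (space M) ?f ?P)"
    using sets.sigma_sets_subset[of _ "vimage_algebra (space M) ?f ?P"] by simp
  moreover have "A \<in> sigma_sets (space M) {X s -` B \<inter> space M |s B. s \<in> {0..T} \<and> B \<in> sets borel}"
    using assms unfolding natural_filtration_def by (subst (asm) sets_measure_of) auto
  ultimately have "A \<in> sets (vimage_algebra (space M) ?f ?P)" by blast
  then show ?thesis using that unfolding sets_vimage_algebra2[OF f] by blast
qed

lemma nn_integral_jump_measure_restrict:
  assumes [measurable]: "F \<in> borel_measurable borel" and "t \<le> T"
  shows "(\<integral>\<^sup>+z. F z \<partial>jump_measure w t) = (\<integral>\<^sup>+z. indicator {..t} (fst z) * F z \<partial>jump_measure w T)"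
proof -
  have "(\<integral>\<^sup>+z. F z \<partial>jump_measure w t) = (\<integral>\<^sup>+s. F (s, jump w s) * indicator (jump_times w t) s \<partial>count_space UNIV)"
    by (simp add: nn_integral_jump_measure nn_integral_count_space_indicator)
  also have "\<dots> = (\<integral>\<^sup>+s. indicator {..t} s * F (s, jump w s) * indicator (jump_times w T) s \<partial>count_space UNIV)"
    using \<open>t \<le> T\<close> by (intro nn_integral_cong) (auto simp: indicator_def jump_times_def)
  also have "\<dots> = (\<integral>\<^sup>+z. indicator {..t} (fst z) * F z \<partial>jump_measure w T)"
    by (simp add: nn_integral_jump_measure nn_integral_count_space_indicator)
  finally show ?thesis .
qed

text \<open>For the partial sums X j of h over the jumps up to time j, the sum of
  \<open>comb\<close> over all jumps up to T is the combination of the X j with coefficients u j,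
  provided all j lie in [0,T].\<close>

definition comb :: "real set \<Rightarrow> (real \<Rightarrow> nat) \<Rightarrow> (real \<times> real \<Rightarrow> real) \<Rightarrow> real \<times> real \<Rightarrow> real" where
  "comb I u h z = (\<Sum>j\<in>I. real (u j) * (indicator {..j} (fst z) * h z))"

lemma comb_measurable [measurable (raw)]:
  assumes [measurable]: "h \<in> borel_measurable borel" shows "comb I u h \<in> borel_measurable borel"
  unfolding comb_def[abs_def] by measurable

lemma comb_nonneg: "(\<And>z. 0 \<le> h z) \<Longrightarrow> 0 \<le> comb I u h z"
  unfolding comb_def by (intro sum_nonneg mult_nonneg_nonneg) auto

lemma comb_cong: "h (s, x) = h' (s, y) \<Longrightarrow> comb I u h (s, x) = comb I u h' (s, y)"
  by (simp add: comb_def)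

section \<open>Finite-dimensional Laplace transforms and the martingale property\<close>

context class_L_transform
begin

text \<open>Linear growth with constant \<kappa> is common to the identity, to \<open>K\<close> and
  to its inverse, and makes their sums over jumps finite at every \<omega>.\<close>

definition admissible :: "(real \<times> real \<Rightarrow> real) \<Rightarrow> bool" where
  "admissible h \<longleftrightarrow> h \<in> borel_measurable borel \<and> (\<forall>z. 0 \<le> h z) \<and> (\<forall>s x. 0 < x \<longrightarrow> h (s, x) \<le> \<kappa> * x)"

definition jump_sum :: "(real \<times> real \<Rightarrow> real) \<Rightarrow> real \<Rightarrow> 'a \<Rightarrow> real" where
  "jump_sum h t \<omega> = enn2real (J t h \<omega>)"

lemma jump_sum_nonneg: "0 \<le> jump_sum h t \<omega>" by (simp add: jump_sum_def)

lemma jump_sum_measurable: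
  "admissible h \<Longrightarrow> jump_sum h t \<in> borel_measurable (natural_filtration M \<xi> t)"
  unfolding jump_sum_def[abs_def] admissible_def
  by (intro borel_measurable_enn2real measurable_J) simp

lemma jump_sum_measurable_M: "admissible h \<Longrightarrow> jump_sum h t \<in> borel_measurable M"
  by (rule measurable_from_subalg[OF subalgebra_natural_filtration jump_sum_measurable])

lemma J_admissible:
  assumes "admissible h" "\<omega> \<in> space M" "0 \<le> t" shows "J t h \<omega> = ennreal (jump_sum h t \<omega>)"
proof -
  have "J t h \<omega> < \<infinity>"
    using assms \<kappa> by (intro J_finite[of \<omega> t h \<kappa>]) (auto simp: admissible_def)
  then show ?thesis by (simp add: jump_sum_def)
qed

lemma nexp_J_comb:
  assumes h: "admissible h" and \<omega>: "\<omega> \<in> space M" and I: "finite I" "I \<subseteq> {0..T}"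
  shows "nexp (J T (comb I u h) \<omega>) = exp (- (\<Sum>j\<in>I. real (u j) * jump_sum h j \<omega>))"
proof -
  have [measurable]: "h \<in> borel_measurable borel" and h0: "\<And>z. 0 \<le> h z" using h by (auto simp: admissible_def)
  have "J T (comb I u h) \<omega> = (\<integral>\<^sup>+z. (\<Sum>j\<in>I. ennreal (real (u j)) * (indicator {..j} (fst z) * ennreal (h z))) \<partial>jump_measure (path \<omega>) T)"
    unfolding J_def comb_def
  proof (intro nn_integral_cong)
    fix z
    have "ennreal (\<Sum>j\<in>I. real (u j) * (indicator {..j} (fst z) * h z)) = (\<Sum>j\<in>I. ennreal (real (u j) * (indicator {..j} (fst z) * h z)))"
      using h0 by (intro sum_ennreal[symmetric]) auto
    also have "\<dots> = (\<Sum>j\<in>I. ennreal (real (u j)) * (indicator {..j} (fst z) * ennreal (h z)))"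
      using h0 by (intro sum.cong refl) (auto simp: ennreal_mult indicator_def)
    finally show "ennreal (\<Sum>j\<in>I. real (u j) * (indicator {..j} (fst z) * h z)) = (\<Sum>j\<in>I. ennreal (real (u j)) * (indicator {..j} (fst z) * ennreal (h z)))" .
  qed
  also have "\<dots> = (\<Sum>j\<in>I. ennreal (real (u j)) * (\<integral>\<^sup>+z. indicator {..j} (fst z) * ennreal (h z) \<partial>jump_measure (path \<omega>) T))"
    by (subst nn_integral_sum) (auto simp: nn_integral_cmult)
  also have "\<dots> = (\<Sum>j\<in>I. ennreal (real (u j)) * J j h \<omega>)"
    unfolding J_def using I by (intro sum.cong refl arg_cong2[where f="(*)"] nn_integral_jump_measure_restrict[symmetric]) auto
  also have "\<dots> = (\<Sum>j\<in>I. ennreal (real (u j) * jump_sum h j \<omega>))"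
  proof (intro sum.cong refl)
    fix j assume "j \<in> I"
    then have "J j h \<omega> = ennreal (jump_sum h j \<omega>)" using I by (intro J_admissible h \<omega>) auto
    then show "ennreal (real (u j)) * J j h \<omega> = ennreal (real (u j) * jump_sum h j \<omega>)"
      by (simp add: ennreal_mult jump_sum_nonneg)
  qed
  also have "\<dots> = ennreal (\<Sum>j\<in>I. real (u j) * jump_sum h j \<omega>)"
    by (intro sum_ennreal) (simp add: jump_sum_nonneg)
  finally show ?thesis by (simp add: sum_nonneg jump_sum_nonneg)
qed

lemma laplace_jump_sums:
  assumes h: "admissible h" and I: "finite I" "I \<subseteq> {0..T}"
  shows "(\<integral>\<^sup>+\<omega>. ennreal (exp (- (\<Sum>j\<in>I. real (u j) * jump_sum h j \<omega>))) \<partial>M)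
    = ennreal (nexp (\<integral>\<^sup>+z. ennreal (1 - exp (- comb I u h z)) \<partial>intensity T))"
proof -
  have hm [measurable]: "h \<in> borel_measurable borel" and h0: "\<And>z. 0 \<le> h z" using h by (auto simp: admissible_def)
  have "(\<integral>\<^sup>+\<omega>. ennreal (exp (- (\<Sum>j\<in>I. real (u j) * jump_sum h j \<omega>))) \<partial>M) = (\<integral>\<^sup>+\<omega>. ennreal (nexp (J T (comb I u h) \<omega>)) \<partial>M)"
    using nexp_J_comb[OF h _ I] by (intro nn_integral_cong) simp
  also have "\<dots> = ennreal (\<integral>\<omega>. nexp (J T (comb I u h) \<omega>) \<partial>M)"
    by (intro nn_integral_eq_integral integrable_const_bound[where B=1]) auto
  also have "(\<integral>\<omega>. nexp (J T (comb I u h) \<omega>) \<partial>M) = nexp (\<integral>\<^sup>+z. ennreal (1 - exp (- comb I u h z)) \<partial>intensity T)"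
    unfolding J_def using comb_nonneg[of h I u, OF h0] by (intro laplace) auto
  finally show ?thesis .
qed

lemma weighted_laplace_jump_sums:
  assumes h: "admissible h" and T: "0 \<le> T" and I: "finite I" "I \<subseteq> {0..T}"
  shows "(\<integral>\<^sup>+\<omega>. ennreal (N T \<omega>) * ennreal (exp (- (\<Sum>j\<in>I. real (u j) * jump_sum h j \<omega>))) \<partial>M)
    = ennreal (nexp (\<integral>\<^sup>+z. ennreal (1 - exp (- comb I u h z)) * ennreal (ratio z) \<partial>intensity T))"
proof -
  have hm [measurable]: "h \<in> borel_measurable borel" and h0: "\<And>z. 0 \<le> h z"
    and hk: "\<And>s x. 0 < x \<Longrightarrow> h (s, x) \<le> \<kappa> * x" using h by (auto simp: admissible_def)
  have "(\<integral>\<^sup>+\<omega>. ennreal (N T \<omega>) * ennreal (exp (- (\<Sum>j\<in>I. real (u j) * jump_sum h j \<omega>))) \<partial>M)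
      = (\<integral>\<^sup>+\<omega>. ennreal (N T \<omega> * nexp (J T (comb I u h) \<omega>)) \<partial>M)"
    using nexp_J_comb[OF h _ I] by (intro nn_integral_cong) (simp add: ennreal_mult N_nonneg)
  also have "\<dots> = ennreal (nexp (\<integral>\<^sup>+z. ennreal (1 - exp (- comb I u h z)) * ennreal (ratio z) \<partial>intensity T))"
  proof (rule weighted_laplace[OF T])
    show "comb I u h (s, x) \<le> (\<Sum>j\<in>I. real (u j)) * \<kappa> * x" if "0 < x" for s x
    proof -
      have "comb I u h (s, x) \<le> (\<Sum>j\<in>I. real (u j) * (\<kappa> * x))"
        unfolding comb_def using hk[OF that, of s] h0[of "(s, x)"]
        by (intro sum_mono mult_left_mono) (auto simp: indicator_def)
      then show ?thesis by (simp add: sum_distrib_right[symmetric] mult.assoc)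
    qed
    show "0 \<le> (\<Sum>j\<in>I. real (u j)) * \<kappa>" using \<kappa> by (intro mult_nonneg_nonneg sum_nonneg) auto
  qed (auto intro: comb_nonneg h0)
  finally show ?thesis .
qed

definition id_jump :: "real \<times> real \<Rightarrow> real" where "id_jump z = max 0 (snd z)"
definition K_jump :: "real \<times> real \<Rightarrow> real" where "K_jump z = (if 0 < snd z then K (fst z) (snd z) else 0)"
definition Kinv_jump :: "real \<times> real \<Rightarrow> real" where "Kinv_jump z = (if 0 < snd z then Kinv (fst z) (snd z) else 0)"

lemma admissible_id: "admissible id_jump"
proof -
  have "x \<le> \<kappa> * x" if "0 < x" for x using \<kappa> that by simp
  then show ?thesis unfolding admissible_def id_jump_def[abs_def] by auto
qed

lemma admissible_K: "admissible K_jump"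
proof -
  have "K_jump \<in> borel_measurable borel" unfolding K_jump_def[abs_def] by measurable
  then show ?thesis
    unfolding admissible_def using K_pos K_bounds(2) by (auto simp: K_jump_def less_imp_le)
qed

lemma admissible_Kinv: "admissible Kinv_jump"
proof -
  have "Kinv_jump \<in> borel_measurable borel" unfolding Kinv_jump_def[abs_def] by measurable
  then show ?thesis
    unfolding admissible_def using Kinv_nonneg Kinv_le by (auto simp: Kinv_jump_def)
qed

lemma AE_jump_sum_id:
  assumes "0 \<le> t" shows "AE \<omega> in M. jump_sum id_jump t \<omega> = \<xi> t \<omega>"
proof -
  have Jid: "J t id_jump \<omega> = J t snd \<omega>" for \<omega>
    unfolding J_def id_jump_def by (simp add: ennreal_max_0)
  show ?thesis
    using sum_jumps_eq[OF assms] AE_space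
    by eventually_elim (simp add: jump_sum_def nonneg assms Jid)
qed

lemma AE_jump_sums_id:
  assumes "finite I" "I \<subseteq> {0..T}"
  shows "AE \<omega> in M. (\<Sum>j\<in>I. real (u j) * jump_sum id_jump j \<omega>) = (\<Sum>j\<in>I. real (u j) * \<xi> j \<omega>)"
proof -
  have "AE \<omega> in M. \<forall>j\<in>I. jump_sum id_jump j \<omega> = \<xi> j \<omega>"
    using assms AE_jump_sum_id by (subst AE_finite_all) auto
  then show ?thesis by eventually_elim simp
qed

lemma laplace_process:
  assumes I: "finite I" "I \<subseteq> {0..T}"
  shows "(\<integral>\<^sup>+\<omega>. ennreal (exp (- (\<Sum>j\<in>I. real (u j) * \<xi> j \<omega>))) \<partial>M)
    = ennreal (nexp (\<integral>\<^sup>+z. ennreal (1 - exp (- comb I u id_jump z)) \<partial>intensity T))"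
  unfolding laplace_jump_sums[OF admissible_id I, symmetric]
  by (rule nn_integral_cong_AE, use AE_jump_sums_id[OF I, of u] in eventually_elim) simp

lemma weighted_laplace_process:
  assumes T: "0 \<le> T" and I: "finite I" "I \<subseteq> {0..T}"
  shows "(\<integral>\<^sup>+\<omega>. ennreal (N T \<omega>) * ennreal (exp (- (\<Sum>j\<in>I. real (u j) * \<xi> j \<omega>))) \<partial>M)
    = ennreal (nexp (\<integral>\<^sup>+z. ennreal (1 - exp (- comb I u id_jump z)) * ennreal (ratio z) \<partial>intensity T))"
  unfolding weighted_laplace_jump_sums[OF admissible_id T I, symmetric]
  by (rule nn_integral_cong_AE, use AE_jump_sums_id[OF I, of u] in eventually_elim) simp

text \<open>The weighted Laplace transform of no coordinates at all: the exponent is 0.\<close>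

lemma nn_integral_N: "0 \<le> T \<Longrightarrow> (\<integral>\<^sup>+\<omega>. ennreal (N T \<omega>) \<partial>M) = 1"
  using weighted_laplace_process[of T "{}"] by (simp add: comb_def)

lemma N_integrable: "0 \<le> T \<Longrightarrow> integrable M (N T)"
  using nn_integral_N[of T] by (intro integrableI_nonneg) (auto simp: N_nonneg)

lemma expectation_N: "0 \<le> T \<Longrightarrow> (\<integral>\<omega>. N T \<omega> \<partial>M) = 1"
  using nn_integral_N[of T] by (subst integral_eq_nn_integral) (auto simp: N_nonneg)

lemma finite_measure_N: "0 \<le> T \<Longrightarrow> finite_measure (density M (\<lambda>\<omega>. ennreal (N T \<omega>)))"
  by (rule finite_measureI) (simp add: emeasure_density nn_integral_N cong: nn_integral_cong)

text \<open>By the mean formula it is enough to compare jump measures, where restriction in time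
  just selects the jumps up to s.\<close>

lemma nn_integral_intensity_restrict:
  assumes F [measurable]: "F \<in> borel_measurable borel" and "s \<le> t"
  shows "(\<integral>\<^sup>+z. indicator {..s} (fst z) * F z \<partial>intensity t) = (\<integral>\<^sup>+z. F z \<partial>intensity s)"
proof -
  have "(\<lambda>z. indicator {..s} (fst z) * F z) \<in> borel_measurable borel" by measurable
  from jump_mean[OF this, of t] show ?thesis
    unfolding jump_mean[OF F, of s, symmetric]
    by (simp add: nn_integral_jump_measure_restrict[OF F \<open>s \<le> t\<close>])
qed

lemma laplace_density_process:
  assumes [measurable]: "Y \<in> borel_measurable M"
  shows "(\<integral>\<^sup>+\<omega>. ennreal (Y \<omega>) \<partial>density M (\<lambda>\<omega>. ennreal (N T \<omega>))) = (\<integral>\<^sup>+\<omega>. ennreal (N T \<omega>) * ennreal (Y \<omega>) \<partial>M)"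
  by (rule nn_integral_density) measurable

lemma \<xi>_sum_measurable [measurable]:
  assumes "I \<subseteq> {0..}" shows "(\<lambda>\<omega>. \<Sum>j\<in>I. real (u j) * \<xi> j \<omega>) \<in> borel_measurable M"
  using assms by (intro borel_measurable_sum borel_measurable_times random_variable) auto

lemma restricted_law:
  assumes "S \<in> sets (\<Pi>\<^sub>M i\<in>I. borel)" and X: "\<And>i. i \<in> I \<Longrightarrow> X i \<in> borel_measurable m"
  shows "emeasure (distr m (\<Pi>\<^sub>M i\<in>I. borel) (\<lambda>\<omega>. \<lambda>i\<in>I. X i \<omega>)) S = emeasure m ((\<lambda>\<omega>. \<lambda>i\<in>I. X i \<omega>) -` S \<inter> space m)"
  using assms by (intro emeasure_distr measurable_restrict) auto

text \<open>A combination of coordinates at times up to s does not involve jumps after s, so its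
  Laplace transform under the weight N t only sees the intensity up to s and equals the one under N
  s. Uniqueness gives equality on the whole sigma-algebra at time s, without factorising N
  t.\<close>

lemma N_martingale_nn:
  assumes s: "0 \<le> s" "s \<le> t" and A: "A \<in> sets (natural_filtration M \<xi> s)"
  shows "emeasure (density M (\<lambda>\<omega>. ennreal (N t \<omega>))) A = emeasure (density M (\<lambda>\<omega>. ennreal (N s \<omega>))) A"
proof -
  let ?M1 = "density M (\<lambda>\<omega>. ennreal (N t \<omega>))" and ?M2 = "density M (\<lambda>\<omega>. ennreal (N s \<omega>))"
  have t: "0 \<le> t" using s by simp
  have rv: "\<And>i. i \<in> {0..s} \<Longrightarrow> \<xi> i \<in> borel_measurable M" using random_variable by auto
  have "distr ?M1 (\<Pi>\<^sub>M i\<in>{0..s}. borel) (\<lambda>\<omega>. \<lambda>i\<in>{0..s}. \<xi> i \<omega>) = distr ?M2 (\<Pi>\<^sub>M i\<in>{0..s}. borel) (\<lambda>\<omega>. \<lambda>i\<in>{0..s}. \<xi> i \<omega>)"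
  proof (rule laplace_unique[OF finite_measure_N[OF t] finite_measure_N[OF s(1)]])
    fix I and u :: "real \<Rightarrow> nat" assume I: "finite I" "I \<subseteq> {0..s}"
    have It: "I \<subseteq> {0..t}" and I0: "I \<subseteq> {0..}" using I s by auto
    have [measurable]: "(\<lambda>\<omega>. \<Sum>j\<in>I. real (u j) * \<xi> j \<omega>) \<in> borel_measurable M" by (rule \<xi>_sum_measurable[OF I0])
    have [measurable]: "id_jump \<in> borel_measurable borel" using admissible_id by (simp add: admissible_def)
    have "(\<integral>\<^sup>+z. ennreal (1 - exp (- comb I u id_jump z)) * ennreal (ratio z) \<partial>intensity t)
      = (\<integral>\<^sup>+z. indicator {..s} (fst z) * (ennreal (1 - exp (- comb I u id_jump z)) * ennreal (ratio z)) \<partial>intensity t)"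
    proof (intro nn_integral_cong)
      fix z
      show "ennreal (1 - exp (- comb I u id_jump z)) * ennreal (ratio z) = indicator {..s} (fst z) * (ennreal (1 - exp (- comb I u id_jump z)) * ennreal (ratio z))"
      proof (cases "fst z \<le> s")
        case False
        then have "comb I u id_jump z = 0" using I unfolding comb_def by (intro sum.neutral) (auto simp: indicator_def)
        then show ?thesis by simp
      qed simp
    qed
    also have "\<dots> = (\<integral>\<^sup>+z. ennreal (1 - exp (- comb I u id_jump z)) * ennreal (ratio z) \<partial>intensity s)"
      by (rule nn_integral_intensity_restrict[OF _ s(2)]) measurable
    finally show "(\<integral>\<^sup>+\<omega>. ennreal (exp (- (\<Sum>j\<in>I. real (u j) * \<xi> j \<omega>))) \<partial>?M1) = (\<integral>\<^sup>+\<omega>. ennreal (exp (- (\<Sum>j\<in>I. real (u j) * \<xi> j \<omega>))) \<partial>?M2)"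
      by (simp add: laplace_density_process weighted_laplace_process[OF t I(1) It] weighted_laplace_process[OF s(1) I])
  qed (use rv nonneg in \<open>auto intro!: AE_density[THEN iffD2] AE_I2\<close>)
  moreover obtain S where S: "S \<in> sets (\<Pi>\<^sub>M i\<in>{0..s}. borel)" "A = (\<lambda>\<omega>. \<lambda>i\<in>{0..s}. \<xi> i \<omega>) -` S \<inter> space M"
    using natural_filtration_vimage[OF A] by blast
  ultimately show ?thesis
    using restricted_law[OF S(1), of \<xi> ?M1] restricted_law[OF S(1), of \<xi> ?M2] rv S(2) by simp
qed

lemma sets_natural_filtration_mono: "s \<le> t \<Longrightarrow> sets (natural_filtration M \<xi> s) \<subseteq> sets (natural_filtration M \<xi> t)"
proof -
  assume "s \<le> t"
  then have "{0..s} \<subseteq> {0..t}" by auto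
  then show ?thesis unfolding sets_natural_filtration by (intro sigma_sets_mono') blast
qed

theorem N_martingale: "martingale M (natural_filtration M \<xi>) N"
  unfolding martingale_def
proof (intro conjI allI impI)
  show "filtration (space M) (natural_filtration M \<xi>)"
    by standard (use sets_natural_filtration_mono in auto)
  fix s t :: real assume s: "0 \<le> s" and st: "s \<le> t"
  interpret S: finite_measure_subalgebra M "natural_filtration M \<xi> s"
    by standard (rule subalgebra_natural_filtration)
  show "AE \<omega> in M. real_cond_exp M (natural_filtration M \<xi> s) (N t) \<omega> = N s \<omega>"
  proof (rule S.real_cond_exp_charact)
    fix A assume A: "A \<in> sets (natural_filtration M \<xi> s)"
    then have [measurable]: "A \<in> sets M" using subalgebra_natural_filtration by (auto simp: subalgebra_def)
    have "(LINT \<omega>:A|M. N t' \<omega>) = enn2real (emeasure (density M (\<lambda>\<omega>. ennreal (N t' \<omega>))) A)" for t'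
    proof -
      have "(LINT \<omega>:A|M. N t' \<omega>) = enn2real (\<integral>\<^sup>+\<omega>. ennreal (indicator A \<omega> *\<^sub>R N t' \<omega>) \<partial>M)"
        unfolding set_lebesgue_integral_def by (rule integral_eq_nn_integral) (auto simp: N_nonneg)
      also have "(\<integral>\<^sup>+\<omega>. ennreal (indicator A \<omega> *\<^sub>R N t' \<omega>) \<partial>M) = emeasure (density M (\<lambda>\<omega>. ennreal (N t' \<omega>))) A"
        by (subst emeasure_density) (auto intro!: nn_integral_cong simp: indicator_def)
      finally show ?thesis .
    qed
    then show "(LINT \<omega>:A|M. N t \<omega>) = (LINT \<omega>:A|M. N s \<omega>)"
      using N_martingale_nn[OF s st A] by simp
  qed (use s st N_integrable N_measurable in auto)
qed (auto simp: subalgebra_natural_filtration N_measurable N_integrable)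

end

section \<open>The transformed process\<close>

lemma mono_tendsto_at_left:
  fixes f :: "real \<Rightarrow> real"
  assumes "mono_on {0..} f" "0 < t" shows "\<exists>l. (f \<longlongrightarrow> l) (at_left t)"
proof
  let ?l = "SUP u\<in>{0..<t}. f u"
  have bdd: "bdd_above (f ` {0..<t})"
    using assms by (intro bdd_aboveI2[of _ _ "f t"]) (auto intro: mono_onD)
  show "(f \<longlongrightarrow> ?l) (at_left t)"
  proof (rule increasing_tendsto)
    show "eventually (\<lambda>u. f u \<le> ?l) (at_left t)"
      using eventually_at_left_real[OF \<open>0 < t\<close>] by eventually_elim (auto intro!: cSUP_upper bdd)
    fix x assume "x < ?l"
    then obtain v where v: "v \<in> {0..<t}" "x < f v"
      using less_cSUP_iff[of "{0..<t}" f x] bdd \<open>0 < t\<close> by auto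
    have "v < t" using v by auto
    then show "eventually (\<lambda>u. x < f u) (at_left t)"
      using eventually_at_left_real[of v t]
      by (auto elim!: eventually_mono intro: less_le_trans[OF v(2)] mono_onD[OF assms(1)] simp: order.order_iff_strict)
        (use v assms(1) in \<open>auto intro!: less_le_trans[OF v(2)] mono_onD[OF assms(1)]\<close>)
  qed
qed

context class_L_transform
begin

text \<open>The change of variables at the level of Laplace exponents. It serves twice: with h the
  inverse of \<open>K\<close> and h' the identity for the construction of the measure, and with h
  the identity and h' = \<open>K\<close> for the law of the transformed process.\<close>

lemma nn_integral_transform:
  assumes h: "\<And>s x. 0 < x \<Longrightarrow> h (s, K s x) = h' (s, x)" and [measurable]: "h \<in> borel_measurable borel"
  shows "(\<integral>\<^sup>+z. ennreal (1 - exp (- comb I u h' z)) * ennreal (ratio z) \<partial>intensity T)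
    = (\<integral>\<^sup>+z. ennreal (1 - exp (- comb I u h z)) \<partial>intensity T)"
proof -
  have "(\<integral>\<^sup>+z. ennreal (1 - exp (- comb I u h' z)) * ennreal (ratio z) \<partial>intensity T)
    = (\<integral>\<^sup>+z. ennreal (1 - exp (- comb I u h (fst z, K (fst z) (snd z)))) * ennreal (ratio z) \<partial>intensity T)"
  proof (rule nn_integral_cong_AE)
    show "AE z in intensity T. ennreal (1 - exp (- comb I u h' z)) * ennreal (ratio z)
      = ennreal (1 - exp (- comb I u h (fst z, K (fst z) (snd z)))) * ennreal (ratio z)"
      using AE_intensity_pos[of T]
    proof eventually_elim
      case (elim z)
      have "comb I u h (fst z, K (fst z) (snd z)) = comb I u h' (fst z, snd z)"
        using h[of "snd z" "fst z"] elim by (intro comb_cong) auto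
      then show ?case by simp
    qed
  qed
  also have "\<dots> = (\<integral>\<^sup>+z. ennreal (1 - exp (- comb I u h z)) \<partial>intensity T)"
    by (rule nn_integral_intensity_ratio) measurable
  finally show ?thesis .
qed

text \<open>The jumps in ]s,t] contribute at most \<kappa> times their sizes, and these add up to at
  most the increment of \<xi>. Right continuity of \<xi> is thereby inherited.\<close>

lemma jump_sum_increment:
  assumes h: "admissible h" and \<omega>: "\<omega> \<in> space M" and st: "0 \<le> s" "s \<le> t"
  shows "jump_sum h s \<omega> \<le> jump_sum h t \<omega>" "jump_sum h t \<omega> - jump_sum h s \<omega> \<le> \<kappa> * (\<xi> t \<omega> - \<xi> s \<omega>)"
proof -
  let ?w = "path \<omega>"
  have hm [measurable]: "h \<in> borel_measurable borel"
    and hk: "\<And>s x. 0 < x \<Longrightarrow> h (s, x) \<le> \<kappa> * x" using h by (auto simp: admissible_def)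
  have t: "0 \<le> t" using st by simp
  have Jt: "J t h \<omega> = ennreal (jump_sum h t \<omega>)" by (rule J_admissible[OF h \<omega> t])
  have Js: "J s h \<omega> = ennreal (jump_sum h s \<omega>)" by (rule J_admissible[OF h \<omega> st(1)])
  let ?R = "\<integral>\<^sup>+r. ennreal (h (r, jump ?w r)) * indicator {s<..t} r \<partial>count_space (jump_times ?w t)"
  have split: "J t h \<omega> = J s h \<omega> + ?R"
  proof -
    have "J s h \<omega> = (\<integral>\<^sup>+z. indicator {..s} (fst z) * ennreal (h z) \<partial>jump_measure ?w t)"
      unfolding J_def by (rule nn_integral_jump_measure_restrict[OF _ st(2)]) measurable
    also have "\<dots> = (\<integral>\<^sup>+r. indicator {..s} r * ennreal (h (r, jump ?w r)) \<partial>count_space (jump_times ?w t))"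
      by (subst nn_integral_jump_measure) auto
    finally have "J s h \<omega> + ?R = (\<integral>\<^sup>+r. indicator {..s} r * ennreal (h (r, jump ?w r)) + ennreal (h (r, jump ?w r)) * indicator {s<..t} r \<partial>count_space (jump_times ?w t))"
      by (simp add: nn_integral_add)
    also have "\<dots> = (\<integral>\<^sup>+r. ennreal (h (r, jump ?w r)) \<partial>count_space (jump_times ?w t))"
      by (intro nn_integral_cong) (auto simp: indicator_def jump_times_def)
    also have "\<dots> = J t h \<omega>" unfolding J_def by (rule nn_integral_jump_measure[symmetric]) measurable
    finally show ?thesis by simp
  qed
  have "?R \<le> (\<integral>\<^sup>+r. ennreal \<kappa> * (ennreal (jump ?w r) * indicator {s<..t} r) \<partial>count_space (jump_times ?w t))"
  proof (intro nn_integral_mono)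
    fix r assume "r \<in> space (count_space (jump_times ?w t))"
    then have "0 < jump ?w r" by (simp add: jump_times_def)
    then have "ennreal (h (r, jump ?w r)) \<le> ennreal \<kappa> * ennreal (jump ?w r)"
      using hk \<kappa> by (simp add: ennreal_mult[symmetric] ennreal_leI)
    then show "ennreal (h (r, jump ?w r)) * indicator {s<..t} r \<le> ennreal \<kappa> * (ennreal (jump ?w r) * indicator {s<..t} r)"
      by (auto simp: indicator_def)
  qed
  also have "\<dots> = ennreal \<kappa> * (\<integral>\<^sup>+r. ennreal (jump ?w r) * indicator {s<..t} r \<partial>count_space (jump_times ?w t))"
    by (rule nn_integral_cmult) simp
  also have "\<dots> \<le> ennreal \<kappa> * ennreal (?w t - ?w s)"
    using st by (intro mult_left_mono nn_integral_jumps_le increasing_path \<omega>) auto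
  also have "\<dots> = ennreal (\<kappa> * (\<xi> t \<omega> - \<xi> s \<omega>))"
    using \<kappa> increasing_pathD[OF increasing_path[OF \<omega>] st] by (simp add: path_def ennreal_mult)
  finally have R: "?R \<le> ennreal (\<kappa> * (\<xi> t \<omega> - \<xi> s \<omega>))" .
  then obtain y where y: "?R = ennreal y" "0 \<le> y" by (cases ?R) (auto simp: top_unique)
  have "y \<le> \<kappa> * (\<xi> t \<omega> - \<xi> s \<omega>)"
    using R y \<kappa> increasing_pathD[OF increasing_path[OF \<omega>] st] by (simp add: path_def)
  moreover have "jump_sum h t \<omega> = jump_sum h s \<omega> + y"
    using split y unfolding Jt Js by (simp add: jump_sum_nonneg flip: ennreal_plus)
  ultimately show "jump_sum h s \<omega> \<le> jump_sum h t \<omega>" "jump_sum h t \<omega> - jump_sum h s \<omega> \<le> \<kappa> * (\<xi> t \<omega> - \<xi> s \<omega>)"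
    using y by auto
qed

text \<open>These are the three properties that \<open>realises_all_paths\<close> asks of a
  path.\<close>

lemma jump_sum_path:
  assumes h: "admissible h" and \<omega>: "\<omega> \<in> space M"
  shows "cadlag (\<lambda>t. jump_sum h t \<omega>)" "mono_on {0..} (\<lambda>t. jump_sum h t \<omega>)" "jump_sum h 0 \<omega> = 0"
proof -
  let ?e = "\<lambda>t. jump_sum h t \<omega>"
  show mono: "mono_on {0..} ?e"
    using jump_sum_increment(1)[OF h \<omega>] by (intro mono_onI) auto
  show "jump_sum h 0 \<omega> = 0" by (simp add: jump_sum_def J_def jump_measure_nonpos)
  show "cadlag ?e"
    unfolding cadlag_def
  proof (intro conjI allI impI)
    fix t :: real assume t: "0 \<le> t"
    have "((\<lambda>u. \<xi> u \<omega>) \<longlongrightarrow> \<xi> t \<omega>) (at_right t)"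
      using cadlag_paths[OF \<omega>] t by (simp add: cadlag_def continuous_within)
    then have lim: "((\<lambda>u. \<kappa> * (\<xi> u \<omega> - \<xi> t \<omega>)) \<longlongrightarrow> 0) (at_right t)"
      by (auto intro!: tendsto_eq_intros)
    have "((\<lambda>u. ?e u - ?e t) \<longlongrightarrow> 0) (at_right t)"
    proof (rule tendsto_sandwich[OF _ _ tendsto_const lim])
      have "eventually (\<lambda>u. t < u) (at_right t)" by (rule eventually_at_right_less)
      then show "eventually (\<lambda>u. 0 \<le> ?e u - ?e t) (at_right t)"
          "eventually (\<lambda>u. ?e u - ?e t \<le> \<kappa> * (\<xi> u \<omega> - \<xi> t \<omega>)) (at_right t)"
        using jump_sum_increment[OF h \<omega> t] by (auto elim!: eventually_mono)
    qed
    then show "continuous (at_right t) ?e" unfolding continuous_within by (rule LIM_zero_cancel)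
  next
    fix t :: real assume "0 < t"
    then show "\<exists>l. (?e \<longlongrightarrow> l) (at_left t)" by (rule mono_tendsto_at_left[OF mono])
  qed
qed

lemma space_terminal_sigma: "space (terminal_sigma M \<xi>) = space M"
  by (auto simp: terminal_sigma_def space_measure_of_conv)

lemma sets_terminal_sigma:
  "sets (terminal_sigma M \<xi>) = sigma_sets (space M) {\<xi> s -` B \<inter> space M |s B. s \<in> {0..} \<and> B \<in> sets borel}"
  unfolding terminal_sigma_def by (subst sets_measure_of) auto

lemma natural_filtration_terminal: "sets (natural_filtration M \<xi> t) \<subseteq> sets (terminal_sigma M \<xi>)"
  unfolding sets_natural_filtration sets_terminal_sigma by (intro sigma_sets_mono') auto

lemma subalgebra_terminal:
  "space Q = space M \<Longrightarrow> sets Q = sets (terminal_sigma M \<xi>) \<Longrightarrow> subalgebra Q (natural_filtration M \<xi> t)"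
  using natural_filtration_terminal by (auto simp: subalgebra_def)

text \<open>No extension theorem is needed: the process with jumps \<open>K(s, \<cdot>)\<^sup>-\<^sup>1(\<Delta>\<xi>\<^sub>s)\<close> has under \<open>M\<close>
  a law with density \<open>N\<^sub>t\<close> with respect to the law of \<open>\<xi>\<close> on each \<open>\<F>\<^sub>t\<close>.\<close>

theorem has_local_density_exists:
  assumes all: "realises_all_paths M \<xi>"
  shows "\<exists>PK. has_local_density PK M \<xi> N"
proof -
  let ?e = "\<lambda>t. jump_sum Kinv_jump t"
  have "\<forall>\<omega>\<in>space M. \<exists>\<omega>'. \<omega>' \<in> space M \<and> (\<forall>t\<ge>0. \<xi> t \<omega>' = ?e t \<omega>)"
    using all jump_sum_path[OF admissible_Kinv] unfolding realises_all_paths_def by blast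
  then obtain \<phi> where \<phi>: "\<And>\<omega>. \<omega> \<in> space M \<Longrightarrow> \<phi> \<omega> \<in> space M"
    "\<And>\<omega> t. \<omega> \<in> space M \<Longrightarrow> 0 \<le> t \<Longrightarrow> \<xi> t (\<phi> \<omega>) = ?e t \<omega>"
    by (auto simp: bchoice_iff)
  have em: "?e t \<in> borel_measurable M" for t by (rule jump_sum_measurable_M[OF admissible_Kinv])
  \<comment> \<open>\<phi> is an arbitrary choice function, yet measurable for the sigma-algebra
    generated by \<xi>, because \<xi> t composed with \<phi> is a measurable process.\<close>
  have \<phi>m: "\<phi> \<in> measurable M (terminal_sigma M \<xi>)"
    unfolding terminal_sigma_def
  proof (rule measurable_measure_of)
    show "\<phi> \<in> space M \<rightarrow> space M" using \<phi> by auto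
    fix y assume "y \<in> {\<xi> s -` B \<inter> space M |s B. s \<in> {0..} \<and> B \<in> sets borel}"
    then obtain s B where y: "y = \<xi> s -` B \<inter> space M" "0 \<le> s" "B \<in> sets borel" by auto
    have "\<phi> -` y \<inter> space M = ?e s -` B \<inter> space M" using \<phi> y by auto
    then show "\<phi> -` y \<inter> space M \<in> sets M" using measurable_sets[OF em y(3), of s] by simp
  qed auto
  define Q where "Q = distr M (terminal_sigma M \<xi>) \<phi>"
  have Q: "space Q = space M" "sets Q = sets (terminal_sigma M \<xi>)" by (simp_all add: Q_def space_terminal_sigma)
  have "restr_to_subalg Q (natural_filtration M \<xi> t) = density (restr_to_subalg M (natural_filtration M \<xi> t)) (\<lambda>\<omega>. ennreal (N t \<omega>))"
    if t: "0 \<le> t" for t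
  proof (rule measure_eqI)
    let ?F = "natural_filtration M \<xi> t"
    have sQ: "subalgebra Q ?F" by (rule subalgebra_terminal[OF Q])
    show "sets (restr_to_subalg Q ?F) = sets (density (restr_to_subalg M ?F) (\<lambda>\<omega>. ennreal (N t \<omega>)))"
      by (simp add: sets_restr_to_subalg[OF sQ] sets_restr_to_subalg[OF subalgebra_natural_filtration])
    fix A assume "A \<in> sets (restr_to_subalg Q ?F)"
    then have A: "A \<in> sets ?F" by (simp add: sets_restr_to_subalg[OF sQ])
    then have AM: "A \<in> sets M" using subalgebra_natural_filtration by (auto simp: subalgebra_def)
    obtain S where S: "S \<in> sets (\<Pi>\<^sub>M i\<in>{0..t}. borel)" "A = (\<lambda>\<omega>. \<lambda>i\<in>{0..t}. \<xi> i \<omega>) -` S \<inter> space M"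
      using natural_filtration_vimage[OF A] by blast
    let ?MN = "density M (\<lambda>\<omega>. ennreal (N t \<omega>))"
    have rv: "\<And>i. i \<in> {0..t} \<Longrightarrow> \<xi> i \<in> borel_measurable M" using random_variable by auto
    \<comment> \<open>Under \<open>M\<close> the inverse-transformed jumps have the intensity that
      the weight N t gives to the jumps of \<xi>, since the inverse composed with \<open>K\<close>
      is the identity.\<close>
    have law: "distr M (\<Pi>\<^sub>M i\<in>{0..t}. borel) (\<lambda>\<omega>. \<lambda>i\<in>{0..t}. ?e i \<omega>) = distr ?MN (\<Pi>\<^sub>M i\<in>{0..t}. borel) (\<lambda>\<omega>. \<lambda>i\<in>{0..t}. \<xi> i \<omega>)"
    proof (rule laplace_unique[OF finite_measure_axioms finite_measure_N[OF t]])
      fix I :: "real set" and u :: "real \<Rightarrow> nat" assume I: "finite I" "I \<subseteq> {0..t}"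
      then have I0: "I \<subseteq> {0..}" by auto
      have [measurable]: "(\<lambda>\<omega>. \<Sum>j\<in>I. real (u j) * \<xi> j \<omega>) \<in> borel_measurable M" by (rule \<xi>_sum_measurable[OF I0])
      have "(\<integral>\<^sup>+z. ennreal (1 - exp (- comb I u id_jump z)) * ennreal (ratio z) \<partial>intensity t)
        = (\<integral>\<^sup>+z. ennreal (1 - exp (- comb I u Kinv_jump z)) \<partial>intensity t)"
        using admissible_Kinv K_pos by (intro nn_integral_transform) (auto simp: Kinv_jump_def id_jump_def Kinv_K admissible_def)
      then show "(\<integral>\<^sup>+\<omega>. ennreal (exp (- (\<Sum>j\<in>I. real (u j) * ?e j \<omega>))) \<partial>M) = (\<integral>\<^sup>+\<omega>. ennreal (exp (- (\<Sum>j\<in>I. real (u j) * \<xi> j \<omega>))) \<partial>?MN)"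
        by (simp add: laplace_density_process weighted_laplace_process[OF t I] laplace_jump_sums[OF admissible_Kinv I])
    qed (use rv em nonneg in \<open>auto intro!: AE_density[THEN iffD2] AE_I2 simp: jump_sum_nonneg\<close>)
    have "emeasure (restr_to_subalg Q ?F) A = emeasure Q A"
      by (rule emeasure_restr_to_subalg[OF sQ A])
    also have "\<dots> = emeasure M (\<phi> -` A \<inter> space M)"
      unfolding Q_def using A natural_filtration_terminal by (intro emeasure_distr \<phi>m) auto
    also have "\<phi> -` A \<inter> space M = (\<lambda>\<omega>. \<lambda>i\<in>{0..t}. ?e i \<omega>) -` S \<inter> space M"
    proof -
      have "(\<lambda>i\<in>{0..t}. \<xi> i (\<phi> \<omega>)) = (\<lambda>i\<in>{0..t}. ?e i \<omega>)" if "\<omega> \<in> space M" for \<omega>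
        using \<phi>(2)[OF that] by (auto simp: restrict_def)
      then show ?thesis using \<phi>(1) unfolding S(2) by auto
    qed
    also have "emeasure M \<dots> = emeasure ?MN A"
      using restricted_law[OF S(1), of ?e M] restricted_law[OF S(1), of \<xi> ?MN] rv em law S(2) by simp
    also have "\<dots> = (\<integral>\<^sup>+\<omega>. ennreal (N t \<omega>) * indicator A \<omega> \<partial>M)"
      using AM by (subst emeasure_density) auto
    also have "\<dots> = (\<integral>\<^sup>+\<omega>. ennreal (N t \<omega>) * indicator A \<omega> \<partial>restr_to_subalg M ?F)"
      by (intro nn_integral_subalgebra2[symmetric] subalgebra_natural_filtration borel_measurable_times_ennreal
          measurable_compose[OF N_measurable measurable_ennreal] borel_measurable_indicator[OF A])
    also have "\<dots> = emeasure (density (restr_to_subalg M ?F) (\<lambda>\<omega>. ennreal (N t \<omega>))) A"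
      using A N_measurable[of t]
      by (intro emeasure_density[symmetric])
        (auto simp: sets_restr_to_subalg[OF subalgebra_natural_filtration] intro!: measurable_in_subalg[OF subalgebra_natural_filtration])
    finally show "emeasure (restr_to_subalg Q ?F) A = emeasure (density (restr_to_subalg M ?F) (\<lambda>\<omega>. ennreal (N t \<omega>))) A" .
  qed
  moreover have "prob_space Q" unfolding Q_def by (rule prob_space_distr[OF \<phi>m])
  ultimately show ?thesis unfolding has_local_density_def using Q by blast
qed

text \<open>Any finite set of times lies in some [0,T], and the integrand is measurable at time T,
  so only the density N T of the new measure matters, however that measure was obtained.\<close>

theorem transformed_law:
  assumes PK: "has_local_density PK M \<xi> N"
  shows "\<And>t. 0 \<le> t \<Longrightarrow> jump_sum K_jump t \<in> borel_measurable PK"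
    and "distr PK (\<Pi>\<^sub>M t\<in>{0..}. borel) (\<lambda>\<omega>. \<lambda>t\<in>{0..}. jump_sum K_jump t \<omega>)
      = distr M (\<Pi>\<^sub>M t\<in>{0..}. borel) (\<lambda>\<omega>. \<lambda>t\<in>{0..}. \<xi> t \<omega>)"
proof -
  interpret PK: prob_space PK using PK by (simp add: has_local_density_def)
  have Q: "space PK = space M" "sets PK = sets (terminal_sigma M \<xi>)" using PK by (auto simp: has_local_density_def)
  note sub = subalgebra_terminal[OF Q]
  let ?X = "\<lambda>t. jump_sum K_jump t"
  have XF: "?X j \<in> borel_measurable (natural_filtration M \<xi> j)" for j by (rule jump_sum_measurable[OF admissible_K])
  show XM: "\<And>t. 0 \<le> t \<Longrightarrow> ?X t \<in> borel_measurable PK"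
    by (rule measurable_from_subalg[OF sub XF])
  show "distr PK (\<Pi>\<^sub>M t\<in>{0..}. borel) (\<lambda>\<omega>. \<lambda>t\<in>{0..}. ?X t \<omega>) = distr M (\<Pi>\<^sub>M t\<in>{0..}. borel) (\<lambda>\<omega>. \<lambda>t\<in>{0..}. \<xi> t \<omega>)"
  proof (rule laplace_unique[OF PK.finite_measure_axioms finite_measure_axioms])
    fix I :: "real set" and u :: "real \<Rightarrow> nat" assume I: "finite I" "I \<subseteq> {0..}"
    \<comment> \<open>The inserted 0 covers the case of no times.\<close>
    define T where "T = Max (insert 0 I)"
    have T: "0 \<le> T" "I \<subseteq> {0..T}" using I by (auto simp: T_def)
    let ?F = "natural_filtration M \<xi> T"
    let ?Y = "\<lambda>\<omega>. ennreal (exp (- (\<Sum>j\<in>I. real (u j) * ?X j \<omega>)))"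
    have XFT: "?X j \<in> borel_measurable ?F" if "j \<in> I" for j
    proof -
      have "j \<le> T" using T(2) that by auto
      then have "subalgebra ?F (natural_filtration M \<xi> j)"
        using sets_natural_filtration_mono by (auto simp: subalgebra_def)
      from measurable_from_subalg[OF this XF] show ?thesis .
    qed
    have YF: "?Y \<in> borel_measurable ?F"
      by (rule measurable_compose[OF borel_measurable_sum, where g = "\<lambda>x. ennreal (exp (- x))"])
        (auto intro!: borel_measurable_times XFT)
    have "(\<integral>\<^sup>+\<omega>. ?Y \<omega> \<partial>PK) = (\<integral>\<^sup>+\<omega>. ?Y \<omega> \<partial>restr_to_subalg PK ?F)"
      by (rule nn_integral_subalgebra2[OF sub YF, symmetric])
    also have "\<dots> = (\<integral>\<^sup>+\<omega>. ?Y \<omega> \<partial>density (restr_to_subalg M ?F) (\<lambda>\<omega>. ennreal (N T \<omega>)))"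
      using PK T(1) by (simp add: has_local_density_def)
    also have "\<dots> = (\<integral>\<^sup>+\<omega>. ennreal (N T \<omega>) * ?Y \<omega> \<partial>restr_to_subalg M ?F)"
      by (intro nn_integral_density measurable_in_subalg[OF subalgebra_natural_filtration] YF
          measurable_compose[OF N_measurable measurable_ennreal])
    also have "\<dots> = (\<integral>\<^sup>+\<omega>. ennreal (N T \<omega>) * ?Y \<omega> \<partial>M)"
      by (intro nn_integral_subalgebra2 subalgebra_natural_filtration borel_measurable_times_ennreal YF
          measurable_compose[OF N_measurable measurable_ennreal])
    also have "\<dots> = ennreal (nexp (\<integral>\<^sup>+z. ennreal (1 - exp (- comb I u K_jump z)) * ennreal (ratio z) \<partial>intensity T))"
      by (rule weighted_laplace_jump_sums[OF admissible_K T(1) I(1) T(2)])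
    also have "(\<integral>\<^sup>+z. ennreal (1 - exp (- comb I u K_jump z)) * ennreal (ratio z) \<partial>intensity T)
        = (\<integral>\<^sup>+z. ennreal (1 - exp (- comb I u id_jump z)) \<partial>intensity T)"
      using admissible_id K_pos by (intro nn_integral_transform) (auto simp: K_jump_def id_jump_def admissible_def less_imp_le max_def)
    also have "ennreal (nexp \<dots>) = (\<integral>\<^sup>+\<omega>. ennreal (exp (- (\<Sum>j\<in>I. real (u j) * \<xi> j \<omega>))) \<partial>M)"
      by (rule laplace_process[OF I(1) T(2), symmetric])
    finally show "(\<integral>\<^sup>+\<omega>. ?Y \<omega> \<partial>PK) = (\<integral>\<^sup>+\<omega>. ennreal (exp (- (\<Sum>j\<in>I. real (u j) * \<xi> j \<omega>))) \<partial>M)" .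
  qed (use XM random_variable nonneg in \<open>auto simp: jump_sum_nonneg\<close>)
qed

lemma unordered_prod_ratio:
  assumes \<omega>: "\<omega> \<in> space M"
    and q: "\<And>s x. 0 < s \<Longrightarrow> 0 < x \<Longrightarrow> q s x = ratio (s, x)" "\<And>s. q s 0 = 1"
  shows "unordered_prod (\<lambda>s. q s (jump (path \<omega>) s)) {0..T} = (if J T (log_plus ratio) \<omega> = \<infinity> then 1 else jump_prod T ratio \<omega>)"
proof (rule unordered_prod_jumps[OF \<omega> ratio_measurable ratio_pos])
  show "q s (jump (path \<omega>) s) = ratio (s, jump (path \<omega>) s)" if "s \<in> jump_times (path \<omega>) T" for s
    using that q(1) by (auto simp: jump_times_def)
  show "q s (jump (path \<omega>) s) = 1" if "s \<in> {0..T} - jump_times (path \<omega>) T" for s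
    using jump_eq_0[OF increasing_path[OF \<omega>] that] q(2) by simp
qed

lemma infsum_K_jumps:
  assumes \<omega>: "\<omega> \<in> space M" and q: "\<And>s x. 0 < s \<Longrightarrow> 0 < x \<Longrightarrow> q s x = K s x" "\<And>s. q s 0 = 0"
  shows "(\<Sum>\<^sub>\<infinity>s\<in>{0..T}. q s (jump (path \<omega>) s)) = jump_sum K_jump T \<omega>"
  unfolding jump_sum_def J_def
proof (rule infsum_jumps(2)[OF increasing_path[OF \<omega>]])
  show "q s (jump (path \<omega>) s) = K_jump (s, jump (path \<omega>) s)" if "s \<in> jump_times (path \<omega>) T" for s
    using that q(1) by (auto simp: jump_times_def K_jump_def)
  show "q s (jump (path \<omega>) s) = 0" if "s \<in> {0..T} - jump_times (path \<omega>) T" for s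
    using jump_eq_0[OF increasing_path[OF \<omega>] that] q(2) by simp
qed (use admissible_K in \<open>auto simp: admissible_def\<close>)

end

theorem corollary3p2:
  fixes M :: "'a measure"
    and \<xi> :: "real \<Rightarrow> 'a \<Rightarrow> real"
    and g :: "real \<Rightarrow> real"
    and g0 :: "real"
    and k :: "real \<Rightarrow> real \<Rightarrow> real"
    and \<kappa> \<alpha> :: real
  defines "N \<equiv> density_process g g0 k \<xi>"
    and "\<xi>K \<equiv> transformed_process k \<xi>"
    and "\<F> \<equiv> natural_filtration M \<xi>"
  assumes "class_L M \<xi> g g0"
    and "(\<lambda>(s, x). k s x) \<in> borel_measurable (restrict_space borel ({0..} \<times> {0..}))"
    and "\<kappa> \<ge> 1" and "0 < \<alpha>" and "\<alpha> < 1"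
    and "\<And>s x y. 0 \<le> s \<Longrightarrow> 0 \<le> x \<Longrightarrow> 0 \<le> y \<Longrightarrow> \<bar>k s x - k s y\<bar> \<le> \<kappa> * \<bar>x - y\<bar> powr \<alpha>"
    and "\<And>s x. 0 \<le> s \<Longrightarrow> 0 \<le> x \<Longrightarrow> inverse \<kappa> \<le> k s x \<and> k s x \<le> \<kappa>"
  shows "martingale M \<F> N
    \<and> (\<forall>t\<ge>0. \<forall>\<omega>\<in>space M. N t \<omega> \<ge> 0)
    \<and> (\<forall>t\<ge>0. (\<integral>\<omega>. N t \<omega> \<partial>M) = 1)
    \<and> (\<forall>t\<ge>0. AE \<omega> in M. N t \<omega> > 0)
    \<and> (realises_all_paths M \<xi> \<longrightarrow> (\<exists>PK. has_local_density PK M \<xi> N))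
    \<and> (\<forall>PK. has_local_density PK M \<xi> N \<longrightarrow>
         (\<forall>t\<ge>0. \<xi>K t \<in> borel_measurable PK) \<and> process_law PK \<xi>K = process_law M \<xi>)"
proof -
  note kmeas = assms(5) and hoelder = assms(9) and kbd = assms(10)
  \<comment> \<open>The hypotheses concern non-negative arguments only. The constant 1 lies between
    inverse \<kappa> and \<kappa>, so the extension keeps the bounds at x \<ge> 0 for all s, the
    Hoelder condition and Borel measurability.\<close>
  define kk where "kk s x = (if 0 \<le> s \<and> 0 \<le> x then k s x else 1)" for s x
  have kk_eq: "kk s x = k s x" if "0 \<le> s" "0 \<le> x" for s x using that by (simp add: kk_def)
  obtain \<zeta> where \<zeta>: "set_integrable lborel {0..1} \<zeta>" "\<forall>x\<in>{0<..1}. g x = g0 / x + \<zeta> x"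
    using assms(4) unfolding class_L_def by blast
  have L: "subordinator M \<xi>" "g \<in> borel_measurable (restrict_space borel {0<..})" "\<forall>x>0. g x > 0"
    "has_drift_levy_measure M \<xi> 0 (density lborel (\<lambda>x. ennreal (indicator {0<..} x * g x)))"
    "set_integrable lborel {1..} g"
    using assms(4) unfolding class_L_def by blast+
  have gm: "(\<lambda>x. indicator {0<..} x * g x) \<in> borel_measurable borel"
    using L(2) by (subst (asm) borel_measurable_restrict_space_iff) auto
  have quad: "{z. 0 \<le> fst z \<and> 0 \<le> snd z} = {0..} \<times> ({0..} :: real set)" by (auto simp: prod_eq_iff)
  have kkm: "(\<lambda>z. kk (fst z) (snd z)) \<in> borel_measurable borel"
  proof -
    have "{0..} \<times> {0..} \<in> sets (borel \<Otimes>\<^sub>M borel :: (real \<times> real) measure)" by (intro pair_measureI) auto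
    then have "{0..} \<times> {0..} \<in> sets (borel :: (real \<times> real) measure)"
      by (simp only: borel_prod)
    then have "{z \<in> space borel. 0 \<le> fst z \<and> 0 \<le> snd z} \<in> sets (borel :: (real \<times> real) measure)"
      by (simp add: quad)
    then show ?thesis
      unfolding kk_def using kmeas by (subst measurable_If_restrict_space_iff) (auto simp: quad case_prod_unfold)
  qed
  interpret hoelder_kernel kk \<kappa> \<alpha>
  proof
    show "\<bar>kk s x - kk s y\<bar> \<le> \<kappa> * \<bar>x - y\<bar> powr \<alpha>" if "0 \<le> x" "0 \<le> y" for s x y
      using hoelder[of s x y] that assms(6) by (cases "0 \<le> s") (auto simp: kk_def)
    show "inverse \<kappa> \<le> kk s x \<and> kk s x \<le> \<kappa>" if "0 \<le> x" for s x
      using kbd[of s x] that assms(6) by (cases "0 \<le> s") (auto simp: kk_def inverse_le_1_iff)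
  qed (use kkm assms in auto)
  interpret X: class_L_transform kk \<kappa> \<alpha> g g0 \<zeta> M \<xi>
    using L \<zeta> gm hoelder_kernel_axioms
    by (auto simp: class_L_transform_def class_L_kernel_def class_L_kernel_axioms_def
        driftless_subordinator_def driftless_subordinator_axioms_def)
  have prim: "primitive k s x = primitive kk s x" if "0 \<le> s" for s x
    unfolding primitive_def using that by (intro set_lebesgue_integral_cong) (auto simp: kk_def)
  have prim_0: "primitive k s 0 = 0" for s
    unfolding primitive_def set_lebesgue_integral_def
    by (rule integral_eq_zero_AE) (use AE_lborel_singleton[of "0 :: real"] in eventually_elim, simp)
  have path: "(\<lambda>r. \<xi> r \<omega>) = X.path \<omega>" for \<omega> by (simp add: X.path_def fun_eq_iff)
  \<comment> \<open>Equality at every \<omega>, not just almost surely: this is what carries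
    measurability for the uncompleted filtration over to the density process.\<close>
  have NX: "N t \<omega> = X.N t \<omega>" if "\<omega> \<in> space M" "0 \<le> t" for t \<omega>
  proof -
    have "(LBINT s:{0..t}. ln (k s 0)) = (LBINT s:{0..t}. ln (kk s 0))"
      by (intro set_lebesgue_integral_cong) (auto simp: kk_def)
    moreover have "unordered_prod (\<lambda>s. jump_factor g k s (jump (X.path \<omega>) s)) {0..t}
      = (if X.J t (X.log_plus X.ratio) \<omega> = \<infinity> then 1 else X.jump_prod t X.ratio \<omega>)"
    proof (rule X.unordered_prod_ratio[OF that(1)])
      fix s x :: real assume "0 < s" "0 < x"
      then show "jump_factor g k s x = X.ratio (s, x)"
        using K_pos[of x s] by (simp add: jump_factor_def X.ratio_def X.G_def prim kk_eq)
    qed (simp add: jump_factor_def)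
    ultimately show ?thesis
      unfolding N_def density_process_def path X.N_def by simp
  qed
  have KX: "\<xi>K t \<omega> = X.jump_sum X.K_jump t \<omega>" if "\<omega> \<in> space M" for t \<omega>
    unfolding \<xi>K_def transformed_process_def path
    by (rule X.infsum_K_jumps[OF that]) (simp_all add: prim prim_0)
  have AEN: "AE \<omega> in M. N t \<omega> = X.N t \<omega>" if "0 \<le> t" for t using NX that by (intro AE_I2) auto
  have Nm: "N t \<in> borel_measurable (natural_filtration M \<xi> t)" if "0 \<le> t" for t
    using X.N_measurable[of t] NX that by (subst measurable_cong[where g="X.N t"]) auto
  have density_eq: "density (restr_to_subalg M (natural_filtration M \<xi> t)) (\<lambda>\<omega>. ennreal (N t \<omega>))
      = density (restr_to_subalg M (natural_filtration M \<xi> t)) (\<lambda>\<omega>. ennreal (X.N t \<omega>))" if "0 \<le> t" for t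
  proof (rule density_cong)
    note m = measurable_in_subalg[OF X.subalgebra_natural_filtration]
    show "(\<lambda>\<omega>. ennreal (N t \<omega>)) \<in> borel_measurable (restr_to_subalg M (natural_filtration M \<xi> t))"
      "(\<lambda>\<omega>. ennreal (X.N t \<omega>)) \<in> borel_measurable (restr_to_subalg M (natural_filtration M \<xi> t))"
      using Nm[OF that] X.N_measurable[of t] by (auto intro!: m)
    show "AE \<omega> in restr_to_subalg M (natural_filtration M \<xi> t). ennreal (N t \<omega>) = ennreal (X.N t \<omega>)"
      using NX that by (intro AE_I2) (auto simp: space_restr_to_subalg)
  qed
  have local_density: "has_local_density PK M \<xi> N \<longleftrightarrow> has_local_density PK M \<xi> X.N" for PK
    unfolding has_local_density_def using density_eq by auto
  have mart: "martingale M \<F> N"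
    unfolding martingale_def \<F>_def
  proof (intro conjI allI impI)
    have XM: "martingale M (natural_filtration M \<xi>) X.N" by (rule X.N_martingale)
    show "filtration (space M) (natural_filtration M \<xi>)" using XM by (simp add: martingale_def)
    show "subalgebra M (natural_filtration M \<xi> t)" for t by (rule X.subalgebra_natural_filtration)
    show "N t \<in> borel_measurable (natural_filtration M \<xi> t)" if "0 \<le> t" for t by (rule Nm[OF that])
    show "integrable M (N t)" if "0 \<le> t" for t
      using X.N_integrable[OF that] NX that by (subst Bochner_Integration.integrable_cong[OF refl, of _ _ "X.N t"]) auto
    fix s t :: real assume s: "0 \<le> s" "s \<le> t"
    interpret S: finite_measure_subalgebra M "natural_filtration M \<xi> s"
      by standard (rule X.subalgebra_natural_filtration)
    have t: "0 \<le> t" using s by simp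
    have N_M: "N t \<in> borel_measurable M" by (rule measurable_from_subalg[OF X.subalgebra_natural_filtration Nm[OF t]])
    have "AE \<omega> in M. real_cond_exp M (natural_filtration M \<xi> s) (N t) \<omega> = real_cond_exp M (natural_filtration M \<xi> s) (X.N t) \<omega>"
      using AEN[OF t] N_M X.N_measurable_M by (rule S.real_cond_exp_cong)
    moreover have "AE \<omega> in M. real_cond_exp M (natural_filtration M \<xi> s) (X.N t) \<omega> = X.N s \<omega>"
      using XM s by (simp add: martingale_def)
    ultimately show "AE \<omega> in M. real_cond_exp M (natural_filtration M \<xi> s) (N t) \<omega> = N s \<omega>"
      using AEN[OF s(1)] by eventually_elim simp
  qed
  have law: "(\<forall>t\<ge>0. \<xi>K t \<in> borel_measurable PK) \<and> process_law PK \<xi>K = process_law M \<xi>"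
    if "has_local_density PK M \<xi> N" for PK
  proof -
    have PK: "has_local_density PK M \<xi> X.N" using that local_density by blast
    then have sp: "space PK = space M" by (simp add: has_local_density_def)
    have "\<xi>K t \<in> borel_measurable PK" if "0 \<le> t" for t
      using X.transformed_law(1)[OF PK that] KX sp by (subst measurable_cong[where g="X.jump_sum X.K_jump t"]) auto
    moreover have "process_law PK \<xi>K = distr PK (\<Pi>\<^sub>M t\<in>{0..}. borel) (\<lambda>\<omega>. \<lambda>t\<in>{0..}. X.jump_sum X.K_jump t \<omega>)"
      unfolding process_law_def using KX sp by (intro distr_cong) auto
    ultimately show ?thesis using X.transformed_law(2)[OF PK] by (simp add: process_law_def)
  qed
  have "(\<integral>\<omega>. N t \<omega> \<partial>M) = 1" if "0 \<le> t" for t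
    using X.expectation_N[OF that] NX that by (subst Bochner_Integration.integral_cong[OF refl, of _ _ "X.N t"]) auto
  moreover have "AE \<omega> in M. 0 < N t \<omega>" if "0 \<le> t" for t
    using X.AE_N[of t] AEN[OF that] by eventually_elim simp
  ultimately show ?thesis
    using mart NX X.N_nonneg X.has_local_density_exists local_density law by auto
qed

end
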